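(* Let $\Omega\subset\mathbb R^n$ and $\phi$ satisfy (A1), (A2), (A3) of the context with constants $\rho>0$ and $0<\lambda\le\Lambda$. Assume in addition that $\partial\Omega\in C^{1,1}$. Let $u\in C(\overline\Omega)\cap C^1(\Omega)\cap W^{2,n}_{loc}(\Omega)$ be a solution of $$\mathcal L_\phi u=f\ \text{ in }\Omega,\qquad u=0\ \text{ on }\partial\Omega .$$ Then there exist $p=p(\rho,\lambda,\Lambda,n)>0$ and $C=C(\rho,\lambda,\Lambda,n,\|\partial\Omega\|_{C^{1,1}})>0$ such that $$\|D^2u\|_{L^p(\Omega)}\le C\,\|f\|_{L^n(\Omega)} .$$
   Context: $\Omega$ is a bounded convex domain; $B_r(z)$ is the ball of radius $r$ and center $z$, $B_r=B_r(0)$. $\mathcal L_\phi u:=\sum_{i,j}\Phi^{ij}u_{ij}$, where $\Phi=(\Phi^{ij})=(\det D^2\phi)(D^2\phi)^{-1}$ is the cofactor matrix of $D^2\phi$; $f\in L^n(\Omega)$. (A1) $\Omega\subset B_{1/\rho}$, and for each $y\in\partial\Omega$ there is a ball $B_\rho(z)\subset\Omega$ that is tangent to $\partial\Omega$ at $y$. (A2) $\phi\in C^{0,1}(\overline\Omega)\cap C^2(\Omega)$ is convex and $\lambda\le\det D^2\phi\le\Lambda$ in $\Omega$. (A3) For all $x,x_0\in\partial\Omega$: $\rho|x-x_0|^2\le\phi(x)-\phi(x_0)-\nabla\phi(x_0)\cdot(x-x_0)\le\rho^{-1}|x-x_0|^2$. For $x_0\in\partial\Omega$ with inner unit normal $\nu$,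 $\nabla\phi(x_0)$ denotes the slope of the tangent plane at $x_0$: $\phi(x)\ge\phi(x_0)+\nabla\phi(x_0)\cdot(x-x_0)$ on $\overline\Omega$, and this fails if $\nabla\phi(x_0)$ is replaced by $\nabla\phi(x_0)+\varepsilon\nu$ for any $\varepsilon>0$ (the usual gradient if $\phi$ is differentiable up to the boundary). $L^p$ "norms" with $p<1$ are $(\int|\cdot|^p)^{1/p}$. *)

theory Defs
  imports "HOL-Analysis.Analysis"
begin

section \<open>Classical derivatives\<close>

definition partial :: "'n::finite \<Rightarrow> (real^'n \<Rightarrow> real) \<Rightarrow> real^'n \<Rightarrow> real" where
  "partial i f x = frechet_derivative f (at x) (axis i 1)"

text \<open>\<open>Ck_on k S f\<close> is meant for open \<open>S\<close>. The values of \<open>f\<close> outside \<open>S\<close> are then irrelevant.\<close>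

primrec Ck_on :: "nat \<Rightarrow> (real^'n::finite) set \<Rightarrow> (real^'n \<Rightarrow> real) \<Rightarrow> bool" where
  "Ck_on 0 S f \<longleftrightarrow> continuous_on S f"
| "Ck_on (Suc k) S f \<longleftrightarrow>
     (\<forall>x\<in>S. f differentiable (at x)) \<and> (\<forall>i. Ck_on k S (partial i f))"

definition hessian :: "(real^'n::finite \<Rightarrow> real) \<Rightarrow> real^'n \<Rightarrow> real^'n^'n" where
  "hessian f x = (\<chi> i j. partial i (partial j f) x)"

section \<open>Lebesgue and Sobolev spaces\<close>

definition in_Lp :: "real \<Rightarrow> ('a::euclidean_space) set \<Rightarrow> ('a \<Rightarrow> 'b::real_normed_vector) \<Rightarrow> bool" where
  "in_Lp p S g \<longleftrightarrow> set_borel_measurable lebesgue S g \<and>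
     set_integrable lebesgue S (\<lambda>x. norm (g x) powr p)"

text \<open>For matrix-valued functions, \<open>norm\<close> is the Frobenius norm. The value of
  \<open>Lp_norm p S g\<close> is meaningful only if \<open>in_Lp p S g\<close>; any exponent \<open>p > 0\<close> is allowed.\<close>

definition Lp_norm :: "real \<Rightarrow> ('a::euclidean_space) set \<Rightarrow> ('a \<Rightarrow> 'b::real_normed_vector) \<Rightarrow> real" where
  "Lp_norm p S g = (LINT x:S|lebesgue. norm (g x) powr p) powr (1 / p)"

definition in_Lp_loc :: "real \<Rightarrow> ('a::euclidean_space) set \<Rightarrow> ('a \<Rightarrow> 'b::real_normed_vector) \<Rightarrow> bool" where
  "in_Lp_loc p \<Omega> g \<longleftrightarrow> (\<forall>K. compact K \<and> K \<subseteq> \<Omega> \<longrightarrow> in_Lp p K g)"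

definition test_function :: "(real^'n::finite) set \<Rightarrow> (real^'n \<Rightarrow> real) \<Rightarrow> bool" where
  "test_function \<Omega> \<psi> \<longleftrightarrow> (\<forall>k. Ck_on k UNIV \<psi>) \<and>
     compact (closure {x. \<psi> x \<noteq> 0}) \<and> closure {x. \<psi> x \<noteq> 0} \<subseteq> \<Omega>"

definition weak_partial ::
  "'n::finite \<Rightarrow> (real^'n) set \<Rightarrow> (real^'n \<Rightarrow> real) \<Rightarrow> (real^'n \<Rightarrow> real) \<Rightarrow> bool" where
  "weak_partial i \<Omega> v w \<longleftrightarrow> in_Lp_loc 1 \<Omega> v \<and> in_Lp_loc 1 \<Omega> w \<and>
     (\<forall>\<psi>. test_function \<Omega> \<psi> \<longrightarrow>
       (LINT x:\<Omega>|lebesgue. v x * partial i \<psi> x) = - (LINT x:\<Omega>|lebesgue. w x * \<psi> x))"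

definition weak_gradient ::
  "(real^'n::finite) set \<Rightarrow> (real^'n \<Rightarrow> real) \<Rightarrow> (real^'n \<Rightarrow> real^'n) \<Rightarrow> bool" where
  "weak_gradient \<Omega> u G \<longleftrightarrow> (\<forall>i. weak_partial i \<Omega> u (\<lambda>x. G x $ i))"

text \<open>Weak derivatives are determined only up to null sets, so they are given by relations:
  \<open>weak_hessian \<Omega> u H\<close> says that \<open>H\<close> is a version of \<open>D\<^sup>2u\<close>.\<close>

definition weak_hessian ::
  "(real^'n::finite) set \<Rightarrow> (real^'n \<Rightarrow> real) \<Rightarrow> (real^'n \<Rightarrow> real^'n^'n) \<Rightarrow> bool" where
  "weak_hessian \<Omega> u H \<longleftrightarrow> (\<exists>G. weak_gradient \<Omega> u G \<and>
     (\<forall>i j. weak_partial i \<Omega> (\<lambda>x. G x $ j) (\<lambda>x. H x $ i $ j)))"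

definition in_W2_loc :: "real \<Rightarrow> (real^'n::finite) set \<Rightarrow> (real^'n \<Rightarrow> real) \<Rightarrow> bool" where
  "in_W2_loc p \<Omega> u \<longleftrightarrow> in_Lp_loc p \<Omega> u \<and>
     (\<exists>G. weak_gradient \<Omega> u G \<and> in_Lp_loc p \<Omega> G) \<and>
     (\<exists>H. weak_hessian \<Omega> u H \<and> in_Lp_loc p \<Omega> H)"

section \<open>The linearized Monge--Ampere equation\<close>

definition cof_hessian :: "(real^'n::finite \<Rightarrow> real) \<Rightarrow> real^'n \<Rightarrow> real^'n^'n" where
  "cof_hessian \<phi> x = det (hessian \<phi> x) *\<^sub>R matrix_inv (hessian \<phi> x)"

text \<open>Solutions in \<open>W\<^sup>2\<^sup>,\<^sup>n_loc\<close> are strong solutions: the equation holds almost everywhere, with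
  \<open>H\<close> a version of the weak Hessian of the solution.\<close>

definition linearized_MA_ae ::
  "(real^'n::finite) set \<Rightarrow> (real^'n \<Rightarrow> real) \<Rightarrow> (real^'n \<Rightarrow> real^'n^'n) \<Rightarrow> (real^'n \<Rightarrow> real) \<Rightarrow> bool" where
  "linearized_MA_ae \<Omega> \<phi> H f \<longleftrightarrow>
     (AE x in lebesgue. x \<in> \<Omega> \<longrightarrow>
        (\<Sum>i\<in>UNIV. \<Sum>j\<in>UNIV. cof_hessian \<phi> x $ i $ j * H x $ i $ j) = f x)"

section \<open>Conditions on the domain and on the potential\<close>

definition bounded_convex_domain :: "(real^'n::finite) set \<Rightarrow> bool" where
  "bounded_convex_domain \<Omega> \<longleftrightarrow> \<Omega> \<noteq> {} \<and> open \<Omega> \<and> convex \<Omega> \<and> bounded \<Omega>"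

text \<open>A ball contained in \<open>\<Omega>\<close> is tangent to the boundary at \<open>y\<close> iff \<open>y\<close> lies on its sphere.\<close>

definition cond_A1 :: "real \<Rightarrow> (real^'n::finite) set \<Rightarrow> bool" where
  "cond_A1 \<rho> \<Omega> \<longleftrightarrow> \<Omega> \<subseteq> ball 0 (1 / \<rho>) \<and>
     (\<forall>y\<in>frontier \<Omega>. \<exists>z. ball z \<rho> \<subseteq> \<Omega> \<and> y \<in> sphere z \<rho>)"

definition cond_A2 :: "real \<Rightarrow> real \<Rightarrow> (real^'n::finite) set \<Rightarrow> (real^'n \<Rightarrow> real) \<Rightarrow> bool" where
  "cond_A2 l L \<Omega> \<phi> \<longleftrightarrow>
     (\<exists>M. M-lipschitz_on (closure \<Omega>) \<phi>) \<and> Ck_on 2 \<Omega> \<phi> \<and> convex_on (closure \<Omega>) \<phi> \<and>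
     (\<forall>x\<in>\<Omega>. l \<le> det (hessian \<phi> x) \<and> det (hessian \<phi> x) \<le> L)"

text \<open>For convex \<open>\<Omega>\<close>: \<open>\<nu>\<close> is normal to a supporting hyperplane at \<open>x0\<close> and points into \<open>\<Omega>\<close>.\<close>

definition inner_unit_normal :: "(real^'n::finite) set \<Rightarrow> real^'n \<Rightarrow> real^'n \<Rightarrow> bool" where
  "inner_unit_normal \<Omega> x0 \<nu> \<longleftrightarrow> norm \<nu> = 1 \<and> (\<forall>x\<in>\<Omega>. 0 < \<nu> \<bullet> (x - x0))"

definition boundary_slope ::
  "(real^'n::finite) set \<Rightarrow> (real^'n \<Rightarrow> real) \<Rightarrow> real^'n \<Rightarrow> real^'n \<Rightarrow> bool" where
  "boundary_slope \<Omega> \<phi> x0 s \<longleftrightarrow>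
     (\<forall>x\<in>closure \<Omega>. \<phi> x0 + s \<bullet> (x - x0) \<le> \<phi> x) \<and>
     (\<forall>\<nu> \<epsilon>. inner_unit_normal \<Omega> x0 \<nu> \<and> \<epsilon> > 0 \<longrightarrow>
        \<not> (\<forall>x\<in>closure \<Omega>. \<phi> x0 + (s + \<epsilon> *\<^sub>R \<nu>) \<bullet> (x - x0) \<le> \<phi> x))"

text \<open>\<open>s\<close> plays the role of \<open>\<nabla>\<phi>(x0)\<close>. Together with the tangent ball condition, the upper bound
  below forces the slope to be unique.\<close>

definition cond_A3 :: "real \<Rightarrow> (real^'n::finite) set \<Rightarrow> (real^'n \<Rightarrow> real) \<Rightarrow> bool" where
  "cond_A3 \<rho> \<Omega> \<phi> \<longleftrightarrow>
     (\<forall>x0\<in>frontier \<Omega>. \<exists>s. boundary_slope \<Omega> \<phi> x0 s \<and>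
        (\<forall>x\<in>frontier \<Omega>.
           \<rho> * (norm (x - x0))\<^sup>2 \<le> \<phi> x - \<phi> x0 - s \<bullet> (x - x0) \<and>
           \<phi> x - \<phi> x0 - s \<bullet> (x - x0) \<le> (1 / \<rho>) * (norm (x - x0))\<^sup>2))"

text \<open>\<open>C11_boundary K \<Omega>\<close> says that the boundary of \<open>\<Omega>\<close> is of class \<open>C\<^sup>1\<^sup>,\<^sup>1\<close> with
  norm at most \<open>K\<close>: in the ball of radius \<open>1/K\<close> about each boundary point, \<open>\<Omega>\<close> is the region above
  the graph, in some direction \<open>\<nu>\<close>, of a function \<open>\<gamma>\<close> on the hyperplane \<open>\<nu>\<^sup>\<bottom>\<close> whose values,
  gradient and Lipschitz constant of the gradient are bounded by \<open>K\<close>. To avoid a type for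
  the hyperplane, \<open>\<gamma>\<close> is defined on a ball of the whole space; this changes nothing, since a function
  on \<open>\<nu>\<^sup>\<bottom>\<close> extends with the same bounds by composing it with the orthogonal projection.\<close>

definition C11_boundary :: "real \<Rightarrow> (real^'n::finite) set \<Rightarrow> bool" where
  "C11_boundary K \<Omega> \<longleftrightarrow>
     (\<forall>x0\<in>frontier \<Omega>. \<exists>\<nu> \<gamma> G. norm \<nu> = 1 \<and>
        (\<forall>y\<in>ball 0 (1 / K). GDERIV \<gamma> y :> G y \<and> \<bar>\<gamma> y\<bar> \<le> K \<and> norm (G y) \<le> K) \<and>
        K-lipschitz_on (ball 0 (1 / K)) G \<and>
        (\<forall>x\<in>ball x0 (1 / K).
           x \<in> \<Omega> \<longleftrightarrow> \<gamma> ((x - x0) - ((x - x0) \<bullet> \<nu>) *\<^sub>R \<nu>) < (x - x0) \<bullet> \<nu>))"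

end

theory Submission
  imports Defs
begin

text \<open>The proof compares the gradient image of \<open>\<phi>\<close> with that of \<open>v = \<phi> + w / M\<close>, where \<open>w\<close> is a mollification
  of \<open>u\<close>, and needs no Harnack inequality. If \<open>\<phi>\<close> exceeds its tangent plane at \<open>x\<close> by more than
  \<open>2 sup \<bar>w\<bar> / M\<close> near the boundary, then \<open>v\<close> minus that plane has an interior minimum, so \<open>\<nabla>\<phi>(x)\<close> is a value
  of \<open>\<nabla>v\<close> on \<open>A = {D\<^sup>2v \<ge> 0}\<close>. On \<open>A\<close> the arithmetic-geometric mean inequality bounds \<open>det D\<^sup>2v\<close> in terms of
  \<open>det D\<^sup>2\<phi>\<close> and \<open>\<L>\<^sub>\<phi> w / M\<close>. Comparing the volumes of the gradient images shows that the points at distance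
  at least \<open>\<delta>\<close> from the boundary lie in \<open>A\<close>, up to a set of measure \<open>O(\<delta> + F / M)\<close>, where \<open>F\<close> is the \<open>L\<^sup>n\<close> norm
  of \<open>f\<close>; the same argument gives \<open>sup \<bar>w\<bar> = O(F)\<close>.

  By (A3) and a barrier, the tangent planes at these points stay \<open>c \<delta>\<^sup>4\<close> below \<open>\<phi>\<close> on the boundary, so \<open>M = O(F \<delta>\<^sup>-\<^sup>4)\<close>
  suffices. Using \<open>w\<close> and \<open>-w\<close>, one gets \<open>\<bar>D\<^sup>2w\<bar> \<le> M tr D\<^sup>2\<phi>\<close> off a set of measure \<open>O(\<delta>)\<close>, and the integral of
  \<open>tr D\<^sup>2\<phi>\<close> over the points at distance at least \<open>\<delta>\<close> is \<open>O(1 / \<delta>)\<close>. Hence \<open>\<bar>D\<^sup>2u\<bar> = O(F \<delta>\<^sup>-\<^sup>6)\<close> off a set of measure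
  \<open>O(\<delta>)\<close>, which gives the estimate for every \<open>p < 1 / 6\<close>; we take \<open>p = 1 / 12\<close>.\<close>

section \<open>Symmetric and positive semidefinite matrices\<close>

text \<open>The comparison of volumes yields a set of measure \<open>O(\<delta>)\<close> only
  because its main terms cancel. The integral of \<open>det D^2\<phi>\<close> over the inner points
  is at most its integral over the contact set plus an error, and the common part of the two sets
  drops out. The bound for \<open>det D^2v\<close> must therefore keep the coefficient of
  \<open>det D^2\<phi>\<close> within \<open>O(F / M)\<close> of 1; a constant multiple would prove
  nothing.

  The exponent 4 comes from scaling. Let d be the height of x above the supporting hyperplane. The
  barrier lives in a cap whose height is of order d^2, so a dip of depth h needs a normal second
  derivative of order h / d^4. The determinant condition excludes this if h is a small multiple of
  d^4.

  Mollifying requires leaving the boundary. The width of the discarded layer and the radius of the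
  kernel depend on u and \<phi> without any rate, which is harmless because no constant of the
  estimates involves them. Mollification does not commute with the operator; local
  \<open>L^n\<close> integrability of D^2u makes the commutator as small as F for a small radius,
  and this merely replaces F by 2F.\<close>

lemma orthogonal_matrix_column_inner:
  "orthogonal_matrix (Q :: real^'n^'n) \<longleftrightarrow>
     (\<forall>a b. column a Q \<bullet> column b Q = (if a = b then 1 else 0))"
  unfolding orthogonal_matrix_orthonormal_columns orthogonal_def norm_eq_1
  by (metis (full_types))

lemma compact_orthogonal_matrices: "compact {Q :: real^'n^'n. orthogonal_matrix Q}"
proof (rule compact_eq_bounded_closed[THEN iffD2], intro conjI)
  have "norm Q \<le> real CARD('n)" if "orthogonal_matrix Q" for Q :: "real^'n^'n"
  proof -
    have "norm (Q $ i) = 1" for i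
      using that unfolding orthogonal_matrix_orthonormal_rows row_def by (simp add: vec_lambda_eta)
    then show ?thesis
      using norm_le_l1_cart[of "\<chi> i. norm (Q $ i)"]
      by (simp add: norm_vec_def)
  qed
  then show "bounded {Q :: real^'n^'n. orthogonal_matrix Q}"
    unfolding bounded_iff by blast
  have "{Q :: real^'n^'n. orthogonal_matrix Q} =
      (\<Inter>a b. {Q. column a Q \<bullet> column b Q = (if a = b then 1 else 0)})"
    unfolding orthogonal_matrix_column_inner by auto
  moreover have "closed {Q :: real^'n^'n. column a Q \<bullet> column b Q = (if a = b then 1 else 0)}" for a b
    unfolding column_def by (intro closed_Collect_eq continuous_intros)
  ultimately show "closed {Q :: real^'n^'n. orthogonal_matrix Q}"
    by (metis (no_types, lifting) closed_INT)
qed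

text \<open>A maximiser over the orthogonal group of \<open>\<Sum>i. c i * (q\<^sub>i \<bullet> C q\<^sub>i)\<close> with distinct weights
  diagonalises \<open>C\<close>: rotating two columns changes the sum to first order by their off-diagonal entry.\<close>

lemma symmetric_matrix_orthogonal_diagonalization:
  fixes C :: "real^'n^'n"
  assumes sym: "transpose C = C"
  obtains Q where "orthogonal_matrix Q" "\<And>i j. i \<noteq> j \<Longrightarrow> column i Q \<bullet> (C *v column j Q) = 0"
proof -
  obtain c0 :: "'n \<Rightarrow> nat" where c0: "inj c0"
    using finite_imp_inj_to_nat_seg[of "UNIV :: 'n set"] by auto
  define c where "c i = real (c0 i)" for i
  have c: "c i \<noteq> c j" if "i \<noteq> j" for i j
    using c0 that by (auto simp: c_def inj_def)
  define f where "f Q = (\<Sum>i\<in>UNIV. c i * (column i Q \<bullet> (C *v column i Q)))" for Q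
  have symC: "x \<bullet> (C *v y) = y \<bullet> (C *v x)" for x y
    by (metis sym dot_lmul_matrix inner_commute transpose_matrix_vector)
  have "continuous_on {Q. orthogonal_matrix Q} f"
    unfolding f_def column_def matrix_vector_mult_def by (intro continuous_intros)
  then obtain Q where Q: "orthogonal_matrix Q" and max: "\<And>R. orthogonal_matrix R \<Longrightarrow> f R \<le> f Q"
    using continuous_attains_sup[OF compact_orthogonal_matrices, of f] orthogonal_matrix_id by blast
  have "column i Q \<bullet> (C *v column j Q) = 0" if ij: "i \<noteq> j" for i j
  proof -
    let ?q = "\<lambda>k. column k Q"
    let ?a = "\<lambda>k l. ?q k \<bullet> (C *v ?q l)"
    have on: "?q a \<bullet> ?q b = (if a = b then 1 else 0)" for a b
      using Q unfolding orthogonal_matrix_column_inner by blast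
    \<comment> \<open>The gain in \<open>f\<close> when columns \<open>i\<close> and
      \<open>j\<close> are rotated by the angle \<open>t\<close>, in a form whose derivative at 0 is
      visible.\<close>
    define h where "h t = (c i - c j) * ((sin t)\<^sup>2 * (?a j j - ?a i i) + 2 * sin t * cos t * ?a i j)" for t
    have "h t \<le> h 0" for t
    proof -
      define R where "R = (\<chi> a b. if b = i then cos t * Q $ a $ i + sin t * Q $ a $ j
         else if b = j then - sin t * Q $ a $ i + cos t * Q $ a $ j else Q $ a $ b)"
      have Ri: "column i R = cos t *\<^sub>R ?q i + sin t *\<^sub>R ?q j"
        by (simp add: R_def column_def vec_eq_iff)
      have Rj: "column j R = (- sin t) *\<^sub>R ?q i + cos t *\<^sub>R ?q j"
        using ij by (simp add: R_def column_def vec_eq_iff)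
      have Rk: "column k R = ?q k" if "k \<noteq> i" "k \<noteq> j" for k
        using that by (simp add: R_def column_def vec_eq_iff)
      have sc: "(sin t)\<^sup>2 = 1 - (cos t)\<^sup>2"
        by (simp add: sin_squared_eq)
      have "column a R \<bullet> column b R = (if a = b then 1 else 0)" for a b
        using ij by (cases "a = i"; cases "a = j"; cases "b = i"; cases "b = j")
          (simp_all add: Ri Rj Rk on inner_add_left inner_add_right inner_diff_left inner_diff_right
             power2_eq_square[symmetric])
      then have "f R \<le> f Q"
        using max unfolding orthogonal_matrix_column_inner by blast
      moreover have "f X = c i * (column i X \<bullet> (C *v column i X)) + c j * (column j X \<bullet> (C *v column j X))
          + (\<Sum>k\<in>UNIV - {i, j}. c k * (column k X \<bullet> (C *v column k X)))" for X
      proof -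
        have "f X = (\<Sum>k\<in>{i,j}. c k * (column k X \<bullet> (C *v column k X)))
          + (\<Sum>k\<in>UNIV - {i, j}. c k * (column k X \<bullet> (C *v column k X)))"
          unfolding f_def by (subst sum.subset_diff[of "{i,j}"]) auto
        then show ?thesis using ij by simp
      qed
      moreover have "(\<Sum>k\<in>UNIV - {i, j}. c k * (column k R \<bullet> (C *v column k R)))
          = (\<Sum>k\<in>UNIV - {i, j}. c k * (column k Q \<bullet> (C *v column k Q)))"
        by (intro sum.cong) (auto simp: Rk)
      ultimately have le: "c i * (column i R \<bullet> (C *v column i R)) + c j * (column j R \<bullet> (C *v column j R))
         \<le> c i * ?a i i + c j * ?a j j"
        by simp
      have e1: "column i R \<bullet> (C *v column i R)
          = (cos t)\<^sup>2 * ?a i i + 2 * sin t * cos t * ?a i j + (sin t)\<^sup>2 * ?a j j"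
        unfolding Ri using symC[of "?q j" "?q i"]
        by (simp add: matrix_vector_right_distrib matrix_vector_mult_scaleR inner_add_left inner_add_right
          algebra_simps power2_eq_square)
      have e2: "column j R \<bullet> (C *v column j R)
          = (sin t)\<^sup>2 * ?a i i - 2 * sin t * cos t * ?a i j + (cos t)\<^sup>2 * ?a j j"
        unfolding Rj using symC[of "?q j" "?q i"]
        by (simp add: matrix_vector_right_distrib matrix_vector_mult_diff_distrib matrix_vector_mult_scaleR inner_add_left inner_add_right
          inner_diff_left inner_diff_right algebra_simps power2_eq_square)
      have "h t = c i * (column i R \<bullet> (C *v column i R)) + c j * (column j R \<bullet> (C *v column j R))
         - (c i * ?a i i + c j * ?a j j)"
        unfolding e1 e2 h_def sc by (simp add: algebra_simps)
      then show "h t \<le> h 0"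
        using le by (simp add: h_def)
    qed
    moreover have "(h has_real_derivative (c i - c j) * (2 * ?a i j)) (at 0)"
      unfolding h_def by (auto intro!: derivative_eq_intros)
    ultimately have "(c i - c j) * (2 * ?a i j) = 0"
      using DERIV_local_max[of h _ 0 1] zero_less_one by blast
    then show ?thesis using c[OF ij] by simp
  qed
  with Q that show ?thesis by blast
qed

section \<open>Determinants and traces of positive semidefinite matrices\<close>

definition psd :: "real^'n^'n \<Rightarrow> bool" where
  "psd A \<longleftrightarrow> transpose A = A \<and> (\<forall>x. 0 \<le> x \<bullet> (A *v x))"

lemma congruence_entry:
  "(transpose S ** A ** S) $ i $ j = column i S \<bullet> ((A :: real^'n^'n) *v column j S)"
  unfolding matrix_matrix_mult_def matrix_vector_mult_def transpose_def column_def inner_vec_def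
  by (simp add: sum_distrib_left sum_distrib_right, subst sum.swap) (simp add: mult_ac)

lemma psd_diagonal_form:
  fixes A :: "real^'n^'n"
  assumes "psd A"
  obtains Q d where "orthogonal_matrix Q" "\<And>i. 0 \<le> d i"
    "A = Q ** (\<chi> i j. if i = j then d i else 0) ** transpose Q"
proof -
  obtain Q where Q: "orthogonal_matrix Q" "\<And>i j. i \<noteq> j \<Longrightarrow> column i Q \<bullet> (A *v column j Q) = 0"
    using symmetric_matrix_orthogonal_diagonalization assms unfolding psd_def by blast
  define d where "d i = column i Q \<bullet> (A *v column i Q)" for i
  have D: "transpose Q ** A ** Q = (\<chi> i j. if i = j then d i else 0)"
    using Q(2) by (simp add: vec_eq_iff congruence_entry d_def)
  have "A = (Q ** transpose Q) ** A ** (Q ** transpose Q)"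
    using Q(1) by (simp add: orthogonal_matrix_def)
  also have "\<dots> = Q ** (\<chi> i j. if i = j then d i else 0) ** transpose Q"
    unfolding D[symmetric] by (simp add: matrix_mul_assoc)
  finally have "A = Q ** (\<chi> i j. if i = j then d i else 0) ** transpose Q" .
  moreover have "0 \<le> d i" for i
    using assms by (simp add: d_def psd_def)
  ultimately show thesis
    using that[OF Q(1)] by (metis (no_types, lifting))
qed

lemma diagonal_trace_det:
  fixes Q :: "real^'n^'n"
  assumes Q: "orthogonal_matrix Q" and A: "A = Q ** (\<chi> i j. if i = j then d i else 0) ** transpose Q"
  shows "trace A = sum d UNIV" "det A = prod d UNIV"
proof -
  have Q2: "transpose Q ** Q = mat 1" using Q by (simp add: orthogonal_matrix_def)
  show "trace A = sum d UNIV"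
    unfolding A by (subst trace_mul_sym) (simp add: matrix_mul_assoc Q2 trace_def)
  have "det Q * det Q = 1"
    using Q2 det_mul[of "transpose Q" Q] by (simp add: det_transpose)
  then show "det A = prod d UNIV"
    unfolding A by (simp add: det_mul det_transpose det_diagonal mult_ac)
qed

lemma psd_trace_det_nonneg:
  fixes A :: "real^'n^'n"
  assumes "psd A"
  shows "0 \<le> trace A" "0 \<le> det A"
proof -
  obtain Q d where "orthogonal_matrix Q" "\<And>i. 0 \<le> d i"
    "A = Q ** (\<chi> i j. if i = j then d i else 0) ** transpose Q"
    using psd_diagonal_form[OF assms] by blast
  then show "0 \<le> trace A" "0 \<le> det A"
    using diagonal_trace_det[of Q A d] by (auto simp: sum_nonneg prod_nonneg)
qed

text \<open>The arithmetic-geometric mean inequality for the eigenvalues.\<close>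

lemma psd_det_le_trace_power:
  fixes A :: "real^'n^'n"
  assumes "psd A"
  shows "det A \<le> (trace A / real CARD('n)) ^ CARD('n)"
proof -
  obtain Q d where Q: "orthogonal_matrix Q" and d: "\<And>i. 0 \<le> d i"
    and A: "A = Q ** (\<chi> i j. if i = j then d i else 0) ** transpose Q"
    using psd_diagonal_form[OF assms] by blast
  have n: "real CARD('n) > 0" by simp
  have "prod d UNIV powr (1 / real CARD('n)) \<le> sum d UNIV / real CARD('n)"
    using arith_geom_mean[of "UNIV :: 'n set" d] d by (simp add: sum_divide_distrib)
  then have "(prod d UNIV powr (1 / real CARD('n))) ^ CARD('n) \<le> (sum d UNIV / real CARD('n)) ^ CARD('n)"
    by (intro power_mono) auto
  moreover have "(prod d UNIV powr (1 / real CARD('n))) ^ CARD('n) = prod d UNIV"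
  proof -
    have "(p powr (1 / real CARD('n))) ^ CARD('n) = p" if "p \<ge> 0" for p :: real
      using that by (cases "p = 0") (auto simp: powr_power)
    then show ?thesis using prod_nonneg[of UNIV d] d by blast
  qed
  ultimately show ?thesis
    by (simp add: diagonal_trace_det[OF Q A])
qed

lemma matrix_add_rdistrib: "(A + B) ** C = A ** C + B ** (C :: real^'n^'m)"
  by (simp add: matrix_matrix_mult_def vec_eq_iff distrib_right sum.distrib)

text \<open>In an eigenbasis the determinant is a product of factors
  \<open>1 + \<tau> * d i\<close>, and dropping all products of two or more nonnegative terms leaves
  the right order. It lets the volume of a gradient image control an integral of the trace.\<close>

lemma det_id_add_psd_ge:
  fixes A :: "real^'n^'n"
  assumes "psd A" and "0 \<le> \<tau>"
  shows "1 + \<tau> * trace A \<le> det (mat 1 + \<tau> *\<^sub>R A)"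
proof -
  obtain Q d where Q: "orthogonal_matrix Q" and d: "\<And>i. 0 \<le> d i"
    and A: "A = Q ** (\<chi> i j. if i = j then d i else 0) ** transpose Q"
    using psd_diagonal_form[OF assms(1)] by blast
  have "mat 1 + \<tau> *\<^sub>R A = Q ** (mat 1 + \<tau> *\<^sub>R (\<chi> i j. if i = j then d i else 0)) ** transpose Q"
  proof -
    have "Q ** (\<tau> *\<^sub>R (\<chi> i j. if i = j then d i else 0)) ** transpose Q = \<tau> *\<^sub>R A"
      unfolding A by (simp only: matrix_scalar_ac scalar_matrix_assoc[symmetric])
    moreover have "Q ** mat 1 ** transpose Q = mat 1"
      using Q by (simp add: orthogonal_matrix_def)
    ultimately show ?thesis
      by (simp only: matrix_add_ldistrib matrix_add_rdistrib)
  qed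
  also have "mat 1 + \<tau> *\<^sub>R (\<chi> i j. if i = j then d i else 0)
      = ((\<chi> i j. if i = j then 1 + \<tau> * d i else 0) :: real^'n^'n)"
    by (auto simp: vec_eq_iff mat_def)
  finally have "det (mat 1 + \<tau> *\<^sub>R A) = (\<Prod>i\<in>UNIV. 1 + \<tau> * d i)"
    by (rule diagonal_trace_det(2)[OF Q])
  moreover have "1 + (\<Sum>i\<in>S. \<tau> * d i) \<le> (\<Prod>i\<in>S. 1 + \<tau> * d i)" if "finite S" for S
    using that
  proof (induction S)
    case (insert x S)
    have "1 + (\<Sum>i\<in>insert x S. \<tau> * d i) \<le> (1 + \<tau> * d x) * (1 + (\<Sum>i\<in>S. \<tau> * d i))"
      using insert d assms(2) sum_nonneg[of S "\<lambda>i. \<tau> * d i"] by (simp add: algebra_simps)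
    also have "\<dots> \<le> (1 + \<tau> * d x) * (\<Prod>i\<in>S. 1 + \<tau> * d i)"
      using insert d assms(2) by (intro mult_left_mono) auto
    finally show ?case using insert by simp
  qed auto
  ultimately show ?thesis
    by (simp add: diagonal_trace_det[OF Q A] sum_distrib_left)
qed

lemma psd_congruence: 
  fixes A :: "real^'n^'n"
  assumes "psd A" shows "psd (transpose S ** A ** S)"
proof -
  have "x \<bullet> ((transpose S ** A ** S) *v x) = (S *v x) \<bullet> (A *v (S *v x))" for x
    by (simp add: matrix_vector_mul_assoc[symmetric] dot_lmul_matrix[symmetric] flip: transpose_matrix_vector)
  moreover have "transpose (transpose S ** A ** S) = transpose S ** A ** S"
    using assms by (simp add: psd_def matrix_transpose_mul matrix_mul_assoc)
  ultimately show ?thesis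
    using assms unfolding psd_def by metis
qed

lemma psd_sqrt:
  fixes A :: "real^'n^'n"
  assumes "psd A"
  obtains R :: "real^'n^'n" where "A = R ** transpose R"
proof -
  obtain Q d where Q: "orthogonal_matrix Q" and d: "\<And>i. 0 \<le> d i"
    and A: "A = Q ** (\<chi> i j. if i = j then d i else 0) ** transpose Q"
    using psd_diagonal_form[OF assms] by blast
  define E :: "real^'n^'n" where "E = (\<chi> i j. if i = j then sqrt (d i) else 0)"
  have E: "E ** E = (\<chi> i j. if i = j then d i else 0)"
  proof -
    have "(E ** E) $ i $ j = (if i = j then d i else 0)" for i j
    proof -
      have "(E ** E) $ i $ j = (\<Sum>k\<in>UNIV. E $ i $ k * E $ k $ j)"
        by (simp add: matrix_matrix_mult_def)
      also have "\<dots> = (\<Sum>k\<in>UNIV. if k = i then (if i = j then d i else 0) else 0)"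
        by (rule sum.cong) (use d in \<open>auto simp: E_def\<close>)
      finally have "(E ** E) $ i $ j = (\<Sum>k\<in>UNIV. if k = i then (if i = j then d i else 0) else 0)" .
      then show ?thesis by simp
    qed
    then show ?thesis by (simp add: vec_eq_iff)
  qed
  have "transpose E = E" by (auto simp: E_def transpose_def vec_eq_iff)
  then have "A = (Q ** E) ** transpose (Q ** E)"
    by (simp only: A E[symmetric] matrix_transpose_mul matrix_mul_assoc)
  then show thesis by (rule that)
qed

text \<open>\<open>A ** B\<close> need not be symmetric. With \<open>A = R ** transpose R\<close>,
  the matrix \<open>transpose R ** B ** R\<close> is positive semidefinite and has the same
  determinant and trace as \<open>A ** B\<close>.\<close>

lemma psd_det_mult_le:
  fixes A B :: "real^'n^'n"
  assumes "psd A" "psd B"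
  shows "det A * det B \<le> (trace (A ** B) / real CARD('n)) ^ CARD('n)"
proof -
  obtain R :: "real^'n^'n" where A: "A = R ** transpose R" by (rule psd_sqrt[OF assms(1)])
  have "det A * det B = det (transpose R ** B ** R)"
    unfolding A by (simp add: det_mul det_transpose)
  also have "\<dots> \<le> (trace (transpose R ** B ** R) / real CARD('n)) ^ CARD('n)"
    by (intro psd_det_le_trace_power psd_congruence assms)
  also have "trace (transpose R ** B ** R) = trace (A ** B)"
    unfolding A by (subst trace_mul_sym) (simp add: matrix_mul_assoc)
  finally show ?thesis .
qed

text \<open>After congruence with the inverse of \<open>T\<close> the form is bounded by the square
  of the norm, so the diagonal entries are at most 1 and the trace bound for determinants applies.
  The majorant is given by a factor \<open>T\<close>, which is how the Hessian of the barrier will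
  be available.\<close>

lemma psd_det_le_of_quadratic_bound:
  fixes A T :: "real^'n^'n"
  assumes A: "psd A" and T: "det T \<noteq> 0" and le: "\<And>x. x \<bullet> (A *v x) \<le> (norm (T *v x))\<^sup>2"
  shows "det A \<le> (det T)\<^sup>2"
proof -
  obtain S where S: "T ** S = mat 1" using T by (metis invertible_det_nz invertible_def)
  have dS: "det T * det S = 1" using S by (metis det_I det_mul)
  let ?C = "transpose S ** A ** S"
  have "?C $ i $ i \<le> 1" for i
  proof -
    have "T *v column i S = axis i 1"
      by (metis S matrix_vector_mul_assoc matrix_vector_mul_lid matrix_vector_mult_basis)
    then have "column i S \<bullet> (A *v column i S) \<le> 1"
      using le[of "column i S"] by (simp add: norm_axis_1)
    then show ?thesis by (simp add: congruence_entry)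
  qed
  then have "trace ?C \<le> real CARD('n)"
    unfolding trace_def using sum_mono[of "UNIV :: 'n set" "\<lambda>i. ?C $ i $ i" "\<lambda>_. 1"] by simp
  then have "(trace ?C / real CARD('n)) ^ CARD('n) \<le> 1"
    using psd_trace_det_nonneg(1)[OF psd_congruence[OF A], of S]
    by (intro power_le_one divide_nonneg_nonneg) auto
  then have "det ?C \<le> 1"
    using psd_det_le_trace_power[OF psd_congruence[OF A], of S] by linarith
  then have "det S * det A * det S \<le> 1" by (simp add: det_mul det_transpose)
  then have "(det T)\<^sup>2 * (det S * det A * det S) \<le> (det T)\<^sup>2"
    using T by (metis mult.right_neutral mult_left_mono zero_le_power2)
  moreover have "(det T)\<^sup>2 * (det S * det A * det S) = (det T * det S)\<^sup>2 * det A"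
    by (simp add: power2_eq_square)
  ultimately show ?thesis using dS by simp
qed

lemma rank_one_update_mult_vec:
  fixes w m h :: "real^'n"
  shows "(\<chi> i j. (if i = j then 1 else 0) + w $ i * m $ j) *v h = h + (m \<bullet> h) *\<^sub>R w"
proof -
  have "((\<chi> i j. (if i = j then 1 else 0) + w $ i * m $ j) *v h) $ i = (h + (m \<bullet> h) *\<^sub>R w) $ i" for i
  proof -
    have "((\<chi> i j. (if i = j then 1 else 0) + w $ i * m $ j) *v h) $ i
        = (\<Sum>j\<in>UNIV. (if i = j then h $ j else 0) + w $ i * (m $ j * h $ j))"
      unfolding matrix_vector_mult_def by (auto intro!: sum.cong simp: algebra_simps)
    also have "\<dots> = h $ i + w $ i * (m \<bullet> h)"
      unfolding sum.distrib by (simp add: inner_vec_def sum_distrib_left)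
    finally show ?thesis by simp
  qed
  then show ?thesis by (simp add: vec_eq_iff)
qed

text \<open>The matrix determinant lemma. After a rotation taking a coordinate axis to the direction
  of \<open>m\<close>, the matrix differs from the identity in a single column, and Cramer's rule
  gives the determinant.\<close>

lemma det_id_add_rank_one:
  fixes w m :: "real^'n"
  shows "det (\<chi> i j. (if i = j then 1 else 0) + w $ i * m $ j) = 1 + w \<bullet> m"
proof (cases "m = 0")
  case True
  have "det (mat 1 :: real^'n^'n) = 1 + w \<bullet> 0"
    by simp
  moreover have "(\<chi> i j. (if i = j then 1 else 0) + w $ i * m $ j) = (mat 1 :: real^'n^'n)"
    unfolding True mat_def by (simp add: vec_eq_iff)
  ultimately show ?thesis
    unfolding True by (simp only:)
next
  case False
  \<comment> \<open>Any coordinate serves; \<open>undefined\<close> just names one index.\<close>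
  define k :: 'n where "k = undefined"
  define e where "e = m /\<^sub>R norm m"
  have e: "norm e = 1" using False by (simp add: e_def)
  obtain Q where Q: "orthogonal_matrix Q" and Qk: "Q *v axis k 1 = e"
    using orthogonal_matrix_exists_basis[OF e] by metis
  have m: "m = norm m *\<^sub>R column k Q" using Qk False by (simp add: e_def matrix_vector_mult_basis)
  define M :: "real^'n^'n" where "M = (\<chi> i j. (if i = j then 1 else 0) + w $ i * m $ j)"
  have Mv: "M *v x = x + (m \<bullet> x) *\<^sub>R w" for x
    unfolding M_def by (rule rank_one_update_mult_vec)
  define w' where "w' = transpose Q *v w"
  define x where "x = axis k 1 + norm m *\<^sub>R w'"
  have on: "column a Q \<bullet> column b Q = (if a = b then 1 else 0)" for a b
    using Q unfolding orthogonal_matrix_column_inner by blast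
  have "transpose Q ** M ** Q = (\<chi> i j. if j = k then (mat 1 *v x) $ i else mat 1 $ i $ j)"
  proof -
    have "(transpose Q ** M ** Q) $ i $ j = (if j = k then (mat 1 *v x) $ i else mat 1 $ i $ j)" for i j
    proof -
      have "m \<bullet> column j Q = norm m * (if k = j then 1 else 0)"
        using arg_cong[OF m, of "\<lambda>v. v \<bullet> column j Q"] on[of k j] by simp
      then have "column i Q \<bullet> (M *v column j Q)
          = (if i = j then 1 else 0) + norm m * (if k = j then 1 else 0) * (column i Q \<bullet> w)"
        by (simp add: Mv inner_add_right on)
      moreover have "w' $ i = column i Q \<bullet> w"
        by (simp add: w'_def matrix_vector_mult_def transpose_def column_def inner_vec_def)
      moreover have "(mat 1 :: real^'n^'n) $ i $ j = (if i = j then 1 else 0)"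
        by (simp add: mat_def)
      ultimately show ?thesis
        by (cases "j = k") (simp_all add: congruence_entry x_def axis_def)
    qed
    then show ?thesis by (simp add: vec_eq_iff)
  qed
  then have "det (transpose Q ** M ** Q) = x $ k * det (mat 1 :: real^'n^'n)"
    by (simp add: cramer_lemma)
  moreover have "det Q * det Q = 1"
    using Q det_mul[of "transpose Q" Q] by (simp add: det_transpose orthogonal_matrix_def)
  ultimately have "det M = x $ k" by (simp add: det_mul det_transpose mult_ac)
  also have "x $ k = 1 + w \<bullet> m"
  proof -
    have "w \<bullet> m = norm m * (column k Q \<bullet> w)"
      using arg_cong[OF m, of "\<lambda>v. w \<bullet> v"] by (simp add: inner_commute)
    moreover have "w' $ k = column k Q \<bullet> w"
      by (simp add: w'_def matrix_vector_mult_def transpose_def column_def inner_vec_def)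
    ultimately show ?thesis by (simp add: x_def)
  qed
  finally show ?thesis by (simp add: M_def)
qed

section \<open>Volume of gradient images\<close>

text \<open>The library states the change of variables formula for index types with a well-order only.
  We transfer it to an arbitrary finite index type, which is in bijection with a type of natural numbers.\<close>

typedef ('a::finite) ordinal_ix = "{..<CARD('a)}"
  by (rule exI[of _ 0]) simp

instance ordinal_ix :: (finite) finite
proof
  have "range (Rep_ordinal_ix :: 'a ordinal_ix \<Rightarrow> nat) \<subseteq> {..<CARD('a)}"
    using Rep_ordinal_ix by blast
  then show "finite (UNIV :: 'a ordinal_ix set)"
    by (metis Rep_ordinal_ix_inject finite_imageD finite_lessThan finite_subset injI)
qed

instantiation ordinal_ix :: (finite) wellorder
begin
definition "x \<le> y \<longleftrightarrow> Rep_ordinal_ix x \<le> Rep_ordinal_ix y"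
definition "x < y \<longleftrightarrow> Rep_ordinal_ix x < Rep_ordinal_ix y"
instance
proof
  fix P :: "'a ordinal_ix \<Rightarrow> bool" and a :: "'a ordinal_ix"
  assume *: "\<And>x. (\<And>y. y < x \<Longrightarrow> P y) \<Longrightarrow> P x"
  show "P a"
    by (induction a rule: measure_induct_rule[of Rep_ordinal_ix]) (use * in \<open>auto simp: less_ordinal_ix_def\<close>)
qed (auto simp: less_eq_ordinal_ix_def less_ordinal_ix_def Rep_ordinal_ix_inject)
end

lemma ordinal_ix_bij: "\<exists>r :: 'a::finite ordinal_ix \<Rightarrow> 'a. bij r"
proof -
  have "bij_betw Rep_ordinal_ix (UNIV :: 'a ordinal_ix set) {..<CARD('a)}"
    using type_definition.Rep_range[OF type_definition_ordinal_ix]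
    by (auto simp: bij_betw_def inj_on_def Rep_ordinal_ix_inject)
  then have "card (UNIV :: 'a ordinal_ix set) = CARD('a)"
    by (metis bij_betw_same_card card_lessThan)
  then show ?thesis
    by (metis finite finite_same_card_bij)
qed

section \<open>Determinants, Lebesgue measure and integrals under a change of the index type\<close>

lemma swapidseq_conj:
  assumes "swapidseq n p" and r: "bij r"
  shows "swapidseq n (inv r \<circ> p \<circ> r)"
  using assms(1)
proof (induction rule: swapidseq.induct)
  case id
  have "inv r \<circ> id \<circ> r = id" using r by (simp add: bij_is_inj fun_eq_iff)
  then show ?case by (simp only: swapidseq.id)
next
  case (comp_Suc n p a b)
  have "inv r \<circ> (Transposition.transpose a b \<circ> p) \<circ> r = Transposition.transpose (inv r a) (inv r b) \<circ> (inv r \<circ> p \<circ> r)"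
  proof
    fix x
    have "inv r y = inv r z \<longleftrightarrow> y = z" for y z
      using r by (metis bij_inv_eq_iff)
    then show "(inv r \<circ> (Transposition.transpose a b \<circ> p) \<circ> r) x
        = (Transposition.transpose (inv r a) (inv r b) \<circ> (inv r \<circ> p \<circ> r)) x"
      by (simp add: Transposition.transpose_def)
  qed
  moreover have "inv r a \<noteq> inv r b"
    using comp_Suc.hyps r by (metis bij_inv_eq_iff)
  ultimately show ?case
    using comp_Suc.IH swapidseq.comp_Suc by metis
qed

lemma sign_conj:
  assumes "permutation p" "bij r"
  shows "sign (inv r \<circ> p \<circ> r) = sign p"
proof -
  obtain n where n: "swapidseq n p" using assms(1) by (auto simp: permutation_def)
  then have "evenperm (inv r \<circ> p \<circ> r) = evenperm p"
    using swapidseq_conj[OF n assms(2)] by (metis evenperm_unique)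
  then show ?thesis by (simp add: sign_def)
qed

text \<open>Conjugation by \<open>r\<close> is a bijection between the two permutation groups and
  preserves signs, so the two Leibniz sums agree term by term.\<close>

lemma det_reindex:
  fixes A :: "real^'n^'n" and r :: "'m::finite \<Rightarrow> 'n"
  assumes r: "bij r"
  shows "det (\<chi> i j. A $ r i $ r j) = det A"
proof -
  have ir: "inv r (r x) = x" "r (inv r y) = y" for x y
    using r by (auto simp: bij_is_inj inv_f_f bij_is_surj surj_f_inv_f)
  have bij: "bij_betw (\<lambda>p. inv r \<circ> p \<circ> r) {p. p permutes (UNIV :: 'n set)} {p. p permutes (UNIV :: 'm set)}"
  proof (rule bij_betwI[where g = "\<lambda>q. r \<circ> q \<circ> inv r"])
    show "(\<lambda>p. inv r \<circ> p \<circ> r) \<in> {p. p permutes UNIV} \<rightarrow> {p. p permutes UNIV}"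
      using r by (auto simp: permutes_univ bij_def[symmetric] intro!: bij_comp bij_imp_bij_inv dest!: permutes_bij simp flip: permutes_univ)
        (auto intro!: bij_imp_permutes bij_comp bij_imp_bij_inv)
    show "(\<lambda>q. r \<circ> q \<circ> inv r) \<in> {p. p permutes UNIV} \<rightarrow> {p. p permutes UNIV}"
      using r by (auto intro!: bij_imp_permutes bij_comp bij_imp_bij_inv dest!: permutes_bij)
  qed (auto simp: fun_eq_iff ir)
  have "det (\<chi> i j. A $ r i $ r j) =
      (\<Sum>q | q permutes (UNIV :: 'm set). of_int (sign q) * (\<Prod>i\<in>UNIV. A $ r i $ r (q i)))"
    by (simp add: det_def)
  also have "\<dots> = (\<Sum>p | p permutes (UNIV :: 'n set).
      of_int (sign (inv r \<circ> p \<circ> r)) * (\<Prod>i\<in>UNIV. A $ r i $ r ((inv r \<circ> p \<circ> r) i)))"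
    by (rule sum.reindex_bij_betw[OF bij, symmetric])
  also have "\<dots> = (\<Sum>p | p permutes (UNIV :: 'n set). of_int (sign p) * (\<Prod>i\<in>UNIV. A $ i $ p i))"
  proof (rule sum.cong)
    fix p :: "'n \<Rightarrow> 'n" assume "p \<in> {p. p permutes UNIV}"
    then have "permutation p" by (auto simp: permutation_permutes)
    moreover have "(\<Prod>i\<in>UNIV. A $ r i $ p (r i)) = (\<Prod>i\<in>UNIV. A $ i $ p i)"
      using prod.reindex_bij_betw[OF r, of "\<lambda>i. A $ i $ p i"] by simp
    ultimately show "of_int (sign (inv r \<circ> p \<circ> r)) * (\<Prod>i\<in>UNIV. A $ r i $ r ((inv r \<circ> p \<circ> r) i))
        = of_int (sign p) * (\<Prod>i\<in>UNIV. A $ i $ p i)"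
      by (simp add: sign_conj[OF _ r] ir)
  qed simp
  also have "\<dots> = det A" by (simp add: det_def)
  finally show ?thesis .
qed

definition reindex :: "('m \<Rightarrow> 'n) \<Rightarrow> real^'n \<Rightarrow> real^'m" where
  "reindex r x = (\<chi> j. x $ r j)"

lemma linear_reindex: "linear (reindex r)"
  by (auto simp: reindex_def linear_iff vec_eq_iff)

lemma reindex_inv:
  assumes "bij r"
  shows "reindex (inv r) (reindex r x) = x" "reindex r (reindex (inv r) y) = y"
  using assms by (auto simp: reindex_def vec_eq_iff bij_is_inj bij_is_surj surj_f_inv_f)

text \<open>Boxes pull back to boxes with the same side lengths, and Lebesgue measure is determined
  by its values on boxes.\<close>

lemma distr_lborel_reindex:
  fixes r :: "'m::finite \<Rightarrow> 'n::finite"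
  assumes r: "bij r"
  shows "distr lborel borel (reindex r) = lborel"
proof (rule lborel_eqI[symmetric])
  have P[measurable]: "reindex r \<in> borel_measurable borel"
    using linear_reindex by (intro borel_measurable_continuous_onI linear_continuous_on) (simp add: linear_conv_bounded_linear)
  fix l u :: "real^'m" assume le: "\<And>b. b \<in> Basis \<Longrightarrow> l \<bullet> b \<le> u \<bullet> b"
  then have le': "l $ i \<le> u $ i" for i
    by (metis axis_in_Basis_iff cart_eq_inner_axis one_neq_zero Basis_real_def insertI1 inner_commute)
  have ir: "inv r (r x) = x" "r (inv r y) = y" for x y
    using r by (auto simp: bij_is_inj inv_f_f bij_is_surj surj_f_inv_f)
  have vimage: "reindex r -` box l u = box (reindex (inv r) l) (reindex (inv r) u)"
    by (auto simp: reindex_def mem_box_cart ir) (metis ir)+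
  have prodB: "(\<Prod>b\<in>Basis. v \<bullet> b) = (\<Prod>i\<in>UNIV. v $ i)" for v :: "real^'k::finite"
  proof -
    have "(Basis :: (real^'k) set) = (\<lambda>i. axis i 1) ` UNIV" by (auto simp: Basis_vec_def)
    then show ?thesis
      by (subst \<open>Basis = _\<close>, subst prod.reindex) (auto simp: inj_on_def axis_eq_axis inner_axis)
  qed
  have "emeasure (distr lborel borel (reindex r)) (box l u)
      = emeasure lborel (box (reindex (inv r) l) (reindex (inv r) u))"
    by (simp add: emeasure_distr vimage)
  also have "\<dots> = (\<Prod>b\<in>Basis. (reindex (inv r) u - reindex (inv r) l) \<bullet> b)"
    by (rule emeasure_lborel_box) (auto simp: Basis_vec_def reindex_def inner_axis le')
  also have "\<dots> = (\<Prod>b\<in>Basis. (u - l) \<bullet> b)"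
    unfolding prodB using prod.reindex_bij_betw[OF bij_imp_bij_inv[OF r], of "\<lambda>i. (u - l) $ i"]
    by (simp add: reindex_def)
  finally show "emeasure (distr lborel borel (reindex r)) (box l u) = (\<Prod>b\<in>Basis. (u - l) \<bullet> b)" .
qed simp

lemma
  fixes r :: "'m::finite \<Rightarrow> 'n::finite"
  assumes r: "bij r"
  shows distr_lebesgue_reindex: "distr lebesgue lebesgue (reindex r) = lebesgue"
    and measurable_lebesgue_reindex: "reindex r \<in> lebesgue \<rightarrow>\<^sub>M lebesgue"
proof -
  have P: "reindex r \<in> borel_measurable borel"
    using linear_reindex by (intro borel_measurable_continuous_onI linear_continuous_on) (simp add: linear_conv_bounded_linear)
  then have P1: "reindex r \<in> lborel \<rightarrow>\<^sub>M lborel" by simp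
  then have P2: "reindex r \<in> lebesgue \<rightarrow>\<^sub>M lborel" by (rule measurable_completion)
  have d: "distr lborel lborel (reindex r) = lborel"
    using distr_lborel_reindex[OF r] by (metis distr_cong sets_lborel)
  have d2: "distr lebesgue lborel (reindex r) = lborel"
    using d distr_completion[OF P1] by simp
  have "completion (distr lebesgue lborel (reindex r)) = distr lebesgue lebesgue (reindex r)"
    by (rule completion.completion_distr_eq[OF P2]) (simp add: d2)
  then show "distr lebesgue lebesgue (reindex r) = lebesgue"
    using d2 by simp
  show "reindex r \<in> lebesgue \<rightarrow>\<^sub>M lebesgue"
    by (rule completion.measurable_completion2[OF P2]) (simp add: d2)
qed

lemma reindex_image:
  assumes "bij r" shows "reindex r ` S = reindex (inv r) -` S"
  using reindex_inv[OF assms] by (auto simp: image_iff) metis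

lemma
  fixes r :: "'m::finite \<Rightarrow> 'n::finite" and S :: "(real^'n) set"
  assumes r: "bij r"
  shows lmeasurable_reindex: "S \<in> lmeasurable \<Longrightarrow> reindex r ` S \<in> lmeasurable"
    and sets_lebesgue_reindex: "S \<in> sets lebesgue \<Longrightarrow> reindex r ` S \<in> sets lebesgue"
    and measure_reindex: "S \<in> sets lebesgue \<Longrightarrow> measure lebesgue (reindex r ` S) = measure lebesgue S"
    and set_integral_reindex: "S \<in> sets lebesgue \<Longrightarrow>
       set_integrable lebesgue S f \<Longrightarrow> set_integrable lebesgue (reindex r ` S) (\<lambda>y. f (reindex (inv r) y) :: real)
       \<and> (LINT y:reindex r ` S|lebesgue. f (reindex (inv r) y)) = (LINT x:S|lebesgue. f x)"
proof -
  have ri: "bij (inv r)" using r by (rule bij_imp_bij_inv)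
  note M = measurable_lebesgue_reindex[OF ri] and D = distr_lebesgue_reindex[OF ri]
  show s: "S \<in> sets lebesgue \<Longrightarrow> reindex r ` S \<in> sets lebesgue"
    unfolding reindex_image[OF r] using measurable_sets[OF M] by simp
  have em: "S \<in> sets lebesgue \<Longrightarrow> emeasure lebesgue (reindex r ` S) = emeasure lebesgue S"
    unfolding reindex_image[OF r]
    using emeasure_distr[OF M, of S] by (simp add: D)
  then show "S \<in> sets lebesgue \<Longrightarrow> measure lebesgue (reindex r ` S) = measure lebesgue S"
    by (simp add: measure_def)
  show "S \<in> lmeasurable \<Longrightarrow> reindex r ` S \<in> lmeasurable"
    using s em by (auto simp: fmeasurable_def)
  assume S: "S \<in> sets lebesgue" and int: "set_integrable lebesgue S f"
  let ?h = "\<lambda>x. indicator S x *\<^sub>R f x"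
  have h: "integrable (distr lebesgue lebesgue (reindex (inv r))) ?h"
    using int by (simp add: set_integrable_def D)
  have eq: "indicator (reindex r ` S) y *\<^sub>R f (reindex (inv r) y) = ?h (reindex (inv r) y)" for y
    by (simp add: reindex_image[OF r] indicator_def)
  have "integrable lebesgue (\<lambda>y. ?h (reindex (inv r) y))"
    using integrable_distr[OF M h] .
  moreover have "integral\<^sup>L lebesgue ?h = integral\<^sup>L lebesgue (\<lambda>y. ?h (reindex (inv r) y))"
    using integral_distr[OF M, of ?h] h by (simp add: D)
  ultimately show "set_integrable lebesgue (reindex r ` S) (\<lambda>y. f (reindex (inv r) y)) \<and>
       (LINT y:reindex r ` S|lebesgue. f (reindex (inv r) y)) = (LINT x:S|lebesgue. f x)"
    unfolding set_integrable_def set_lebesgue_integral_def eq by simp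
qed

text \<open>Conjugating \<open>f\<close> by the reindexing permutes rows and columns of its
  derivative in the same way, so the determinant is kept and the change of variables formula can be
  read back.\<close>

lemma
  fixes f :: "real^'n::finite \<Rightarrow> real^'n"
  assumes S: "S \<in> sets lebesgue"
    and deriv: "\<And>x. x \<in> S \<Longrightarrow> (f has_derivative f' x) (at x)"
    and int: "set_integrable lebesgue S (\<lambda>x. \<bar>det (matrix (f' x))\<bar>)"
  shows lmeasurable_gradient_image: "f ` S \<in> lmeasurable"
    and measure_gradient_image_le: "measure lebesgue (f ` S) \<le> (LINT x:S|lebesgue. \<bar>det (matrix (f' x))\<bar>)"
    and measure_gradient_image_eq: "inj_on f S \<Longrightarrow> measure lebesgue (f ` S) = (LINT x:S|lebesgue. \<bar>det (matrix (f' x))\<bar>)"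
proof -
  obtain r :: "'n ordinal_ix \<Rightarrow> 'n" where r: "bij r" using ordinal_ix_bij by blast
  have ri: "bij (inv r)" using r by (rule bij_imp_bij_inv)
  have rii: "inv (inv r) = r" using r by (rule inv_inv_eq)
  let ?P = "reindex r" and ?Q = "reindex (inv r)"
  let ?F = "\<lambda>y. ?P (f (?Q y))" and ?F' = "\<lambda>y h. ?P (f' (?Q y) (?Q h))"
  let ?T = "?P ` S"
  have QT: "?Q ` ?T = S" by (auto simp: image_image reindex_inv[OF r])
  have F': "(?F has_derivative ?F' y) (at y within ?T)" if "y \<in> ?T" for y
  proof -
    have "?Q y \<in> S" using that QT by blast
    then have "(f has_derivative f' (?Q y)) (at (?Q y))" by (rule deriv)
    moreover have "(?Q has_derivative ?Q) (at y)"
      using linear_reindex by (intro bounded_linear_imp_has_derivative) (simp add: linear_conv_bounded_linear)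
    ultimately have "((\<lambda>y. f (?Q y)) has_derivative (\<lambda>h. f' (?Q y) (?Q h))) (at y)"
      using has_derivative_compose by blast
    then have "(?F has_derivative ?F' y) (at y)"
      using linear_reindex by (intro bounded_linear.has_derivative[of ?P]) (simp_all add: linear_conv_bounded_linear)
    then show ?thesis by (rule has_derivative_at_withinI)
  qed
  have det: "det (matrix (?F' y)) = det (matrix (f' (?Q y)))" for y
  proof -
    have ax: "?Q (axis j 1) = axis (r j) 1" for j
    proof -
      have "inv r i = j \<longleftrightarrow> i = r j" for i
        using r by (metis bij_inv_eq_iff)
      then show ?thesis by (simp add: reindex_def axis_def vec_eq_iff)
    qed
    have "matrix (?F' y) = (\<chi> i j. matrix (f' (?Q y)) $ r i $ r j)"
      unfolding matrix_def ax by (simp add: reindex_def vec_eq_iff)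
    then show ?thesis by (simp add: det_reindex[OF r])
  qed
  have T: "?T \<in> sets lebesgue" by (rule sets_lebesgue_reindex[OF r S])
  have iT: "set_integrable lebesgue ?T (\<lambda>y. \<bar>det (matrix (?F' y))\<bar>)"
    and IT: "(LINT y:?T|lebesgue. \<bar>det (matrix (?F' y))\<bar>) = (LINT x:S|lebesgue. \<bar>det (matrix (f' x))\<bar>)"
    using set_integral_reindex[OF r S int] unfolding det by auto
  have IT': "(\<lambda>y. \<bar>det (matrix (?F' y))\<bar>) integrable_on ?T"
    "integral ?T (\<lambda>y. \<bar>det (matrix (?F' y))\<bar>) = (LINT x:S|lebesgue. \<bar>det (matrix (f' x))\<bar>)"
    using set_lebesgue_integral_eq_integral[OF iT] IT by auto
  have im: "?F ` ?T = ?P ` f ` S" by (auto simp: image_image reindex_inv[OF r])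
  have im2: "f ` S = ?Q ` (?F ` ?T)" unfolding im by (auto simp: image_image reindex_inv[OF r])
  have FT: "?F ` ?T \<in> lmeasurable"
    by (rule measurable_differentiable_image[OF T F' IT'(1)])
  then show fS: "f ` S \<in> lmeasurable"
    unfolding im2 by (rule lmeasurable_reindex[OF ri])
  have meq: "measure lebesgue (f ` S) = measure lebesgue (?F ` ?T)"
    unfolding im by (rule measure_reindex[OF r, symmetric]) (use fS in auto)
  show "measure lebesgue (f ` S) \<le> (LINT x:S|lebesgue. \<bar>det (matrix (f' x))\<bar>)"
    unfolding meq IT'(2)[symmetric] by (rule measure_differentiable_image[OF T F' IT'(1)])
  assume inj: "inj_on f S"
  have "inj_on ?F ?T"
  proof (rule inj_onI)
    fix x y assume xy: "x \<in> ?T" "y \<in> ?T" "?F x = ?F y"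
    then have "f (?Q x) = f (?Q y)" by (metis reindex_inv(1)[OF r])
    moreover have "?Q x \<in> S" "?Q y \<in> S" using xy QT by blast+
    ultimately have "?Q x = ?Q y" using inj by (meson inj_onD)
    then show "x = y" by (metis reindex_inv(2)[OF r])
  qed
  then show "measure lebesgue (f ` S) = (LINT x:S|lebesgue. \<bar>det (matrix (f' x))\<bar>)"
    unfolding meq IT'(2)[symmetric] using measure_differentiable_image_eq[OF T F' _ IT'(1)] by blast
qed

section \<open>Functions of class \<open>C\<^sup>2\<close>\<close>

definition grad :: "(real^'n::finite \<Rightarrow> real) \<Rightarrow> real^'n \<Rightarrow> real^'n" where
  "grad f x = (\<chi> i. partial i f x)"

lemma partial_eq: "(f has_derivative D) (at x) \<Longrightarrow> partial i f x = D (axis i 1)"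
  unfolding partial_def by (metis frechet_derivative_at)

lemma has_derivative_grad:
  assumes "f differentiable (at x)"
  shows "(f has_derivative (\<lambda>h. grad f x \<bullet> h)) (at x)"
proof -
  have D: "(f has_derivative frechet_derivative f (at x)) (at x)"
    using assms frechet_derivative_works by blast
  have "frechet_derivative f (at x) h = grad f x \<bullet> h" for h
  proof -
    interpret linear "frechet_derivative f (at x)" using D by (rule has_derivative_linear)
    have "frechet_derivative f (at x) h = frechet_derivative f (at x) (\<Sum>i\<in>UNIV. h $ i *\<^sub>R axis i 1)"
      by (simp only: basis_expansion scalar_mult_eq_scaleR[symmetric])
    also have "\<dots> = grad f x \<bullet> h"
      by (simp add: sum scale grad_def partial_def inner_vec_def mult.commute)
    finally show ?thesis .
  qed
  then have "frechet_derivative f (at x) = (\<lambda>h. grad f x \<bullet> h)" by blast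
  with D show ?thesis by simp
qed

lemma Ck_on_2_iff:
  "Ck_on 2 S f \<longleftrightarrow> (\<forall>x\<in>S. f differentiable (at x)) \<and> (\<forall>i. \<forall>x\<in>S. partial i f differentiable (at x))
     \<and> (\<forall>i j. continuous_on S (partial j (partial i f)))"
  by (auto simp: numeral_2_eq_2)

lemma Ck_on_subset: "Ck_on k S f \<Longrightarrow> T \<subseteq> S \<Longrightarrow> Ck_on k T f"
  by (induction k arbitrary: f) (auto intro: continuous_on_subset)

lemma continuous_on_hessian: "Ck_on 2 S f \<Longrightarrow> continuous_on S (hessian f)"
  unfolding Ck_on_2_iff hessian_def by (intro continuous_on_vec_lambda) blast

lemma has_derivative_vec:
  fixes f :: "'a::real_normed_vector \<Rightarrow> real^'n"
  assumes "\<And>i. ((\<lambda>x. f x $ i) has_derivative (\<lambda>h. D h $ i)) (at x)"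
  shows "(f has_derivative D) (at x)"
  by (subst has_derivative_componentwise_within)
    (use assms in \<open>auto simp: Basis_vec_def inner_axis\<close>)

lemma has_derivative_grad2:
  assumes "Ck_on 2 S f" "x \<in> S"
  shows "(grad f has_derivative (\<lambda>h. transpose (hessian f x) *v h)) (at x)"
proof (rule has_derivative_vec)
  fix i
  have "(partial i f has_derivative (\<lambda>h. grad (partial i f) x \<bullet> h)) (at x)"
    using assms by (intro has_derivative_grad) (simp add: Ck_on_2_iff)
  moreover have "grad (partial i f) x \<bullet> h = (transpose (hessian f x) *v h) $ i" for h
    by (simp add: grad_def hessian_def transpose_def matrix_vector_mult_def inner_vec_def)
  ultimately show "((\<lambda>x. grad f x $ i) has_derivative (\<lambda>h. (transpose (hessian f x) *v h) $ i)) (at x)"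
    by (simp add: grad_def)
qed

lemma Ck_on_2_imp_continuous_on:
  assumes "Ck_on 2 S f" shows "continuous_on S f"
  using assms unfolding Ck_on_2_iff
  by (auto intro!: continuous_at_imp_continuous_on differentiable_imp_continuous_within)

lemma DERIV_along_line:
  assumes "f differentiable (at (x + t *\<^sub>R h))"
  shows "((\<lambda>t. f (x + t *\<^sub>R h)) has_real_derivative grad f (x + t *\<^sub>R h) \<bullet> h) (at t)"
proof -
  have "((\<lambda>t. f (x + t *\<^sub>R h)) has_derivative (\<lambda>s. grad f (x + t *\<^sub>R h) \<bullet> (s *\<^sub>R h))) (at t)"
    by (rule has_derivative_compose[of "\<lambda>t. x + t *\<^sub>R h" "\<lambda>s. s *\<^sub>R h" t UNIV f "\<lambda>v. grad f (x + t *\<^sub>R h) \<bullet> v"])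
      (auto intro!: derivative_eq_intros has_derivative_grad[OF assms])
  then show ?thesis by (simp add: has_field_derivative_def mult.commute[of _ "_ \<bullet> _"])
qed

section \<open>Symmetry of the Hessian, second-order conditions and convexity\<close>

lemma second_difference_mean_value:
  fixes f :: "real^'n::finite \<Rightarrow> real"
  assumes C: "Ck_on 2 S f" and h: "0 < h" and S: "cball x (2 * h) \<subseteq> S"
  shows "\<exists>y\<in>cball x (2 * h). f (x + h *\<^sub>R axis i 1 + h *\<^sub>R axis j 1) - f (x + h *\<^sub>R axis i 1)
     - f (x + h *\<^sub>R axis j 1) + f x = h\<^sup>2 * partial j (partial i f) y"
proof -
  let ?a = "axis i 1 :: real^'n" and ?b = "axis j 1 :: real^'n"
  have near: "x + s *\<^sub>R ?a + t *\<^sub>R ?b \<in> cball x (2 * h)" if "0 \<le> s" "s \<le> h" "0 \<le> t" "t \<le> h" for s t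
  proof -
    have "norm (s *\<^sub>R ?a + t *\<^sub>R ?b) \<le> s + t"
      using norm_triangle_ineq[of "s *\<^sub>R ?a" "t *\<^sub>R ?b"] that by (simp add: norm_axis_1)
    then show ?thesis using that by (simp add: dist_norm algebra_simps norm_minus_commute)
  qed
  have df: "f differentiable (at y)" "partial i f differentiable (at y)" if "y \<in> cball x (2 * h)" for y
    using C S that by (auto simp: Ck_on_2_iff)
  define F where "F s = f (x + h *\<^sub>R ?b + s *\<^sub>R ?a) - f (x + s *\<^sub>R ?a)" for s
  have "(F has_real_derivative
      partial i f (x + h *\<^sub>R ?b + s *\<^sub>R ?a) - partial i f (x + s *\<^sub>R ?a)) (at s)" if "0 \<le> s" "s \<le> h" for s
  proof -
    have "((\<lambda>s. f (x + h *\<^sub>R ?b + s *\<^sub>R ?a)) has_real_derivative grad f (x + h *\<^sub>R ?b + s *\<^sub>R ?a) \<bullet> ?a) (at s)"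
      using near[of s h] that h by (intro DERIV_along_line df) (auto simp: add_ac)
    moreover have "((\<lambda>s. f (x + s *\<^sub>R ?a)) has_real_derivative grad f (x + s *\<^sub>R ?a) \<bullet> ?a) (at s)"
      using near[of s 0] that h by (intro DERIV_along_line df) auto
    ultimately show ?thesis
      unfolding F_def by (auto intro!: derivative_eq_intros simp: grad_def inner_axis)
  qed
  from MVT2[OF h this]
  obtain s where s: "0 < s" "s < h" and
    Fs: "F h - F 0 = (h - 0) * (partial i f (x + h *\<^sub>R ?b + s *\<^sub>R ?a) - partial i f (x + s *\<^sub>R ?a))"
    by auto
  have "((\<lambda>t. partial i f (x + s *\<^sub>R ?a + t *\<^sub>R ?b)) has_real_derivative
      partial j (partial i f) (x + s *\<^sub>R ?a + t *\<^sub>R ?b)) (at t)" if "0 \<le> t" "t \<le> h" for t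
    using DERIV_along_line[of "partial i f" "x + s *\<^sub>R ?a" t ?b] df(2)[OF near[of s t]] that s
    by (simp add: grad_def inner_axis)
  from MVT2[OF h this]
  obtain t where t: "0 < t" "t < h" and
    Gt: "partial i f (x + s *\<^sub>R ?a + h *\<^sub>R ?b) - partial i f (x + s *\<^sub>R ?a + 0 *\<^sub>R ?b)
      = (h - 0) * partial j (partial i f) (x + s *\<^sub>R ?a + t *\<^sub>R ?b)"
    by auto
  have "F h - F 0 = h\<^sup>2 * partial j (partial i f) (x + s *\<^sub>R ?a + t *\<^sub>R ?b)"
    using Fs Gt by (simp add: add_ac power2_eq_square)
  moreover have eq: "x + h *\<^sub>R ?a + h *\<^sub>R ?b = x + h *\<^sub>R ?b + h *\<^sub>R ?a"
    by (simp only: add_ac)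
  ultimately have "f (x + h *\<^sub>R ?a + h *\<^sub>R ?b) - f (x + h *\<^sub>R ?a) - f (x + h *\<^sub>R ?b) + f x
      = h\<^sup>2 * partial j (partial i f) (x + s *\<^sub>R ?a + t *\<^sub>R ?b)"
    unfolding F_def eq by simp
  moreover have "x + s *\<^sub>R ?a + t *\<^sub>R ?b \<in> cball x (2 * h)"
    using s t by (intro near) auto
  ultimately show ?thesis by blast
qed

text \<open>Schwarz's theorem. The second difference is symmetric in the two directions, so both
  mixed partial derivatives take a common value, possibly at different points, arbitrarily close to
  \<open>x\<close>; continuity does the rest.\<close>

lemma hessian_symmetric:
  fixes f :: "real^'n::finite \<Rightarrow> real"
  assumes C: "Ck_on 2 S f" and S: "open S" "x \<in> S"
  shows "transpose (hessian f x) = hessian f x"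
proof -
  have "partial j (partial i f) x = partial i (partial j f) x" for i j
  proof -
    obtain r where r: "0 < r" "cball x r \<subseteq> S" using S by (meson open_contains_cball)
    have ex: "\<exists>y y'. y \<in> cball x (2 * h) \<and> y' \<in> cball x (2 * h) \<and>
        partial j (partial i f) y = partial i (partial j f) y'" if "0 < h" "2 * h \<le> r" for h
    proof -
      have "cball x (2 * h) \<subseteq> S" using that r by (meson order_trans subset_cball)
      note * = second_difference_mean_value[OF C that(1) this]
      obtain y where y: "y \<in> cball x (2 * h)" "f (x + h *\<^sub>R axis i 1 + h *\<^sub>R axis j 1) - f (x + h *\<^sub>R axis i 1)
          - f (x + h *\<^sub>R axis j 1) + f x = h\<^sup>2 * partial j (partial i f) y"
        using *[of i j] by blast
      obtain y' where y': "y' \<in> cball x (2 * h)" "f (x + h *\<^sub>R axis j 1 + h *\<^sub>R axis i 1) - f (x + h *\<^sub>R axis j 1)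
          - f (x + h *\<^sub>R axis i 1) + f x = h\<^sup>2 * partial i (partial j f) y'"
        using *[of j i] by blast
      have "x + h *\<^sub>R axis j 1 + h *\<^sub>R axis i 1 = x + h *\<^sub>R axis i 1 + h *\<^sub>R axis j 1"
        by (simp only: add_ac)
      then have "h\<^sup>2 * partial j (partial i f) y = h\<^sup>2 * partial i (partial j f) y'"
        using y(2) y'(2)[unfolded \<open>x + _ + _ = _\<close>] by linarith
      then show ?thesis using y(1) y'(1) that(1) by auto
    qed
    define h where "h n = r / 2 / real (Suc n)" for n
    have h: "0 < h n" "2 * h n \<le> r" for n using r by (auto simp: h_def field_simps)
    have h0: "(\<lambda>n. 2 * h n) \<longlonglongrightarrow> 0"
    proof -
      have "(\<lambda>n. 2 * h n) = (\<lambda>n. r * inverse (real (Suc n)))"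
        unfolding h_def fun_eq_iff divide_inverse by simp
      then show ?thesis
        using tendsto_mult[OF tendsto_const[of r] LIMSEQ_inverse_real_of_nat] by (simp only: mult_zero_right)
    qed
    obtain y y' where y: "\<And>n. y n \<in> cball x (2 * h n)" "\<And>n. y' n \<in> cball x (2 * h n)"
      "\<And>n. partial j (partial i f) (y n) = partial i (partial j f) (y' n)"
    proof -
      have "\<forall>n. \<exists>p. fst p \<in> cball x (2 * h n) \<and> snd p \<in> cball x (2 * h n) \<and>
        partial j (partial i f) (fst p) = partial i (partial j f) (snd p)"
        using ex[OF h] by (metis fst_conv snd_conv)
      then obtain p where "\<forall>n. fst (p n) \<in> cball x (2 * h n) \<and> snd (p n) \<in> cball x (2 * h n) \<and>
        partial j (partial i f) (fst (p n)) = partial i (partial j f) (snd (p n))"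
        by (rule choice[THEN exE])
      then show ?thesis using that[of "\<lambda>n. fst (p n)" "\<lambda>n. snd (p n)"] by blast
    qed
    have lim: "z \<longlonglongrightarrow> x" if "\<And>n. z n \<in> cball x (2 * h n)" for z
    proof (rule metric_tendsto_imp_tendsto[OF h0], rule always_eventually, rule allI)
      show "dist (z n) x \<le> dist (2 * h n) 0" for n
        using that[of n] by (simp add: dist_commute)
    qed
    have c: "isCont (partial j (partial i f)) x" for i j
      using C S by (auto simp: Ck_on_2_iff continuous_on_eq_continuous_at)
    have "(\<lambda>n. partial j (partial i f) (y n)) \<longlonglongrightarrow> partial j (partial i f) x"
      by (rule isCont_tendsto_compose[OF c lim[OF y(1)]])
    moreover have "(\<lambda>n. partial i (partial j f) (y' n)) \<longlonglongrightarrow> partial i (partial j f) x"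
      by (rule isCont_tendsto_compose[OF c lim[OF y(2)]])
    ultimately show ?thesis unfolding y(3) by (rule LIMSEQ_unique)
  qed
  then show ?thesis by (simp add: transpose_def hessian_def vec_eq_iff)
qed

lemma inner_transpose_scaleR: "(transpose A *v (s *\<^sub>R h)) \<bullet> h = (h \<bullet> ((A :: real^'n^'n) *v h)) * s"
  by (simp add: dot_lmul_matrix mult.commute)

text \<open>The difference of \<open>q\<close> and the parabola has a minimum at 0. If
  \<open>c < 2 * b\<close>, its derivative, which vanishes at 0, would be negative just to the
  right, and the difference would fall below its minimum. The second derivative is used at 0
  only.\<close>

lemma second_derivative_lower_bound:
  fixes q q' :: "real \<Rightarrow> real"
  assumes e: "0 < e" and q: "\<And>t. \<bar>t\<bar> < e \<Longrightarrow> (q has_real_derivative q' t) (at t)"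
    and q': "(q' has_real_derivative c) (at 0)"
    and le: "\<And>t. \<bar>t\<bar> < e \<Longrightarrow> q 0 + a * t + b * t\<^sup>2 \<le> q t"
  shows "2 * b \<le> c"
proof (rule ccontr)
  assume "\<not> 2 * b \<le> c"
  define r where "r t = q t - q 0 - a * t - b * t\<^sup>2" for t
  define r' where "r' t = q' t - a - 2 * b * t" for t
  have r: "(r has_real_derivative r' t) (at t)" if "\<bar>t\<bar> < e" for t
    unfolding r_def r'_def using q[OF that] by (auto intro!: derivative_eq_intros)
  have r0: "r 0 \<le> r t" if "\<bar>t\<bar> < e" for t
    using le[OF that] by (simp add: r_def)
  have "r' 0 = 0"
    using DERIV_local_min[OF r[of 0], of e] e r0 by auto
  moreover have "(r' has_real_derivative c - 2 * b) (at 0)"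
    unfolding r'_def using q' by (auto intro!: derivative_eq_intros)
  ultimately obtain d where d: "0 < d" "\<And>h. 0 < h \<Longrightarrow> h < d \<Longrightarrow> r' h < 0"
    using DERIV_neg_dec_right[of r' "c - 2 * b" 0] \<open>\<not> 2 * b \<le> c\<close> by auto
  define s where "s = min d e / 2"
  have s: "0 < s" "s < d" "s < e" using d e by (auto simp: s_def)
  obtain z where z: "0 < z" "z < s" "r s - r 0 = (s - 0) * r' z"
    using MVT2[OF s(1), of r r'] r s by auto
  have "s * r' z < 0" using d(2)[of z] z s by (intro mult_pos_neg) auto
  then have "r s < r 0" using z by simp
  then show False using r0[of s] s by auto
qed

lemma
  fixes f :: "real^'n::finite \<Rightarrow> real"
  assumes C: "Ck_on 2 S f" and S: "open S" "x \<in> S" and e: "0 < e"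
  shows quadratic_lower_imp_hessian_ge:
      "(\<And>t. \<bar>t\<bar> < e \<Longrightarrow> f x + a * t + b * t\<^sup>2 \<le> f (x + t *\<^sub>R h)) \<Longrightarrow> 2 * b \<le> h \<bullet> (hessian f x *v h)"
    and quadratic_upper_imp_hessian_le:
      "(\<And>t. \<bar>t\<bar> < e \<Longrightarrow> f (x + t *\<^sub>R h) \<le> f x + a * t + b * t\<^sup>2) \<Longrightarrow> h \<bullet> (hessian f x *v h) \<le> 2 * b"
proof -
  have "\<exists>d>0. \<forall>t. \<bar>t\<bar> < d \<longrightarrow> x + t *\<^sub>R h \<in> S"
  proof -
    obtain r where r: "0 < r" "ball x r \<subseteq> S" using S by (meson open_contains_ball)
    have "x + t *\<^sub>R h \<in> S" if "\<bar>t\<bar> < r / (norm h + 1)" for t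
    proof -
      have "\<bar>t\<bar> * (norm h + 1) < r" using that by (simp add: pos_less_divide_eq add_nonneg_pos)
      then have "\<bar>t\<bar> * norm h < r" by (simp add: algebra_simps) 
      then show ?thesis using r by (auto simp: dist_norm subset_iff)
    qed
    then show ?thesis using r by (intro exI[of _ "r / (norm h + 1)"]) (auto simp: add_nonneg_pos)
  qed
  then obtain d where d: "0 < d" "\<And>t. \<bar>t\<bar> < d \<Longrightarrow> x + t *\<^sub>R h \<in> S" by blast
  define e' where "e' = min e d"
  have e': "0 < e'" "\<And>t. \<bar>t\<bar> < e' \<Longrightarrow> \<bar>t\<bar> < e \<and> \<bar>t\<bar> < d" using e d by (auto simp: e'_def)
  define q where "q t = f (x + t *\<^sub>R h)" for t
  define q' where "q' t = grad f (x + t *\<^sub>R h) \<bullet> h" for t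
  have q: "(q has_real_derivative q' t) (at t)" if "\<bar>t\<bar> < e'" for t
    unfolding q_def q'_def using C d(2) e'(2)[OF that] by (intro DERIV_along_line) (simp add: Ck_on_2_iff)
  have "((\<lambda>t. grad f (x + t *\<^sub>R h)) has_derivative (\<lambda>s. transpose (hessian f x) *v (s *\<^sub>R h))) (at 0)"
    by (rule has_derivative_compose[of "\<lambda>t. x + t *\<^sub>R h" "\<lambda>s. s *\<^sub>R h" 0 UNIV "grad f"
          "\<lambda>v. transpose (hessian f x) *v v"])
      (auto intro!: derivative_eq_intros simp del: transpose_matrix_vector, use has_derivative_grad2[OF C S(2)] in simp)
  then have "(q' has_derivative (\<lambda>s. (transpose (hessian f x) *v (s *\<^sub>R h)) \<bullet> h)) (at 0)"
    unfolding q'_def by (auto intro!: derivative_eq_intros)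
  moreover have "(transpose (hessian f x) *v (s *\<^sub>R h)) \<bullet> h = (h \<bullet> (hessian f x *v h)) * s" for s
    by (rule inner_transpose_scaleR)
  ultimately have q'': "(q' has_real_derivative h \<bullet> (hessian f x *v h)) (at 0)"
    by (simp add: has_field_derivative_def)
  show "2 * b \<le> h \<bullet> (hessian f x *v h)" if "\<And>t. \<bar>t\<bar> < e \<Longrightarrow> f x + a * t + b * t\<^sup>2 \<le> f (x + t *\<^sub>R h)"
    by (rule second_derivative_lower_bound[OF e'(1) q q'', where a = a]) (use that e' in \<open>auto simp: q_def\<close>)
  show "h \<bullet> (hessian f x *v h) \<le> 2 * b" if "\<And>t. \<bar>t\<bar> < e \<Longrightarrow> f (x + t *\<^sub>R h) \<le> f x + a * t + b * t\<^sup>2"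
  proof -
    have "2 * (-b) \<le> - (h \<bullet> (hessian f x *v h))"
    proof (rule second_derivative_lower_bound[OF e'(1), of "\<lambda>t. - q t" "\<lambda>t. - q' t" _ "-a"])
      show "((\<lambda>t. - q t) has_real_derivative - q' t) (at t)" if "\<bar>t\<bar> < e'" for t
        using q[OF that] by (rule DERIV_minus)
      show "((\<lambda>t. - q' t) has_real_derivative - (h \<bullet> (hessian f x *v h))) (at 0)"
        using q'' by (rule DERIV_minus)
      show "- q 0 + - a * t + - b * t\<^sup>2 \<le> - q t" if "\<bar>t\<bar> < e'" for t
        using \<open>\<And>t. \<bar>t\<bar> < e \<Longrightarrow> f (x + t *\<^sub>R h) \<le> _\<close>[of t] e'(2)[OF that] by (simp add: q_def)
    qed
    then show ?thesis by simp
  qed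
qed

text \<open>By convexity the difference quotients along the segment are at most
  \<open>f z - f x\<close>. Differentiability is asked at \<open>x\<close> alone, so
  \<open>T\<close> may be a closure and \<open>z\<close> a boundary point.\<close>

lemma convex_on_above_tangent:
  fixes f :: "real^'n::finite \<Rightarrow> real"
  assumes conv: "convex_on T f" and T: "x \<in> T" "z \<in> T" and d: "f differentiable (at x)"
  shows "f x + grad f x \<bullet> (z - x) \<le> f z"
proof -
  have "((\<lambda>t. f (x + t *\<^sub>R (z - x))) has_real_derivative grad f x \<bullet> (z - x)) (at 0)"
    using DERIV_along_line[of f x 0 "z - x"] d by simp
  then have "((\<lambda>t. (f (x + t *\<^sub>R (z - x)) - f x) / t) \<longlongrightarrow> grad f x \<bullet> (z - x)) (at_right 0)"
    unfolding has_field_derivative_iff using filterlim_at_split by auto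
  moreover have "eventually (\<lambda>t. (f (x + t *\<^sub>R (z - x)) - f x) / t \<le> f z - f x) (at_right (0::real))"
  proof -
    have "(f (x + t *\<^sub>R (z - x)) - f x) / t \<le> f z - f x" if "0 < t" "t < 1" for t
    proof -
      have eq: "(1 - t) *\<^sub>R x + t *\<^sub>R z = x + t *\<^sub>R (z - x)" by (simp add: algebra_simps)
      have "f ((1 - t) *\<^sub>R x + t *\<^sub>R z) \<le> (1 - t) * f x + t * f z"
        using convex_onD[OF conv, of t x z] that T by auto
      moreover have "(1 - t) * f x + t * f z = f x + (f z - f x) * t" by (simp add: algebra_simps)
      ultimately have "f (x + t *\<^sub>R (z - x)) - f x \<le> (f z - f x) * t"
        unfolding eq by linarith
      then show ?thesis using that by (simp add: pos_divide_le_eq)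
    qed
    then show ?thesis unfolding eventually_at_right_field by (intro exI[of _ 1]) auto
  qed
  ultimately have "grad f x \<bullet> (z - x) \<le> f z - f x"
    by (rule tendsto_upperbound) simp
  then show ?thesis by simp
qed

lemma psd_hessian_of_convex:
  fixes f :: "real^'n::finite \<Rightarrow> real"
  assumes C: "Ck_on 2 S f" and S: "open S" "x \<in> S" and conv: "convex_on S f"
  shows "psd (hessian f x)"
  unfolding psd_def
proof (intro conjI allI)
  show "transpose (hessian f x) = hessian f x" by (rule hessian_symmetric[OF C S])
  fix h
  obtain r where r: "0 < r" "ball x r \<subseteq> S" using S by (meson open_contains_ball)
  have "2 * 0 \<le> h \<bullet> (hessian f x *v h)"
  proof (cases "h = 0")
    case False
    show ?thesis
    proof (rule quadratic_lower_imp_hessian_ge[OF C S, of "r / norm h" "grad f x \<bullet> h"])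
      show "0 < r / norm h" using r False by simp
      fix t assume "\<bar>t\<bar> < r / norm h"
      then have "x + t *\<^sub>R h \<in> S" using r False by (auto simp: dist_norm subset_iff pos_less_divide_eq)
      then show "f x + (grad f x \<bullet> h) * t + 0 * t\<^sup>2 \<le> f (x + t *\<^sub>R h)"
        using convex_on_above_tangent[OF conv S(2), of "x + t *\<^sub>R h"] C S by (simp add: Ck_on_2_iff mult.commute)
    qed
  qed simp
  then show "0 \<le> h \<bullet> (hessian f x *v h)" by simp
qed

lemma psd_definite:
  fixes A :: "real^'n^'n"
  assumes "psd A" "det A \<noteq> 0" "x \<bullet> (A *v x) = 0"
  shows "x = 0"
proof -
  obtain R :: "real^'n^'n" where R: "A = R ** transpose R" by (rule psd_sqrt[OF assms(1)])
  have "x \<bullet> (A *v x) = (transpose R *v x) \<bullet> (transpose R *v x)"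
    unfolding R by (simp add: dot_lmul_matrix flip: matrix_vector_mul_assoc)
  then have "transpose R *v x = 0" using assms by simp
  moreover have "det (transpose R) \<noteq> 0" using assms(2) R by (auto simp: det_mul)
  ultimately show ?thesis
    by (metis invertible_det_nz invertible_def matrix_vector_mul_assoc matrix_vector_mul_lid matrix_vector_mult_0_right)
qed

text \<open>If two gradients agree, the mean value theorem along the segment gives a point where the
  Hessian annihilates its direction, against definiteness. Injectivity turns the volume of the
  gradient image into an exact integral.\<close>

lemma grad_inj_on:
  fixes f :: "real^'n::finite \<Rightarrow> real"
  assumes C: "Ck_on 2 S f" and S: "open S" "convex S" and conv: "convex_on S f"
    and det: "\<And>x. x \<in> S \<Longrightarrow> det (hessian f x) \<noteq> 0"
  shows "inj_on (grad f) S"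
proof (rule inj_onI, rule ccontr)
  fix x y assume xy: "x \<in> S" "y \<in> S" "grad f x = grad f y" "x \<noteq> y"
  let ?h = "y - x"
  have in_S: "x + t *\<^sub>R ?h \<in> S" if "0 \<le> t" "t \<le> 1" for t
    using convexD_alt[OF S(2) xy(1,2), of t] that by (simp add: algebra_simps)
  have "((\<lambda>t. grad f (x + t *\<^sub>R ?h) \<bullet> ?h) has_real_derivative
      ?h \<bullet> (hessian f (x + t *\<^sub>R ?h) *v ?h)) (at t)" if "0 \<le> t" "t \<le> 1" for t
  proof -
    have "((\<lambda>t. grad f (x + t *\<^sub>R ?h)) has_derivative (\<lambda>s. transpose (hessian f (x + t *\<^sub>R ?h)) *v (s *\<^sub>R ?h))) (at t)"
      by (rule has_derivative_compose[of "\<lambda>t. x + t *\<^sub>R ?h" "\<lambda>s. s *\<^sub>R ?h" t UNIV "grad f"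
            "\<lambda>v. transpose (hessian f (x + t *\<^sub>R ?h)) *v v"])
        (auto intro!: derivative_eq_intros has_derivative_grad2[OF C in_S[OF that]] simp del: transpose_matrix_vector)
    then have "((\<lambda>t. grad f (x + t *\<^sub>R ?h) \<bullet> ?h) has_derivative
        (\<lambda>s. (transpose (hessian f (x + t *\<^sub>R ?h)) *v (s *\<^sub>R ?h)) \<bullet> ?h)) (at t)"
      by (auto intro!: derivative_eq_intros)
    moreover have "(transpose A *v (s *\<^sub>R ?h)) \<bullet> ?h = (?h \<bullet> (A *v ?h)) * s" for s and A :: "real^'n^'n"
      by (rule inner_transpose_scaleR)
    ultimately show ?thesis by (simp add: has_field_derivative_def)
  qed
  from MVT2[OF zero_less_one this]
  obtain t where t: "0 < t" "t < 1" and "grad f (x + 1 *\<^sub>R ?h) \<bullet> ?h - grad f (x + 0 *\<^sub>R ?h) \<bullet> ?h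
      = (1 - 0) * (?h \<bullet> (hessian f (x + t *\<^sub>R ?h) *v ?h))"
    by auto
  then have "?h \<bullet> (hessian f (x + t *\<^sub>R ?h) *v ?h) = 0" using xy by simp
  moreover have z: "x + t *\<^sub>R ?h \<in> S"
    using t by (intro in_S) auto
  ultimately have "?h = 0"
    using psd_definite[OF psd_hessian_of_convex[OF C S(1) z conv] det[OF z]] by blast
  then show False using xy by simp
qed

section \<open>Strict convexity of the potential up to the boundary\<close>

text \<open>A supporting hyperplane at \<open>y\<close> must also be tangent to the interior ball
  touching there, which forces the centre of the ball onto the normal through
  \<open>y\<close>.\<close>

lemma tangent_ball_normal:
  fixes \<Omega> :: "(real^'n::finite) set"
  assumes conv: "convex \<Omega>" and op: "open \<Omega>" and y: "y \<in> frontier \<Omega>" and \<rho>: "0 < \<rho>"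
    and A1: "cond_A1 \<rho> \<Omega>"
  obtains \<nu> where "norm \<nu> = 1" "ball (y + \<rho> *\<^sub>R \<nu>) \<rho> \<subseteq> \<Omega>" "\<And>x. x \<in> closure \<Omega> \<Longrightarrow> 0 \<le> \<nu> \<bullet> (x - y)"
proof -
  obtain z where z: "ball z \<rho> \<subseteq> \<Omega>" "dist z y = \<rho>"
    using A1 y unfolding cond_A1_def by auto
  have ynot: "y \<notin> \<Omega>" using y op by (simp add: frontier_def interior_open)
  have "z \<in> \<Omega>" using z \<rho> by auto
  then obtain a b where a: "a \<noteq> 0" and ab: "a \<bullet> y \<le> b" "\<And>w. w \<in> \<Omega> \<Longrightarrow> b \<le> a \<bullet> w"
    using separating_hyperplane_sets[of "{y}" \<Omega>] conv ynot by auto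
  define \<nu> where "\<nu> = a /\<^sub>R norm a"
  have \<nu>: "norm \<nu> = 1" using a by (simp add: \<nu>_def)
  have pos: "0 \<le> \<nu> \<bullet> (w - y)" if "w \<in> \<Omega>" for w
    using ab(1) ab(2)[OF that] a by (auto simp: \<nu>_def inner_diff_right intro!: divide_right_mono)
  have \<nu>\<nu>: "\<nu> \<bullet> \<nu> = 1" using \<nu> by (simp add: norm_eq_1)
  have ge: "\<rho> \<le> \<nu> \<bullet> (z - y)"
  proof (rule dense_le_bounded[OF \<rho>])
    fix w assume w: "0 < w" "w < \<rho>"
    have "z - w *\<^sub>R \<nu> \<in> ball z \<rho>" using w \<nu> by (simp add: dist_norm)
    then have "0 \<le> \<nu> \<bullet> (z - w *\<^sub>R \<nu> - y)" using pos z by blast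
    then show "w \<le> \<nu> \<bullet> (z - y)" by (simp add: inner_diff_right \<nu>\<nu>)
  qed
  \<comment> \<open>The equality case of Cauchy-Schwarz: \<open>z - y\<close> has length
    \<open>\<rho>\<close> and component at least \<open>\<rho>\<close> along a unit vector.\<close>
  have "(norm ((z - y) - \<rho> *\<^sub>R \<nu>))\<^sup>2 = \<rho>\<^sup>2 - 2 * \<rho> * (\<nu> \<bullet> (z - y)) + \<rho>\<^sup>2"
  proof -
    define v where "v = z - y"
    have "v \<bullet> v = \<rho>\<^sup>2" using z(2) by (simp add: v_def dist_norm flip: power2_norm_eq_inner)
    then have "(norm (v - \<rho> *\<^sub>R \<nu>))\<^sup>2 = \<rho>\<^sup>2 - 2 * \<rho> * (\<nu> \<bullet> v) + \<rho>\<^sup>2"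
      unfolding power2_norm_eq_inner
      by (simp add: inner_diff_left inner_diff_right inner_commute \<nu>\<nu> power2_eq_square)
    then show ?thesis by (simp add: v_def)
  qed
  moreover have "\<rho> * \<rho> \<le> \<rho> * (\<nu> \<bullet> (z - y))" using ge \<rho> by simp
  ultimately have "(norm ((z - y) - \<rho> *\<^sub>R \<nu>))\<^sup>2 \<le> 0" by (simp add: power2_eq_square)
  then have "z - y - \<rho> *\<^sub>R \<nu> = 0" by simp
  then have zeq: "z = y + \<rho> *\<^sub>R \<nu>" by (metis add.commute diff_add_cancel eq_iff_diff_eq_0)
  have "0 \<le> \<nu> \<bullet> (x - y)" if "x \<in> closure \<Omega>" for x
  proof -
    have "closed {x. 0 \<le> \<nu> \<bullet> (x - y)}" by (intro closed_Collect_le continuous_intros)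
    then have "closure \<Omega> \<subseteq> {x. 0 \<le> \<nu> \<bullet> (x - y)}" using pos by (intro closure_minimal) auto
    with that show ?thesis by blast
  qed
  moreover have "ball (y + \<rho> *\<^sub>R \<nu>) \<rho> \<subseteq> \<Omega>" using z(1) unfolding zeq .
  ultimately show thesis using that[OF \<nu>] by simp
qed

lemma det_scaleR: "det (c *\<^sub>R A) = c ^ CARD('n) * det (A :: real^'n^'n)"
proof -
  have "c *\<^sub>R A = (c *\<^sub>R mat 1) ** A"
    by (metis matrix_mul_lid scalar_matrix_assoc)
  moreover have "det (c *\<^sub>R mat 1 :: real^'n^'n) = c ^ CARD('n)"
    by (subst det_diagonal) (auto simp: mat_def)
  ultimately show ?thesis by (simp add: det_mul)
qed

locale tangent_point =
  fixes \<Omega> :: "(real^'n::finite) set" and \<rho> :: real and y \<nu> :: "real^'n"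
  assumes op: "open \<Omega>" and conv: "convex \<Omega>" and rho: "0 < \<rho>"
    and y: "y \<in> frontier \<Omega>" and unit: "norm \<nu> = 1"
    and tball: "ball (y + \<rho> *\<^sub>R \<nu>) \<rho> \<subseteq> \<Omega>"
    and halfspace: "x \<in> closure \<Omega> \<Longrightarrow> 0 \<le> \<nu> \<bullet> (x - y)"
begin

lemma nu_nu: "\<nu> \<bullet> \<nu> = 1" using unit by (simp add: norm_eq_1)

lemma ball_height:
  assumes "ball x \<delta> \<subseteq> \<Omega>" "0 < \<delta>" shows "\<delta> \<le> \<nu> \<bullet> (x - y)"
proof -
  have "\<eta> \<le> \<nu> \<bullet> (x - y)" if "0 < \<eta>" "\<eta> < \<delta>" for \<eta>
  proof -
    have "x - \<eta> *\<^sub>R \<nu> \<in> ball x \<delta>" using that unit by (simp add: dist_norm)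
    then have "0 \<le> \<nu> \<bullet> (x - \<eta> *\<^sub>R \<nu> - y)" using halfspace closure_subset assms(1) by blast
    then show ?thesis by (simp add: inner_diff_right nu_nu)
  qed
  then show ?thesis using assms(2) by (intro dense_le_bounded[of 0 \<delta>]) auto
qed

lemma height_pos: assumes "x \<in> \<Omega>" shows "0 < \<nu> \<bullet> (x - y)"
proof -
  obtain d where "0 < d" "ball x d \<subseteq> \<Omega>" using op assms by (meson open_contains_ball)
  then show ?thesis using ball_height by fastforce
qed

text \<open>Boundary points lie outside the open tangent ball; expanding the square of their
  distance to its centre gives the bound.\<close>

lemma height_le_square:
  assumes "z \<in> frontier \<Omega>" shows "2 * \<rho> * (\<nu> \<bullet> (z - y)) \<le> (norm (z - y))\<^sup>2"
proof -
  have "z \<notin> \<Omega>" using assms op by (simp add: frontier_def interior_open)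
  then have "\<rho> \<le> norm ((z - y) - \<rho> *\<^sub>R \<nu>)"
    using tball by (force simp: dist_norm norm_minus_commute algebra_simps)
  then have "\<rho>\<^sup>2 \<le> (norm ((z - y) - \<rho> *\<^sub>R \<nu>))\<^sup>2" using rho by (intro power_mono) auto
  also have "\<dots> = (norm (z - y))\<^sup>2 - 2 * \<rho> * (\<nu> \<bullet> (z - y)) + \<rho>\<^sup>2"
    unfolding power2_norm_eq_inner
    by (simp add: inner_diff_left inner_diff_right inner_commute nu_nu power2_eq_square)
  finally show ?thesis by simp
qed

text \<open>Going up from a point of the tangent hyperplane one starts outside
  \<open>\<Omega>\<close> and ends inside the tangent ball, so the boundary is crossed at a height
  of order \<open>r\<^sup>2\<close>.\<close>

lemma frontier_over_tangent:
  assumes \<tau>: "norm \<tau> = 1" "\<nu> \<bullet> \<tau> = 0" and r: "0 < r" "r < \<rho>"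
  obtains \<sigma> where "0 \<le> \<sigma>" "\<sigma> \<le> r\<^sup>2 / \<rho>" "y + r *\<^sub>R \<tau> + \<sigma> *\<^sub>R \<nu> \<in> frontier \<Omega>"
proof -
  let ?a = "y + r *\<^sub>R \<tau>" and ?b = "y + r *\<^sub>R \<tau> + (r\<^sup>2 / \<rho>) *\<^sub>R \<nu>"
  have "?a \<notin> \<Omega>" using height_pos[of ?a] \<tau> by auto
  moreover have "?b \<in> \<Omega>"
  proof -
    have "(dist (y + \<rho> *\<^sub>R \<nu>) ?b)\<^sup>2 = (norm (r *\<^sub>R \<tau> + (r\<^sup>2 / \<rho> - \<rho>) *\<^sub>R \<nu>))\<^sup>2"
      by (simp add: dist_norm norm_minus_commute algebra_simps)
    also have "\<dots> = r\<^sup>2 + (r\<^sup>2 / \<rho> - \<rho>)\<^sup>2"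
      using \<tau> unfolding power2_norm_eq_inner
      by (simp add: inner_add_left inner_add_right inner_commute nu_nu norm_eq_1 power2_eq_square)
    also have "\<dots> = \<rho>\<^sup>2 - r\<^sup>2 * (1 - (r / \<rho>)\<^sup>2)"
      using rho by (simp add: field_simps power2_eq_square)
    also have "\<dots> < \<rho>\<^sup>2"
      using r rho by (simp add: power_less_one_iff)
    finally have "dist (y + \<rho> *\<^sub>R \<nu>) ?b < \<rho>"
      using rho by (meson less_eq_real_def power_less_imp_less_base)
    then show ?thesis using tball by auto
  qed
  ultimately have "closed_segment ?a ?b \<inter> frontier \<Omega> \<noteq> {}"
    by (intro connected_Int_frontier) auto
  then obtain u where u: "0 \<le> u" "u \<le> 1" "(1 - u) *\<^sub>R ?a + u *\<^sub>R ?b \<in> frontier \<Omega>"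
    by (auto simp: closed_segment_def)
  have "(1 - u) *\<^sub>R ?a + u *\<^sub>R ?b = y + r *\<^sub>R \<tau> + (u * (r\<^sup>2 / \<rho>)) *\<^sub>R \<nu>"
    by (simp add: algebra_simps)
  then show thesis
    using u rho that[of "u * (r\<^sup>2 / \<rho>)"] mult_left_le_one_le[of "r\<^sup>2 / \<rho>" u] by simp
qed

text \<open>The boundary values pin down the tangential part of the slope at a minimum point on the
  boundary; convexity at an interior point determines the sign of the normal part.\<close>

lemma slope_inner_nonpos:
  fixes F :: "real^'n \<Rightarrow> real"
  assumes min: "\<And>z. z \<in> frontier \<Omega> \<Longrightarrow> F y \<le> F z" and K: "0 \<le> K"
    and upper: "\<And>z. z \<in> frontier \<Omega> \<Longrightarrow> F z \<le> F y + a \<bullet> (z - y) + K * (norm (z - y))\<^sup>2"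
    and x: "x \<in> \<Omega>" "a \<bullet> (x - y) \<le> 0" and z: "z \<in> closure \<Omega>"
  shows "a \<bullet> (z - y) \<le> 0"
proof -
  have tang: "0 \<le> a \<bullet> \<tau>" if \<tau>: "norm \<tau> = 1" "\<nu> \<bullet> \<tau> = 0" for \<tau>
  proof -
    \<comment> \<open>Compare \<open>y\<close> with the boundary point above
      \<open>y + r *\<^sub>R \<tau>\<close>. Its height is of order \<open>r\<^sup>2\<close>, so
      after division by \<open>r\<close> only the tangential slope survives as \<open>r\<close>
      tends to 0.\<close>
    have bound: "- (norm a / \<rho> + 2 * K) * r \<le> a \<bullet> \<tau>" if r: "0 < r" "r < \<rho>" for r
    proof -
      obtain \<sigma> where \<sigma>: "0 \<le> \<sigma>" "\<sigma> \<le> r\<^sup>2 / \<rho>" "y + r *\<^sub>R \<tau> + \<sigma> *\<^sub>R \<nu> \<in> frontier \<Omega>"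
        using frontier_over_tangent[OF \<tau> r] .
      have "0 \<le> a \<bullet> (r *\<^sub>R \<tau> + \<sigma> *\<^sub>R \<nu>) + K * (norm (r *\<^sub>R \<tau> + \<sigma> *\<^sub>R \<nu>))\<^sup>2"
        using min[OF \<sigma>(3)] upper[OF \<sigma>(3)] by (simp add: add.assoc)
      moreover have "a \<bullet> (r *\<^sub>R \<tau> + \<sigma> *\<^sub>R \<nu>) \<le> r * (a \<bullet> \<tau>) + norm a * (r\<^sup>2 / \<rho>)"
      proof -
        have "\<sigma> * (a \<bullet> \<nu>) \<le> \<sigma> * norm a"
          using \<sigma>(1) norm_cauchy_schwarz[of a \<nu>] unit by (intro mult_left_mono) auto
        also have "\<dots> \<le> (r\<^sup>2 / \<rho>) * norm a" using \<sigma>(2) by (intro mult_right_mono) auto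
        finally show ?thesis by (simp add: inner_add_right mult.commute)
      qed
      moreover have "K * (norm (r *\<^sub>R \<tau> + \<sigma> *\<^sub>R \<nu>))\<^sup>2 \<le> K * (2 * r\<^sup>2)"
      proof (rule mult_left_mono[OF _ K])
        have "\<sigma> \<le> r" using \<sigma>(2) r rho by (smt (verit) divide_right_mono mult_left_mono nonzero_mult_div_cancel_right power2_eq_square)
        then have "\<sigma>\<^sup>2 \<le> r\<^sup>2" using \<sigma>(1) by (intro power_mono) auto
        moreover have "(norm (r *\<^sub>R \<tau> + \<sigma> *\<^sub>R \<nu>))\<^sup>2 = r\<^sup>2 + \<sigma>\<^sup>2"
          using \<tau> unfolding power2_norm_eq_inner
          by (simp add: inner_add_left inner_add_right inner_commute nu_nu norm_eq_1 power2_eq_square)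
        ultimately show "(norm (r *\<^sub>R \<tau> + \<sigma> *\<^sub>R \<nu>))\<^sup>2 \<le> 2 * r\<^sup>2" by simp
      qed
      ultimately have "0 \<le> r * (a \<bullet> \<tau>) + norm a * (r\<^sup>2 / \<rho>) + K * (2 * r\<^sup>2)" by linarith
      also have "\<dots> = r * (a \<bullet> \<tau> + (norm a / \<rho> + 2 * K) * r)"
        by (simp add: algebra_simps power2_eq_square)
      finally have "0 \<le> a \<bullet> \<tau> + (norm a / \<rho> + 2 * K) * r"
        using r(1) by (simp add: zero_le_mult_iff)
      then show ?thesis unfolding mult_minus_left by linarith
    qed
    have "((\<lambda>r. - (norm a / \<rho> + 2 * K) * r) \<longlongrightarrow> - (norm a / \<rho> + 2 * K) * 0) (at_right 0)"
      by (intro tendsto_intros)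
    moreover have "eventually (\<lambda>r. - (norm a / \<rho> + 2 * K) * r \<le> a \<bullet> \<tau>) (at_right 0)"
      unfolding eventually_at_right_field using bound rho by blast
    ultimately have "- (norm a / \<rho> + 2 * K) * 0 \<le> a \<bullet> \<tau>"
      by (rule tendsto_upperbound) simp
    then show ?thesis by simp
  qed
  \<comment> \<open>The tangential part of \<open>a\<close>. Testing with the direction opposite to
    it shows that it vanishes.\<close>
  define b where "b = a - (a \<bullet> \<nu>) *\<^sub>R \<nu>"
  have b\<nu>: "\<nu> \<bullet> b = 0" by (simp add: b_def inner_diff_right nu_nu inner_commute)
  have "b = 0"
  proof (rule ccontr)
    assume b: "b \<noteq> 0"
    have "0 \<le> a \<bullet> (- (b /\<^sub>R norm b))" using b b\<nu> by (intro tang) auto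
    then have "a \<bullet> b \<le> 0" using b by (simp add: divide_le_0_iff inverse_eq_divide)
    moreover have "a \<bullet> b = b \<bullet> b" using b\<nu> by (simp add: b_def inner_diff_left inner_commute)
    ultimately show False using b inner_gt_zero_iff[of b] by linarith
  qed
  then have a: "a = (a \<bullet> \<nu>) *\<^sub>R \<nu>" by (simp add: b_def)
  obtain \<kappa> where "a = \<kappa> *\<^sub>R \<nu>" using a ..
  then have eq: "a \<bullet> v = \<kappa> * (\<nu> \<bullet> v)" for v by simp
  have "\<kappa> \<le> 0"
    using x(2)[unfolded eq] height_pos[OF x(1)] by (simp add: mult_le_0_iff)
  then show ?thesis
    unfolding eq using halfspace[OF z] by (simp add: mult_nonpos_nonneg)
qed

text \<open>Split \<open>z - y\<close> into \<open>s z *\<^sub>R X\<close> and a part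
  \<open>Z z\<close> in the tangent hyperplane, so that \<open>s\<close> is 0 at \<open>y\<close>
  and 1 at \<open>x\<close>. In the cap \<open>s z \<le> s0\<close> the quadratic \<open>Q\<close>
  lies above \<open>F\<close> on the boundary of \<open>\<Omega>\<close> and on the lid
  \<open>s z = s0\<close>, but drops to \<open>- T\<close>, below \<open>F\<close>, halfway up the
  axis. Hence \<open>F - Q\<close> has an interior maximum, where D^2\<phi> is at most D^2Q. The
  determinant of D^2Q is proportional to \<open>c\<close> and too small.\<close>

lemma barrier:
  fixes \<phi> :: "real^'n \<Rightarrow> real" and x p :: "real^'n" and l c :: real
  defines "d \<equiv> \<nu> \<bullet> (x - y)"
  defines "F \<equiv> \<lambda>z. \<phi> z - \<phi> x - p \<bullet> (z - x)"
  assumes C: "Ck_on 2 \<Omega> \<phi>" and convex: "convex_on (closure \<Omega>) \<phi>"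
    and cont: "continuous_on (closure \<Omega>) \<phi>" and bd: "bounded \<Omega>"
    and det: "\<And>z. z \<in> \<Omega> \<Longrightarrow> l \<le> det (hessian \<phi> z)"
    and x: "x \<in> \<Omega>" and diam: "norm (x - y) \<le> 2 / \<rho>" and \<rho>1: "\<rho> \<le> 1"
    and nonneg: "\<And>z. z \<in> closure \<Omega> \<Longrightarrow> 0 \<le> F z"
    and c: "0 < c" "c \<le> \<rho> ^ 5 / 512" "c * (1024 * (18 / \<rho>) ^ CARD('n)) \<le> l * \<rho> ^ 6"
    and upper: "\<And>z. z \<in> frontier \<Omega> \<Longrightarrow> F z \<le> c * d ^ 4 + (norm (z - y))\<^sup>2 / \<rho>"
  shows False
proof -
  define X where "X = x - y"
  \<comment> \<open>\<open>T\<close> is the assumed height. \<open>s0\<close> is so small that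
    \<open>s0 \<le> 1 / 4\<close> and \<open>s0 * (norm X)\<^sup>2 \<le> \<rho> * d / 2\<close>.
    \<open>B\<close> is fixed by \<open>B * s0\<^sup>2 = 8 * T\<close>, which makes the dip of
    \<open>Q\<close> at \<open>s0 / 2\<close> equal to \<open>2 * T\<close>. \<open>A\<close> leaves
    room over the coefficient \<open>4 / \<rho>\<close> in the bound for \<open>F\<close> on the
    boundary.\<close>
  define T where "T = c * d ^ 4"
  define s0 where "s0 = \<rho> ^ 3 * d / 8"
  define B where "B = 512 * c * d\<^sup>2 / \<rho> ^ 6"
  define A where "A = 9 / \<rho>"
  define m where "m = \<nu> /\<^sub>R d"
  define s where "s z = m \<bullet> (z - y)" for z
  define Z where "Z z = (z - y) - s z *\<^sub>R X" for z
  define Q where "Q z = T + A * (norm (Z z))\<^sup>2 - B * s z * (s0 - s z)" for z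
  have d: "0 < d" using height_pos[OF x] by (simp add: d_def)
  have T: "0 < T" using c d by (simp add: T_def)
  have s0: "0 < s0" using d rho by (simp add: s0_def)
  have B: "0 < B" using d rho c by (simp add: B_def)
  have A: "0 < A" using rho by (simp add: A_def)
  have Bs0: "B * s0\<^sup>2 = 8 * T"
    using rho by (simp add: B_def s0_def T_def field_simps power2_eq_square power4_eq_xxxx)
      (simp add: power_numeral_reduce)?
  have dX: "d \<le> norm X"
    using norm_cauchy_schwarz[of \<nu> X] unit by (simp add: d_def X_def)
  have dle: "d \<le> 2 / \<rho>" using dX diam by (simp add: X_def)
  have d\<rho>: "d * \<rho> \<le> 2" using dle rho by (simp add: pos_le_divide_eq)
  have s0le: "s0 \<le> 1 / 4"
  proof -
    have "\<rho>\<^sup>2 * (d * \<rho>) \<le> 1 * 2"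
      using d\<rho> \<rho>1 rho d by (intro mult_mono power_le_one) auto
    then show ?thesis by (simp add: s0_def power3_eq_cube power2_eq_square mult_ac)
  qed
  have mX: "m \<bullet> X = 1" using d by (simp add: m_def X_def d_def)
  have m\<nu>: "m \<bullet> v = (\<nu> \<bullet> v) / d" for v by (simp add: m_def divide_inverse mult.commute)
  have X2: "(norm X)\<^sup>2 \<le> 4 / \<rho>\<^sup>2"
    using power_mono[OF diam, of 2] by (simp add: X_def power_divide)
  have s0X: "s0 * (norm X)\<^sup>2 \<le> \<rho> * d / 2"
  proof -
    have "s0 * (norm X)\<^sup>2 \<le> s0 * (4 / \<rho>\<^sup>2)" using X2 s0 by (intro mult_left_mono) auto
    also have "\<dots> = \<rho> * d / 2" using rho by (simp add: s0_def field_simps power2_eq_square power3_eq_cube)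
    finally show ?thesis .
  qed
  have s_nonneg: "0 \<le> s z" if "z \<in> closure \<Omega>" for z
    using halfspace[OF that] d by (simp add: s_def m\<nu>)
  have frontier_closure: "z \<in> closure \<Omega>" if "z \<in> frontier \<Omega>" for z
    using that by (simp add: frontier_def)
  have split: "(norm (z - y))\<^sup>2 \<le> 2 * (norm (Z z))\<^sup>2 + 2 * (s z)\<^sup>2 * (norm X)\<^sup>2" for z
  proof -
    have "norm (z - y) \<le> norm (Z z) + \<bar>s z\<bar> * norm X"
      using norm_triangle_ineq[of "Z z" "s z *\<^sub>R X"] by (simp add: Z_def)
    then have "(norm (z - y))\<^sup>2 \<le> (norm (Z z) + \<bar>s z\<bar> * norm X)\<^sup>2" by (intro power_mono) auto
    also have "\<dots> \<le> 2 * (norm (Z z))\<^sup>2 + 2 * (\<bar>s z\<bar> * norm X)\<^sup>2"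
      using sum_squares_bound[of "norm (Z z)" "\<bar>s z\<bar> * norm X"] by (simp add: power2_sum)
    finally show ?thesis by (simp add: power_mult_distrib)
  qed
  \<comment> \<open>The boundary leaves the tangent hyperplane only quadratically. The term of
    \<open>split\<close> containing \<open>s z\<close> is absorbed into the left-hand side because
    \<open>s z \<le> s0\<close>.\<close>
  have s_small: "s z \<le> 2 * (norm (Z z))\<^sup>2 / (\<rho> * d) \<and> (s z)\<^sup>2 * (norm X)\<^sup>2 \<le> (norm (Z z))\<^sup>2"
    if z: "z \<in> frontier \<Omega>" "s z \<le> s0" for z
  proof -
    have s: "0 \<le> s z" by (rule s_nonneg[OF frontier_closure[OF z(1)]])
    have "(s z)\<^sup>2 * (norm X)\<^sup>2 \<le> s z * (s0 * (norm X)\<^sup>2)"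
      unfolding power2_eq_square mult.assoc using s z(2) by (intro mult_left_mono mult_right_mono) auto
    also have "\<dots> \<le> s z * (\<rho> * d / 2)" using s0X s by (intro mult_left_mono) auto
    finally have 1: "(s z)\<^sup>2 * (norm X)\<^sup>2 \<le> s z * (\<rho> * d) / 2" by simp
    have "2 * \<rho> * (\<nu> \<bullet> (z - y)) = 2 * (s z * (\<rho> * d))" using d by (simp add: s_def m\<nu>)
    then have "2 * (s z * (\<rho> * d)) \<le> 2 * (norm (Z z))\<^sup>2 + 2 * (s z)\<^sup>2 * (norm X)\<^sup>2"
      using height_le_square[OF z(1)] split[of z] by linarith
    with 1 have 2: "s z * (\<rho> * d) \<le> 2 * (norm (Z z))\<^sup>2" by linarith
    then have "s z \<le> 2 * (norm (Z z))\<^sup>2 / (\<rho> * d)"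
      using rho d by (simp add: pos_le_divide_eq)
    moreover have "(s z)\<^sup>2 * (norm X)\<^sup>2 \<le> (norm (Z z))\<^sup>2" using 1 2 by linarith
    ultimately show ?thesis by blast
  qed
  have Fb: "F z \<le> T + (4 / \<rho>) * (norm (Z z))\<^sup>2" if z: "z \<in> frontier \<Omega>" "s z \<le> s0" for z
  proof -
    have "(norm (z - y))\<^sup>2 \<le> 4 * (norm (Z z))\<^sup>2" using split[of z] s_small[OF z] by linarith
    then have "(norm (z - y))\<^sup>2 / \<rho> \<le> 4 * (norm (Z z))\<^sup>2 / \<rho>" using rho by (intro divide_right_mono) auto
    then show ?thesis using upper[OF z(1)] by (simp add: T_def)
  qed
  \<comment> \<open>The negative term of \<open>Q\<close> costs at most
    \<open>(1 / \<rho>) * (norm (Z z))\<^sup>2\<close> here, which is the purpose of the bound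
    \<open>c \<le> \<rho> ^ 5 / 512\<close>.\<close>
  have frontier_le: "F z \<le> Q z" if z: "z \<in> frontier \<Omega>" "s z \<le> s0" for z
  proof -
    have s: "0 \<le> s z" by (rule s_nonneg[OF frontier_closure[OF z(1)]])
    have "B * s z * (s0 - s z) \<le> B * s z * s0" using B s by (intro mult_left_mono) auto
    also have "\<dots> \<le> B * s0 * (2 * (norm (Z z))\<^sup>2 / (\<rho> * d))"
    proof -
      have "B * s z * s0 = B * s0 * s z" by simp
      also have "\<dots> \<le> B * s0 * (2 * (norm (Z z))\<^sup>2 / (\<rho> * d))"
        using s_small[OF z] B s0 by (intro mult_left_mono) auto
      finally show ?thesis .
    qed
    also have "\<dots> = (128 * c * d\<^sup>2 / \<rho> ^ 4) * (norm (Z z))\<^sup>2"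
      using rho d by (simp add: B_def s0_def field_simps power2_eq_square power3_eq_cube) (simp add: power_numeral_reduce)?
    also have "\<dots> \<le> (1 / \<rho>) * (norm (Z z))\<^sup>2"
    proof (rule mult_right_mono)
      have "c * d\<^sup>2 \<le> (\<rho> ^ 5 / 512) * (2 / \<rho>)\<^sup>2" using c dle d rho by (intro mult_mono power_mono) auto
      also have "\<dots> = \<rho> ^ 3 / 128" using rho by (simp add: field_simps power2_eq_square) (simp add: power_numeral_reduce)?
      finally have "128 * c * d\<^sup>2 / \<rho> ^ 4 \<le> \<rho> ^ 3 / \<rho> ^ 4" using rho by (intro divide_right_mono) auto
      also have "\<dots> = 1 / \<rho>" using rho by (simp add: power_numeral_reduce)
      finally show "128 * c * d\<^sup>2 / \<rho> ^ 4 \<le> 1 / \<rho>" .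
    qed simp
    finally have "B * s z * (s0 - s z) \<le> (1 / \<rho>) * (norm (Z z))\<^sup>2" .
    moreover have "(4 / \<rho>) * (norm (Z z))\<^sup>2 + (1 / \<rho>) * (norm (Z z))\<^sup>2 \<le> A * (norm (Z z))\<^sup>2"
      unfolding distrib_right[symmetric] A_def using rho by (intro mult_right_mono) (auto simp: field_simps)
    ultimately show ?thesis using Fb[OF z] by (simp add: Q_def)
  qed
  \<comment> \<open>Prolong the ray from \<open>x\<close> through \<open>q\<close> to the boundary.
    \<open>F\<close> vanishes at \<open>x\<close>, so convexity gives
    \<open>F q \<le> \<theta> * F z\<close>. The boundary point is still in the cap since
    \<open>s\<close> is larger at \<open>x\<close>, and \<open>\<theta> \<ge> 3 / 4\<close> keeps
    the loss in passing from \<open>Z z\<close> to \<open>Z q\<close> bounded.\<close>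
  have lid_le: "F q \<le> Q q" if q: "q \<in> \<Omega>" "s q = s0" for q
  proof -
    have "q \<noteq> x" using q s0le mX by (auto simp: s_def X_def)
    then obtain e where e: "0 < e" "x + e *\<^sub>R (q - x) \<in> frontier \<Omega>"
      using ray_to_frontier[OF bd, of x "q - x"] x op by (auto simp: interior_open)
    define z where "z = x + e *\<^sub>R (q - x)"
    have zf: "z \<in> frontier \<Omega>" using e by (simp add: z_def)
    have e1: "1 < e"
    proof (rule ccontr)
      assume "\<not> 1 < e"
      then have "z \<in> \<Omega>"
        using convexD_alt[OF conv x q(1), of e] e(1) by (simp add: z_def algebra_simps)
      then show False using zf op by (simp add: frontier_def interior_open)
    qed
    define \<theta> where "\<theta> = 1 / e"
    have \<theta>: "0 < \<theta>" "\<theta> < 1" using e1 by (auto simp: \<theta>_def)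
    have qz: "q = x + \<theta> *\<^sub>R (z - x)" using e1 by (simp add: \<theta>_def z_def)
    have qy: "q - y = (1 - \<theta>) *\<^sub>R X + \<theta> *\<^sub>R (z - y)" by (simp add: qz X_def algebra_simps)
    have sq: "s q = (1 - \<theta>) + \<theta> * s z" unfolding s_def qy by (simp add: inner_add_right mX)
    have Zq: "Z q = \<theta> *\<^sub>R Z z" unfolding Z_def sq unfolding qy by (simp add: algebra_simps)
    have sz: "0 \<le> s z" by (rule s_nonneg[OF frontier_closure[OF zf]])
    then have "0 \<le> \<theta> * s z" using \<theta> by simp
    then have \<theta>4: "3 / 4 \<le> \<theta>" using sq q(2) s0le by linarith
    have szs0: "s z \<le> s0"
    proof -
      have "\<theta> * s z \<le> \<theta> * s0"
      proof -
        have "(1 - \<theta>) * s0 \<le> (1 - \<theta>) * 1" using \<theta> s0le by (intro mult_left_mono) auto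
        then show ?thesis using sq q(2) by (simp add: algebra_simps)
      qed
      then show ?thesis using \<theta> by simp
    qed
    have "F q \<le> \<theta> * F z"
    proof -
      have "\<phi> ((1 - \<theta>) *\<^sub>R x + \<theta> *\<^sub>R z) \<le> (1 - \<theta>) * \<phi> x + \<theta> * \<phi> z"
        using convex_onD[OF convex, of \<theta> x z] \<theta> x closure_subset frontier_closure[OF zf] by auto
      moreover have "(1 - \<theta>) *\<^sub>R x + \<theta> *\<^sub>R z = q" by (simp add: qz algebra_simps)
      moreover have "q - x = \<theta> *\<^sub>R (z - x)" by (simp add: qz)
      then have "F q = \<phi> q - \<phi> x - \<theta> * (p \<bullet> (z - x))" by (simp add: F_def)
      moreover have "\<theta> * F z = \<theta> * \<phi> z - \<theta> * \<phi> x - \<theta> * (p \<bullet> (z - x))"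
        by (simp add: F_def right_diff_distrib)
      ultimately show ?thesis by (simp add: left_diff_distrib)
    qed
    also have "\<dots> \<le> \<theta> * (T + (4 / \<rho>) * (norm (Z z))\<^sup>2)"
      using Fb[OF zf szs0] \<theta> by (intro mult_left_mono) auto
    also have "\<dots> \<le> T + A * (norm (Z q))\<^sup>2"
    proof -
      have "\<theta> * T \<le> T" using \<theta> T by simp
      moreover have "\<theta> * (4 / \<rho>) * (norm (Z z))\<^sup>2 \<le> A * (\<theta>\<^sup>2 * (norm (Z z))\<^sup>2)"
      proof -
        have "\<theta> * 4 \<le> \<theta> * (9 * \<theta>)" using \<theta> \<theta>4 by (intro mult_left_mono) auto
        then have "\<theta> * 4 / \<rho> \<le> \<theta> * (9 * \<theta>) / \<rho>" using rho by (intro divide_right_mono) auto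
        then have "\<theta> * (4 / \<rho>) \<le> A * \<theta>\<^sup>2" by (simp add: A_def power2_eq_square mult_ac)
        then show ?thesis unfolding mult.assoc[symmetric] by (intro mult_right_mono) auto
      qed
      ultimately show ?thesis using \<theta> by (simp add: Zq power_mult_distrib distrib_left mult.assoc)
    qed
    also have "\<dots> = Q q" by (simp add: Q_def q(2))
    finally show ?thesis .
  qed
  define R where "R = {z \<in> closure \<Omega>. s z \<le> s0}"
  define W where "W z = F z - Q z" for z
  have s_cont: "continuous_on U s" for U unfolding s_def by (intro continuous_intros)
  have "R = closure \<Omega> \<inter> {z. s z \<le> s0}" by (auto simp: R_def)
  moreover have "closed {z. s z \<le> s0}" by (intro closed_Collect_le s_cont continuous_on_const)
  ultimately have "compact R" using bd by (simp add: compact_Int_closed)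
  moreover have "continuous_on R W"
  proof -
    have "continuous_on R \<phi>" using cont by (rule continuous_on_subset) (auto simp: R_def)
    then show ?thesis
      unfolding W_def F_def Q_def Z_def by (intro continuous_intros s_cont)
  qed
  moreover define w where "w = y + (s0 / 2) *\<^sub>R X"
  have sw: "s w = s0 / 2" by (simp add: s_def w_def mX)
  have w\<Omega>: "w \<in> closure \<Omega>"
    using convexD_alt[OF convex_closure[OF conv] frontier_closure[OF y], of x "s0 / 2"] s0 s0le x closure_subset
    by (auto simp: w_def X_def algebra_simps)
  have wR: "w \<in> R" using w\<Omega> sw s0 by (simp add: R_def)
  ultimately obtain z where z: "z \<in> R" and zmax: "\<And>v. v \<in> R \<Longrightarrow> W v \<le> W z"
    using continuous_attains_sup[of R W] by auto
  have "Q w = - T"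
  proof -
    have "Z w = 0" by (simp add: Z_def sw) (simp add: w_def)
    then have "Q w = T - B * s0\<^sup>2 / 4" by (simp add: Q_def sw power2_eq_square)
    then show ?thesis using Bs0 by simp
  qed
  then have "0 < W w" using nonneg[OF w\<Omega>] T by (simp add: W_def)
  then have Wz: "0 < W z" using zmax[OF wR] by linarith
  have z_in: "z \<in> \<Omega>"
  proof (rule ccontr)
    assume "z \<notin> \<Omega>"
    then have "z \<in> frontier \<Omega>" using z op by (simp add: R_def frontier_def interior_open)
    then show False using frontier_le[of z] z Wz by (simp add: R_def W_def)
  qed
  have sz: "s z < s0"
  proof (rule ccontr)
    assume "\<not> s z < s0"
    then have "s z = s0" using z by (simp add: R_def)
    then show False using lid_le[OF z_in] Wz by (simp add: W_def)
  qed
  \<comment> \<open>A factor of the Hessian of \<open>Q\<close>: D^2Q is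
    \<open>transpose T1 ** T1\<close>. Being a multiple of a rank-one update of the identity,
    \<open>T1\<close> has an explicit determinant.\<close>
  define T1 where "T1 = sqrt (2 * A) *\<^sub>R (\<chi> i j. (if i = j then 1 else 0) + (sqrt (B / A) *\<^sub>R \<nu> - X) $ i * m $ j)"
  have \<alpha>: "sqrt (2 * A) * sqrt (B / A) = sqrt (2 * B)"
    using A B by (simp flip: real_sqrt_mult)
  have T1v: "T1 *v h = sqrt (2 * A) *\<^sub>R (h - (m \<bullet> h) *\<^sub>R X) + (sqrt (2 * B) * (m \<bullet> h)) *\<^sub>R \<nu>" for h
  proof -
    have "T1 *v h = sqrt (2 * A) *\<^sub>R (h + (m \<bullet> h) *\<^sub>R (sqrt (B / A) *\<^sub>R \<nu> - X))"
      unfolding T1_def by (simp only: scaleR_matrix_vector_assoc[symmetric] rank_one_update_mult_vec)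
    also have "\<dots> = sqrt (2 * A) *\<^sub>R (h - (m \<bullet> h) *\<^sub>R X) + ((sqrt (2 * A) * sqrt (B / A)) * (m \<bullet> h)) *\<^sub>R \<nu>"
      by (simp add: algebra_simps)
    finally show ?thesis unfolding \<alpha> .
  qed
  have T1norm: "(norm (T1 *v h))\<^sup>2 = 2 * (A * (norm (h - (m \<bullet> h) *\<^sub>R X))\<^sup>2 + B * (m \<bullet> h)\<^sup>2)" for h
  proof -
    define k where "k = h - (m \<bullet> h) *\<^sub>R X"
    have "m \<bullet> k = 0" using mX by (simp add: k_def inner_diff_right)
    then have k: "\<nu> \<bullet> k = 0" using d m\<nu>[of k] by simp
    then have k': "k \<bullet> \<nu> = 0" by (simp add: inner_commute)
    have "(norm (sqrt (2 * A) *\<^sub>R k + (sqrt (2 * B) * (m \<bullet> h)) *\<^sub>R \<nu>))\<^sup>2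
        = (sqrt (2 * A))\<^sup>2 * (k \<bullet> k) + (sqrt (2 * B))\<^sup>2 * (m \<bullet> h)\<^sup>2"
      unfolding power2_norm_eq_inner
      by (simp add: inner_add_left inner_add_right k k' nu_nu power2_eq_square del: real_sqrt_mult_self real_sqrt_abs2)
    also have "\<dots> = 2 * A * (norm k)\<^sup>2 + 2 * B * (m \<bullet> h)\<^sup>2"
      using A B by (simp add: power2_norm_eq_inner)
    finally show ?thesis unfolding T1v k_def by simp
  qed
  have hess: "h \<bullet> (hessian \<phi> z *v h) \<le> (norm (T1 *v h))\<^sup>2" for h
  proof -
    define k where "k = h - (m \<bullet> h) *\<^sub>R X"
    define b where "b = A * (norm k)\<^sup>2 + B * (m \<bullet> h)\<^sup>2"
    define a where "a = p \<bullet> h + 2 * A * (Z z \<bullet> k) - B * (m \<bullet> h) * s0 + 2 * B * s z * (m \<bullet> h)"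
    have "open (\<Omega> \<inter> {z. s z < s0})"
      by (intro open_Int op open_Collect_less s_cont continuous_on_const)
    then obtain r where r: "0 < r" "ball z r \<subseteq> \<Omega> \<inter> {z. s z < s0}"
      using z_in sz unfolding open_contains_ball by blast
    have step: "\<phi> (z + t *\<^sub>R h) \<le> \<phi> z + a * t + b * t\<^sup>2" if "\<bar>t\<bar> * norm h < r" for t
    proof -
      have "z + t *\<^sub>R h \<in> ball z r" using that by (simp add: dist_norm)
      then have "z + t *\<^sub>R h \<in> \<Omega> \<inter> {z. s z < s0}" using r(2) by (rule rev_subsetD)
      then have "z + t *\<^sub>R h \<in> R" using closure_subset[of \<Omega>] by (auto simp: R_def)
      then have le: "W (z + t *\<^sub>R h) \<le> W z" by (rule zmax)
      have st: "s (z + t *\<^sub>R h) = s z + t * (m \<bullet> h)"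
        by (simp add: s_def inner_diff_right inner_add_right)
      have Zt: "Z (z + t *\<^sub>R h) = Z z + t *\<^sub>R k"
        unfolding Z_def st k_def by (simp add: algebra_simps)
      have "(norm (Z z + t *\<^sub>R k))\<^sup>2 = (norm (Z z))\<^sup>2 + 2 * t * (Z z \<bullet> k) + t\<^sup>2 * (norm k)\<^sup>2"
        unfolding power2_norm_eq_inner by (simp add: inner_add_left inner_add_right inner_commute power2_eq_square)
      then have "Q (z + t *\<^sub>R h) - Q z + t * (p \<bullet> h) = a * t + b * t\<^sup>2"
        unfolding Q_def Zt st a_def b_def by (simp add: algebra_simps power2_eq_square)
      moreover have "F (z + t *\<^sub>R h) - F z = \<phi> (z + t *\<^sub>R h) - \<phi> z - t * (p \<bullet> h)"
        by (simp add: F_def inner_diff_right inner_add_right)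
      ultimately show ?thesis using le by (simp add: W_def)
    qed
    have "h \<bullet> (hessian \<phi> z *v h) \<le> 2 * b"
    proof (cases "h = 0")
      case True
      then show ?thesis using A B by (simp add: b_def k_def)
    next
      case False
      show ?thesis
        by (rule quadratic_upper_imp_hessian_le[OF C op z_in, of "r / norm h" _ a])
          (use r(1) False step in \<open>auto simp: pos_less_divide_eq\<close>)
    qed
    then show ?thesis by (simp add: T1norm b_def k_def)
  qed
  have "det T1 = sqrt (2 * A) ^ CARD('n) * (sqrt (B / A) / d)"
  proof -
    have "\<nu> \<bullet> m = 1 / d" using m\<nu>[of \<nu>] by (simp add: nu_nu inner_commute)
    then have "1 + (sqrt (B / A) *\<^sub>R \<nu> - X) \<bullet> m = sqrt (B / A) / d"
      using mX by (simp add: inner_diff_left inner_commute[of X])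
    then show ?thesis unfolding T1_def det_scaleR det_id_add_rank_one by simp
  qed
  moreover have "0 < B / A" using A B by simp
  ultimately have dT: "det T1 \<noteq> 0" "(det T1)\<^sup>2 = (2 * A) ^ CARD('n) * (B / A / d\<^sup>2)"
    using A d by (auto simp: power_mult_distrib power_divide simp flip: power_mult power_even_eq)
      (simp add: power_mult mult.commute[of _ 2])
  have "convex_on \<Omega> \<phi>" using convex by (rule convex_on_subset) (rule closure_subset, rule conv)
  then have "psd (hessian \<phi> z)" by (rule psd_hessian_of_convex[OF C op z_in])
  from psd_det_le_of_quadratic_bound[OF this dT(1) hess]
  have "l \<le> (2 * A) ^ CARD('n) * (B / A / d\<^sup>2)"
    using det[OF z_in] dT(2) by linarith
  also have "\<dots> \<le> (18 / \<rho>) ^ CARD('n) * (512 * c / \<rho> ^ 6)"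
  proof -
    \<comment> \<open>\<open>d\<close> cancels because \<open>B\<close> is proportional to
      \<open>d\<^sup>2\<close>; this is what the fourth power in \<open>T\<close> achieves.\<close>
    have "B / A / d\<^sup>2 = (\<rho> / 9) * (512 * c / \<rho> ^ 6)"
      using d rho by (simp add: A_def B_def mult_ac)
    also have "\<dots> \<le> 1 * (512 * c / \<rho> ^ 6)"
      using \<rho>1 rho c by (intro mult_right_mono) auto
    finally have *: "B / A / d\<^sup>2 \<le> 512 * c / \<rho> ^ 6" by simp
    have "2 * A = 18 / \<rho>" by (simp add: A_def)
    then show ?thesis using * rho by (simp only:) (intro mult_left_mono, auto)
  qed
  finally have "l * \<rho> ^ 6 \<le> (18 / \<rho>) ^ CARD('n) * (512 * c)"
    using rho by (simp add: pos_le_divide_eq)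
  moreover have "0 < (18 / \<rho>) ^ CARD('n) * c" using c rho by simp
  moreover have "c * (1024 * (18 / \<rho>) ^ CARD('n)) = 1024 * ((18 / \<rho>) ^ CARD('n) * c)"
    "(18 / \<rho>) ^ CARD('n) * (512 * c) = 512 * ((18 / \<rho>) ^ CARD('n) * c)" by simp_all
  ultimately show False using c(3) by linarith
qed

end

section \<open>Tangent planes at inner points stay away from the boundary values\<close>

lemma cond_A1_facts:
  fixes \<Omega> :: "(real^'n::finite) set"
  assumes dom: "bounded_convex_domain \<Omega>" and \<rho>: "0 < \<rho>" and A1: "cond_A1 \<rho> \<Omega>"
  shows "frontier \<Omega> \<noteq> {}" "\<rho> \<le> 1" "\<And>v w. v \<in> closure \<Omega> \<Longrightarrow> w \<in> closure \<Omega> \<Longrightarrow> norm (v - w) \<le> 2 / \<rho>"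
    "\<exists>z. ball z \<rho> \<subseteq> \<Omega>"
proof -
  have "\<Omega> \<noteq> UNIV" using dom not_bounded_UNIV unfolding bounded_convex_domain_def by metis
  then show fr: "frontier \<Omega> \<noteq> {}"
    using dom frontier_eq_empty unfolding bounded_convex_domain_def by metis
  then obtain y where "y \<in> frontier \<Omega>" by blast
  then show ex: "\<exists>z. ball z \<rho> \<subseteq> \<Omega>" using A1 unfolding cond_A1_def by blast
  then obtain z where "ball z \<rho> \<subseteq> \<Omega>" by blast
  then have "ball z \<rho> \<subseteq> ball 0 (1 / \<rho>)" using A1 unfolding cond_A1_def by (meson order_trans)
  then have "dist z 0 + \<rho> \<le> 1 / \<rho>" using \<rho> by (simp add: ball_subset_ball_iff)
  then have "\<rho> \<le> 1 / \<rho>" using zero_le_dist[of z 0] by linarith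
  then have "\<rho>\<^sup>2 \<le> 1" using \<rho> by (simp add: field_simps power2_eq_square)
  then show "\<rho> \<le> 1" using \<rho> by (simp add: power2_le_iff_abs_le[of 1 \<rho>, simplified] abs_square_le_1)
  have "closure \<Omega> \<subseteq> cball 0 (1 / \<rho>)"
    using A1 unfolding cond_A1_def by (intro closure_minimal) auto
  then have "norm v \<le> 1 / \<rho>" if "v \<in> closure \<Omega>" for v using that by auto
  then show "norm (v - w) \<le> 2 / \<rho>" if "v \<in> closure \<Omega>" "w \<in> closure \<Omega>" for v w
    using norm_triangle_ineq4[of v w] that by (smt (verit) add_divide_distrib)
qed

text \<open>The two smallness conditions of \<open>barrier\<close>: the first keeps the barrier
  above \<open>\<phi>\<close> on the boundary, the second brings its determinant below
  \<open>l\<close>.\<close>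

definition section_const :: "real \<Rightarrow> real \<Rightarrow> nat \<Rightarrow> real" where
  "section_const \<rho> l n = min (\<rho> ^ 5 / 512) (l * \<rho> ^ 6 / (1024 * (18 / \<rho>) ^ n))"

lemma section_const_pos: "0 < \<rho> \<Longrightarrow> 0 < l \<Longrightarrow> 0 < section_const \<rho> l n"
  by (simp add: section_const_def)

text \<open>If the tangent plane at \<open>x\<close> almost touches the boundary values of \<open>\<phi>\<close>, then by the upper bound in (A3)
  \<open>\<phi>\<close> lies below a flat quadratic barrier near the touching point, and at an interior maximum of the
  difference the determinant of \<open>D\<^sup>2\<phi>\<close> would be less than \<open>l\<close>.\<close>

lemma section_height_ge:
  fixes \<Omega> :: "(real^'n::finite) set"
  assumes dom: "bounded_convex_domain \<Omega>" and \<rho>: "0 < \<rho>" and l: "0 < l"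
    and A1: "cond_A1 \<rho> \<Omega>" and A2: "cond_A2 l L \<Omega> \<phi>" and A3: "cond_A3 \<rho> \<Omega> \<phi>"
    and x: "ball x \<delta> \<subseteq> \<Omega>" "0 < \<delta>" and z: "z \<in> frontier \<Omega>"
  shows "section_const \<rho> l CARD('n) * \<delta> ^ 4 \<le> \<phi> z - \<phi> x - grad \<phi> x \<bullet> (z - x)"
proof (rule ccontr)
  assume small: "\<not> ?thesis"
  have op: "open \<Omega>" and conv: "convex \<Omega>" and bd: "bounded \<Omega>"
    using dom by (auto simp: bounded_convex_domain_def)
  have C: "Ck_on 2 \<Omega> \<phi>" and cvx: "convex_on (closure \<Omega>) \<phi>" and cont: "continuous_on (closure \<Omega>) \<phi>"
    and det: "\<And>z. z \<in> \<Omega> \<Longrightarrow> l \<le> det (hessian \<phi> z)"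
    using A2 lipschitz_on_continuous_on by (auto simp: cond_A2_def)
  have x\<Omega>: "x \<in> \<Omega>" using x by auto
  define p where "p = grad \<phi> x"
  define F where "F z = \<phi> z - \<phi> x - p \<bullet> (z - x)" for z
  define c where "c = section_const \<rho> l CARD('n)"
  have nonneg: "0 \<le> F v" if "v \<in> closure \<Omega>" for v
  proof -
    have "x \<in> closure \<Omega>" using x\<Omega> closure_subset by blast
    moreover have "\<phi> differentiable (at x)" using C x\<Omega> by (simp add: Ck_on_2_iff)
    ultimately show ?thesis
      using convex_on_above_tangent[OF cvx _ that] by (simp add: F_def p_def algebra_simps)
  qed
  have "compact (frontier \<Omega>)" using bd by (rule compact_frontier_bounded)
  moreover have "continuous_on (frontier \<Omega>) F"
    unfolding F_def using cont by (intro continuous_intros) (auto simp: frontier_def intro: continuous_on_subset)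
  \<comment> \<open>The boundary point where the tangent plane at \<open>x\<close> comes closest to
    \<open>\<phi>\<close>; the barrier is centred there.\<close>
  ultimately obtain y where y: "y \<in> frontier \<Omega>" and ymin: "\<And>v. v \<in> frontier \<Omega> \<Longrightarrow> F y \<le> F v"
    using continuous_attains_inf[of "frontier \<Omega>" F] z by blast
  obtain \<nu> where \<nu>: "norm \<nu> = 1" "ball (y + \<rho> *\<^sub>R \<nu>) \<rho> \<subseteq> \<Omega>" "\<And>x. x \<in> closure \<Omega> \<Longrightarrow> 0 \<le> \<nu> \<bullet> (x - y)"
    using tangent_ball_normal[OF conv op y \<rho> A1] by blast
  interpret tangent_point \<Omega> \<rho> y \<nu>
    using op conv \<rho> y \<nu> by unfold_locales
  have d: "\<delta> \<le> \<nu> \<bullet> (x - y)" by (rule ball_height[OF x])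
  obtain s where s: "\<And>v. v \<in> closure \<Omega> \<Longrightarrow> \<phi> y + s \<bullet> (v - y) \<le> \<phi> v"
    "\<And>v. v \<in> frontier \<Omega> \<Longrightarrow> \<phi> v - \<phi> y - s \<bullet> (v - y) \<le> (1 / \<rho>) * (norm (v - y))\<^sup>2"
    using A3 y unfolding cond_A3_def boundary_slope_def by blast
  define a where "a = s - p"
  have Fa: "F v \<le> F y + a \<bullet> (v - y) + (1 / \<rho>) * (norm (v - y))\<^sup>2" if "v \<in> frontier \<Omega>" for v
    using s(2)[OF that] by (simp add: F_def a_def inner_diff_left inner_diff_right)
  have ax: "a \<bullet> (x - y) \<le> 0"
  proof -
    have "\<phi> y + s \<bullet> (x - y) \<le> \<phi> x" using s(1) x\<Omega> closure_subset by blast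
    moreover have "0 \<le> F y" using nonneg y by (auto simp: frontier_def)
    ultimately show ?thesis by (simp add: F_def a_def inner_diff_left inner_diff_right)
  qed
  \<comment> \<open>Minimality of \<open>y\<close> gives the linear term in \<open>Fa\<close> a
    sign, so only the height and the quadratic term remain.\<close>
  have "F v \<le> c * (\<nu> \<bullet> (x - y)) ^ 4 + (norm (v - y))\<^sup>2 / \<rho>" if v: "v \<in> frontier \<Omega>" for v
  proof -
    have "a \<bullet> (v - y) \<le> 0"
      by (rule slope_inner_nonpos[where F = F and K = "1 / \<rho>", OF ymin _ Fa x\<Omega> ax])
        (use \<rho> v in \<open>auto simp: frontier_def\<close>)
    moreover have "F y \<le> c * \<delta> ^ 4" using small ymin[OF z] by (simp add: F_def c_def p_def)
    moreover have "c * \<delta> ^ 4 \<le> c * (\<nu> \<bullet> (x - y)) ^ 4"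
      using d x(2) section_const_pos[OF \<rho> l] by (intro mult_left_mono power_mono) (auto simp: c_def less_imp_le)
    ultimately show ?thesis using Fa[OF v] by simp
  qed
  moreover have "c \<le> \<rho> ^ 5 / 512" "c * (1024 * (18 / \<rho>) ^ CARD('n)) \<le> l * \<rho> ^ 6"
    using \<rho> pos_le_divide_eq[of "1024 * (18 / \<rho>) ^ CARD('n)" c "l * \<rho> ^ 6"]
    by (auto simp: c_def section_const_def)
  moreover have "norm (x - y) \<le> 2 / \<rho>"
    using cond_A1_facts(3)[OF dom \<rho> A1] x\<Omega> y closure_subset by (auto simp: frontier_def)
  moreover have "0 < c" using section_const_pos[OF \<rho> l] by (simp add: c_def)
  ultimately show False
    using barrier[OF C cvx cont bd det x\<Omega>, of p c] cond_A1_facts(2)[OF dom \<rho> A1] nonneg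
    unfolding F_def by blast
qed

section \<open>Contact sets\<close>

text \<open>Convexity of the power with weights \<open>1 - \<theta>\<close> and
  \<open>\<theta>\<close>. A small \<open>\<theta>\<close> keeps the coefficient of
  \<open>x ^ n\<close> close to 1 and puts the whole loss on \<open>y ^ n\<close>; the comparison of
  volumes depends on this.\<close>

lemma power_add_le_weighted:
  fixes x y \<theta> :: real
  assumes "0 \<le> x" "0 \<le> y" "0 < \<theta>" "\<theta> < 1" and n: "0 < n"
  shows "(x + y) ^ n \<le> x ^ n / (1 - \<theta>) ^ (n - 1) + y ^ n / \<theta> ^ (n - 1)"
proof -
  have conv: "convex_on {0..} (\<lambda>x :: real. x ^ n)"
    using convex_power_even[of n] convex_power_odd[of n] convex_on_subset[of UNIV "\<lambda>x :: real. x ^ n" "{0..}"]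
    by (cases "even n") auto
  have "(x + y) ^ n = ((1 - \<theta>) *\<^sub>R (x / (1 - \<theta>)) + \<theta> *\<^sub>R (y / \<theta>)) ^ n"
    using assms by simp
  also have "\<dots> \<le> (1 - \<theta>) * (x / (1 - \<theta>)) ^ n + \<theta> * (y / \<theta>) ^ n"
    using assms by (intro convex_onD[OF conv]) auto
  also have "\<dots> = x ^ n / (1 - \<theta>) ^ (n - 1) + y ^ n / \<theta> ^ (n - 1)"
    using assms by (cases n) (auto simp: power_divide)
  finally show ?thesis .
qed

lemma inverse_one_minus_power_le:
  fixes \<theta> :: real
  assumes "0 \<le> \<theta>" "\<theta> \<le> 1 / 2"
  shows "1 / (1 - \<theta>) ^ k \<le> 1 + \<theta> * 2 ^ (k + 1)"
proof -
  have 1: "(1 + s) ^ k \<le> 1 + s * (2 ^ k - 1)" if "0 \<le> s" "s \<le> 1" for s :: real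
  proof (induction k)
    case (Suc k)
    have "s * (s * (2 ^ k - 1)) \<le> 1 * (s * (2 ^ k - 1))"
      using that by (intro mult_right_mono) auto
    have "(1 + s) ^ Suc k \<le> (1 + s) * (1 + s * (2 ^ k - 1))"
      using Suc that by (simp add: mult_left_mono)
    also have "\<dots> = 1 + s + s * (2 ^ k - 1) + s * (s * (2 ^ k - 1))" by (simp add: algebra_simps)
    also have "\<dots> \<le> 1 + s + s * (2 ^ k - 1) + s * (2 ^ k - 1)"
      using \<open>s * (s * (2 ^ k - 1)) \<le> 1 * (s * (2 ^ k - 1))\<close> by simp
    also have "\<dots> = 1 + s * (2 ^ Suc k - 1)" by (simp add: algebra_simps)
    finally show ?case .
  qed simp
  have "1 / (1 - \<theta>) \<le> 1 + 2 * \<theta>"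
  proof -
    have "0 \<le> \<theta> * (1 - 2 * \<theta>)" using assms by (intro mult_nonneg_nonneg) auto
    then have "1 \<le> (1 + 2 * \<theta>) * (1 - \<theta>)" by (simp add: algebra_simps)
    then show ?thesis using assms by (simp add: pos_divide_le_eq)
  qed
  then have "(1 / (1 - \<theta>)) ^ k \<le> (1 + 2 * \<theta>) ^ k" using assms by (intro power_mono) auto
  also have "\<dots> \<le> 1 + 2 * \<theta> * (2 ^ k - 1)" using assms by (intro 1) auto
  also have "\<dots> \<le> 1 + \<theta> * 2 ^ (k + 1)" using assms by (simp add: algebra_simps)
  finally show ?thesis by (simp add: power_divide)
qed

section \<open>Inequalities and continuity for the cofactor matrix\<close>

lemma matrix_inv_right: "det (A :: real^'n^'n) \<noteq> 0 \<Longrightarrow> A ** matrix_inv A = mat 1"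
  and matrix_inv_left: "det (A :: real^'n^'n) \<noteq> 0 \<Longrightarrow> matrix_inv A ** A = mat 1"
  using someI_ex[of "\<lambda>B. A ** B = mat 1 \<and> B ** A = mat 1"]
  unfolding invertible_det_nz[symmetric] invertible_def matrix_inv_def by auto

lemma psd_matrix_inv:
  fixes A :: "real^'n^'n"
  assumes A: "psd A" "det A \<noteq> 0"
  shows "psd (matrix_inv A)"
  unfolding psd_def
proof (intro conjI allI)
  let ?B = "matrix_inv A"
  have t: "transpose A = A" using A by (simp add: psd_def)
  have "transpose ?B ** A = mat 1"
    using arg_cong[OF matrix_inv_right[OF A(2)], of transpose] by (simp add: matrix_transpose_mul t transpose_mat)
  then show "transpose ?B = ?B"
    by (metis A(2) matrix_inv_right matrix_mul_assoc matrix_mul_lid matrix_mul_rid)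
  fix x
  have "x = A *v (?B *v x)"
    by (simp add: matrix_vector_mul_assoc matrix_inv_right[OF A(2)])
  then have "x \<bullet> (?B *v x) = (?B *v x) \<bullet> (A *v (?B *v x))" by (metis inner_commute)
  then show "0 \<le> x \<bullet> (?B *v x)" using A(1) unfolding psd_def by metis
qed

text \<open>The cofactor matrix is positive semidefinite with determinant
  \<open>det A ^ (CARD('n) - 1)\<close>; by symmetry of \<open>V\<close> the double sum is the trace
  of its product with \<open>V\<close>, and \<open>psd_det_mult_le\<close> applies.\<close>

lemma cofactor_det_inequality:
  fixes A V :: "real^'n^'n"
  assumes A: "psd A" "0 < det A" and V: "psd V"
  shows "det V * det A ^ (CARD('n) - 1) \<le>
     ((\<Sum>i\<in>UNIV. \<Sum>j\<in>UNIV. (det A *\<^sub>R matrix_inv A) $ i $ j * V $ i $ j) / real CARD('n)) ^ CARD('n)"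
proof -
  let ?B = "det A *\<^sub>R matrix_inv A"
  have B0: "psd (matrix_inv A)" using A by (intro psd_matrix_inv) auto
  then have B: "psd ?B"
    using A(2) by (auto simp: psd_def transpose_scalar scaleR_matrix_vector_assoc[symmetric])
  have "det A * det (matrix_inv A) = 1"
    using matrix_inv_right[of A] A by (metis det_I det_mul less_irrefl)
  then have "det ?B * det A = det A ^ CARD('n)"
    by (simp add: det_scaleR mult.assoc mult.commute[of "det (matrix_inv A)"])
  moreover have "det A ^ CARD('n) = det A ^ (CARD('n) - 1) * det A"
    by (simp flip: power_Suc2)
  ultimately have "det ?B = det A ^ (CARD('n) - 1)" using A(2) by simp
  moreover have "trace (?B ** V) = (\<Sum>i\<in>UNIV. \<Sum>j\<in>UNIV. ?B $ i $ j * V $ i $ j)"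
  proof -
    have "V $ j $ i = V $ i $ j" for i j
      using V unfolding psd_def by (metis transpose_def vec_lambda_beta)
    then show ?thesis by (simp add: trace_def matrix_matrix_mult_def)
  qed
  ultimately show ?thesis
    using psd_det_mult_le[OF B V] by (simp add: mult.commute)
qed

text \<open>For the Hessian of \<open>\<phi>\<close> this is the operator applied to
  \<open>\<phi>\<close> itself. It supplies the main term when \<open>\<phi>\<close> is
  perturbed.\<close>

lemma cofactor_contraction_self:
  fixes A :: "real^'n^'n"
  assumes A: "psd A" "0 < det A"
  shows "(\<Sum>i\<in>UNIV. \<Sum>j\<in>UNIV. (det A *\<^sub>R matrix_inv A) $ i $ j * A $ i $ j) = real CARD('n) * det A"
proof -
  have "A $ j $ i = A $ i $ j" for i j
    using A unfolding psd_def by (metis transpose_def vec_lambda_beta)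
  then have "(\<Sum>i\<in>UNIV. \<Sum>j\<in>UNIV. (det A *\<^sub>R matrix_inv A) $ i $ j * A $ i $ j) = trace (det A *\<^sub>R (matrix_inv A ** A))"
    by (simp add: trace_def matrix_matrix_mult_def sum_distrib_left mult.assoc)
  also have "\<dots> = real CARD('n) * det A"
    using A by (simp add: matrix_inv_left trace_def mat_def)
  finally show ?thesis .
qed

lemma continuous_on_det:
  fixes A :: "'a::topological_space \<Rightarrow> real^'n^'n"
  assumes "\<And>i j. continuous_on S (\<lambda>x. A x $ i $ j)"
  shows "continuous_on S (\<lambda>x. det (A x))"
  unfolding det_def by (intro continuous_intros assms)

text \<open>Cramer's rule. It exhibits the entries as polynomials in the entries of
  \<open>A\<close>, from which continuity of the coefficients follows.\<close>

lemma cofactor_entry: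
  fixes A :: "real^'n^'n"
  assumes "det A \<noteq> 0"
  shows "(det A *\<^sub>R matrix_inv A) $ k $ j = det (\<chi> r s. if s = k then axis j 1 $ r else A $ r $ s)"
proof -
  let ?x = "matrix_inv A *v axis j 1"
  have "A *v ?x = axis j 1"
    by (simp add: matrix_vector_mul_assoc matrix_inv_right[OF assms] del: matrix_vector_mult_basis)
  then have "det (\<chi> r s. if s = k then axis j 1 $ r else A $ r $ s) = ?x $ k * det A"
    using cramer_lemma[of k A ?x] by (simp only:)
  then show ?thesis by (simp add: matrix_vector_mult_basis column_def)
qed

lemma continuous_on_cof_hessian:
  fixes \<phi> :: "real^'n::finite \<Rightarrow> real"
  assumes C: "Ck_on 2 S \<phi>" and d: "\<And>x. x \<in> S \<Longrightarrow> det (hessian \<phi> x) \<noteq> 0"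
  shows "continuous_on S (\<lambda>x. cof_hessian \<phi> x $ k $ j)"
proof -
  have h: "continuous_on S (\<lambda>x. hessian \<phi> x $ r $ s)" for r s
    using continuous_on_hessian[OF C] by (intro continuous_intros)
  have "continuous_on S (\<lambda>x. det (\<chi> r s. if s = k then axis j 1 $ r else hessian \<phi> x $ r $ s))"
  proof (rule continuous_on_det)
    fix r s
    show "continuous_on S (\<lambda>x. (\<chi> r s. if s = k then axis j 1 $ r else hessian \<phi> x $ r $ s) $ r $ s)"
      using h by (cases "s = k") auto
  qed
  then show ?thesis
    by (rule continuous_on_eq) (simp only: cof_hessian_def cofactor_entry[OF d])
qed

section \<open>Gradient images of contact sets and their volumes\<close>

lemma set_integrable_continuous_compact:
  fixes f :: "'a::euclidean_space \<Rightarrow> real"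
  assumes "compact K" "continuous_on K f" "S \<subseteq> K" "S \<in> sets lebesgue"
  shows "set_integrable lebesgue S f"
proof -
  have "integrable lborel (\<lambda>x. indicat_real K x *\<^sub>R f x)"
    by (rule borel_integrable_compact[OF assms(1,2)])
  then have "set_integrable lebesgue K f"
    unfolding set_integrable_def by (subst integrable_completion) auto
  then show ?thesis by (rule set_integrable_subset[OF _ assms(4,3)])
qed

lemma closed_psd: "closed {A :: real^'n^'n. psd A}"
proof -
  have "{A :: real^'n^'n. psd A} = {A. transpose A = A} \<inter> (\<Inter>x. {A. 0 \<le> x \<bullet> (A *v x)})"
    by (auto simp: psd_def)
  moreover have "closed {A :: real^'n^'n. transpose A = A}"
    unfolding transpose_def by (intro closed_Collect_eq continuous_intros)
  moreover have "closed {A :: real^'n^'n. 0 \<le> x \<bullet> (A *v x)}" for x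
    unfolding matrix_vector_mult_def by (intro closed_Collect_le continuous_intros)
  ultimately show ?thesis by (simp only:) (intro closed_Int closed_INT ballI)
qed

lemma psd_hessian_set_lebesgue:
  fixes v :: "real^'n::finite \<Rightarrow> real"
  assumes "Ck_on 2 S v" "open U" "U \<subseteq> S"
  shows "{z \<in> U. psd (hessian v z)} \<in> sets lebesgue"
proof -
  have "continuous_on U (hessian v)"
    using continuous_on_hessian[OF assms(1)] assms(3) by (rule continuous_on_subset)
  then have "closedin (top_of_set U) (U \<inter> hessian v -` {A. psd A})"
    using closed_psd by (rule continuous_closedin_preimage)
  then obtain T where "closed T" "U \<inter> hessian v -` {A. psd A} = U \<inter> T"
    unfolding closedin_closed by blast
  moreover have "{z \<in> U. psd (hessian v z)} = U \<inter> hessian v -` {A. psd A}" by auto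
  ultimately show ?thesis
    using assms(2) by simp
qed

text \<open>The function \<open>v\<close> minus the linear function with slope \<open>p\<close>
  attains its minimum over the closure, by \<open>lt\<close> not on the frontier. At an interior
  minimum the gradient of \<open>v\<close> is \<open>p\<close> and its Hessian is positive
  semidefinite.\<close>

lemma interior_min_in_grad_image:
  fixes v :: "real^'n::finite \<Rightarrow> real"
  assumes C: "Ck_on 2 S v" and U: "open U" "bounded U" "closure U \<subseteq> S" and x: "x \<in> U"
    and lt: "\<And>y. y \<in> frontier U \<Longrightarrow> v x - p \<bullet> x < v y - p \<bullet> y"
  shows "p \<in> grad v ` {z \<in> U. psd (hessian v z)}"
proof -
  have cpt: "compact (closure U)" using U(2) by (simp add: compact_closure)
  have cnt: "continuous_on (closure U) (\<lambda>z. v z - p \<bullet> z)"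
    using continuous_on_subset[OF Ck_on_2_imp_continuous_on[OF C] U(3)] by (intro continuous_intros)
  have xc: "x \<in> closure U" using x closure_subset by blast
  then have "closure U \<noteq> {}" by auto
  from continuous_attains_inf[OF cpt this cnt]
  obtain z where z: "z \<in> closure U" and zmin: "\<And>y. y \<in> closure U \<Longrightarrow> v z - p \<bullet> z \<le> v y - p \<bullet> y"
    by auto
  have zU: "z \<in> U"
  proof (rule ccontr)
    assume "z \<notin> U"
    then have "z \<in> frontier U" using z U(1) by (simp add: frontier_def interior_open)
    then show False using lt zmin[OF xc] by force
  qed
  have zS: "z \<in> S" using zU U(3) closure_subset by blast
  have CU: "Ck_on 2 U v" using C by (rule Ck_on_subset) (use U(3) closure_subset in blast)
  have "((\<lambda>z. v z - p \<bullet> z) has_derivative (\<lambda>h. grad v z \<bullet> h - p \<bullet> h)) (at z)"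
    using C zS by (intro derivative_intros has_derivative_grad) (simp add: Ck_on_2_iff)
  then have "(\<lambda>h. grad v z \<bullet> h - p \<bullet> h) = (\<lambda>h. 0)"
    using zmin closure_subset by (intro differential_zero_maxmin[OF zU U(1)]) auto
  then have "grad v z \<bullet> (grad v z - p) - p \<bullet> (grad v z - p) = 0" by meson
  then have gz: "grad v z = p" by (simp flip: inner_diff_left)
  have "psd (hessian v z)"
    unfolding psd_def
  proof (intro conjI allI)
    show "transpose (hessian v z) = hessian v z" by (rule hessian_symmetric[OF CU U(1) zU])
    fix h
    show "0 \<le> h \<bullet> (hessian v z *v h)"
    proof (cases "h = 0")
      case False
      obtain r where r: "0 < r" "ball z r \<subseteq> U" using U(1) zU unfolding open_contains_ball by blast
      have "2 * 0 \<le> h \<bullet> (hessian v z *v h)"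
      proof (rule quadratic_lower_imp_hessian_ge[OF CU U(1) zU, of "r / norm h" "p \<bullet> h"])
        show "0 < r / norm h" using r False by simp
        fix t assume "\<bar>t\<bar> < r / norm h"
        then have "z + t *\<^sub>R h \<in> ball z r" using False by (simp add: dist_norm pos_less_divide_eq)
        then have "z + t *\<^sub>R h \<in> closure U" using r closure_subset by blast
        from zmin[OF this] show "v z + (p \<bullet> h) * t + 0 * t\<^sup>2 \<le> v (z + t *\<^sub>R h)"
          by (simp add: inner_add_right mult.commute)
      qed
      then show ?thesis by simp
    qed simp
  qed
  then show ?thesis using gz zU by blast
qed

lemma matrix_mult_vec_matrix: "matrix (\<lambda>h. transpose A *v h) = transpose (A :: real^'n^'n)"
  by (rule matrix_of_matrix_vector_mul)

lemma measure_grad_image: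
  fixes v :: "real^'n::finite \<Rightarrow> real"
  assumes C: "Ck_on 2 S v" and K: "compact K" "K \<subseteq> S" and A: "A \<subseteq> K" "A \<in> sets lebesgue"
  shows "grad v ` A \<in> lmeasurable"
    and "measure lebesgue (grad v ` A) \<le> (LINT z:A|lebesgue. \<bar>det (hessian v z)\<bar>)"
    and "inj_on (grad v) A \<Longrightarrow> measure lebesgue (grad v ` A) = (LINT z:A|lebesgue. \<bar>det (hessian v z)\<bar>)"
    and "set_integrable lebesgue A (\<lambda>z. \<bar>det (hessian v z)\<bar>)"
proof -
  have det: "det (matrix (\<lambda>h. transpose (hessian v z) *v h)) = det (hessian v z)" for z
    unfolding matrix_mult_vec_matrix by simp
  have d: "(grad v has_derivative (\<lambda>h. transpose (hessian v z) *v h)) (at z)" if "z \<in> A" for z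
    using that A K by (intro has_derivative_grad2[OF C]) blast
  have h: "continuous_on K (hessian v)"
    using continuous_on_hessian[OF C] K(2) by (rule continuous_on_subset)
  have "continuous_on K (\<lambda>z. \<bar>det (hessian v z)\<bar>)"
    by (intro continuous_intros continuous_on_det h)
  then show i: "set_integrable lebesgue A (\<lambda>z. \<bar>det (hessian v z)\<bar>)"
    using K A by (intro set_integrable_continuous_compact)
  note i' = i[folded det]
  show "grad v ` A \<in> lmeasurable" by (rule lmeasurable_gradient_image[OF A(2) d i'])
  show "measure lebesgue (grad v ` A) \<le> (LINT z:A|lebesgue. \<bar>det (hessian v z)\<bar>)"
    using measure_gradient_image_le[OF A(2) d i'] unfolding det .
  show "inj_on (grad v) A \<Longrightarrow> measure lebesgue (grad v ` A) = (LINT z:A|lebesgue. \<bar>det (hessian v z)\<bar>)"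
    using measure_gradient_image_eq[OF A(2) d i'] unfolding det .
qed

lemma Ck_on_2_add_scaled:
  fixes f g :: "real^'n::finite \<Rightarrow> real"
  assumes f: "Ck_on 2 S f" and g: "Ck_on 2 S g" and S: "open S"
  shows "Ck_on 2 S (\<lambda>x. f x + c * g x)"
    and "\<And>x. x \<in> S \<Longrightarrow> grad (\<lambda>x. f x + c * g x) x = grad f x + c *\<^sub>R grad g x"
    and "\<And>x. x \<in> S \<Longrightarrow> hessian (\<lambda>x. f x + c * g x) x = hessian f x + c *\<^sub>R hessian g x"
proof -
  let ?v = "\<lambda>x. f x + c * g x"
  have D: "((\<lambda>x. a x + c * b x) has_derivative (\<lambda>h. grad a x \<bullet> h + c * (grad b x \<bullet> h))) (at x)"
    if "a differentiable (at x)" "b differentiable (at x)" for a b :: "real^'n \<Rightarrow> real" and x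
    using that by (intro derivative_intros has_derivative_grad)
  have p1: "partial i (\<lambda>x. a x + c * b x) x = partial i a x + c * partial i b x"
    if "a differentiable (at x)" "b differentiable (at x)" for a b :: "real^'n \<Rightarrow> real" and x i
    using partial_eq[OF D[OF that]] by (simp add: grad_def inner_axis)
  have df: "f differentiable (at x)" "g differentiable (at x)" if "x \<in> S" for x
    using f g that by (auto simp: Ck_on_2_iff)
  have dp: "partial i f differentiable (at x)" "partial i g differentiable (at x)" if "x \<in> S" for x i
    using f g that by (auto simp: Ck_on_2_iff)
  have p: "partial i ?v x = partial i f x + c * partial i g x" if "x \<in> S" for x i
    by (rule p1[OF df[OF that]])
  have Dp: "(partial i ?v has_derivative (\<lambda>h. grad (partial i f) x \<bullet> h + c * (grad (partial i g) x \<bullet> h))) (at x)"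
    if "x \<in> S" for x i
    by (rule has_derivative_transform_within_open[OF D[OF dp[OF that]] S that]) (simp add: p)
  have pp: "partial j (partial i ?v) x = partial j (partial i f) x + c * partial j (partial i g) x" if "x \<in> S" for x i j
    using partial_eq[OF Dp[OF that]] by (simp add: grad_def inner_axis)
  show "Ck_on 2 S ?v"
    unfolding Ck_on_2_iff
  proof (intro conjI ballI allI)
    show "?v differentiable (at x)" if "x \<in> S" for x
      using D[OF df[OF that]] by (rule differentiableI)
    show "partial i ?v differentiable (at x)" if "x \<in> S" for x i
      using Dp[OF that] by (rule differentiableI)
    fix i j
    have "continuous_on S (\<lambda>x. partial j (partial i f) x + c * partial j (partial i g) x)"
      using f g by (intro continuous_intros) (auto simp: Ck_on_2_iff)
    then show "continuous_on S (partial j (partial i ?v))"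
      by (rule continuous_on_eq) (simp add: pp)
  qed
  show "grad ?v x = grad f x + c *\<^sub>R grad g x" if "x \<in> S" for x
    using p[OF that] by (simp add: grad_def vec_eq_iff)
  show "hessian ?v x = hessian f x + c *\<^sub>R hessian g x" if "x \<in> S" for x
    using pp[OF that] by (simp add: hessian_def vec_eq_iff)
qed

lemma Ck_on_2_uminus:
  fixes f :: "real^'n::finite \<Rightarrow> real"
  assumes f: "Ck_on 2 S f" and S: "open S"
  shows "Ck_on 2 S (\<lambda>x. - f x)"
    and "\<And>x. x \<in> S \<Longrightarrow> hessian (\<lambda>x. - f x) x = - hessian f x"
  using Ck_on_2_add_scaled(1)[OF f f S, where c = "-2"] Ck_on_2_add_scaled(3)[OF f f S, where c = "-2"]
  by (simp_all add: vec_eq_iff)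

text \<open>The second argument is a matrix field rather than a function, so that one operator
  serves both weak Hessians and Hessians of mollifications.\<close>

definition lma :: "(real^'n::finite \<Rightarrow> real) \<Rightarrow> (real^'n \<Rightarrow> real^'n^'n) \<Rightarrow> real^'n \<Rightarrow> real" where
  "lma \<phi> H x = (\<Sum>i\<in>UNIV. \<Sum>j\<in>UNIV. cof_hessian \<phi> x $ i $ j * H x $ i $ j)"

lemma continuous_on_lma:
  fixes \<phi> :: "real^'n::finite \<Rightarrow> real"
  assumes "Ck_on 2 S \<phi>" "\<And>x. x \<in> S \<Longrightarrow> det (hessian \<phi> x) \<noteq> 0" "continuous_on S H"
  shows "continuous_on S (lma \<phi> H)"
  unfolding lma_def[abs_def] by (intro continuous_intros continuous_on_cof_hessian assms)

section \<open>The maximum principle and the measure of the contact set\<close>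

locale potential =
  fixes \<Omega> :: "(real^'n::finite) set" and \<phi> :: "real^'n \<Rightarrow> real" and l L :: real
  assumes op: "open \<Omega>" and conv: "convex \<Omega>" and C: "Ck_on 2 \<Omega> \<phi>" and convex: "convex_on \<Omega> \<phi>"
    and l: "0 < l" and det_ge: "x \<in> \<Omega> \<Longrightarrow> l \<le> det (hessian \<phi> x)"
    and det_le: "x \<in> \<Omega> \<Longrightarrow> det (hessian \<phi> x) \<le> L"
begin

lemma det_pos: "x \<in> \<Omega> \<Longrightarrow> 0 < det (hessian \<phi> x)" using l det_ge by force

lemma L_pos: "x \<in> \<Omega> \<Longrightarrow> 0 < L" using det_pos det_le by force

lemma psd_hessian: "x \<in> \<Omega> \<Longrightarrow> psd (hessian \<phi> x)"
  by (rule psd_hessian_of_convex[OF C op _ convex])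

lemma grad_inj: "inj_on (grad \<phi>) \<Omega>"
  using det_pos by (intro grad_inj_on[OF C op conv convex]) force

text \<open>Contracting the cofactors with the perturbed Hessian splits into \<open>n\<close> times
  the determinant and \<open>c\<close> times \<open>lma\<close>. After division by \<open>n\<close>
  the factor in front of the second term is bounded by 1.\<close>

lemma det_le_lma:
  assumes x: "x \<in> \<Omega>" and V: "psd (hessian \<phi> x + c *\<^sub>R hessian w x)"
  shows "det (hessian \<phi> x + c *\<^sub>R hessian w x) * det (hessian \<phi> x) ^ (CARD('n) - 1)
     \<le> (det (hessian \<phi> x) + \<bar>c * lma \<phi> (hessian w) x\<bar>) ^ CARD('n)"
proof -
  let ?A = "hessian \<phi> x" and ?W = "hessian w x"
  have "(\<Sum>i\<in>UNIV. \<Sum>j\<in>UNIV. (det ?A *\<^sub>R matrix_inv ?A) $ i $ j * (?A + c *\<^sub>R ?W) $ i $ j)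
      = (\<Sum>i\<in>UNIV. \<Sum>j\<in>UNIV. (det ?A *\<^sub>R matrix_inv ?A) $ i $ j * ?A $ i $ j) + c * lma \<phi> (hessian w) x"
    by (simp add: lma_def cof_hessian_def distrib_left sum.distrib sum_distrib_left mult_ac)
  also have "\<dots> = real CARD('n) * det ?A + c * lma \<phi> (hessian w) x"
    by (simp only: cofactor_contraction_self[OF psd_hessian[OF x] det_pos[OF x]])
  finally have eq: "(\<Sum>i\<in>UNIV. \<Sum>j\<in>UNIV. (det ?A *\<^sub>R matrix_inv ?A) $ i $ j * (?A + c *\<^sub>R ?W) $ i $ j) / real CARD('n)
      = det ?A + c * lma \<phi> (hessian w) x / real CARD('n)"
    by (simp add: add_divide_distrib)
  have "det (?A + c *\<^sub>R ?W) * det ?A ^ (CARD('n) - 1) \<le> (det ?A + c * lma \<phi> (hessian w) x / real CARD('n)) ^ CARD('n)"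
    using cofactor_det_inequality[OF psd_hessian[OF x] det_pos[OF x] V] unfolding eq .
  also have "\<dots> \<le> \<bar>det ?A + c * lma \<phi> (hessian w) x / real CARD('n)\<bar> ^ CARD('n)"
    by (metis abs_ge_self power_abs)
  also have "\<dots> \<le> (det ?A + \<bar>c * lma \<phi> (hessian w) x\<bar>) ^ CARD('n)"
  proof (rule power_mono)
    have "\<bar>c * lma \<phi> (hessian w) x\<bar> / real CARD('n) \<le> \<bar>c * lma \<phi> (hessian w) x\<bar> / 1"
      by (intro divide_left_mono) (auto simp: Suc_le_eq)
    then show "\<bar>det ?A + c * lma \<phi> (hessian w) x / real CARD('n)\<bar> \<le> det ?A + \<bar>c * lma \<phi> (hessian w) x\<bar>"
      using det_pos[OF x] by (intro order_trans[OF abs_triangle_ineq]) auto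
  qed simp
  finally show ?thesis .
qed

text \<open>The Alexandrov-Bakelman-Pucci argument. If \<open>w\<close> dips too far, all slopes in
  a ball are attained where D^2w is positive semidefinite, and there \<open>det D^2w\<close> is at
  most the \<open>n\<close>-th power of \<open>lma\<close> over \<open>l ^ (CARD('n) - 1)\<close>.
  The volume of the ball is thus bounded by the integral of the right-hand side.\<close>

lemma sup_bound:
  assumes w: "Ck_on 2 \<Omega> w" and U: "open U" "bounded U" "closure U \<subseteq> \<Omega>"
    and bd: "\<And>y. y \<in> frontier U \<Longrightarrow> - \<eta> \<le> w y"
    and R: "0 < R" "\<And>x y. x \<in> U \<Longrightarrow> y \<in> frontier U \<Longrightarrow> norm (y - x) \<le> R"
    and F0: "0 \<le> F0" "(LINT z:U|lebesgue. \<bar>lma \<phi> (hessian w) z\<bar> ^ CARD('n)) \<le> F0 ^ CARD('n)"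
    and x: "x \<in> U"
  shows "- (\<eta> + R * max 1 (1 / (l ^ (CARD('n) - 1) * unit_ball_vol (real CARD('n)))) * F0) \<le> w x"
proof (rule ccontr)
  let ?K = "max 1 (1 / (l ^ (CARD('n) - 1) * unit_ball_vol (real CARD('n))))"
  assume "\<not> ?thesis"
  then have neg: "\<eta> + R * ?K * F0 < - w x" by simp
  \<comment> \<open>Depth below the boundary values divided by the diameter bound: a plane through
    the graph at \<open>x\<close> with slope shorter than \<open>r\<close> stays below
    \<open>w\<close> on the frontier.\<close>
  define r where "r = (- w x - \<eta>) / R"
  have r: "?K * F0 < r" using neg R(1) by (simp add: r_def pos_less_divide_eq mult_ac)
  have r0: "0 < r" using F0(1) by (intro le_less_trans[OF _ r]) simp
  define A where "A = {z \<in> U. psd (hessian w z)}"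
  have A: "A \<in> sets lebesgue"
    unfolding A_def using U closure_subset by (intro psd_hessian_set_lebesgue[OF w]) auto
  have UO: "U \<subseteq> \<Omega>" using U(3) closure_subset by blast
  have AU: "A \<subseteq> closure U" using closure_subset by (auto simp: A_def)
  have K: "compact (closure U)" using U(2) by (simp add: compact_closure)
  have sub: "ball 0 r \<subseteq> grad w ` A"
  proof
    fix p :: "real^'n" assume p: "p \<in> ball 0 r"
    show "p \<in> grad w ` A"
      unfolding A_def
    proof (rule interior_min_in_grad_image[OF w U x])
      fix y assume y: "y \<in> frontier U"
      have "p \<bullet> (y - x) \<le> norm p * norm (y - x)" by (rule norm_cauchy_schwarz)
      also have "\<dots> \<le> norm p * R" using R(2)[OF x y] by (intro mult_left_mono) auto
      also have "\<dots> < r * R" using p R(1) by (intro mult_strict_right_mono) auto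
      also have "\<dots> = - w x - \<eta>" using R(1) by (simp add: r_def)
      finally show "w x - p \<bullet> x < w y - p \<bullet> y" using bd[OF y] by (simp add: inner_diff_right)
    qed
  qed
  note img = measure_grad_image[OF w K U(3) AU A]
  have hw: "continuous_on (closure U) (hessian w)"
    using continuous_on_hessian[OF w] U(3) by (rule continuous_on_subset)
  have Fc: "continuous_on (closure U) (\<lambda>z. \<bar>lma \<phi> (hessian w) z\<bar> ^ CARD('n))"
    using det_pos U(3) by (intro continuous_intros continuous_on_lma hw Ck_on_subset[OF C]) force+
  have Fi: "set_integrable lebesgue S (\<lambda>z. \<bar>lma \<phi> (hessian w) z\<bar> ^ CARD('n))"
    if "S \<subseteq> closure U" "S \<in> sets lebesgue" for S
    using set_integrable_continuous_compact[OF K Fc that] .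
  have "unit_ball_vol (real CARD('n)) * r ^ CARD('n) = measure lebesgue (ball (0 :: real^'n) r)"
    using r0 by (simp add: content_ball)
  also have "\<dots> \<le> measure lebesgue (grad w ` A)"
    by (rule measure_mono_fmeasurable[OF sub _ img(1)]) simp
  also have "\<dots> \<le> (LINT z:A|lebesgue. \<bar>det (hessian w z)\<bar>)" by (rule img(2))
  also have "\<dots> \<le> (LINT z:A|lebesgue. (1 / l ^ (CARD('n) - 1)) * \<bar>lma \<phi> (hessian w) z\<bar> ^ CARD('n))"
  proof (rule set_integral_mono[OF img(4)])
    show "set_integrable lebesgue A (\<lambda>z. (1 / l ^ (CARD('n) - 1)) * \<bar>lma \<phi> (hessian w) z\<bar> ^ CARD('n))"
      using Fi[OF AU A] by (intro set_integrable_mult_right)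
    fix z assume z: "z \<in> A"
    then have zO: "z \<in> \<Omega>" and pw: "psd (hessian w z)" using UO by (auto simp: A_def)
    have "det (hessian w z) * l ^ (CARD('n) - 1) \<le> det (hessian w z) * det (hessian \<phi> z) ^ (CARD('n) - 1)"
      using psd_trace_det_nonneg(2)[OF pw] det_ge[OF zO] l by (intro mult_left_mono power_mono) auto
    also have "\<dots> \<le> ((\<Sum>i\<in>UNIV. \<Sum>j\<in>UNIV. (det (hessian \<phi> z) *\<^sub>R matrix_inv (hessian \<phi> z)) $ i $ j * hessian w z $ i $ j) / real CARD('n)) ^ CARD('n)"
      by (rule cofactor_det_inequality[OF psd_hessian[OF zO] det_pos[OF zO] pw])
    also have "\<dots> = (lma \<phi> (hessian w) z / real CARD('n)) ^ CARD('n)"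
      by (simp add: lma_def cof_hessian_def)
    also have "\<dots> \<le> \<bar>lma \<phi> (hessian w) z / real CARD('n)\<bar> ^ CARD('n)"
      by (metis abs_ge_self power_abs)
    also have "\<dots> \<le> \<bar>lma \<phi> (hessian w) z\<bar> ^ CARD('n)"
    proof (rule power_mono)
      have "\<bar>lma \<phi> (hessian w) z\<bar> / real CARD('n) \<le> \<bar>lma \<phi> (hessian w) z\<bar> / 1"
        by (intro divide_left_mono) (auto simp: Suc_le_eq)
      then show "\<bar>lma \<phi> (hessian w) z / real CARD('n)\<bar> \<le> \<bar>lma \<phi> (hessian w) z\<bar>" by simp
    qed simp
    finally show "\<bar>det (hessian w z)\<bar> \<le> (1 / l ^ (CARD('n) - 1)) * \<bar>lma \<phi> (hessian w) z\<bar> ^ CARD('n)"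
      using psd_trace_det_nonneg(2)[OF pw] l by (simp add: pos_le_divide_eq)
  qed
  also have "\<dots> = (1 / l ^ (CARD('n) - 1)) * (LINT z:A|lebesgue. \<bar>lma \<phi> (hessian w) z\<bar> ^ CARD('n))"
    by (rule set_integral_mult_right)
  also have "\<dots> \<le> (1 / l ^ (CARD('n) - 1)) * (LINT z:U|lebesgue. \<bar>lma \<phi> (hessian w) z\<bar> ^ CARD('n))"
  proof (rule mult_left_mono)
    show "(LINT z:A|lebesgue. \<bar>lma \<phi> (hessian w) z\<bar> ^ CARD('n)) \<le> (LINT z:U|lebesgue. \<bar>lma \<phi> (hessian w) z\<bar> ^ CARD('n))"
      using Fi[OF AU A] Fi[OF closure_subset] U(1)
      unfolding set_lebesgue_integral_def set_integrable_def
      by (intro integral_mono) (auto simp: A_def indicator_def)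
  qed (use l in auto)
  also have "\<dots> \<le> (1 / l ^ (CARD('n) - 1)) * F0 ^ CARD('n)" using F0(2) l by (intro mult_left_mono) auto
  finally have "r ^ CARD('n) \<le> (1 / (l ^ (CARD('n) - 1) * unit_ball_vol (real CARD('n)))) * F0 ^ CARD('n)"
    using l unit_ball_vol_pos[of "real CARD('n)"] by (simp add: pos_le_divide_eq field_simps)
  also have "\<dots> \<le> ?K * F0 ^ CARD('n)" using F0(1) by (intro mult_right_mono) auto
  \<comment> \<open>The maximum with 1 in \<open>?K\<close> makes
    \<open>?K \<le> ?K ^ CARD('n)\<close>, so no \<open>n\<close>-th root of the constant has to be
    taken.\<close>
  also have "\<dots> \<le> ?K ^ CARD('n) * F0 ^ CARD('n)"
    using F0(1) self_le_power[of ?K "CARD('n)"] by (intro mult_right_mono) (simp_all only: zero_le_power max.cobounded1 zero_less_card_finite)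
  also have "\<dots> = (?K * F0) ^ CARD('n)" by (simp add: power_mult_distrib)
  finally have "r \<le> ?K * F0"
    using r0 F0(1) by (intro power_mono_iff[THEN iffD1, of r "?K * F0" "CARD('n)"]) auto
  then show False using r by simp
qed

text \<open>\<open>\<phi>\<close> has injective gradient, so the image of \<open>D\<close> has
  volume exactly the integral of \<open>det D^2\<phi>\<close>. This image is covered by the image of
  the contact set \<open>A\<close> under \<open>grad v\<close>, for which the upper bound suffices.
  Since \<open>det D^2v\<close> exceeds \<open>det D^2\<phi>\<close> on \<open>A\<close> by a small
  term only, the integrals over \<open>D\<close> and \<open>A\<close> can be subtracted.\<close>

lemma contact_set_measure:
  assumes w: "Ck_on 2 \<Omega> w" and U: "open U" "bounded U" "closure U \<subseteq> \<Omega>"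
    and bd: "\<And>z. z \<in> closure U \<Longrightarrow> \<bar>w z\<bar> \<le> m"
    and D: "D \<in> sets lebesgue" "D \<subseteq> U"
    and T: "2 \<le> T" and F0: "0 < F0" "(LINT z:U|lebesgue. \<bar>lma \<phi> (hessian w) z\<bar> ^ CARD('n)) \<le> F0 ^ CARD('n)"
    and M: "M = T * F0"
    and height: "\<And>x y. x \<in> D \<Longrightarrow> y \<in> frontier U \<Longrightarrow> 2 * m / M < \<phi> y - \<phi> x - grad \<phi> x \<bullet> (y - x)"
  shows "l * measure lebesgue (D - {z \<in> U. psd (hessian \<phi> z + (1 / M) *\<^sub>R hessian w z)})
     \<le> L * measure lebesgue (U - D) + (2 ^ CARD('n) * L * measure lebesgue U + 1 / l ^ (CARD('n) - 1)) / T"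
proof (cases "U = {}")
  case True
  then show ?thesis using D T l by simp
next
  case False
  have M0: "0 < M" using M T F0(1) by simp
  define v where "v z = \<phi> z + (1 / M) * w z" for z
  note v = Ck_on_2_add_scaled[OF C w op, where c = "1 / M", folded v_def]
  define A where "A = {z \<in> U. psd (hessian v z)}"
  have UO: "U \<subseteq> \<Omega>" using U(3) closure_subset by blast
  have Aeq: "A = {z \<in> U. psd (hessian \<phi> z + (1 / M) *\<^sub>R hessian w z)}"
    unfolding A_def using v(3) UO by auto
  have A: "A \<in> sets lebesgue"
    unfolding A_def by (rule psd_hessian_set_lebesgue[OF v(1) U(1) UO])
  have AU: "A \<subseteq> closure U" using closure_subset by (auto simp: A_def)
  have DU: "D \<subseteq> closure U" using D(2) closure_subset by blast
  have K: "compact (closure U)" using U(2) by (simp add: compact_closure)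
  have Ul: "U \<in> lmeasurable" using U(1,2) by (simp add: lmeasurable_open)
  have sub: "grad \<phi> ` D \<subseteq> grad v ` A"
  proof
    fix p assume "p \<in> grad \<phi> ` D"
    then obtain x where x: "x \<in> D" and p: "p = grad \<phi> x" by blast
    show "p \<in> grad v ` A"
      unfolding A_def
    proof (rule interior_min_in_grad_image[OF v(1) U])
      show "x \<in> U" using x D(2) by blast
      fix y assume y: "y \<in> frontier U"
      have "w x \<le> m" "- m \<le> w y"
        using bd[of x] bd[of y] x DU y by (auto simp: frontier_def)
      then have "w x - w y \<le> 2 * m" by linarith
      then have "(1 / M) * w x - (1 / M) * w y \<le> 2 * m / M"
        using M0 by (simp add: divide_right_mono flip: diff_divide_distrib)
      then show "v x - p \<bullet> x < v y - p \<bullet> y"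
        using height[OF x y] by (simp add: v_def p inner_diff_right)
    qed
  qed
  note img\<phi> = measure_grad_image[OF C K U(3) DU D(1)] and imgv = measure_grad_image[OF v(1) K U(3) AU A]
  let ?g = "\<lambda>z. det (hessian \<phi> z)" and ?F = "\<lambda>z. \<bar>lma \<phi> (hessian w) z\<bar> ^ CARD('n)"
  have hw: "continuous_on (closure U) (hessian w)" and h\<phi>: "continuous_on (closure U) (hessian \<phi>)"
    using continuous_on_hessian[OF w] continuous_on_hessian[OF C] U(3) by (auto intro: continuous_on_subset)
  have gi: "set_integrable lebesgue S ?g" if "S \<subseteq> closure U" "S \<in> sets lebesgue" for S
    by (rule set_integrable_continuous_compact[OF K _ that]) (intro continuous_on_det continuous_intros h\<phi>)
  have Fc: "continuous_on (closure U) ?F"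
    using det_pos U(3) by (intro continuous_intros continuous_on_lma hw Ck_on_subset[OF C]) force+
  have Fi: "set_integrable lebesgue S ?F" if "S \<subseteq> closure U" "S \<in> sets lebesgue" for S
    using set_integrable_continuous_compact[OF K Fc that] .
  \<comment> \<open>This weight balances the two errors: \<open>\<theta> * 2 ^ CARD('n) * L\<close>
    per unit volume from the main term, and \<open>cF * F0 ^ CARD('n)\<close>, where
    \<open>M = T * F0\<close> cancels \<open>F0\<close>. Both are of order
    \<open>1 / T\<close>.\<close>
  define \<theta> where "\<theta> = 1 / T"
  have \<theta>: "0 < \<theta>" "\<theta> \<le> 1 / 2" using T by (auto simp: \<theta>_def field_simps)
  define cF where "cF = 1 / (\<theta> ^ (CARD('n) - 1) * M ^ CARD('n) * l ^ (CARD('n) - 1))"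
  obtain x0 where "x0 \<in> U" using False by blast
  then have L: "0 < L" using UO L_pos by blast
  have inj: "inj_on (grad \<phi>) D"
    using grad_inj by (rule inj_on_subset) (use D(2) UO in blast)
  have absg: "(LINT z:D|lebesgue. \<bar>?g z\<bar>) = (LINT z:D|lebesgue. ?g z)"
    by (rule set_lebesgue_integral_cong[OF D(1)]) (use det_pos D(2) UO in \<open>auto simp: less_imp_le\<close>)
  have point: "\<bar>det (hessian v z)\<bar> \<le> ?g z + \<theta> * 2 ^ CARD('n) * L + cF * ?F z" if z: "z \<in> A" for z
  proof -
    have zO: "z \<in> \<Omega>" and pv: "psd (hessian v z)" using z UO by (auto simp: A_def)
    let ?a = "\<bar>(1 / M) * lma \<phi> (hessian w) z\<bar>"
    have g: "0 < ?g z" by (rule det_pos[OF zO])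
    have "det (hessian v z) * ?g z ^ (CARD('n) - 1) \<le> (?g z + ?a) ^ CARD('n)"
      using det_le_lma[OF zO, of "1 / M" w] pv unfolding v(3)[OF zO] by blast
    also have "\<dots> \<le> ?g z ^ CARD('n) / (1 - \<theta>) ^ (CARD('n) - 1) + ?a ^ CARD('n) / \<theta> ^ (CARD('n) - 1)"
      using g \<theta> by (intro power_add_le_weighted) auto
    finally have "det (hessian v z) \<le> (?g z ^ CARD('n) / (1 - \<theta>) ^ (CARD('n) - 1) + ?a ^ CARD('n) / \<theta> ^ (CARD('n) - 1)) / ?g z ^ (CARD('n) - 1)"
      using g by (simp add: pos_le_divide_eq)
    also have "\<dots> = ?g z * (1 / (1 - \<theta>) ^ (CARD('n) - 1)) + ?a ^ CARD('n) / \<theta> ^ (CARD('n) - 1) / ?g z ^ (CARD('n) - 1)"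
    proof -
      have "?g z ^ CARD('n) = ?g z * ?g z ^ (CARD('n) - 1)" by (simp flip: power_Suc)
      then show ?thesis using g by (simp add: add_divide_distrib)
    qed
    also have "\<dots> \<le> ?g z * (1 + \<theta> * 2 ^ CARD('n)) + cF * ?F z"
    proof (rule add_mono)
      have "1 / (1 - \<theta>) ^ (CARD('n) - 1) \<le> 1 + \<theta> * 2 ^ (CARD('n) - 1 + 1)"
        using \<theta> by (intro inverse_one_minus_power_le) auto
      then show "?g z * (1 / (1 - \<theta>) ^ (CARD('n) - 1)) \<le> ?g z * (1 + \<theta> * 2 ^ CARD('n))"
        using g by (intro mult_left_mono) auto
      have "?a ^ CARD('n) / \<theta> ^ (CARD('n) - 1) / ?g z ^ (CARD('n) - 1) \<le> ?a ^ CARD('n) / \<theta> ^ (CARD('n) - 1) / l ^ (CARD('n) - 1)"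
        using l g det_ge[OF zO] \<theta> by (intro divide_left_mono power_mono mult_pos_pos) auto
      also have "\<dots> = cF * ?F z"
        using M0 by (simp add: cF_def abs_mult power_mult_distrib power_divide)
      finally show "?a ^ CARD('n) / \<theta> ^ (CARD('n) - 1) / ?g z ^ (CARD('n) - 1) \<le> cF * ?F z" .
    qed
    also have "?g z * (1 + \<theta> * 2 ^ CARD('n)) \<le> ?g z + \<theta> * 2 ^ CARD('n) * L"
      using det_le[OF zO] \<theta> by (simp add: distrib_left mult.commute[of "?g z"] mult_left_mono)
    finally show ?thesis using psd_trace_det_nonneg(2)[OF pv] by simp
  qed
  have ci: "set_integrable lebesgue A (\<lambda>z. \<theta> * 2 ^ CARD('n) * L)"
    by (rule set_integrable_continuous_compact[OF K _ AU A]) (rule continuous_on_const)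
  have rhs_i: "set_integrable lebesgue A (\<lambda>z. ?g z + \<theta> * 2 ^ CARD('n) * L + cF * ?F z)"
    by (rule set_integral_add(1)[OF set_integral_add(1)[OF gi[OF AU A] ci] set_integrable_mult_right[OF Fi[OF AU A]]])
  have Afin: "emeasure lebesgue A \<noteq> \<infinity>"
    using fmeasurableI2[OF Ul _ A] by (auto simp: A_def fmeasurable_def)
  have mAU: "measure lebesgue A \<le> measure lebesgue U"
    by (rule measure_mono_fmeasurable[OF _ A Ul]) (auto simp: A_def)
  have "(LINT z:D|lebesgue. ?g z) = measure lebesgue (grad \<phi> ` D)"
    using img\<phi>(3)[OF inj] absg by simp
  also have "\<dots> \<le> measure lebesgue (grad v ` A)"
    by (rule measure_mono_fmeasurable[OF sub _ imgv(1)]) (use img\<phi>(1) in auto)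
  also have "\<dots> \<le> (LINT z:A|lebesgue. \<bar>det (hessian v z)\<bar>)" by (rule imgv(2))
  also have "\<dots> \<le> (LINT z:A|lebesgue. ?g z + \<theta> * 2 ^ CARD('n) * L + cF * ?F z)"
    by (rule set_integral_mono[OF imgv(4) rhs_i point])
  also have "\<dots> = (LINT z:A|lebesgue. ?g z) + measure lebesgue A * (\<theta> * 2 ^ CARD('n) * L) + cF * (LINT z:A|lebesgue. ?F z)"
    using set_integral_add(2)[OF set_integral_add(1)[OF gi[OF AU A] ci] set_integrable_mult_right[OF Fi[OF AU A]], of cF]
      set_integral_add(2)[OF gi[OF AU A] ci] set_integral_const[OF A Afin, of "\<theta> * 2 ^ CARD('n) * L"]
    by (simp only: set_integral_mult_right real_scaleR_def)
  also have "\<dots> \<le> (LINT z:A|lebesgue. ?g z) + measure lebesgue U * (\<theta> * 2 ^ CARD('n) * L) + cF * F0 ^ CARD('n)"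
  proof -
    have "(LINT z:A|lebesgue. ?F z) \<le> (LINT z:U|lebesgue. ?F z)"
      using Fi[OF AU A] Fi[OF closure_subset] U(1)
      unfolding set_lebesgue_integral_def set_integrable_def
      by (intro integral_mono) (auto simp: A_def indicator_def)
    then have "cF * (LINT z:A|lebesgue. ?F z) \<le> cF * F0 ^ CARD('n)"
      using F0(2) \<theta> M0 l by (intro mult_left_mono) (auto simp: cF_def)
    moreover have "measure lebesgue A * (\<theta> * 2 ^ CARD('n) * L) \<le> measure lebesgue U * (\<theta> * 2 ^ CARD('n) * L)"
      using mAU \<theta> L by (intro mult_right_mono) auto
    ultimately show ?thesis by linarith
  qed
  also have "cF * F0 ^ CARD('n) = (1 / l ^ (CARD('n) - 1)) / T"
  proof -
    have "M ^ CARD('n) = T * T ^ (CARD('n) - 1) * F0 ^ CARD('n)"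
      by (simp add: M power_mult_distrib flip: power_Suc)
    then show ?thesis using T F0(1) by (simp add: cF_def \<theta>_def power_divide)
  qed
  also have "(LINT z:A|lebesgue. ?g z) + measure lebesgue U * (\<theta> * 2 ^ CARD('n) * L) + (1 / l ^ (CARD('n) - 1)) / T
      = (LINT z:A|lebesgue. ?g z) + (2 ^ CARD('n) * L * measure lebesgue U + 1 / l ^ (CARD('n) - 1)) / T"
    by (simp add: \<theta>_def add_divide_distrib)
  finally have main: "(LINT z:D|lebesgue. ?g z)
      \<le> (LINT z:A|lebesgue. ?g z) + (2 ^ CARD('n) * L * measure lebesgue U + 1 / l ^ (CARD('n) - 1)) / T" .
  have spl: "(LINT z:S|lebesgue. ?g z) = (LINT z:S \<inter> V|lebesgue. ?g z) + (LINT z:S - V|lebesgue. ?g z)"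
    if "S \<subseteq> closure U" "S \<in> sets lebesgue" "V \<in> sets lebesgue" for S V
  proof -
    have "S = (S \<inter> V) \<union> (S - V)" by blast
    then have "(LINT z:S|lebesgue. ?g z) = (LINT z:(S \<inter> V) \<union> (S - V)|lebesgue. ?g z)" by simp
    also have "\<dots> = (LINT z:S \<inter> V|lebesgue. ?g z) + (LINT z:S - V|lebesgue. ?g z)"
      using that by (intro set_integral_Un gi) auto
    finally show ?thesis .
  qed
  have fin: "emeasure lebesgue S \<noteq> \<infinity>" if "S \<subseteq> U" "S \<in> sets lebesgue" for S
    using fmeasurableI2[OF Ul that] by (auto simp: fmeasurable_def)
  have ADU: "A - D \<subseteq> closure U" "D - A \<subseteq> closure U" using AU DU by auto
  \<comment> \<open>The integrals over \<open>D \<inter> A\<close> cancel in \<open>main\<close>. On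
    the differences the determinant is bounded below by \<open>l\<close> and above by
    \<open>L\<close>.\<close>
  have "l * measure lebesgue (D - A) = (LINT z:D - A|lebesgue. l)"
    using fin[of "D - A"] D A by (simp add: set_integral_const subset_iff)
  also have "\<dots> \<le> (LINT z:D - A|lebesgue. ?g z)"
  proof (rule set_integral_mono)
    show "set_integrable lebesgue (D - A) (\<lambda>z. l)"
      by (rule set_integrable_continuous_compact[OF K continuous_on_const ADU(2)]) (use D A in auto)
    show "set_integrable lebesgue (D - A) ?g" using gi[OF ADU(2)] D A by auto
  qed (use det_ge D(2) UO in auto)
  also have "\<dots> \<le> (LINT z:A - D|lebesgue. ?g z) + (2 ^ CARD('n) * L * measure lebesgue U + 1 / l ^ (CARD('n) - 1)) / T"
    using main spl[OF DU D(1) A] spl[OF AU A D(1)] by (simp add: Int_commute)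
  also have "(LINT z:A - D|lebesgue. ?g z) \<le> (LINT z:A - D|lebesgue. L)"
  proof (rule set_integral_mono)
    show "set_integrable lebesgue (A - D) (\<lambda>z. L)"
      by (rule set_integrable_continuous_compact[OF K continuous_on_const ADU(1)]) (use D A in auto)
    show "set_integrable lebesgue (A - D) ?g" using gi[OF ADU(1)] D A by auto
  qed (use det_le UO in \<open>auto simp: A_def\<close>)
  also have "\<dots> = L * measure lebesgue (A - D)"
    using fin[of "A - D"] D A by (simp add: set_integral_const A_def subset_iff)
  also have "\<dots> \<le> L * measure lebesgue (U - D)"
    using L A D(1) Ul by (intro mult_left_mono measure_mono_fmeasurable) (auto simp: A_def intro: fmeasurable_Diff)
  finally show ?thesis unfolding Aeq by simp
qed

end

section \<open>Distance to the boundary\<close>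

text \<open>The strict inequality makes the set open. The distance to an empty set is 0 by
  convention, so for \<open>\<Omega> = UNIV\<close> and \<open>\<delta> \<ge> 0\<close> the set is
  empty; hence the conditions \<open>\<Omega> \<noteq> UNIV\<close> below.\<close>

definition inner_part :: "'a::metric_space set \<Rightarrow> real \<Rightarrow> 'a set" where
  "inner_part \<Omega> \<delta> = {x. \<delta> < infdist x (- \<Omega>)}"

lemma open_inner_part: "open (inner_part \<Omega> \<delta>)"
  unfolding inner_part_def by (intro open_Collect_less continuous_intros)

lemma ball_subset_of_inner_part:
  assumes "x \<in> inner_part \<Omega> \<delta>" shows "ball x \<delta> \<subseteq> \<Omega>"
proof
  fix y assume y: "y \<in> ball x \<delta>"
  show "y \<in> \<Omega>"
  proof (rule ccontr)
    assume "y \<notin> \<Omega>"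
    then have "infdist x (- \<Omega>) \<le> dist x y" by (intro infdist_le) simp
    then show False using assms y by (simp add: inner_part_def)
  qed
qed

lemma inner_part_subset: "0 \<le> \<delta> \<Longrightarrow> inner_part \<Omega> \<delta> \<subseteq> \<Omega>"
proof
  fix x assume "0 \<le> \<delta>" "x \<in> inner_part \<Omega> \<delta>"
  then have "infdist x (- \<Omega>) \<noteq> 0" by (simp add: inner_part_def)
  then show "x \<in> \<Omega>" using infdist_zero[of x "- \<Omega>"] by blast
qed

lemma inner_part_lebesgue: "inner_part (\<Omega> :: 'a::euclidean_space set) \<delta> \<in> sets lebesgue"
  by (intro sets_completionI_sets) (simp add: open_inner_part)

lemma inner_part_mono: "\<delta> \<le> \<delta>' \<Longrightarrow> inner_part \<Omega> \<delta>' \<subseteq> inner_part \<Omega> \<delta>"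
  by (auto simp: inner_part_def)

lemma closure_inner_part: "closure (inner_part \<Omega> \<delta>) \<subseteq> {x. \<delta> \<le> infdist x (- \<Omega>)}"
  by (rule closure_minimal) (auto simp: inner_part_def intro!: closed_Collect_le continuous_intros)

lemma closure_inner_part_subset: "\<sigma> < \<delta> \<Longrightarrow> closure (inner_part \<Omega> \<delta>) \<subseteq> inner_part \<Omega> \<sigma>"
  using closure_inner_part[of \<Omega> \<delta>] by (force simp: inner_part_def)

lemma frontier_inner_part:
  assumes "x \<in> frontier (inner_part \<Omega> \<delta>)" shows "infdist x (- \<Omega>) = \<delta>"
proof (rule antisym)
  show "\<delta> \<le> infdist x (- \<Omega>)"
    using assms closure_inner_part by (force simp: frontier_def)
  show "infdist x (- \<Omega>) \<le> \<delta>"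
    using assms by (simp add: frontier_def interior_open[OF open_inner_part]) (simp add: inner_part_def)
qed

lemma le_infdist_compl:
  assumes "ball x r \<subseteq> \<Omega>" "\<Omega> \<noteq> UNIV" shows "r \<le> infdist x (- \<Omega>)"
proof -
  have "- \<Omega> \<noteq> {}" using assms(2) by auto
  moreover have "r \<le> dist x y" if "y \<in> - \<Omega>" for y
    using that assms(1) by (auto simp: subset_iff not_less[symmetric])
  ultimately show ?thesis unfolding infdist_def by (simp only: if_False) (rule cINF_greatest)
qed

lemma nearest_frontier_point:
  fixes \<Omega> :: "'a::euclidean_space set"
  assumes "open \<Omega>" "\<Omega> \<noteq> UNIV" and x: "0 < infdist x (- \<Omega>)"
  obtains y where "y \<in> frontier \<Omega>" "dist x y = infdist x (- \<Omega>)"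
proof -
  have "closed (- \<Omega>)" "- \<Omega> \<noteq> {}" using assms by auto
  then obtain y where y: "y \<in> - \<Omega>" "infdist x (- \<Omega>) = dist x y"
    using infdist_attains_inf by blast
  have b: "ball x (dist x y) \<subseteq> \<Omega>"
  proof
    fix z assume "z \<in> ball x (dist x y)"
    show "z \<in> \<Omega>"
    proof (rule ccontr)
      assume "z \<notin> \<Omega>"
      then have "infdist x (- \<Omega>) \<le> dist x z" by (intro infdist_le) simp
      then show False using \<open>z \<in> ball x (dist x y)\<close> y(2) by simp
    qed
  qed
  have "y \<in> closure (ball x (dist x y))" using x y(2) by simp
  then have "y \<in> closure \<Omega>" using closure_mono[OF b] by blast
  then have "y \<in> frontier \<Omega>" using y(1) assms(1) by (simp add: frontier_def interior_open)
  then show thesis using that y(2) by simp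
qed

text \<open>Contract \<open>\<Omega>\<close> towards the centre of the inscribed ball by the factor
  \<open>1 - s\<close>. By convexity the image keeps distance \<open>s * \<rho>\<close> from the
  complement, and its volume is at least \<open>1 - s * CARD('n)\<close> times that of
  \<open>\<Omega>\<close> by Bernoulli's inequality.\<close>

lemma measure_boundary_layer_le:
  fixes \<Omega> :: "(real^'n::finite) set"
  assumes dom: "bounded_convex_domain \<Omega>" and \<rho>: "0 < \<rho>" and z: "ball z \<rho> \<subseteq> \<Omega>" and \<delta>: "0 < \<delta>"
  shows "measure lebesgue (\<Omega> - inner_part \<Omega> \<delta>) \<le> 2 * real CARD('n) * \<delta> / \<rho> * measure lebesgue \<Omega>"
proof -
  have op: "open \<Omega>" and conv: "convex \<Omega>" and bd: "bounded \<Omega>"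
    using dom by (auto simp: bounded_convex_domain_def)
  have m: "\<Omega> \<in> lmeasurable" using op bd by (simp add: lmeasurable_open)
  have mi: "inner_part \<Omega> \<delta> \<in> lmeasurable"
    by (rule fmeasurableI2[OF m _ inner_part_lebesgue]) (use \<delta> inner_part_subset[of \<delta> \<Omega>] in auto)
  have nU: "\<Omega> \<noteq> UNIV" using bd by (metis not_bounded_UNIV)
  have diff: "measure lebesgue (\<Omega> - inner_part \<Omega> \<delta>) = measure lebesgue \<Omega> - measure lebesgue (inner_part \<Omega> \<delta>)"
    by (rule measurable_measure_Diff[OF m]) (use mi \<delta> inner_part_subset[of \<delta> \<Omega>] in auto)
  \<comment> \<open>The factor 2 gives distance \<open>2 * \<delta>\<close>, hence the strict
    inequality in \<open>inner_part\<close>.\<close>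
  define s where "s = 2 * \<delta> / \<rho>"
  have s0: "0 < s" using \<delta> \<rho> by (simp add: s_def)
  show ?thesis
  proof (cases "s \<le> 1")
    case False
    have "1 \<le> real CARD('n)" by (simp add: Suc_le_eq)
    then have "1 * 1 \<le> real CARD('n) * s" using False by (intro mult_mono) auto
    then have "measure lebesgue \<Omega> * 1 \<le> measure lebesgue \<Omega> * (real CARD('n) * s)" by (intro mult_left_mono) auto
    then have "measure lebesgue \<Omega> \<le> 2 * real CARD('n) * \<delta> / \<rho> * measure lebesgue \<Omega>"
      by (simp add: s_def mult_ac)
    then show ?thesis unfolding diff using measure_nonneg[of lebesgue "inner_part \<Omega> \<delta>"] by linarith
  next
    case True
    define f where "f x = (1 - s) *\<^sub>R x + s *\<^sub>R z" for x
    have sub: "f ` \<Omega> \<subseteq> inner_part \<Omega> \<delta>"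
    proof
      fix y assume "y \<in> f ` \<Omega>"
      then obtain x where x: "x \<in> \<Omega>" and y: "y = f x" by blast
      have "ball y (2 * \<delta>) \<subseteq> \<Omega>"
      proof
        fix v assume "v \<in> ball y (2 * \<delta>)"
        then have "norm (v - y) < \<rho> * s"
          using \<rho> by (simp add: dist_norm norm_minus_commute s_def)
        then have "norm ((1 / s) *\<^sub>R (v - y)) < \<rho>"
          using s0 by (simp add: pos_divide_less_eq)
        then have "z + (1 / s) *\<^sub>R (v - y) \<in> \<Omega>" using z by (auto simp: dist_norm subset_iff)
        then have "(1 - s) *\<^sub>R x + s *\<^sub>R (z + (1 / s) *\<^sub>R (v - y)) \<in> \<Omega>"
          using convexD_alt[OF conv x] s0 True by auto
        \<comment> \<open>Every point within \<open>2 * \<delta>\<close> of \<open>f x\<close> is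
          the same convex combination of \<open>x\<close> and some point of the inscribed
          ball.\<close>
        moreover have "(1 - s) *\<^sub>R x + s *\<^sub>R (z + (1 / s) *\<^sub>R (v - y)) = v"
          using s0 by (simp add: y f_def algebra_simps)
        ultimately show "v \<in> \<Omega>" by simp
      qed
      from le_infdist_compl[OF this nU] show "y \<in> inner_part \<Omega> \<delta>"
        using \<delta> by (simp add: inner_part_def)
    qed
    have "(1 - s) ^ CARD('n) * measure lebesgue \<Omega> = measure lebesgue (f ` \<Omega>)"
      using measure_lebesgue_affine[of "1 - s" "s *\<^sub>R z" \<Omega>] True by (simp add: f_def[abs_def])
    also have "\<dots> \<le> measure lebesgue (inner_part \<Omega> \<delta>)"
    proof (rule measure_mono_fmeasurable[OF sub _ mi])
      show "f ` \<Omega> \<in> sets lebesgue"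
      proof (rule differentiable_image_in_sets_lebesgue)
        show "f differentiable_on \<Omega>" unfolding f_def[abs_def] differentiable_on_def by (auto intro!: derivative_intros)
      qed (use op in auto)
    qed
    finally have "(1 - s) ^ CARD('n) * measure lebesgue \<Omega> \<le> measure lebesgue (inner_part \<Omega> \<delta>)" .
    moreover have "1 - real CARD('n) * s \<le> (1 - s) ^ CARD('n)"
      using Bernoulli_inequality[of "- s" "CARD('n)"] True by simp
    then have "(1 - real CARD('n) * s) * measure lebesgue \<Omega> \<le> (1 - s) ^ CARD('n) * measure lebesgue \<Omega>"
      by (intro mult_right_mono) auto
    ultimately have "(1 - real CARD('n) * s) * measure lebesgue \<Omega> \<le> measure lebesgue (inner_part \<Omega> \<delta>)"
      by linarith
    then show ?thesis unfolding diff by (simp add: s_def algebra_simps)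
  qed
qed

section \<open>Gradient bound and integral of the trace of the Hessian\<close>

context potential
begin

lemma grad_monotone:
  assumes "x \<in> \<Omega>" "y \<in> \<Omega>" shows "0 \<le> (grad \<phi> x - grad \<phi> y) \<bullet> (x - y)"
proof -
  have "\<phi> x + grad \<phi> x \<bullet> (y - x) \<le> \<phi> y" "\<phi> y + grad \<phi> y \<bullet> (x - y) \<le> \<phi> x"
    using assms C by (auto intro!: convex_on_above_tangent[OF convex] simp: Ck_on_2_iff)
  then show ?thesis by (simp add: inner_diff_left inner_diff_right)
qed

text \<open>Along its gradient the normalised potential rises at least linearly over any distance
  shorter than \<open>\<delta>\<close>, while its values stay between 0 and
  \<open>C0\<close>.\<close>

lemma grad_bound:
  assumes bnd: "\<And>z. z \<in> \<Omega> \<Longrightarrow> 0 \<le> \<phi> z - a - s \<bullet> z \<and> \<phi> z - a - s \<bullet> z \<le> C0"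
    and x: "x \<in> inner_part \<Omega> \<delta>" and \<delta>: "0 < \<delta>"
  shows "\<delta> * norm (grad \<phi> x - s) \<le> C0"
proof -
  have xO: "x \<in> \<Omega>" using x \<delta> inner_part_subset[of \<delta> \<Omega>] by auto
  let ?g = "grad \<phi> x - s"
  show ?thesis
  proof (cases "?g = 0")
    case True
    then show ?thesis using bnd[OF xO] by simp
  next
    case False
    have "r * norm ?g \<le> C0" if r: "0 < r" "r < \<delta>" for r
    proof -
      define h where "h = (r / norm ?g) *\<^sub>R ?g"
      have "norm h = r" using r False by (simp add: h_def)
      then have "x + h \<in> ball x \<delta>" using r by (simp add: dist_norm)
      then have y: "x + h \<in> \<Omega>" using ball_subset_of_inner_part[OF x] by blast
      have "\<phi> x + grad \<phi> x \<bullet> h \<le> \<phi> (x + h)"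
        using convex_on_above_tangent[OF convex xO y] C xO by (simp add: Ck_on_2_iff)
      then have "?g \<bullet> h \<le> C0"
        using bnd[OF xO] bnd[OF y] by (simp add: inner_add_right inner_diff_left)
      moreover have "?g \<bullet> h = r * norm ?g"
        using False by (simp add: h_def power2_eq_square flip: power2_norm_eq_inner)
      ultimately show ?thesis by simp
    qed
    then have "r \<le> C0 / norm ?g" if "0 < r" "r < \<delta>" for r
      using that False by (simp add: pos_le_divide_eq)
    then have "\<delta> \<le> C0 / norm ?g" by (rule dense_le_bounded[OF \<delta>])
    then show ?thesis using False by (simp add: pos_le_divide_eq)
  qed
qed

text \<open>The gradient of \<open>|x|\<^sup>2/2 + \<delta> (\<phi> - s \<bullet> x)\<close> is injective with a bounded image, whose volume
  dominates the integral of \<open>\<delta> \<Delta>\<phi>\<close>.\<close>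

lemma integral_trace_hessian_le:
  assumes bnd: "\<And>z. z \<in> \<Omega> \<Longrightarrow> 0 \<le> \<phi> z - a - s \<bullet> z \<and> \<phi> z - a - s \<bullet> z \<le> C0"
    and R: "\<Omega> \<subseteq> cball 0 R" and \<delta>: "0 < \<delta>" and D: "D = inner_part \<Omega> \<delta>"
  shows "set_integrable lebesgue D (\<lambda>x. trace (hessian \<phi> x))"
    and "\<delta> * (LINT x:D|lebesgue. trace (hessian \<phi> x)) \<le> measure lebesgue (cball (0 :: real^'n) (R + C0))"
proof -
  define K where "K = closure D"
  have KO: "K \<subseteq> \<Omega>"
    using closure_inner_part_subset[of 0 \<delta> \<Omega>] \<delta> inner_part_subset[of 0 \<Omega>] by (auto simp: K_def D)
  have DO: "D \<subseteq> \<Omega>" using \<delta> inner_part_subset[of \<delta> \<Omega>] by (simp add: D)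
  have DK: "D \<subseteq> K" by (simp add: K_def closure_subset)
  have Dm: "D \<in> sets lebesgue" unfolding D by (rule inner_part_lebesgue)
  have "bounded \<Omega>" using R bounded_subset bounded_cball by blast
  then have K: "compact K" using DO bounded_subset by (auto simp: K_def compact_closure)
  have h: "continuous_on K (hessian \<phi>)"
    using continuous_on_hessian[OF C] KO by (rule continuous_on_subset)
  have ti: "set_integrable lebesgue D (\<lambda>x. trace (hessian \<phi> x))"
    by (rule set_integrable_continuous_compact[OF K _ DK Dm]) (unfold trace_def, intro continuous_intros h)
  then show "set_integrable lebesgue D (\<lambda>x. trace (hessian \<phi> x))" .
  define G where "G x = x + \<delta> *\<^sub>R (grad \<phi> x - s)" for x
  define G' where "G' x v = v + \<delta> *\<^sub>R (hessian \<phi> x *v v)" for x v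
  have sym: "transpose (hessian \<phi> x) = hessian \<phi> x" if "x \<in> \<Omega>" for x
    by (rule hessian_symmetric[OF C op that])
  have dG: "(G has_derivative G' x) (at x)" if "x \<in> D" for x
    unfolding G_def G'_def using has_derivative_grad2[OF C, of x] that DO sym[of x]
    by (auto intro!: derivative_eq_intros simp: subset_iff simp del: transpose_matrix_vector)
  have mG: "matrix (G' x) = mat 1 + \<delta> *\<^sub>R hessian \<phi> x" for x
  proof -
    have "G' x = (\<lambda>v. (mat 1 + \<delta> *\<^sub>R hessian \<phi> x) *v v)"
      by (simp add: G'_def fun_eq_iff matrix_vector_mult_add_rdistrib scaleR_matrix_vector_assoc)
    then show ?thesis by (simp add: matrix_of_matrix_vector_mul)
  qed
  have det_ge1: "1 + \<delta> * trace (hessian \<phi> x) \<le> \<bar>det (matrix (G' x))\<bar>" if "x \<in> D" for x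
    using det_id_add_psd_ge[OF psd_hessian, of x \<delta>] \<delta> that DO unfolding mG by force
  have ai: "set_integrable lebesgue D (\<lambda>x. \<bar>det (matrix (G' x))\<bar>)"
    by (rule set_integrable_continuous_compact[OF K _ DK Dm])
      (unfold mG, intro continuous_intros continuous_on_det h)
  have inj: "inj_on G D"
  proof (rule inj_onI)
    fix x y assume xy: "x \<in> D" "y \<in> D" "G x = G y"
    \<comment> \<open>Monotonicity of the gradient of a convex function makes \<open>G\<close>
      expansive.\<close>
    have "(G x - G y) \<bullet> (x - y) = (x - y) \<bullet> (x - y) + \<delta> * ((grad \<phi> x - grad \<phi> y) \<bullet> (x - y))"
      by (simp add: G_def algebra_simps inner_diff_left inner_add_left)
    moreover have "0 \<le> \<delta> * ((grad \<phi> x - grad \<phi> y) \<bullet> (x - y))"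
      using \<delta> grad_monotone[of x y] xy DO by (intro mult_nonneg_nonneg) auto
    ultimately have "(x - y) \<bullet> (x - y) \<le> 0" using xy(3) by simp
    then have "x - y = 0" using inner_gt_zero_iff[of "x - y"] by linarith
    then show "x = y" by simp
  qed
  \<comment> \<open>The factor \<open>\<delta>\<close> in \<open>G\<close> exactly offsets the
    growth \<open>C0 / \<delta>\<close> of the gradient, so the radius does not depend on
    \<open>\<delta>\<close>.\<close>
  have "G ` D \<subseteq> cball 0 (R + C0)"
  proof
    fix y assume "y \<in> G ` D"
    then obtain x where x: "x \<in> D" "y = G x" by blast
    have "norm (G x) \<le> norm x + \<delta> * norm (grad \<phi> x - s)"
      using norm_triangle_ineq[of x "\<delta> *\<^sub>R (grad \<phi> x - s)"] \<delta> by (simp add: G_def)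
    moreover have "norm x \<le> R" using x DO R by auto
    moreover have "\<delta> * norm (grad \<phi> x - s) \<le> C0" using grad_bound[OF bnd _ \<delta>] x D by blast
    ultimately show "y \<in> cball 0 (R + C0)" using x by simp
  qed
  then have "measure lebesgue (G ` D) \<le> measure lebesgue (cball (0 :: real^'n) (R + C0))"
    using lmeasurable_gradient_image[OF Dm dG ai] by (intro measure_mono_fmeasurable) auto
  moreover have "(LINT x:D|lebesgue. \<delta> * trace (hessian \<phi> x)) \<le> (LINT x:D|lebesgue. \<bar>det (matrix (G' x))\<bar>)"
  proof (rule set_integral_mono[OF set_integrable_mult_right[OF ti] ai])
    fix x assume "x \<in> D"
    then show "\<delta> * trace (hessian \<phi> x) \<le> \<bar>det (matrix (G' x))\<bar>" using det_ge1 by force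
  qed
  ultimately show "\<delta> * (LINT x:D|lebesgue. trace (hessian \<phi> x)) \<le> measure lebesgue (cball (0 :: real^'n) (R + C0))"
    using measure_gradient_image_eq[OF Dm dG ai inj] by simp
qed

end

section \<open>Mollification\<close>

text \<open>The derivative is quantified rather than named, so that in inductions the sum, product
  and chain rules supply it directly.\<close>

primrec smooth1 :: "nat \<Rightarrow> (real \<Rightarrow> real) \<Rightarrow> bool" where
  "smooth1 0 h \<longleftrightarrow> continuous_on UNIV h"
| "smooth1 (Suc m) h \<longleftrightarrow> (\<exists>h'. (\<forall>t. (h has_real_derivative h' t) (at t)) \<and> smooth1 m h')"

lemma smooth1_Suc_imp: "smooth1 (Suc m) h \<Longrightarrow> smooth1 m h"
proof (induction m arbitrary: h)
  case 0
  then obtain h' where "\<And>t. (h has_real_derivative h' t) (at t)" by auto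
  then show ?case by (simp, intro DERIV_continuous_on) simp
next
  case (Suc m)
  then obtain h' where "\<forall>t. (h has_real_derivative h' t) (at t)" "smooth1 (Suc m) h'"
    unfolding smooth1.simps(2)[of "Suc m" h] by blast
  with Suc.IH show ?case unfolding smooth1.simps(2)[of m h] by blast
qed

lemma smooth1_add: "smooth1 m f \<Longrightarrow> smooth1 m g \<Longrightarrow> smooth1 m (\<lambda>t. f t + g t)"
proof (induction m arbitrary: f g)
  case 0
  then show ?case by (auto intro: continuous_on_add)
next
  case (Suc m)
  then obtain f' g' where "\<And>t. (f has_real_derivative f' t) (at t)" "\<And>t. (g has_real_derivative g' t) (at t)"
    "smooth1 m f'" "smooth1 m g'" by auto
  then show ?case
    unfolding smooth1.simps by (intro exI[of _ "\<lambda>t. f' t + g' t"] conjI allI DERIV_add Suc.IH)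
qed

lemma smooth1_mult: "smooth1 m f \<Longrightarrow> smooth1 m g \<Longrightarrow> smooth1 m (\<lambda>t. f t * g t)"
proof (induction m arbitrary: f g)
  case 0
  then show ?case by (auto intro: continuous_on_mult)
next
  case (Suc m)
  then obtain f' g' where d: "\<And>t. (f has_real_derivative f' t) (at t)" "\<And>t. (g has_real_derivative g' t) (at t)"
    and s: "smooth1 m f'" "smooth1 m g'" by auto
  have "smooth1 m (\<lambda>t. f' t * g t + g' t * f t)"
    by (intro smooth1_add Suc.IH s smooth1_Suc_imp[OF Suc.prems(1)] smooth1_Suc_imp[OF Suc.prems(2)])
  then show ?case
    unfolding smooth1.simps by (intro exI[of _ "\<lambda>t. f' t * g t + g' t * f t"] conjI allI DERIV_mult d)
qed

lemma smooth1_const: "smooth1 m (\<lambda>t. c)"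
proof (induction m arbitrary: c)
  case (Suc m)
  then show ?case by (auto intro!: exI[of _ "\<lambda>t. 0"])
qed auto

lemma smooth1_affine: "smooth1 m h \<Longrightarrow> smooth1 m (\<lambda>t. h (a * t + b))"
proof (induction m arbitrary: h)
  case 0
  then have "continuous_on UNIV (h \<circ> (\<lambda>t. a * t + b))"
    by (intro continuous_on_compose continuous_intros) (auto intro: continuous_on_subset)
  then show ?case by (simp add: o_def)
next
  case (Suc m)
  then obtain h' where d: "\<And>t. (h has_real_derivative h' t) (at t)" and s: "smooth1 m h'" by auto
  have "((\<lambda>t. h (a * t + b)) has_real_derivative h' (a * t + b) * a) (at t)" for t
    by (rule DERIV_chain2[OF d]) (auto intro!: derivative_eq_intros)
  moreover have "smooth1 m (\<lambda>t. h' (a * t + b) * a)"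
    by (rule smooth1_mult[OF Suc.IH[OF s] smooth1_const])
  ultimately show ?case
    unfolding smooth1.simps by (intro exI[of _ "\<lambda>t. h' (a * t + b) * a"] conjI allI)
qed

text \<open>The extra power \<open>s ^ k\<close> is what lets the induction over the coefficients go
  through.\<close>

lemma poly_div_exp_tendsto_0: "((\<lambda>s :: real. s ^ k * poly p s / exp s) \<longlongrightarrow> 0) at_top"
proof (induction p arbitrary: k)
  case (pCons a p)
  have "((\<lambda>s :: real. a * (s ^ k / exp s) + s ^ Suc k * poly p s / exp s) \<longlongrightarrow> a * 0 + 0) at_top"
    by (intro tendsto_intros tendsto_power_div_exp_0 pCons.IH)
  then show ?case by (simp add: algebra_simps add_divide_distrib)
qed auto

text \<open>The classical flat function exp(-1/t), multiplied by a polynomial in 1/t: this family is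
  closed under differentiation.\<close>

definition flat_exp :: "real poly \<Rightarrow> real \<Rightarrow> real" where
  "flat_exp p t = (if 0 < t then poly p (1 / t) * exp (- (1 / t)) else 0)"

lemma flat_exp_tendsto_0: "(flat_exp p \<longlongrightarrow> 0) (at 0)"
proof -
  have inv: "filterlim (\<lambda>t :: real. 1 / t) at_top (at_right 0)"
    using filterlim_inverse_at_top_right by (simp add: inverse_eq_divide)
  have "((\<lambda>t. (1 / t) ^ 0 * poly p (1 / t) / exp (1 / t)) \<longlongrightarrow> 0) (at_right (0 :: real))"
    by (rule filterlim_compose[OF poly_div_exp_tendsto_0 inv])
  moreover have "eventually (\<lambda>t. (1 / t) ^ 0 * poly p (1 / t) / exp (1 / t) = flat_exp p t) (at_right (0 :: real))"
    unfolding eventually_at_right_field by (intro exI[of _ 1]) (auto simp: flat_exp_def exp_minus field_simps)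
  ultimately have "(flat_exp p \<longlongrightarrow> 0) (at_right 0)"
    by (rule Lim_transform_eventually)
  moreover have "(flat_exp p \<longlongrightarrow> 0) (at_left 0)"
  proof (rule Lim_transform_eventually[OF tendsto_const])
    show "eventually (\<lambda>t. 0 = flat_exp p t) (at_left 0)"
      unfolding eventually_at_left_field by (intro exI[of _ "-1"]) (auto simp: flat_exp_def)
  qed
  ultimately show ?thesis by (simp add: filterlim_at_split)
qed

lemma flat_exp_deriv:
  "(flat_exp p has_real_derivative flat_exp ([:0, 0, 1:] * (p - pderiv p)) t) (at t)"
proof -
  consider "0 < t" | "t < 0" | "t = 0" by linarith
  then show ?thesis
  proof cases
    case 1
    have "((\<lambda>t. poly p (1 / t) * exp (- (1 / t))) has_real_derivative
        poly ([:0, 0, 1:] * (p - pderiv p)) (1 / t) * exp (- (1 / t))) (at t)"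
      using 1 by (auto intro!: derivative_eq_intros DERIV_chain2[OF poly_DERIV] simp: field_simps power2_eq_square)
    moreover have "\<forall>\<^sub>F s in nhds t. poly p (1 / s) * exp (- (1 / s)) = flat_exp p s"
      using eventually_nhds_in_open[of "{0<..}" t] 1 by (auto elim!: eventually_mono simp: flat_exp_def)
    ultimately show ?thesis
      using DERIV_cong_ev[of t t "\<lambda>t. poly p (1 / t) * exp (- (1 / t))" "flat_exp p"] 1
      by (simp add: flat_exp_def)
  next
    case 2
    have "\<forall>\<^sub>F s in nhds t. 0 = flat_exp p s"
      using eventually_nhds_in_open[of "{..<0}" t] 2 by (auto elim!: eventually_mono simp: flat_exp_def)
    then have "(flat_exp p has_real_derivative 0) (at t)"
      using DERIV_cong_ev[of t t "\<lambda>_. 0" "flat_exp p" 0 0] by simp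
    then show ?thesis using 2 by (simp add: flat_exp_def)
  next
    case 3
    \<comment> \<open>Division by \<open>s\<close> is one more factor 1/s, that is, a shift of the
      coefficients; the difference quotient at 0 is again in the family.\<close>
    have "(\<lambda>s. (flat_exp p s - flat_exp p 0) / (s - 0)) = flat_exp (pCons 0 p)"
      by (auto simp: flat_exp_def fun_eq_iff)
    then show ?thesis
      using flat_exp_tendsto_0[of "pCons 0 p"] 3
      by (simp add: has_field_derivative_iff flat_exp_def[of _ 0])
  qed
qed

lemma smooth1_flat_exp: "smooth1 m (flat_exp p)"
proof (induction m arbitrary: p)
  case 0
  show ?case
    using DERIV_isCont[OF flat_exp_deriv] by (simp add: continuous_at_imp_continuous_on)
next
  case (Suc m)
  show ?case
    unfolding smooth1.simps by (intro exI conjI allI) (rule flat_exp_deriv, rule Suc.IH)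
qed

text \<open>Both arguments have the shape \<open>a * t + b\<close> that
  \<open>smooth1_affine\<close> expects.\<close>

definition bump1 :: "real \<Rightarrow> real" where
  "bump1 t = flat_exp 1 (1 * t + 1) * flat_exp 1 (- 1 * t + 1)"

lemma smooth1_bump1: "smooth1 m (\<lambda>t. bump1 (a * t + b))"
proof -
  have "smooth1 m bump1"
    unfolding bump1_def[abs_def] by (rule smooth1_mult[OF smooth1_affine[OF smooth1_flat_exp] smooth1_affine[OF smooth1_flat_exp]])
  then show ?thesis by (rule smooth1_affine)
qed

lemma bump1_nonneg: "0 \<le> bump1 t" and bump1_pos: "\<bar>t\<bar> < 1 \<Longrightarrow> 0 < bump1 t" and bump1_zero: "1 \<le> \<bar>t\<bar> \<Longrightarrow> bump1 t = 0"
  by (auto simp: bump1_def flat_exp_def)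

text \<open>A partial derivative replaces one factor by its derivative, so it is a product of the
  same kind; the factors must be allowed to differ for this induction.\<close>

lemma Ck_on_prod_coords:
  fixes h :: "'n::finite \<Rightarrow> real \<Rightarrow> real"
  assumes "\<And>i. smooth1 k (h i)"
  shows "Ck_on k UNIV (\<lambda>x :: real^'n. \<Prod>i\<in>UNIV. h i (x $ i))"
  using assms
proof (induction k arbitrary: h)
  case 0
  have "continuous_on UNIV (\<lambda>x :: real^'n. h i (x $ i))" for i
  proof (rule continuous_on_compose2[of UNIV "h i"])
    show "continuous_on UNIV (h i)" using 0[of i] by simp
  qed (auto intro!: continuous_intros)
  then show ?case by (auto intro!: continuous_intros)
next
  case (Suc k)
  have "\<exists>h'. \<forall>i. (\<forall>t. (h i has_real_derivative h' i t) (at t)) \<and> smooth1 k (h' i)"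
    using Suc.prems by (intro choice) auto
  then obtain h' where d: "\<And>i t. (h i has_real_derivative h' i t) (at t)" and s: "\<And>i. smooth1 k (h' i)"
    by blast
  have dc: "((\<lambda>x :: real^'n. h i (x $ i)) has_derivative (\<lambda>v. h' i (x $ i) * v $ i)) (at x)" for i x
  proof -
    have "((\<lambda>x :: real^'n. x $ i) has_derivative (\<lambda>v. v $ i)) (at x)"
      by (rule bounded_linear_imp_has_derivative[OF bounded_linear_vec_nth])
    from has_derivative_compose[OF this, of "h i" "\<lambda>s. h' i (x $ i) * s"] d
    show ?thesis by (simp add: has_field_derivative_def)
  qed
  let ?f = "\<lambda>x :: real^'n. \<Prod>i\<in>UNIV. h i (x $ i)"
  have D: "(?f has_derivative (\<lambda>v. \<Sum>i\<in>UNIV. (h' i (x $ i) * v $ i) * (\<Prod>j\<in>UNIV - {i}. h j (x $ j)))) (at x)" for x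
    by (rule has_derivative_prod) (rule dc)
  have "partial i ?f = (\<lambda>x. \<Prod>j\<in>UNIV. (h(i := h' i)) j (x $ j))" for i
  proof
    fix x
    have "partial i ?f x = (\<Sum>k\<in>UNIV. (h' k (x $ k) * axis i 1 $ k) * (\<Prod>j\<in>UNIV - {k}. h j (x $ j)))"
      by (rule partial_eq[OF D])
    also have "\<dots> = (\<Sum>k\<in>UNIV. if k = i then h' i (x $ i) * (\<Prod>j\<in>UNIV - {i}. h j (x $ j)) else 0)"
      by (rule sum.cong) (auto simp: axis_def)
    also have "\<dots> = h' i (x $ i) * (\<Prod>j\<in>UNIV - {i}. h j (x $ j))" by simp
    also have "\<dots> = (\<Prod>j\<in>UNIV. (h(i := h' i)) j (x $ j))"
    proof -
      have "(\<Prod>j\<in>UNIV. (h(i := h' i)) j (x $ j)) = (h(i := h' i)) i (x $ i) * (\<Prod>j\<in>UNIV - {i}. (h(i := h' i)) j (x $ j))"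
        by (rule prod.remove) auto
      also have "(\<Prod>j\<in>UNIV - {i}. (h(i := h' i)) j (x $ j)) = (\<Prod>j\<in>UNIV - {i}. h j (x $ j))"
        by (rule prod.cong) auto
      finally show ?thesis by simp
    qed
    finally show "partial i ?f x = (\<Prod>j\<in>UNIV. (h(i := h' i)) j (x $ j))" .
  qed
  moreover have "Ck_on k UNIV (\<lambda>x :: real^'n. \<Prod>j\<in>UNIV. (h(i := h' i)) j (x $ j))" for i
    by (rule Suc.IH) (simp add: s smooth1_Suc_imp[OF Suc.prems])
  ultimately show ?case
    using differentiableI[OF D] by (simp only: Ck_on.simps) blast
qed

text \<open>The constant \<open>c\<close> takes up the sign that each differentiation of the
  reflection produces.\<close>

lemma Ck_on_scale_reflect:
  fixes f :: "real^'n::finite \<Rightarrow> real"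
  assumes "Ck_on k UNIV f"
  shows "Ck_on k UNIV (\<lambda>y. c * f (x - y))"
  using assms
proof (induction k arbitrary: f c)
  case 0
  have "continuous_on UNIV (\<lambda>y. f (x - y))"
  proof (rule continuous_on_compose2[of UNIV f])
    show "continuous_on UNIV f" using 0 by simp
  qed (auto intro!: continuous_intros)
  then show ?case by (auto intro!: continuous_intros)
next
  case (Suc k)
  have D: "((\<lambda>y. c * f (x - y)) has_derivative (\<lambda>v. c * (grad f (x - y) \<bullet> (- v)))) (at y)" for y
  proof -
    have "((\<lambda>y. x - y) has_derivative (\<lambda>v. - v)) (at y)" by (auto intro!: derivative_eq_intros)
    from has_derivative_compose[OF this has_derivative_grad] Suc.prems
    show ?thesis by (intro has_derivative_mult_right) simp
  qed
  have "partial i (\<lambda>y. c * f (x - y)) = (\<lambda>y. (- c) * partial i f (x - y))" for i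
    by (rule ext) (simp add: partial_eq[OF D] grad_def inner_axis)
  moreover have "Ck_on k UNIV (\<lambda>y. (- c) * partial i f (x - y))" for i
    by (rule Suc.IH) (use Suc.prems in simp)
  ultimately show ?case
    using differentiableI[OF D] by (simp only: Ck_on.simps) blast
qed

section \<open>Mollifiers and convolution with smooth kernels\<close>

definition mollifier :: "real \<Rightarrow> (real^'n::finite \<Rightarrow> real) \<Rightarrow> bool" where
  "mollifier r K \<longleftrightarrow> (\<forall>k. Ck_on k UNIV K) \<and> (\<forall>z. 0 \<le> K z) \<and> (\<forall>z. r \<le> norm z \<longrightarrow> K z = 0) \<and>
     integrable lborel K \<and> (LINT z|lborel. K z) = 1"

lemma exists_mollifier:
  assumes r: "0 < r"
  shows "\<exists>K :: real^'n::finite \<Rightarrow> real. mollifier r K"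
proof -
  \<comment> \<open>A vector of norm at least \<open>r\<close> has a coordinate of size at least
    \<open>r / CARD('n)\<close>, and there the corresponding factor vanishes.\<close>
  define a where "a = real CARD('n) / r"
  have a: "0 < a" using r by (simp add: a_def)
  define K0 :: "real^'n \<Rightarrow> real" where "K0 z = (\<Prod>i\<in>UNIV. bump1 (a * z $ i + 0))" for z
  have C: "Ck_on k UNIV K0" for k
    unfolding K0_def[abs_def] by (rule Ck_on_prod_coords) (rule smooth1_bump1)
  have nn: "0 \<le> K0 z" for z by (simp add: K0_def prod_nonneg bump1_nonneg)
  have zero: "K0 z = 0" if "r \<le> norm z" for z
  proof -
    have "\<exists>i. 1 \<le> \<bar>a * z $ i\<bar>"
    proof (rule ccontr)
      assume "\<not> ?thesis"
      then have lt: "\<bar>z $ i\<bar> < r / real CARD('n)" for i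
        using a r by (auto simp: not_le abs_mult a_def field_simps)
      have "norm z \<le> (\<Sum>i\<in>UNIV. \<bar>z $ i\<bar>)" by (rule norm_le_l1_cart)
      also have "\<dots> < (\<Sum>i\<in>(UNIV :: 'n set). r / real CARD('n))"
        by (rule sum_strict_mono) (use lt in auto)
      also have "\<dots> = r" by simp
      finally show False using that by simp
    qed
    then obtain i where "1 \<le> \<bar>a * z $ i + 0\<bar>" by auto
    then have "bump1 (a * z $ i + 0) = 0" by (rule bump1_zero)
    then show ?thesis unfolding K0_def by (intro prod_zero) auto
  qed
  have cont: "continuous_on UNIV K0" using C[of 0] by simp
  have i1: "integrable lborel (\<lambda>z. indicat_real (cball 0 r) z *\<^sub>R K0 z)"
    by (rule borel_integrable_compact) (auto intro: continuous_on_subset[OF cont])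
  moreover have eq: "(\<lambda>z. indicat_real (cball 0 r) z *\<^sub>R K0 z) = K0"
    using zero by (auto simp: fun_eq_iff indicator_def)
  ultimately have i: "integrable lborel K0" by simp
  have "K0 0 > 0" by (simp add: K0_def prod_pos bump1_pos)
  have "(LINT z|lborel. K0 z) \<noteq> 0"
  proof
    assume "(LINT z|lborel. K0 z) = 0"
    then have "AE z in lborel. K0 z = 0"
      using integral_nonneg_eq_0_iff_AE[OF i] nn by simp
    moreover have o: "open {z. K0 z \<noteq> 0}" by (intro open_Collect_neq cont continuous_on_const)
    ultimately have "{z. K0 z \<noteq> 0} \<in> null_sets lborel"
      by (subst AE_iff_null_sets) (auto simp: borel_open)
    then have "negligible {z. K0 z \<noteq> 0}"
      unfolding negligible_iff_null_sets by (rule null_sets_completionI)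
    then have "{z. K0 z \<noteq> 0} = {}"
      using open_not_negligible[OF o] by auto
    then show False using \<open>K0 0 > 0\<close> by auto
  qed
  moreover have "0 \<le> (LINT z|lborel. K0 z)" using nn by simp
  ultimately have I: "0 < (LINT z|lborel. K0 z)" by simp
  define c where "c = 1 / (LINT z|lborel. K0 z)"
  \<comment> \<open>The double reflection is the identity; it gives the scaled kernel the form
    produced by two uses of \<open>Ck_on_scale_reflect\<close>.\<close>
  have "mollifier r (\<lambda>z. c * K0 (0 - (0 - z)))"
    unfolding mollifier_def
  proof (intro conjI allI impI)
    fix k
    have "Ck_on k UNIV (\<lambda>z. 1 * K0 (0 - z))" by (rule Ck_on_scale_reflect[OF C])
    then have "Ck_on k UNIV (\<lambda>y. c * (\<lambda>z. 1 * K0 (0 - z)) (0 - y))" by (rule Ck_on_scale_reflect)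
    then show "Ck_on k UNIV (\<lambda>z. c * K0 (0 - (0 - z)))" by simp
  qed (use I nn zero i in \<open>auto simp: c_def\<close>)
  then show ?thesis by blast
qed

text \<open>Derivatives of a mollifier lose sign and normalisation, but stay in this class. The
  kernel is required to vanish only for \<open>r < norm z\<close>, an open condition, so that its
  derivatives vanish on the same set.\<close>

definition nice_kernel :: "real \<Rightarrow> (real^'n::finite \<Rightarrow> real) \<Rightarrow> bool" where
  "nice_kernel r K \<longleftrightarrow> (\<forall>k. Ck_on k UNIV K) \<and> (\<forall>z. r < norm z \<longrightarrow> K z = 0)"

lemma mollifier_nice: "mollifier r K \<Longrightarrow> nice_kernel r K"
  by (simp add: mollifier_def nice_kernel_def)

lemma nice_kernel_continuous: "nice_kernel r K \<Longrightarrow> continuous_on S K"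
  using continuous_on_subset[of UNIV K S] Ck_on.simps(1)[of UNIV K] unfolding nice_kernel_def by blast

lemma nice_kernel_differentiable: "nice_kernel r K \<Longrightarrow> K differentiable (at z)"
  using Ck_on.simps(2)[of 0 UNIV K] unfolding nice_kernel_def by blast

lemma nice_kernel_partial:
  assumes "nice_kernel r K" shows "nice_kernel r (partial i K)"
  unfolding nice_kernel_def
proof (intro conjI allI impI)
  show "Ck_on k UNIV (partial i K)" for k
    using assms Ck_on.simps(2)[of k UNIV K] unfolding nice_kernel_def by blast
  fix z :: "real^'a" assume z: "r < norm z"
  have o: "open {z :: real^'a. r < norm z}" by (intro open_Collect_less continuous_intros)
  have "(K has_derivative (\<lambda>h. 0)) (at z)"
    by (rule has_derivative_transform_within_open[OF _ o, of "\<lambda>z. 0"])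
      (use assms z in \<open>auto simp: nice_kernel_def\<close>)
  then show "partial i K z = 0" by (rule partial_eq)
qed

lemma nice_kernel_bounded:
  assumes K: "nice_kernel r K" obtains B where "0 \<le> B" "\<And>z. \<bar>K z\<bar> \<le> B"
proof -
  have "compact (K ` cball 0 r)"
    by (intro compact_continuous_image nice_kernel_continuous[OF K] compact_cball)
  then obtain B where B: "\<And>v. v \<in> K ` cball 0 r \<Longrightarrow> norm v \<le> B"
    using compact_imp_bounded bounded_iff by metis
  have "\<bar>K z\<bar> \<le> max 0 B" for z
    using B[of "K z"] K by (cases "norm z \<le> r") (auto simp: nice_kernel_def)
  then show thesis using that[of "max 0 B"] by simp
qed

lemma nice_kernel_uniformly_continuous:
  assumes K: "nice_kernel r K" and \<eta>: "0 < \<eta>"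
  obtains d where "0 < d" "\<And>z z'. dist z z' < d \<Longrightarrow> \<bar>K z - K z'\<bar> < \<eta>"
proof -
  have "uniformly_continuous_on (cball 0 (r + 2)) K"
    by (intro compact_uniformly_continuous nice_kernel_continuous[OF K] compact_cball)
  then obtain d where d: "0 < d" "\<And>z z'. z \<in> cball 0 (r + 2) \<Longrightarrow> z' \<in> cball 0 (r + 2) \<Longrightarrow> dist z' z < d \<Longrightarrow> dist (K z') (K z) < \<eta>"
    using \<eta> unfolding uniformly_continuous_on_def by metis
  have "\<bar>K z - K z'\<bar> < \<eta>" if zz: "dist z z' < min d 1" for z z'
  proof (cases "norm z \<le> r + 2 \<and> norm z' \<le> r + 2")
    case True
    then show ?thesis using d(2)[of z' z] zz by (simp add: dist_real_def)
  next
    case False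
    have "norm z \<le> norm z' + 1" "norm z' \<le> norm z + 1"
      using zz norm_triangle_ineq2[of z z'] norm_triangle_ineq2[of z' z] by (auto simp: dist_norm norm_minus_commute)
    then have "r < norm z" "r < norm z'" using False by auto
    then show ?thesis using K \<eta> by (simp add: nice_kernel_def)
  qed
  then show thesis using that[of "min d 1"] d(1) by simp
qed

text \<open>The gradient is uniformly continuous by compact support, so the first-order remainder is
  uniform in the base point.\<close>

lemma nice_kernel_taylor:
  fixes K :: "real^'n::finite \<Rightarrow> real"
  assumes K: "nice_kernel r K" and \<eta>: "0 < \<eta>"
  obtains d where "0 < d" "\<And>z h. norm h < d \<Longrightarrow> \<bar>K (z + h) - K z - grad K z \<bullet> h\<bar> \<le> \<eta> * norm h"
proof -
  define \<eta>' where "\<eta>' = \<eta> / real CARD('n)"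
  have \<eta>': "0 < \<eta>'" using \<eta> by (simp add: \<eta>'_def)
  have "\<exists>d>0. \<forall>z z'. dist z z' < d \<longrightarrow> \<bar>partial i K z - partial i K z'\<bar> < \<eta>'" for i
    using nice_kernel_uniformly_continuous[OF nice_kernel_partial[OF K] \<eta>', of i] by metis
  then have "\<exists>d. \<forall>i. 0 < d i \<and> (\<forall>z z'. dist z z' < d i \<longrightarrow> \<bar>partial i K z - partial i K z'\<bar> < \<eta>')"
    by (intro choice) auto
  then obtain d where d: "\<And>i. 0 < d i" "\<And>i z z'. dist z z' < d i \<Longrightarrow> \<bar>partial i K z - partial i K z'\<bar> < \<eta>'"
    by blast
  define d0 where "d0 = Min (range d)"
  have d0: "0 < d0" "\<And>i. d0 \<le> d i" using d(1) by (auto simp: d0_def)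
  have "\<bar>K (z + h) - K z - grad K z \<bullet> h\<bar> \<le> \<eta> * norm h" if h: "norm h < d0" for z h
  proof -
    have "((\<lambda>t. K (z + t *\<^sub>R h)) has_real_derivative grad K (z + t *\<^sub>R h) \<bullet> h) (at t)" for t
      by (rule DERIV_along_line[OF nice_kernel_differentiable[OF K]])
    from MVT2[OF zero_less_one this]
    obtain t where t: "0 < t" "t < 1" "K (z + 1 *\<^sub>R h) - K (z + 0 *\<^sub>R h) = (1 - 0) * (grad K (z + t *\<^sub>R h) \<bullet> h)"
      by auto
    then have "K (z + h) - K z - grad K z \<bullet> h = (grad K (z + t *\<^sub>R h) - grad K z) \<bullet> h"
      by (simp add: inner_diff_left)
    also have "\<bar>\<dots>\<bar> \<le> norm (grad K (z + t *\<^sub>R h) - grad K z) * norm h"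
      by (rule Cauchy_Schwarz_ineq2)
    also have "\<dots> \<le> \<eta> * norm h"
    proof (rule mult_right_mono)
      have th: "t * norm h \<le> norm h" using t mult_right_mono[of t 1 "norm h"] by simp
      have "norm (grad K (z + t *\<^sub>R h) - grad K z) \<le> (\<Sum>i\<in>UNIV. \<bar>(grad K (z + t *\<^sub>R h) - grad K z) $ i\<bar>)"
        by (rule norm_le_l1_cart)
      also have "\<dots> \<le> (\<Sum>i\<in>(UNIV :: 'n set). \<eta>')"
      proof (rule sum_mono)
        fix i
        have "dist (z + t *\<^sub>R h) z < d i"
          using th t h d0(2)[of i] by (simp add: dist_norm)
        from d(2)[OF this] show "\<bar>(grad K (z + t *\<^sub>R h) - grad K z) $ i\<bar> \<le> \<eta>'" by (simp add: grad_def)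
      qed
      also have "\<dots> = \<eta>" by (simp add: \<eta>'_def)
      finally show "norm (grad K (z + t *\<^sub>R h) - grad K z) \<le> \<eta>" .
    qed simp
    finally show ?thesis .
  qed
  then show thesis using that d0(1) by blast
qed

definition conv :: "(real^'n::finite \<Rightarrow> real) \<Rightarrow> (real^'n \<Rightarrow> real) \<Rightarrow> real^'n \<Rightarrow> real" where
  "conv K u x = (LINT y|lborel. K (x - y) * u y)"

lemma nice_kernel_borel: "nice_kernel r K \<Longrightarrow> (\<lambda>y. K (x - y)) \<in> borel_measurable borel"
  by (intro borel_measurable_continuous_onI continuous_on_compose2[OF nice_kernel_continuous[of r K UNIV]])
    (auto intro!: continuous_intros)

lemma conv_integrable:
  assumes K: "nice_kernel r K" and u: "integrable lborel u"
  shows "integrable lborel (\<lambda>y. K (x - y) * u y)"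
proof -
  obtain B where B: "0 \<le> B" "\<And>z. \<bar>K z\<bar> \<le> B" by (rule nice_kernel_bounded[OF K]) blast
  have [measurable]: "(\<lambda>y. K (x - y)) \<in> borel_measurable borel" by (rule nice_kernel_borel[OF K])
  have [measurable]: "u \<in> borel_measurable borel" using borel_measurable_integrable[OF u] by simp
  show ?thesis
    by (rule Bochner_Integration.integrable_bound[of _ "\<lambda>y. B * u y"])
      (use u B in \<open>auto simp: abs_mult intro!: mult_right_mono\<close>)
qed

text \<open>The remainder of the kernel is small uniformly in the base point, hence can be
  integrated against \<open>\<bar>u\<bar>\<close>; no convergence theorem is called for.\<close>

lemma conv_has_derivative:
  fixes K :: "real^'n::finite \<Rightarrow> real"
  assumes K: "nice_kernel r K" and u: "integrable lborel u"
  shows "(conv K u has_derivative (\<lambda>h. (\<chi> i. conv (partial i K) u x) \<bullet> h)) (at x)"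
  unfolding has_derivative_at_alt
proof (intro conjI allI impI)
  show "bounded_linear (\<lambda>h. (\<chi> i. conv (partial i K) u x) \<bullet> h)" by (rule bounded_linear_inner_right)
  fix e :: real assume e: "0 < e"
  define I where "I = (LINT y|lborel. \<bar>u y\<bar>)"
  have I: "0 \<le> I" by (simp add: I_def)
  define \<eta> where "\<eta> = e / (I + 1)"
  have \<eta>: "0 < \<eta>" "\<eta> * I \<le> e" using e I by (auto simp: \<eta>_def field_simps)
  obtain d where d: "0 < d" "\<And>z h. norm h < d \<Longrightarrow> \<bar>K (z + h) - K z - grad K z \<bullet> h\<bar> \<le> \<eta> * norm h"
    by (rule nice_kernel_taylor[OF K \<eta>(1)]) blast
  have "norm (conv K u x' - conv K u x - (\<chi> i. conv (partial i K) u x) \<bullet> (x' - x)) \<le> e * norm (x' - x)"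
    if x': "norm (x' - x) < d" for x'
  proof -
    define h where "h = x' - x"
    have i1: "integrable lborel (\<lambda>y. K (x' - y) * u y)" "integrable lborel (\<lambda>y. K (x - y) * u y)"
      using conv_integrable[OF K u] by auto
    have i2: "integrable lborel (\<lambda>y. partial i K (x - y) * u y * h $ i)" for i
      using conv_integrable[OF nice_kernel_partial[OF K] u] by (intro integrable_mult_left)
    have "(\<chi> i. conv (partial i K) u x) \<bullet> h = (\<Sum>i\<in>UNIV. LINT y|lborel. partial i K (x - y) * u y * h $ i)"
      by (simp add: inner_vec_def conv_def)
    also have "\<dots> = (LINT y|lborel. (\<Sum>i\<in>UNIV. partial i K (x - y) * u y * h $ i))"
      using i2 by (subst Bochner_Integration.integral_sum) auto
    also have "\<dots> = (LINT y|lborel. (grad K (x - y) \<bullet> h) * u y)"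
      by (simp add: grad_def inner_vec_def sum_distrib_left sum_distrib_right mult_ac)
    finally have e1: "(\<chi> i. conv (partial i K) u x) \<bullet> h = (LINT y|lborel. (grad K (x - y) \<bullet> h) * u y)" .
    have i3: "integrable lborel (\<lambda>y. (grad K (x - y) \<bullet> h) * u y)"
    proof -
      have "integrable lborel (\<lambda>y. \<Sum>i\<in>UNIV. partial i K (x - y) * u y * h $ i)"
        using i2 by (intro Bochner_Integration.integrable_sum)
      then show ?thesis by (simp add: grad_def inner_vec_def sum_distrib_left sum_distrib_right mult_ac)
    qed
    have "conv K u x' - conv K u x - (\<chi> i. conv (partial i K) u x) \<bullet> h
        = (LINT y|lborel. K (x' - y) * u y - K (x - y) * u y - (grad K (x - y) \<bullet> h) * u y)"
      unfolding e1 unfolding conv_def using i1 i3 by simp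
    also have "norm \<dots> \<le> (LINT y|lborel. (\<eta> * norm h) * \<bar>u y\<bar>)"
    proof (rule Bochner_Integration.integral_norm_bound_integral)
      show "integrable lborel (\<lambda>y. K (x' - y) * u y - K (x - y) * u y - (grad K (x - y) \<bullet> h) * u y)"
        using i1 i3 by (intro Bochner_Integration.integrable_diff)
      show "integrable lborel (\<lambda>y. (\<eta> * norm h) * \<bar>u y\<bar>)" using u by (intro integrable_mult_right integrable_abs)
      fix y
      have "K (x' - y) * u y - K (x - y) * u y - (grad K (x - y) \<bullet> h) * u y
          = (K ((x - y) + h) - K (x - y) - grad K (x - y) \<bullet> h) * u y"
        by (simp add: h_def left_diff_distrib algebra_simps)
      moreover have "\<bar>K ((x - y) + h) - K (x - y) - grad K (x - y) \<bullet> h\<bar> \<le> \<eta> * norm h"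
        using x' by (intro d(2)) (simp add: h_def)
      ultimately show "norm (K (x' - y) * u y - K (x - y) * u y - (grad K (x - y) \<bullet> h) * u y) \<le> (\<eta> * norm h) * \<bar>u y\<bar>"
        by (simp add: abs_mult mult_right_mono)
    qed
    also have "\<dots> = \<eta> * I * norm h" by (simp add: I_def)
    also have "\<dots> \<le> e * norm h" using \<eta> by (intro mult_right_mono) auto
    finally show ?thesis by (simp add: h_def)
  qed
  then show "\<exists>d>0. \<forall>y. norm (y - x) < d \<longrightarrow> norm (conv K u y - conv K u x - (\<chi> i. conv (partial i K) u x) \<bullet> (y - x)) \<le> e * norm (y - x)"
    using d(1) by blast
qed

lemma partial_conv:
  assumes "nice_kernel r K" "integrable lborel u"
  shows "partial i (conv K u) = conv (partial i K) u"
  by (rule ext) (simp add: partial_eq[OF conv_has_derivative[OF assms]] inner_axis)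

lemma Ck_on_2_conv:
  assumes K: "nice_kernel r K" and u: "integrable lborel u"
  shows "Ck_on 2 UNIV (conv K u)"
  unfolding Ck_on_2_iff partial_conv[OF K u] partial_conv[OF nice_kernel_partial[OF K] u]
proof (intro conjI ballI allI)
  show "conv K u differentiable (at x)" for x using conv_has_derivative[OF K u] by (rule differentiableI)
  show "conv (partial i K) u differentiable (at x)" for i x
    using conv_has_derivative[OF nice_kernel_partial[OF K] u] by (rule differentiableI)
  show "continuous_on UNIV (conv (partial j (partial i K)) u)" for i j
    using has_derivative_continuous[OF conv_has_derivative[OF nice_kernel_partial[OF nice_kernel_partial[OF K]] u]]
    by (simp add: continuous_at_imp_continuous_on)
qed

lemma hessian_conv:
  assumes K: "nice_kernel r K" and u: "integrable lborel u"
  shows "hessian (conv K u) x $ i $ j = conv (partial i (partial j K)) u x"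
  by (simp add: hessian_def partial_conv[OF K u] partial_conv[OF nice_kernel_partial[OF K] u])

lemma partial_reflect:
  assumes "nice_kernel r K"
  shows "partial i (\<lambda>y. K (x - y)) = (\<lambda>y. - partial i K (x - y))"
proof
  fix y
  have "((\<lambda>y. x - y) has_derivative (\<lambda>v. - v)) (at y)" by (auto intro!: derivative_eq_intros)
  from has_derivative_compose[OF this has_derivative_grad[OF nice_kernel_differentiable[OF assms]]]
  have "((\<lambda>y. K (x - y)) has_derivative (\<lambda>v. grad K (x - y) \<bullet> - v)) (at y)" .
  from partial_eq[OF this] show "partial i (\<lambda>y. K (x - y)) y = - partial i K (x - y)"
    by (simp add: grad_def inner_axis)
qed

lemma test_function_reflect:
  assumes K: "nice_kernel r K" and x: "cball x r \<subseteq> \<Omega>"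
  shows "test_function \<Omega> (\<lambda>y. c * K (x - y))"
proof -
  have "{y. c * K (x - y) \<noteq> 0} \<subseteq> cball x r"
    using K by (auto simp: nice_kernel_def dist_norm not_less[symmetric])
  then have cl: "closure {y. c * K (x - y) \<noteq> 0} \<subseteq> cball x r" by (simp add: closure_minimal)
  then have "compact (closure {y. c * K (x - y) \<noteq> 0})"
    using bounded_subset[OF bounded_cball] by (simp add: compact_eq_bounded_closed) blast
  moreover have "Ck_on k UNIV (\<lambda>y. c * K (x - y))" for k
    using K by (intro Ck_on_scale_reflect) (simp add: nice_kernel_def)
  ultimately show ?thesis using cl x by (auto simp: test_function_def)
qed

text \<open>When the ball of radius \<open>r\<close> about \<open>x\<close> lies in
  \<open>\<Omega>\<close>, the reflected kernel and its derivatives are test functions. Two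
  integrations by parts move both derivatives onto \<open>u\<close>, and their signs cancel.\<close>

lemma weak_hessian_mollified:
  fixes u :: "real^'n::finite \<Rightarrow> real"
  assumes K: "nice_kernel r K" and x: "cball x r \<subseteq> \<Omega>"
    and wh: "weak_hessian \<Omega> u H"
    and u0: "integrable lborel (\<lambda>y. indicator \<Omega> y * u y)"
  shows "hessian (conv K (\<lambda>y. indicator \<Omega> y * u y)) x $ i $ j = (LINT y:\<Omega>|lebesgue. H y $ i $ j * K (x - y))"
proof -
  let ?u = "\<lambda>y. indicator \<Omega> y * u y"
  obtain G where G: "weak_partial j \<Omega> u (\<lambda>x. G x $ j)" and GH: "weak_partial i \<Omega> (\<lambda>x. G x $ j) (\<lambda>x. H x $ i $ j)"
    using wh unfolding weak_hessian_def weak_gradient_def by blast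
  have t1: "test_function \<Omega> (\<lambda>y. K (x - y))" using test_function_reflect[OF K x, of 1] by simp
  have p1: "partial i (\<lambda>y. K (x - y)) = (\<lambda>y. - 1 * partial i K (x - y))"
    using partial_reflect[OF K] by simp
  have t2: "test_function \<Omega> (partial i (\<lambda>y. K (x - y)))"
    unfolding p1 by (rule test_function_reflect[OF nice_kernel_partial[OF K] x])
  have p2: "partial j (partial i (\<lambda>y. K (x - y))) = (\<lambda>y. partial j (partial i K) (x - y))"
  proof
    fix y
    have "((\<lambda>y. x - y) has_derivative (\<lambda>v. - v)) (at y)" by (auto intro!: derivative_eq_intros)
    from has_derivative_compose[OF this has_derivative_grad[OF nice_kernel_differentiable[OF nice_kernel_partial[OF K]]], of i]
    have "((\<lambda>y. - 1 * partial i K (x - y)) has_derivative (\<lambda>v. - 1 * (grad (partial i K) (x - y) \<bullet> - v))) (at y)"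
      by (rule has_derivative_mult_right)
    from partial_eq[OF this, of j] show "partial j (partial i (\<lambda>y. K (x - y))) y = partial j (partial i K) (x - y)"
      unfolding p1 by (simp add: grad_def inner_axis)
  qed
  have "(LINT y:\<Omega>|lebesgue. u y * partial j (partial i (\<lambda>y. K (x - y))) y)
      = - (LINT y:\<Omega>|lebesgue. G y $ j * partial i (\<lambda>y. K (x - y)) y)"
    using G t2 unfolding weak_partial_def by blast
  also have "\<dots> = (LINT y:\<Omega>|lebesgue. H y $ i $ j * K (x - y))"
    using GH t1 unfolding weak_partial_def by simp
  finally have e: "(LINT y:\<Omega>|lebesgue. u y * partial j (partial i K) (x - y)) = (LINT y:\<Omega>|lebesgue. H y $ i $ j * K (x - y))"
    unfolding p2 .
  \<comment> \<open>Integration by parts and \<open>hessian_conv\<close> produce the two derivatives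
    of the kernel in opposite orders.\<close>
  have sym: "partial i (partial j K) z = partial j (partial i K) z" for z
  proof -
    have "transpose (hessian K z) = hessian K z"
      using K by (intro hessian_symmetric[of UNIV]) (auto simp: nice_kernel_def)
    then have "hessian K z $ i $ j = hessian K z $ j $ i" by (metis transpose_def vec_lambda_beta)
    then show ?thesis by (simp add: hessian_def)
  qed
  have "hessian (conv K ?u) x $ i $ j = (LINT y|lborel. partial j (partial i K) (x - y) * ?u y)"
    unfolding hessian_conv[OF K u0] conv_def sym ..
  also have "\<dots> = (LINT y|lebesgue. partial j (partial i K) (x - y) * ?u y)"
    using borel_measurable_integrable[OF conv_integrable[OF nice_kernel_partial[OF nice_kernel_partial[OF K]] u0]]
    by (intro integral_completion[symmetric]) simp
  also have "\<dots> = (LINT y:\<Omega>|lebesgue. u y * partial j (partial i K) (x - y))"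
    unfolding set_lebesgue_integral_def by (simp add: mult_ac)
  finally show ?thesis using e by simp
qed

section \<open>Convergence of mollifications in L^1, and their integral bounds\<close>

lemma nn_integral_translate:
  fixes f :: "'a::euclidean_space \<Rightarrow> ennreal"
  assumes [measurable]: "f \<in> borel_measurable borel"
  shows "(\<integral>\<^sup>+x. f (x + c) \<partial>lborel) = (\<integral>\<^sup>+x. f x \<partial>lborel)"
proof -
  have "(\<integral>\<^sup>+x. f x \<partial>lborel) = (\<integral>\<^sup>+x. f x \<partial>distr lborel borel ((+) c))"
    by (simp only: lborel_distr_plus)
  also have "\<dots> = (\<integral>\<^sup>+x. f (c + x) \<partial>lborel)" by (rule nn_integral_distr) auto
  finally show ?thesis by (simp add: add.commute)
qed

lemma nn_integral_reflect:
  fixes f :: "'a::euclidean_space \<Rightarrow> ennreal"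
  assumes [measurable]: "f \<in> borel_measurable borel"
  shows "(\<integral>\<^sup>+x. f (- x) \<partial>lborel) = (\<integral>\<^sup>+x. f x \<partial>lborel)"
proof -
  have "distr lborel borel (uminus :: 'a \<Rightarrow> 'a) = lborel"
    using lborel_affine[of "-1" "0 :: 'a"] by (simp add: density_1)
  then have "(\<integral>\<^sup>+x. f x \<partial>lborel) = (\<integral>\<^sup>+x. f x \<partial>distr lborel borel uminus)"
    by (simp only:)
  also have "\<dots> = (\<integral>\<^sup>+x. f (- x) \<partial>lborel)" by (rule nn_integral_distr) auto
  finally show ?thesis by simp
qed

text \<open>Regularity of Lebesgue measure. A large ball first cuts off all but a small part of
  \<open>A\<close>, so that the closed inner approximation becomes compact; three errors of
  \<open>e / 3\<close> add up.\<close>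

lemma compact_open_approximation:
  fixes A :: "'a::euclidean_space set"
  assumes A: "A \<in> sets lborel" and fin: "emeasure lborel A < \<infinity>" and e: "0 < e"
  obtains C V where "compact C" "open V" "C \<subseteq> A" "A \<subseteq> V" "emeasure lborel (V - C) \<le> ennreal e"
proof -
  have AL: "A \<in> sets lebesgue" and finL: "emeasure lebesgue A < \<infinity>"
    using A fin by (auto intro: sets_completionI_sets)
  obtain V where V: "open V" "A \<subseteq> V" "V - A \<in> lmeasurable" "emeasure lebesgue (V - A) < ennreal (e / 3)"
  proof -
    have e3: "0 < e / 3" using e by simp
    show ?thesis by (rule sets_lebesgue_outer_open[OF AL e3]) (rule that)
  qed
  have "(\<lambda>k. emeasure lebesgue (A - cball 0 (real k))) \<longlonglongrightarrow> emeasure lebesgue (\<Inter>k. A - cball 0 (real k))"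
  proof (rule Lim_emeasure_decseq)
    show "decseq (\<lambda>k. A - cball 0 (real k))" by (auto simp: decseq_def)
    show "emeasure lebesgue (A - cball 0 (real k)) \<noteq> \<infinity>" for k
      using emeasure_mono[of "A - cball 0 (real k)" A lebesgue] AL finL by (auto simp: top_unique)
  qed (use AL in auto)
  moreover have "(\<Inter>k. A - cball 0 (real k)) = {}"
  proof -
    have "\<exists>k. norm x \<le> real k" for x :: 'a by (meson real_arch_simple)
    then show ?thesis by auto
  qed
  ultimately have "(\<lambda>k. emeasure lebesgue (A - cball 0 (real k))) \<longlonglongrightarrow> 0"
    by (simp only: emeasure_empty)
  then have "eventually (\<lambda>k. emeasure lebesgue (A - cball 0 (real k)) < ennreal (e / 3)) sequentially"
    using e by (intro order_tendstoD(2)) auto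
  then obtain k where k: "emeasure lebesgue (A - cball 0 (real k)) < ennreal (e / 3)"
    by (auto simp: eventually_sequentially)
  have BL: "A \<inter> cball 0 (real k) \<in> sets lebesgue" using AL by auto
  obtain C where C: "closed C" "C \<subseteq> A \<inter> cball 0 (real k)" "emeasure lebesgue (A \<inter> cball 0 (real k) - C) < ennreal (e / 3)"
  proof -
    have e3: "0 < e / 3" using e by simp
    show ?thesis by (rule sets_lebesgue_inner_closed[OF BL e3]) (rule that)
  qed
  have "bounded C" using C(2) bounded_cball bounded_subset by blast
  then have cC: "compact C" using C(1) by (simp add: compact_eq_bounded_closed)
  have CL: "C \<in> sets lebesgue" using C(1) by (auto intro: sets_completionI_sets)
  have s3: "V - A \<in> sets lebesgue" "A - cball 0 (real k) \<in> sets lebesgue" "A \<inter> cball 0 (real k) - C \<in> sets lebesgue"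
    using V(3) AL CL BL by (auto simp: fmeasurable_def)
  then have s2: "(A - cball 0 (real k)) \<union> (A \<inter> cball 0 (real k) - C) \<in> sets lebesgue" by blast
  have "emeasure lebesgue (V - C) \<le> emeasure lebesgue ((V - A) \<union> ((A - cball 0 (real k)) \<union> (A \<inter> cball 0 (real k) - C)))"
    by (rule emeasure_mono[OF _ sets.Un[OF s3(1) s2]]) auto
  also have "\<dots> \<le> emeasure lebesgue (V - A) + emeasure lebesgue ((A - cball 0 (real k)) \<union> (A \<inter> cball 0 (real k) - C))"
    by (rule emeasure_subadditive[OF s3(1) s2])
  also have "\<dots> \<le> emeasure lebesgue (V - A) + (emeasure lebesgue (A - cball 0 (real k)) + emeasure lebesgue (A \<inter> cball 0 (real k) - C))"
    by (rule add_left_mono[OF emeasure_subadditive[OF s3(2,3)]])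
  also have "\<dots> \<le> ennreal (e / 3) + (ennreal (e / 3) + ennreal (e / 3))"
    by (rule add_mono[OF less_imp_le[OF V(4)] add_mono[OF less_imp_le[OF k] less_imp_le[OF C(3)]]])
  also have "\<dots> = ennreal e" using e by (simp flip: ennreal_plus)
  finally have "emeasure lebesgue (V - C) \<le> ennreal e" .
  moreover have "V - C \<in> sets lborel" using V(1) C(1) by (auto simp: borel_open borel_closed)
  ultimately have "emeasure lborel (V - C) \<le> ennreal e" by simp
  then show thesis using that[OF cC V(1) _ V(2)] C(2) by blast
qed

text \<open>Indicators first, then sums, then limits in L^1, where translation invariance controls
  the error of the shifted function.\<close>

lemma L1_translation_continuous:
  fixes h :: "'a::euclidean_space \<Rightarrow> real"
  assumes "integrable lborel h" "0 < e"
  shows "\<exists>d>0. \<forall>z. norm z < d \<longrightarrow> (\<integral>\<^sup>+x. ennreal \<bar>h (x + z) - h x\<bar> \<partial>lborel) \<le> ennreal e"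
  using assms
proof (induction arbitrary: e rule: integrable_induct)
  case (base A c e)
  define e' where "e' = e / (\<bar>c\<bar> + 1) / 2"
  have e': "0 < e'" using base by (simp add: e'_def add_nonneg_pos)
  obtain C V where CV: "compact C" "open V" "C \<subseteq> A" "A \<subseteq> V" "emeasure lborel (V - C) \<le> ennreal e'"
    using compact_open_approximation[OF base(1,2) e'] .
  obtain d where d: "0 < d" "\<And>x z. x \<in> C \<Longrightarrow> norm z < d \<Longrightarrow> x + z \<in> V"
  proof -
    obtain d where d: "0 < d" "(\<Union>x\<in>C. ball x d) \<subseteq> V"
      using compact_subset_open_imp_ball_epsilon_subset[OF CV(1,2)] CV(3,4) by blast
    have "x + z \<in> V" if "x \<in> C" "norm z < d" for x z
    proof -
      have "x + z \<in> ball x d" using that by (simp add: dist_norm)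
      then show ?thesis using d(2) that(1) by blast
    qed
    then show ?thesis using that d(1) by blast
  qed
  have W[measurable]: "V - C \<in> sets borel" using CV(1,2) by (auto simp: borel_open borel_closed compact_imp_closed)
  have "(\<integral>\<^sup>+x. ennreal \<bar>indicat_real A (x + z) *\<^sub>R c - indicat_real A x *\<^sub>R c\<bar> \<partial>lborel) \<le> ennreal e"
    if z: "norm z < d" for z
  proof -
    have pt: "ennreal \<bar>indicat_real A (x + z) *\<^sub>R c - indicat_real A x *\<^sub>R c\<bar>
        \<le> ennreal \<bar>c\<bar> * (indicator (V - C) (x + z) + indicator (V - C) x)" for x
    proof (cases "x + z \<in> A \<longleftrightarrow> x \<in> A")
      case False
      \<comment> \<open>A shift shorter than \<open>d\<close> keeps points of \<open>C\<close>
        inside \<open>V\<close>, so a change of membership in \<open>A\<close> can only involve a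
        point of \<open>V - C\<close>.\<close>
      have "x + z \<in> V - C \<or> x \<in> V - C"
      proof (cases "x \<in> A")
        case True
        then show ?thesis using False d(2)[of x z] z CV(3,4) by blast
      next
        case xA: False
        then have "x + z \<in> A" using False by blast
        moreover have "x + z \<in> C \<Longrightarrow> x \<in> V"
          using d(2)[of "x + z" "- z"] z by simp
        ultimately show ?thesis using xA CV(3,4) by blast
      qed
      then have "1 \<le> (indicator (V - C) (x + z) + indicator (V - C) x :: ennreal)"
        by (auto simp: indicator_def)
      then have "ennreal \<bar>c\<bar> * 1 \<le> ennreal \<bar>c\<bar> * (indicator (V - C) (x + z) + indicator (V - C) x)"
        by (intro mult_left_mono) auto
      moreover have "\<bar>indicat_real A (x + z) *\<^sub>R c - indicat_real A x *\<^sub>R c\<bar> = \<bar>c\<bar>"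
        using False by (auto simp: indicator_def)
      ultimately show ?thesis by simp
    qed (auto simp: indicator_def)
    have "(\<integral>\<^sup>+x. ennreal \<bar>indicat_real A (x + z) *\<^sub>R c - indicat_real A x *\<^sub>R c\<bar> \<partial>lborel)
        \<le> (\<integral>\<^sup>+x. ennreal \<bar>c\<bar> * (indicator (V - C) (x + z) + indicator (V - C) x) \<partial>lborel)"
      by (rule nn_integral_mono) (rule pt)
    also have "\<dots> = ennreal \<bar>c\<bar> * ((\<integral>\<^sup>+x. indicator (V - C) (x + z) \<partial>lborel) + (\<integral>\<^sup>+x. indicator (V - C) x \<partial>lborel))"
      by (subst nn_integral_cmult) (auto simp: nn_integral_add)
    also have "(\<integral>\<^sup>+x. indicator (V - C) (x + z) \<partial>lborel) = (\<integral>\<^sup>+x. indicator (V - C) x \<partial>lborel)"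
      by (rule nn_integral_translate) simp
    also have "(\<integral>\<^sup>+x. indicator (V - C) x \<partial>lborel) = emeasure lborel (V - C)" by simp
    also have "ennreal \<bar>c\<bar> * (emeasure lborel (V - C) + emeasure lborel (V - C)) \<le> ennreal \<bar>c\<bar> * (ennreal e' + ennreal e')"
      using CV(5) by (intro mult_left_mono add_mono) auto
    also have "\<dots> = ennreal (\<bar>c\<bar> * (e' + e'))" using e' by (simp add: ennreal_mult flip: ennreal_plus)
    also have "\<dots> \<le> ennreal e"
    proof (rule ennreal_leI)
      have c1: "0 < \<bar>c\<bar> + 1" by (simp add: add_nonneg_pos)
      have "\<bar>c\<bar> * (e' + e') = \<bar>c\<bar> * (e / (\<bar>c\<bar> + 1))" by (simp only: e'_def field_sum_of_halves)
      also have "\<dots> \<le> (\<bar>c\<bar> + 1) * (e / (\<bar>c\<bar> + 1))" using base(3) c1 by (intro mult_right_mono) auto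
      also have "\<dots> = e" using c1 by simp
      finally show "\<bar>c\<bar> * (e' + e') \<le> e" .
    qed
    finally show ?thesis .
  qed
  then show ?case using d(1) by blast
next
  case (add f g e)
  obtain d1 where d1: "0 < d1" "\<And>z. norm z < d1 \<Longrightarrow> (\<integral>\<^sup>+x. ennreal \<bar>f (x + z) - f x\<bar> \<partial>lborel) \<le> ennreal (e / 2)"
    using add.IH(1)[of "e / 2"] add.prems by auto
  obtain d2 where d2: "0 < d2" "\<And>z. norm z < d2 \<Longrightarrow> (\<integral>\<^sup>+x. ennreal \<bar>g (x + z) - g x\<bar> \<partial>lborel) \<le> ennreal (e / 2)"
    using add.IH(2)[of "e / 2"] add.prems by auto
  have [measurable]: "f \<in> borel_measurable borel" "g \<in> borel_measurable borel"
    using add.hyps by (auto dest: borel_measurable_integrable)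
  have "(\<integral>\<^sup>+x. ennreal \<bar>(f (x + z) + g (x + z)) - (f x + g x)\<bar> \<partial>lborel) \<le> ennreal e"
    if z: "norm z < min d1 d2" for z
  proof -
    have "(\<integral>\<^sup>+x. ennreal \<bar>(f (x + z) + g (x + z)) - (f x + g x)\<bar> \<partial>lborel)
        \<le> (\<integral>\<^sup>+x. ennreal \<bar>f (x + z) - f x\<bar> + ennreal \<bar>g (x + z) - g x\<bar> \<partial>lborel)"
      by (intro nn_integral_mono) (auto simp flip: ennreal_plus intro!: ennreal_leI)
    also have "\<dots> = (\<integral>\<^sup>+x. ennreal \<bar>f (x + z) - f x\<bar> \<partial>lborel) + (\<integral>\<^sup>+x. ennreal \<bar>g (x + z) - g x\<bar> \<partial>lborel)"
      by (rule nn_integral_add) auto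
    also have "\<dots> \<le> ennreal (e / 2) + ennreal (e / 2)" using d1(2)[of z] d2(2)[of z] z by (intro add_mono) auto
    also have "\<dots> = ennreal e" using add.prems by (simp flip: ennreal_plus)
    finally show ?thesis .
  qed
  then show ?case using d1(1) d2(1) by (intro exI[of _ "min d1 d2"]) auto
next
  case (lim f s e)
  have [measurable]: "f \<in> borel_measurable borel" "\<And>i. s i \<in> borel_measurable borel"
    using lim.hyps by (auto dest: borel_measurable_integrable)
  have "(\<lambda>i. \<integral>\<^sup>+x. ennreal (norm (f x - s i x)) \<partial>lborel) \<longlonglongrightarrow> 0"
  proof (rule nn_integral_dominated_convergence_norm[where w = "\<lambda>x. 2 * norm (f x)"])
    have "integrable lborel (\<lambda>x. 2 * norm (f x))" using lim.hyps by auto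
    then show "(\<integral>\<^sup>+x. ennreal (2 * norm (f x)) \<partial>lborel) < \<infinity>"
      unfolding integrable_iff_bounded by simp
  qed (use lim.hyps in auto)
  then have "eventually (\<lambda>i. (\<integral>\<^sup>+x. ennreal (norm (f x - s i x)) \<partial>lborel) < ennreal (e / 3)) sequentially"
    using lim.prems by (intro order_tendstoD(2)) auto
  then obtain i where i: "(\<integral>\<^sup>+x. ennreal \<bar>f x - s i x\<bar> \<partial>lborel) < ennreal (e / 3)"
    by (auto simp: eventually_sequentially)
  obtain d where d: "0 < d" "\<And>z. norm z < d \<Longrightarrow> (\<integral>\<^sup>+x. ennreal \<bar>s i (x + z) - s i x\<bar> \<partial>lborel) \<le> ennreal (e / 3)"
    using lim.IH[of "e / 3" i] lim.prems by auto
  have "(\<integral>\<^sup>+x. ennreal \<bar>f (x + z) - f x\<bar> \<partial>lborel) \<le> ennreal e" if z: "norm z < d" for z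
  proof -
    have "(\<integral>\<^sup>+x. ennreal \<bar>f (x + z) - f x\<bar> \<partial>lborel)
        \<le> (\<integral>\<^sup>+x. ennreal \<bar>f (x + z) - s i (x + z)\<bar> + (ennreal \<bar>s i (x + z) - s i x\<bar> + ennreal \<bar>f x - s i x\<bar>) \<partial>lborel)"
      by (intro nn_integral_mono) (auto simp flip: ennreal_plus intro!: ennreal_leI)
    also have "\<dots> = (\<integral>\<^sup>+x. ennreal \<bar>f (x + z) - s i (x + z)\<bar> \<partial>lborel)
        + ((\<integral>\<^sup>+x. ennreal \<bar>s i (x + z) - s i x\<bar> \<partial>lborel) + (\<integral>\<^sup>+x. ennreal \<bar>f x - s i x\<bar> \<partial>lborel))"
      by (subst nn_integral_add, simp, simp, subst nn_integral_add, simp_all)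
    also have "(\<integral>\<^sup>+x. ennreal \<bar>f (x + z) - s i (x + z)\<bar> \<partial>lborel) = (\<integral>\<^sup>+x. ennreal \<bar>f x - s i x\<bar> \<partial>lborel)"
      by (rule nn_integral_translate) simp
    also have "(\<integral>\<^sup>+x. ennreal \<bar>f x - s i x\<bar> \<partial>lborel) + ((\<integral>\<^sup>+x. ennreal \<bar>s i (x + z) - s i x\<bar> \<partial>lborel) + (\<integral>\<^sup>+x. ennreal \<bar>f x - s i x\<bar> \<partial>lborel))
        \<le> ennreal (e / 3) + (ennreal (e / 3) + ennreal (e / 3))"
      using i d(2)[OF z] by (intro add_mono) auto
    also have "\<dots> = ennreal e" using lim.prems by (simp flip: ennreal_plus)
    finally show ?thesis .
  qed
  then show ?case using d(1) by blast
qed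

lemma mollifier_facts:
  assumes "mollifier r K"
  shows "nice_kernel r K" "0 \<le> K z" "K z \<noteq> 0 \<Longrightarrow> norm z < r" "integrable lborel K" "K \<in> borel_measurable borel"
    "(\<integral>\<^sup>+z. ennreal (K z) \<partial>lborel) = 1"
    "integrable lborel (\<lambda>y. K (x - y))" "(LINT y|lborel. K (x - y)) = 1"
proof -
  show n: "nice_kernel r K" by (rule mollifier_nice[OF assms])
  show nn: "0 \<le> K z" for z using assms by (simp add: mollifier_def)
  show "K z \<noteq> 0 \<Longrightarrow> norm z < r" using assms by (force simp: mollifier_def)
  show i: "integrable lborel K" using assms by (simp add: mollifier_def)
  show m[measurable]: "K \<in> borel_measurable borel" using borel_measurable_integrable[OF i] by simp
  show 1: "(\<integral>\<^sup>+z. ennreal (K z) \<partial>lborel) = 1"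
    using nn_integral_eq_integral[OF i] nn assms by (simp add: mollifier_def)
  have "(\<integral>\<^sup>+y. ennreal (K (x - y)) \<partial>lborel) = (\<integral>\<^sup>+y. ennreal (K (- (y + (- x)))) \<partial>lborel)" by simp
  also have "\<dots> = (\<integral>\<^sup>+y. ennreal (K (- y)) \<partial>lborel)" by (rule nn_integral_translate) simp
  also have "\<dots> = 1" using nn_integral_reflect[of "\<lambda>z. ennreal (K z)"] 1 by simp
  finally have 2: "(\<integral>\<^sup>+y. ennreal (K (x - y)) \<partial>lborel) = ennreal 1" by simp
  show 3: "integrable lborel (\<lambda>y. K (x - y))"
    by (rule integrableI_nn_integral_finite[OF _ _ 2]) (use nn in auto)
  show "(LINT y|lborel. K (x - y)) = 1"
    by (rule integral_eq_nn_integral[THEN trans]) (use nn 2 in auto)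
qed

text \<open>The error is an average, with weights given by the kernel, of the L^1 distances between
  \<open>h\<close> and its translates by less than \<open>r\<close>.\<close>

lemma conv_L1_close:
  fixes h :: "real^'n::finite \<Rightarrow> real"
  assumes K: "mollifier r K" and h: "integrable lborel h"
    and tr: "\<And>z. norm z < r \<Longrightarrow> (\<integral>\<^sup>+x. ennreal \<bar>h (x + z) - h x\<bar> \<partial>lborel) \<le> ennreal e"
  shows "(\<integral>\<^sup>+x. ennreal \<bar>conv K h x - h x\<bar> \<partial>lborel) \<le> ennreal e"
proof -
  note m = mollifier_facts[OF K]
  have [measurable]: "K \<in> borel_measurable borel" "h \<in> borel_measurable borel"
    using m(5) borel_measurable_integrable[OF h] by auto
  have pt: "ennreal \<bar>conv K h x - h x\<bar> \<le> (\<integral>\<^sup>+z. ennreal (K (- z) * \<bar>h (x + z) - h x\<bar>) \<partial>lborel)" for x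
  proof -
    have i1: "integrable lborel (\<lambda>y. K (x - y) * h y)" by (rule conv_integrable[OF m(1) h])
    have i2: "integrable lborel (\<lambda>y. K (x - y) * h x)" using m(7) by (rule integrable_mult_left)
    have i3: "integrable lborel (\<lambda>y. K (x - y) * (h y - h x))"
      using Bochner_Integration.integrable_diff[OF i1 i2] by (simp add: right_diff_distrib)
    have "conv K h x - h x = (LINT y|lborel. K (x - y) * h y) - (LINT y|lborel. K (x - y) * h x)"
      using m(8) by (simp add: conv_def)
    also have "\<dots> = (LINT y|lborel. K (x - y) * h y - K (x - y) * h x)"
      by (rule Bochner_Integration.integral_diff[OF i1 i2, symmetric])
    finally have "conv K h x - h x = (LINT y|lborel. K (x - y) * (h y - h x))" by (simp add: right_diff_distrib)
    then have "ennreal \<bar>conv K h x - h x\<bar> \<le> (\<integral>\<^sup>+y. ennreal (norm (K (x - y) * (h y - h x))) \<partial>lborel)"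
      using integral_norm_bound_ennreal[OF i3] by simp
    also have "\<dots> = (\<integral>\<^sup>+y. ennreal (K (x - y) * \<bar>h y - h x\<bar>) \<partial>lborel)"
      using m(2) by (simp add: abs_mult)
    also have "\<dots> = (\<integral>\<^sup>+z. ennreal (K (x - (z + x)) * \<bar>h (z + x) - h x\<bar>) \<partial>lborel)"
      by (rule nn_integral_translate[symmetric]) simp
    finally show ?thesis by (simp add: add.commute)
  qed
  have "(\<integral>\<^sup>+x. ennreal \<bar>conv K h x - h x\<bar> \<partial>lborel)
      \<le> (\<integral>\<^sup>+x. (\<integral>\<^sup>+z. ennreal (K (- z) * \<bar>h (x + z) - h x\<bar>) \<partial>lborel) \<partial>lborel)"
    by (rule nn_integral_mono) (rule pt)
  also have "\<dots> = (\<integral>\<^sup>+z. (\<integral>\<^sup>+x. ennreal (K (- z) * \<bar>h (x + z) - h x\<bar>) \<partial>lborel) \<partial>lborel)"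
    by (rule lborel_pair.Fubini') simp
  also have "\<dots> = (\<integral>\<^sup>+z. ennreal (K (- z)) * (\<integral>\<^sup>+x. ennreal \<bar>h (x + z) - h x\<bar> \<partial>lborel) \<partial>lborel)"
    using m(2) by (simp add: ennreal_mult nn_integral_cmult)
  also have "\<dots> \<le> (\<integral>\<^sup>+z. ennreal (K (- z)) * ennreal e \<partial>lborel)"
  proof (rule nn_integral_mono)
    fix z
    show "ennreal (K (- z)) * (\<integral>\<^sup>+x. ennreal \<bar>h (x + z) - h x\<bar> \<partial>lborel) \<le> ennreal (K (- z)) * ennreal e"
    proof (cases "K (- z) = 0")
      case False
      then have "norm z < r" using m(3)[of "- z"] by simp
      then show ?thesis using tr by (intro mult_left_mono) auto
    qed simp
  qed
  also have "\<dots> = (\<integral>\<^sup>+z. ennreal (K (- z)) \<partial>lborel) * ennreal e"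
    by (rule nn_integral_multc) simp
  also have "\<dots> = ennreal e" using nn_integral_reflect[of "\<lambda>z. ennreal (K z)"] m(6) by simp
  finally show ?thesis .
qed

lemma power_tangent_le:
  fixes a m :: real
  assumes "0 \<le> a" "0 \<le> m" "0 < n"
  shows "m ^ n + real n * m ^ (n - 1) * (a - m) \<le> a ^ n"
proof (cases "m = 0")
  case True
  then show ?thesis using assms by (cases "n = 1") (auto simp: power_0_left)
next
  case False
  then have m: "0 < m" using assms by simp
  have "1 + real n * (a / m - 1) \<le> (1 + (a / m - 1)) ^ n"
    using assms m by (intro Bernoulli_inequality) auto
  then have "m ^ n * (1 + real n * (a / m - 1)) \<le> m ^ n * (a / m) ^ n"
    using m by (intro mult_left_mono) auto
  moreover have "m ^ n * (a / m) ^ n = a ^ n" using m by (simp add: power_divide)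
  moreover have "m ^ n * (1 + real n * (a / m - 1)) = m ^ n + real n * m ^ (n - 1) * (a - m)"
  proof -
    have "m ^ n = m ^ (n - 1) * m" using assms(3) by (simp flip: power_Suc2)
    then show ?thesis using m by (simp add: field_simps)
  qed
  ultimately show ?thesis by simp
qed

text \<open>Jensen's inequality, obtained by integrating the tangent line of the power at the mean
  \<open>m\<close> against the kernel.\<close>

lemma conv_power_le:
  fixes P :: "real^'n::finite \<Rightarrow> real"
  assumes K: "mollifier r K" and P: "integrable lborel P" "\<And>y. 0 \<le> P y"
    and Pn: "integrable lborel (\<lambda>y. P y ^ n)" and n: "0 < n"
  shows "conv K P x ^ n \<le> conv K (\<lambda>y. P y ^ n) x"
proof -
  note k = mollifier_facts[OF K]
  define m where "m = conv K P x"
  have m0: "0 \<le> m" unfolding m_def conv_def using k(2) P(2) by simp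
  let ?c = "real n * m ^ (n - 1)"
  have i1: "integrable lborel (\<lambda>y. K (x - y) * P y)" by (rule conv_integrable[OF k(1) P(1)])
  have i2: "integrable lborel (\<lambda>y. K (x - y) * (m ^ n - ?c * m))" using k(7) by (rule integrable_mult_left)
  have i3: "integrable lborel (\<lambda>y. ?c * (K (x - y) * P y))" using i1 by (rule integrable_mult_right)
  have "m ^ n = (LINT y|lborel. K (x - y) * (m ^ n - ?c * m)) + (LINT y|lborel. ?c * (K (x - y) * P y))"
    using k(8) by (simp add: m_def conv_def)
  also have "\<dots> = (LINT y|lborel. K (x - y) * (m ^ n - ?c * m) + ?c * (K (x - y) * P y))"
    by (rule Bochner_Integration.integral_add[OF i2 i3, symmetric])
  also have "\<dots> \<le> (LINT y|lborel. K (x - y) * P y ^ n)"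
  proof (rule integral_mono)
    show "integrable lborel (\<lambda>y. K (x - y) * (m ^ n - ?c * m) + ?c * (K (x - y) * P y))"
      by (rule Bochner_Integration.integrable_add[OF i2 i3])
    show "integrable lborel (\<lambda>y. K (x - y) * P y ^ n)" by (rule conv_integrable[OF k(1) Pn])
    fix y
    have "K (x - y) * (m ^ n + ?c * (P y - m)) \<le> K (x - y) * P y ^ n"
      using power_tangent_le[OF P(2) m0 n] k(2) by (intro mult_left_mono) auto
    then show "K (x - y) * (m ^ n - ?c * m) + ?c * (K (x - y) * P y) \<le> K (x - y) * P y ^ n"
      by (simp add: algebra_simps)
  qed
  finally show ?thesis by (simp add: m_def conv_def)
qed

text \<open>Tonelli's theorem together with the unit mass of the kernel.\<close>

lemma
  fixes q :: "real^'n::finite \<Rightarrow> real"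
  assumes K: "mollifier r K" and q: "integrable lborel q" "\<And>y. 0 \<le> q y"
  shows conv_L1: "integrable lborel (conv K q)" and integral_conv: "(LINT x|lborel. conv K q x) = (LINT y|lborel. q y)"
proof -
  note k = mollifier_facts[OF K]
  have [measurable]: "K \<in> borel_measurable borel" "q \<in> borel_measurable borel"
    using k(5) borel_measurable_integrable[OF q(1)] by auto
  have [measurable]: "conv K q \<in> borel_measurable borel"
    using Ck_on_2_imp_continuous_on[OF Ck_on_2_conv[OF k(1) q(1)]] by (rule borel_measurable_continuous_onI)
  have nn: "0 \<le> conv K q x" for x unfolding conv_def using k(2) q(2) by simp
  have "ennreal (conv K q x) = (\<integral>\<^sup>+y. ennreal (K (x - y) * q y) \<partial>lborel)" for x
    unfolding conv_def by (rule nn_integral_eq_integral[symmetric]) (use conv_integrable[OF k(1) q(1)] k(2) q(2) in auto)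
  then have "(\<integral>\<^sup>+x. ennreal (conv K q x) \<partial>lborel) = (\<integral>\<^sup>+x. (\<integral>\<^sup>+y. ennreal (K (x - y) * q y) \<partial>lborel) \<partial>lborel)"
    by simp
  also have "\<dots> = (\<integral>\<^sup>+y. (\<integral>\<^sup>+x. ennreal (K (x - y) * q y) \<partial>lborel) \<partial>lborel)"
    by (rule lborel_pair.Fubini') simp
  also have "\<dots> = (\<integral>\<^sup>+y. (\<integral>\<^sup>+x. ennreal (K (x + (- y))) \<partial>lborel) * ennreal (q y) \<partial>lborel)"
    using k(2) q(2) by (simp add: ennreal_mult nn_integral_multc)
  also have "\<dots> = (\<integral>\<^sup>+y. ennreal (q y) \<partial>lborel)"
    using k(6) by (subst nn_integral_translate[of "\<lambda>x. ennreal (K x)"]) auto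
  also have "\<dots> = ennreal (LINT y|lborel. q y)"
    by (rule nn_integral_eq_integral) (use q in auto)
  finally have e: "(\<integral>\<^sup>+x. ennreal (conv K q x) \<partial>lborel) = ennreal (LINT y|lborel. q y)" .
  show "integrable lborel (conv K q)"
    by (rule integrableI_nn_integral_finite[OF _ _ e]) (use nn in auto)
  show "(LINT x|lborel. conv K q x) = (LINT y|lborel. q y)"
    by (rule integral_eq_nn_integral[THEN trans]) (use nn e q in auto)
qed

section \<open>Approximation of strong solutions\<close>

lemma set_integrable_of_in_Lp_1:
  fixes g :: "'a::euclidean_space \<Rightarrow> real"
  assumes "in_Lp 1 N g" shows "set_integrable lebesgue N g"
proof -
  have m: "(\<lambda>x. indicator N x *\<^sub>R g x) \<in> borel_measurable lebesgue"
    and i: "integrable lebesgue (\<lambda>x. indicator N x *\<^sub>R \<bar>g x\<bar>)"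
    using assms by (auto simp: in_Lp_def set_borel_measurable_def set_integrable_def)
  show ?thesis
    unfolding set_integrable_def
    by (rule Bochner_Integration.integrable_bound[OF i m]) (auto simp: indicator_def)
qed

text \<open>Convolutions and iterated integrals are formed with \<open>lborel\<close>; Lebesgue
  measurable data enter through such Borel representatives.\<close>

lemma borel_version:
  fixes g :: "'a::euclidean_space \<Rightarrow> real"
  assumes "set_integrable lebesgue N g"
  obtains h where "integrable lborel h" "AE y in lborel. h y = indicator N y * g y"
proof -
  let ?g = "\<lambda>x. indicator N x *\<^sub>R g x"
  have i: "integrable lebesgue ?g" using assms by (simp add: set_integrable_def)
  then obtain h where h: "h \<in> borel_measurable lborel" "AE y in lborel. ?g y = h y"
    using completion_ex_borel_measurable_real[of ?g lborel] borel_measurable_integrable by blast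
  have "integrable lebesgue h"
  proof (rule integrable_cong_AE_imp[OF i])
    show "h \<in> borel_measurable lebesgue" using h(1) by (rule measurable_completion)
    show "AE x in lebesgue. ?g x = h x" using h(2) by (simp add: AE_completion_iff)
  qed
  then have "integrable lborel h" using integrable_completion[OF h(1)] by simp
  then show thesis using that[of h] h(2) by (simp add: eq_commute)
qed

lemma conv_borel_version:
  fixes g h :: "real^'n::finite \<Rightarrow> real"
  assumes K: "nice_kernel r K" and x: "cball x r \<subseteq> N" and N: "N \<subseteq> \<Omega>"
    and h: "integrable lborel h" "AE y in lborel. h y = indicator N y * g y"
  shows "(LINT y:\<Omega>|lebesgue. g y * K (x - y)) = conv K h x"
proof -
  note c = conv_integrable[OF K h(1)]
  have b: "(\<lambda>y. K (x - y) * h y) \<in> borel_measurable lborel" using c by (rule borel_measurable_integrable)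
  have ae: "AE y in lebesgue. K (x - y) * h y = indicator \<Omega> y *\<^sub>R (g y * K (x - y))"
    unfolding AE_completion_iff using h(2)
  proof eventually_elim
    case (elim y)
    show ?case
    proof (cases "y \<in> N")
      case True
      then show ?thesis using elim N by (auto simp: indicator_def)
    next
      case False
      then have "r < norm (x - y)" using x by (auto simp: dist_norm not_le[symmetric])
      then show ?thesis using K by (simp add: nice_kernel_def)
    qed
  qed
  have "conv K h x = (LINT y|lebesgue. K (x - y) * h y)"
    unfolding conv_def by (rule integral_completion[OF b, symmetric])
  also have "\<dots> = (LINT y|lebesgue. indicator \<Omega> y *\<^sub>R (g y * K (x - y)))"
  proof (rule integral_cong_AE[OF _ _ ae])
    show m: "(\<lambda>y. K (x - y) * h y) \<in> borel_measurable lebesgue" by (rule measurable_completion[OF b])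
    show "(\<lambda>y. indicator \<Omega> y *\<^sub>R (g y * K (x - y))) \<in> borel_measurable lebesgue"
      by (rule borel_measurable_AE[OF m ae])
  qed
  finally show ?thesis by (simp add: set_lebesgue_integral_def)
qed

lemma mollifier_L1_radius:
  fixes h :: "real^'n::finite \<Rightarrow> real"
  assumes "integrable lborel h" "0 < e"
  obtains r0 where "0 < r0"
    "\<And>r K. r \<le> r0 \<Longrightarrow> mollifier r K \<Longrightarrow> (\<integral>\<^sup>+x. ennreal \<bar>conv K h x - h x\<bar> \<partial>lborel) \<le> ennreal e"
proof -
  obtain d where d: "0 < d" "\<And>z. norm z < d \<Longrightarrow> (\<integral>\<^sup>+x. ennreal \<bar>h (x + z) - h x\<bar> \<partial>lborel) \<le> ennreal e"
    using L1_translation_continuous[OF assms] by blast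
  have "(\<integral>\<^sup>+x. ennreal \<bar>conv K h x - h x\<bar> \<partial>lborel) \<le> ennreal e" if "r \<le> d" "mollifier r K" for r K
    by (rule conv_L1_close[OF that(2) assms(1)]) (use that(1) d(2) in auto)
  then show thesis using that d(1) by blast
qed

text \<open>Taking \<open>\<delta>\<close> as powers of 1/2, the levels grow like
  \<open>2 ^ (6 * k)\<close> and the measures decay like \<open>1 / 2 ^ k\<close>. Any power below
  1/6 gives a convergent geometric series; the power 1/12 makes its ratio
  \<open>1 / sqrt 2\<close>.\<close>

lemma weak_type_imp_Lp:
  fixes g :: "'a::euclidean_space \<Rightarrow> real"
  assumes \<Omega>: "\<Omega> \<in> lmeasurable" and m: "set_borel_measurable lebesgue \<Omega> g" and g: "\<And>x. 0 \<le> g x"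
    and A: "0 < A" and B: "0 \<le> B"
    and w: "\<And>\<delta>. 0 < \<delta> \<Longrightarrow> \<delta> \<le> 1 \<Longrightarrow> measure lebesgue {x \<in> \<Omega>. A / \<delta> ^ 6 < g x} \<le> B * \<delta>"
  shows "set_integrable lebesgue \<Omega> (\<lambda>x. g x powr (1 / 12))"
    and "(LINT x:\<Omega>|lebesgue. g x powr (1 / 12)) \<le> A powr (1 / 12) * (measure lebesgue \<Omega> + B * (sqrt 2 / (1 - 1 / sqrt 2)))"
proof -
  have \<Omega>s: "\<Omega> \<in> sets lebesgue" and fin: "emeasure lebesgue \<Omega> < \<infinity>" using \<Omega> by (auto simp: fmeasurable_def)
  let ?g = "\<lambda>x. indicator \<Omega> x *\<^sub>R g x"
  have gm[measurable]: "?g \<in> borel_measurable lebesgue" using m by (simp add: set_borel_measurable_def)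
  define E where "E k = {x \<in> \<Omega>. A * 2 ^ (6 * k) < g x}" for k :: nat
  have Es: "E k \<in> sets lebesgue" for k
  proof -
    have "{x \<in> space lebesgue. A * 2 ^ (6 * k) < ?g x} \<in> sets lebesgue" by measurable
    moreover have "E k = {x \<in> space lebesgue. A * 2 ^ (6 * k) < ?g x}"
    proof -
      have "0 < A * 2 ^ (6 * k)" using A by simp
      then have "\<not> A * 2 ^ (6 * k) < 0" by linarith
      then show ?thesis by (auto simp: E_def indicator_def)
    qed
    ultimately show ?thesis by simp
  qed
  have Em: "measure lebesgue (E k) \<le> B / 2 ^ k" for k
  proof -
    have "A / (1 / 2 ^ k) ^ 6 = A * 2 ^ (6 * k)" by (simp add: power_divide power_mult mult.commute[of 6])
    then show ?thesis using w[of "1 / 2 ^ k"] by (simp add: E_def)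
  qed
  have Ee: "emeasure lebesgue (E k) \<le> ennreal (B / 2 ^ k)" for k
  proof -
    have "E k \<in> lmeasurable" using fmeasurableI2[OF \<Omega> _ Es] by (auto simp: E_def)
    then show ?thesis using Em[of k] by (simp add: emeasure_eq_measure2 ennreal_leI)
  qed
  define a where "a = A powr (1 / 12)"
  have a: "0 < a" using A by (simp add: a_def)
  have pt: "ennreal (indicator \<Omega> x *\<^sub>R g x powr (1 / 12))
      \<le> ennreal a * indicator \<Omega> x + (\<Sum>k. ennreal (a * sqrt 2 ^ (k + 1)) * indicator (E k) x)" for x
  proof (cases "x \<in> \<Omega>")
    case x: True
    show ?thesis
    proof (cases "g x \<le> A")
      case True
      then have "g x powr (1 / 12) \<le> a" using g[of x] by (simp add: a_def powr_mono2)
      then have "ennreal (g x powr (1 / 12)) \<le> ennreal a + 0" by (simp add: ennreal_leI)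
      also have "\<dots> \<le> ennreal a + (\<Sum>k. ennreal (a * sqrt 2 ^ (k + 1)) * indicator (E k) x)"
        by (intro add_left_mono) simp
      finally show ?thesis using x by simp
    next
      case False
      \<comment> \<open>The least such \<open>k\<close> places \<open>g x\<close> between
        consecutive levels, so the single term with index \<open>k\<close> of the series already
        dominates.\<close>
      define k where "k = (LEAST k. g x \<le> A * 2 ^ (6 * (k + 1)))"
      have "\<exists>k. g x \<le> A * 2 ^ (6 * (k + 1))"
      proof -
        obtain j where j: "g x / A < 2 ^ j" using real_arch_pow[of 2 "g x / A"] by auto
        have "(2 :: real) ^ j \<le> 2 ^ (6 * (j + 1))" by (rule power_increasing) auto
        then have "g x / A \<le> 2 ^ (6 * (j + 1))" using j by linarith
        then show ?thesis using A by (auto simp: pos_divide_le_eq mult.commute)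
      qed
      then have k1: "g x \<le> A * 2 ^ (6 * (k + 1))" unfolding k_def by (rule LeastI_ex)
      have k2: "A * 2 ^ (6 * k) < g x"
      proof (cases k)
        case 0
        then show ?thesis using False by simp
      next
        case (Suc i)
        then have "\<not> g x \<le> A * 2 ^ (6 * (i + 1))" using not_less_Least[of i "\<lambda>k. g x \<le> A * 2 ^ (6 * (k + 1))"]
          unfolding k_def[symmetric] by simp
        then show ?thesis using Suc by simp
      qed
      have "g x powr (1 / 12) \<le> (A * 2 ^ (6 * (k + 1))) powr (1 / 12)"
        using k1 g[of x] by (intro powr_mono2) auto
      also have "\<dots> = a * (2 ^ (6 * (k + 1))) powr (1 / 12)" using A by (simp add: a_def powr_mult)
      also have "(2 ^ (6 * (k + 1))) powr (1 / 12) = sqrt 2 ^ (k + 1)"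
      proof -
        have "((2 :: real) ^ (6 * (k + 1))) powr (1 / 12) = (2 powr real (6 * (k + 1))) powr (1 / 12)"
          by (subst powr_realpow) auto
        also have "\<dots> = 2 powr (real (k + 1) * (1 / 2))"
        proof -
          have "real (6 * (k + 1)) * (1 / 12) = real (k + 1) * (1 / 2)" by simp
          then show ?thesis by (simp only: powr_powr)
        qed
        also have "\<dots> = (2 powr (1 / 2)) powr real (k + 1)" by (simp add: powr_powr mult.commute)
        also have "\<dots> = sqrt 2 ^ (k + 1)" by (simp only: powr_half_sqrt powr_realpow real_sqrt_gt_zero zero_less_numeral)
        finally show ?thesis .
      qed
      finally have "ennreal (g x powr (1 / 12)) \<le> ennreal (a * sqrt 2 ^ (k + 1)) * indicator (E k) x"
        using k2 x by (simp add: E_def ennreal_leI)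
      also have "\<dots> \<le> (\<Sum>k. ennreal (a * sqrt 2 ^ (k + 1)) * indicator (E k) x)"
      proof -
        define t where "t k = ennreal (a * sqrt 2 ^ (k + 1)) * indicator (E k) x" for k
        have "sum t {k} \<le> suminf t" by (rule sum_le_suminf) auto
        then have "t k \<le> suminf t" by simp
        then show ?thesis unfolding t_def[abs_def] .
      qed
      also have "\<dots> \<le> ennreal a * indicator \<Omega> x + \<dots>" by (rule add_increasing) auto
      finally show ?thesis using x by simp
    qed
  qed simp
  have s2: "0 < 1 - 1 / sqrt 2" by (simp add: field_simps)
  have "(\<integral>\<^sup>+x. ennreal (indicator \<Omega> x *\<^sub>R g x powr (1 / 12)) \<partial>lebesgue)
      \<le> (\<integral>\<^sup>+x. ennreal a * indicator \<Omega> x + (\<Sum>k. ennreal (a * sqrt 2 ^ (k + 1)) * indicator (E k) x) \<partial>lebesgue)"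
    by (rule nn_integral_mono) (rule pt)
  also have "\<dots> = (\<integral>\<^sup>+x. ennreal a * indicator \<Omega> x \<partial>lebesgue) + (\<integral>\<^sup>+x. (\<Sum>k. ennreal (a * sqrt 2 ^ (k + 1)) * indicator (E k) x) \<partial>lebesgue)"
    using \<Omega>s Es by (intro nn_integral_add) auto
  also have "(\<integral>\<^sup>+x. (\<Sum>k. ennreal (a * sqrt 2 ^ (k + 1)) * indicator (E k) x) \<partial>lebesgue)
      = (\<Sum>k. \<integral>\<^sup>+x. ennreal (a * sqrt 2 ^ (k + 1)) * indicator (E k) x \<partial>lebesgue)"
    using Es by (intro nn_integral_suminf) auto
  also have "\<dots> = (\<Sum>k. ennreal (a * sqrt 2 ^ (k + 1)) * emeasure lebesgue (E k))"
    using Es by (simp add: nn_integral_cmult_indicator)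
  also have "\<dots> \<le> (\<Sum>k. ennreal (a * B * sqrt 2 * (1 / sqrt 2) ^ k))"
  proof (rule suminf_le)
    fix k
    have "ennreal (a * sqrt 2 ^ (k + 1)) * emeasure lebesgue (E k) \<le> ennreal (a * sqrt 2 ^ (k + 1)) * ennreal (B / 2 ^ k)"
      by (rule mult_left_mono[OF Ee]) simp
    also have "\<dots> = ennreal (a * sqrt 2 ^ (k + 1) * (B / 2 ^ k))" using a B by (intro ennreal_mult[symmetric]) auto
    also have "a * sqrt 2 ^ (k + 1) * (B / 2 ^ k) = a * B * sqrt 2 * (1 / sqrt 2) ^ k"
    proof -
      have "(2 :: real) ^ k = sqrt 2 ^ k * sqrt 2 ^ k" by (simp flip: power_mult_distrib)
      then have "sqrt 2 ^ k / 2 ^ k = (1 / sqrt 2) ^ k" by (simp add: power_one_over)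
      then show ?thesis by (simp add: field_simps)
    qed
    finally show "ennreal (a * sqrt 2 ^ (k + 1)) * emeasure lebesgue (E k) \<le> ennreal (a * B * sqrt 2 * (1 / sqrt 2) ^ k)" .
  qed auto
  also have "\<dots> = ennreal (\<Sum>k. a * B * sqrt 2 * (1 / sqrt 2) ^ k)"
    using a B by (intro suminf_ennreal2 summable_mult summable_geometric) (auto simp: field_simps)
  also have "(\<Sum>k. a * B * sqrt 2 * (1 / sqrt 2) ^ k) = a * B * sqrt 2 * (1 / (1 - 1 / sqrt 2))"
    by (subst suminf_mult) (auto simp: suminf_geometric summable_geometric field_simps)
  also have "(\<integral>\<^sup>+x. ennreal a * indicator \<Omega> x \<partial>lebesgue) = ennreal (a * measure lebesgue \<Omega>)"
    using \<Omega> \<Omega>s a by (simp add: nn_integral_cmult_indicator emeasure_eq_measure2 ennreal_mult)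
  also have "ennreal (a * measure lebesgue \<Omega>) + ennreal (a * B * sqrt 2 * (1 / (1 - 1 / sqrt 2)))
      = ennreal (a * (measure lebesgue \<Omega> + B * (sqrt 2 / (1 - 1 / sqrt 2))))"
    using a B s2 by (subst ennreal_plus[symmetric]) (auto simp: algebra_simps intro!: mult_nonneg_nonneg divide_nonneg_pos)
  finally have bnd: "(\<integral>\<^sup>+x. ennreal (indicator \<Omega> x *\<^sub>R g x powr (1 / 12)) \<partial>lebesgue)
      \<le> ennreal (a * (measure lebesgue \<Omega> + B * (sqrt 2 / (1 - 1 / sqrt 2))))"
    by simp
  have pm: "(\<lambda>x. indicator \<Omega> x *\<^sub>R g x powr (1 / 12)) \<in> borel_measurable lebesgue"
  proof -
    have "(\<lambda>x. ?g x powr (1 / 12)) \<in> borel_measurable lebesgue" by measurable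
    moreover have "(\<lambda>x. ?g x powr (1 / 12)) = (\<lambda>x. indicator \<Omega> x *\<^sub>R g x powr (1 / 12))"
      by (auto simp: indicator_def)
    ultimately show ?thesis by simp
  qed
  show i: "set_integrable lebesgue \<Omega> (\<lambda>x. g x powr (1 / 12))"
    unfolding set_integrable_def
    using bnd by (intro integrableI_nonneg[OF pm]) (auto intro: le_less_trans)
  have "ennreal (LINT x:\<Omega>|lebesgue. g x powr (1 / 12)) = (\<integral>\<^sup>+x. ennreal (indicator \<Omega> x *\<^sub>R g x powr (1 / 12)) \<partial>lebesgue)"
    unfolding set_lebesgue_integral_def using i
    by (intro nn_integral_eq_integral[symmetric]) (auto simp: set_integrable_def)
  then have "ennreal (LINT x:\<Omega>|lebesgue. g x powr (1 / 12)) \<le> ennreal (a * (measure lebesgue \<Omega> + B * (sqrt 2 / (1 - 1 / sqrt 2))))"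
    using bnd by simp
  then show "(LINT x:\<Omega>|lebesgue. g x powr (1 / 12)) \<le> A powr (1 / 12) * (measure lebesgue \<Omega> + B * (sqrt 2 / (1 - 1 / sqrt 2)))"
    using a B s2 unfolding a_def[symmetric]
    by (subst (asm) ennreal_le_iff) (auto intro!: mult_nonneg_nonneg add_nonneg_nonneg divide_nonneg_pos)
qed

text \<open>Subtract the supporting plane at one boundary point. Condition (A3) and the diameter
  bound \<open>2 / \<rho>\<close> control the rest on the boundary, and convexity along a chord
  carries the bound inside.\<close>

lemma potential_affine_bound:
  fixes \<Omega> :: "(real^'n::finite) set"
  assumes dom: "bounded_convex_domain \<Omega>" and \<rho>: "0 < \<rho>"
    and A1: "cond_A1 \<rho> \<Omega>" and A2: "cond_A2 l L \<Omega> \<phi>" and A3: "cond_A3 \<rho> \<Omega> \<phi>"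
  obtains a s where "\<And>z. z \<in> \<Omega> \<Longrightarrow> 0 \<le> \<phi> z - a - s \<bullet> z \<and> \<phi> z - a - s \<bullet> z \<le> 4 / \<rho> ^ 3"
proof -
  have op: "open \<Omega>" and bd: "bounded \<Omega>" using dom by (auto simp: bounded_convex_domain_def)
  have cvx: "convex_on (closure \<Omega>) \<phi>" using A2 by (simp add: cond_A2_def)
  obtain x0 where x0: "x0 \<in> frontier \<Omega>" using cond_A1_facts(1)[OF dom \<rho> A1] by blast
  obtain s where s: "\<And>v. v \<in> closure \<Omega> \<Longrightarrow> \<phi> x0 + s \<bullet> (v - x0) \<le> \<phi> v"
    "\<And>v. v \<in> frontier \<Omega> \<Longrightarrow> \<phi> v - \<phi> x0 - s \<bullet> (v - x0) \<le> (1 / \<rho>) * (norm (v - x0))\<^sup>2"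
    using A3 x0 unfolding cond_A3_def boundary_slope_def by blast
  define F where "F v = \<phi> v - \<phi> x0 - s \<bullet> (v - x0)" for v
  have fc: "v \<in> closure \<Omega>" if "v \<in> frontier \<Omega>" for v using that by (simp add: frontier_def)
  have front: "F v \<le> 4 / \<rho> ^ 3" if v: "v \<in> frontier \<Omega>" for v
  proof -
    have "norm (v - x0) \<le> 2 / \<rho>" by (rule cond_A1_facts(3)[OF dom \<rho> A1 fc[OF v] fc[OF x0]])
    then have "(norm (v - x0))\<^sup>2 \<le> (2 / \<rho>)\<^sup>2" by (intro power_mono) auto
    then have "(1 / \<rho>) * (norm (v - x0))\<^sup>2 \<le> (1 / \<rho>) * (2 / \<rho>)\<^sup>2" using \<rho> by (intro mult_left_mono) auto
    also have "\<dots> = 4 / \<rho> ^ 3" by (simp add: power_divide power2_eq_square power3_eq_cube)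
    finally show ?thesis using s(2)[OF v] by (simp add: F_def)
  qed
  have "F z \<le> 4 / \<rho> ^ 3" if z: "z \<in> \<Omega>" for z
  proof -
    \<comment> \<open>An arbitrary coordinate; any chord through \<open>z\<close> would do.\<close>
    obtain k :: 'n where "k = k" by simp
    define e :: "real^'n" where "e = axis k 1"
    have e: "e \<noteq> 0" by (simp add: e_def axis_eq_0_iff)
    obtain d1 where d1: "0 < d1" "z + d1 *\<^sub>R e \<in> frontier \<Omega>"
      using ray_to_frontier[OF bd, of z e] z op e by (auto simp: interior_open)
    obtain d2 where d2: "0 < d2" "z + d2 *\<^sub>R (- e) \<in> frontier \<Omega>"
      using ray_to_frontier[OF bd, of z "- e"] z op e by (auto simp: interior_open)
    define \<theta> where "\<theta> = d1 / (d1 + d2)"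
    have \<theta>: "0 \<le> \<theta>" "\<theta> \<le> 1" using d1 d2 by (auto simp: \<theta>_def)
    let ?v = "z + d1 *\<^sub>R e" and ?w = "z + d2 *\<^sub>R (- e)"
    have "(1 - \<theta>) * d1 = \<theta> * d2" using d1 d2 by (simp add: \<theta>_def field_simps)
    moreover have "(1 - \<theta>) *\<^sub>R ?v + \<theta> *\<^sub>R ?w = z + ((1 - \<theta>) * d1 - \<theta> * d2) *\<^sub>R e"
      by (simp add: algebra_simps)
    ultimately have zeq: "(1 - \<theta>) *\<^sub>R ?v + \<theta> *\<^sub>R ?w = z" by simp
    have "\<phi> z \<le> (1 - \<theta>) * \<phi> ?v + \<theta> * \<phi> ?w"
      using convex_onD[OF cvx \<theta> fc[OF d1(2)] fc[OF d2(2)]] unfolding zeq .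
    moreover have "s \<bullet> (z - x0) = (1 - \<theta>) * (s \<bullet> (?v - x0)) + \<theta> * (s \<bullet> (?w - x0))"
    proof -
      have "z - x0 = (1 - \<theta>) *\<^sub>R (?v - x0) + \<theta> *\<^sub>R (?w - x0)"
        by (subst zeq[symmetric]) (simp add: algebra_simps)
      then show ?thesis by (simp only: inner_add_right inner_scaleR_right)
    qed
    ultimately have "F z \<le> (1 - \<theta>) * F ?v + \<theta> * F ?w"
      by (simp add: F_def right_diff_distrib left_diff_distrib)
    also have "\<dots> \<le> (1 - \<theta>) * (4 / \<rho> ^ 3) + \<theta> * (4 / \<rho> ^ 3)"
      using \<theta> front[OF d1(2)] front[OF d2(2)] by (intro add_mono mult_left_mono) auto
    also have "\<dots> = 4 / \<rho> ^ 3" by (simp add: left_diff_distrib flip: add_divide_distrib)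
    finally show ?thesis .
  qed
  moreover have "0 \<le> F z" if "z \<in> \<Omega>" for z
  proof -
    have "z \<in> closure \<Omega>" using that closure_subset by blast
    then show ?thesis using s(1) by (simp add: F_def algebra_simps)
  qed
  ultimately show thesis
    using that[of "\<phi> x0 - s \<bullet> x0" s] by (simp add: F_def inner_diff_right algebra_simps)
qed

lemma cball_subset_inner_part:
  fixes \<Omega> :: "'a::euclidean_space set"
  assumes "x \<in> closure (inner_part \<Omega> \<sigma>)" "r < \<sigma> / 2"
  shows "cball x r \<subseteq> inner_part \<Omega> (\<sigma> / 2)"
proof
  fix y assume y: "y \<in> cball x r"
  have "\<sigma> \<le> infdist x (- \<Omega>)" using assms(1) closure_inner_part by blast
  moreover have "infdist x (- \<Omega>) - infdist y (- \<Omega>) \<le> dist x y"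
    using infdist_triangle_abs[of x "- \<Omega>" y] by linarith
  ultimately show "y \<in> inner_part \<Omega> (\<sigma> / 2)" using y assms(2) by (simp add: inner_part_def)
qed

lemma conv_close:
  assumes K: "mollifier r K" and u: "integrable lborel u"
    and le: "\<And>y. norm (x - y) < r \<Longrightarrow> \<bar>u y - c\<bar> \<le> \<eta>"
  shows "\<bar>conv K u x - c\<bar> \<le> \<eta>"
proof -
  note m = mollifier_facts[OF K]
  have i1: "integrable lborel (\<lambda>y. K (x - y) * u y)" by (rule conv_integrable[OF m(1) u])
  have i2: "integrable lborel (\<lambda>y. K (x - y) * c)" "integrable lborel (\<lambda>y. K (x - y) * \<eta>)"
    using m(7) by (auto intro: integrable_mult_left)
  have "conv K u x - c = (LINT y|lborel. K (x - y) * u y - K (x - y) * c)"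
    using m(8) Bochner_Integration.integral_diff[OF i1 i2(1)] by (simp add: conv_def)
  also have "\<bar>\<dots>\<bar> \<le> (LINT y|lborel. K (x - y) * \<eta>)"
  proof (rule Bochner_Integration.integral_abs_bound_integral)
    show "integrable lborel (\<lambda>y. K (x - y) * u y - K (x - y) * c)"
      using i1 i2(1) by (rule Bochner_Integration.integrable_diff)
    fix y
    have "K (x - y) * \<bar>u y - c\<bar> \<le> K (x - y) * \<eta>"
      using m(2,3)[of "x - y"] le[of y] by (cases "K (x - y) = 0") (auto intro: mult_left_mono)
    then show "\<bar>K (x - y) * u y - K (x - y) * c\<bar> \<le> K (x - y) * \<eta>"
      using m(2)[of "x - y"] by (simp add: abs_mult flip: right_diff_distrib)
  qed (rule i2(2))
  also have "\<dots> = \<eta>" using m(8) by simp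
  finally show ?thesis .
qed

section \<open>Mollified solutions and uniqueness of weak Hessians\<close>

locale weak_solution =
  fixes \<Omega> :: "(real^'n::finite) set" and u :: "real^'n \<Rightarrow> real" and H :: "real^'n \<Rightarrow> real^'n^'n"
  assumes op\<Omega>: "open \<Omega>" and bd: "bounded \<Omega>" and ucont: "continuous_on (closure \<Omega>) u"
    and wh: "weak_hessian \<Omega> u H"
begin

text \<open>Extension by zero makes the convolution meaningful everywhere. At inner points a kernel
  of small radius never sees the jump.\<close>

definition u0 where "u0 y = indicator \<Omega> y * u y"

lemma u0_integrable: "integrable lborel u0"
proof -
  have "set_integrable lebesgue \<Omega> u"
    by (rule set_integrable_continuous_compact[OF _ ucont closure_subset])
      (use bd op\<Omega> in \<open>auto simp: compact_closure\<close>)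
  then have "integrable lebesgue u0" by (simp add: set_integrable_def u0_def[abs_def])
  moreover have "u0 \<in> borel_measurable lborel"
  proof -
    have "continuous_on \<Omega> u" using ucont closure_subset by (rule continuous_on_subset)
    then have "(\<lambda>y. indicator \<Omega> y *\<^sub>R u y) \<in> borel_measurable borel"
      using op\<Omega> by (intro borel_measurable_continuous_on_indicator) auto
    then show ?thesis by (simp add: u0_def[abs_def])
  qed
  ultimately show ?thesis using integrable_completion[of u0 lborel] by simp
qed

lemma H_integrable:
  assumes "compact N" "N \<subseteq> \<Omega>" shows "set_integrable lebesgue N (\<lambda>x. H x $ i $ j)"
  using wh assms unfolding weak_hessian_def weak_partial_def in_Lp_loc_def
  by (blast intro: set_integrable_of_in_Lp_1)

lemma closure_inner_part_compact: "compact (closure (inner_part \<Omega> \<sigma>))" if "0 \<le> \<sigma>"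
proof -
  have "bounded (inner_part \<Omega> \<sigma>)" using bd inner_part_subset[OF that] by (rule bounded_subset)
  then show ?thesis by (simp add: compact_closure)
qed

lemma closure_inner_part_subset': "closure (inner_part \<Omega> \<sigma>) \<subseteq> \<Omega>" if "0 < \<sigma>"
  using closure_inner_part_subset[OF that] inner_part_subset[of 0 \<Omega>] by blast

lemma hessian_mollified:
  assumes K: "mollifier r K" and x: "x \<in> closure (inner_part \<Omega> \<sigma>)" and r: "r < \<sigma> / 2" "0 < \<sigma>"
    and h: "integrable lborel h" "AE y in lborel. h y = indicator (closure (inner_part \<Omega> (\<sigma> / 2))) y * H y $ i $ j"
  shows "hessian (conv K u0) x $ i $ j = conv K h x"
proof -
  let ?N = "closure (inner_part \<Omega> (\<sigma> / 2))"
  have N: "cball x r \<subseteq> ?N" "?N \<subseteq> \<Omega>"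
    using cball_subset_inner_part[OF x r(1)] closure_subset closure_inner_part_subset'[of "\<sigma> / 2"] r by auto
  then have x\<Omega>: "cball x r \<subseteq> \<Omega>" by blast
  have "hessian (conv K (\<lambda>y. indicator \<Omega> y * u y)) x $ i $ j = (LINT y:\<Omega>|lebesgue. H y $ i $ j * K (x - y))"
    by (rule weak_hessian_mollified[OF mollifier_nice[OF K] x\<Omega> wh])
      (use u0_integrable in \<open>simp add: u0_def[abs_def]\<close>)
  also have "\<dots> = conv K h x"
    by (rule conv_borel_version[OF mollifier_nice[OF K] N h])
  finally show ?thesis by (simp add: u0_def[abs_def])
qed

end

text \<open>Both versions have the same mollification on inner parts, namely the Hessian of the
  mollified function, and mollifications converge in L^1.\<close>

lemma weak_hessian_unique:
  fixes u :: "real^'n::finite \<Rightarrow> real"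
  assumes 1: "weak_solution \<Omega> u H" and 2: "weak_solution \<Omega> u H'"
  shows "AE x in lebesgue. x \<in> \<Omega> \<longrightarrow> H x $ i $ j = H' x $ i $ j"
proof -
  interpret A: weak_solution \<Omega> u H by (rule 1)
  interpret B: weak_solution \<Omega> u H' by (rule 2)
  have AU: "AE x in lebesgue. x \<in> inner_part \<Omega> \<sigma> \<longrightarrow> H x $ i $ j = H' x $ i $ j" if \<sigma>: "0 < \<sigma>" for \<sigma>
  proof -
    let ?N = "closure (inner_part \<Omega> (\<sigma> / 2))" and ?U = "inner_part \<Omega> \<sigma>"
    have N: "compact ?N" "?N \<subseteq> \<Omega>"
      using A.closure_inner_part_compact[of "\<sigma> / 2"] A.closure_inner_part_subset'[of "\<sigma> / 2"] \<sigma> by auto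
    obtain h where h: "integrable lborel h" "AE y in lborel. h y = indicator ?N y * H y $ i $ j"
      using borel_version[OF A.H_integrable[OF N]] .
    obtain h' where h': "integrable lborel h'" "AE y in lborel. h' y = indicator ?N y * H' y $ i $ j"
      using borel_version[OF B.H_integrable[OF N]] .
    have [measurable]: "h \<in> borel_measurable borel" "h' \<in> borel_measurable borel"
      using borel_measurable_integrable[OF h(1)] borel_measurable_integrable[OF h'(1)] by auto
    have [measurable]: "?U \<in> sets borel" using open_inner_part by (rule borel_open)
    have small: "(\<integral>\<^sup>+x. indicator ?U x * ennreal \<bar>h x - h' x\<bar> \<partial>lborel) \<le> ennreal e" if e: "0 < e" for e
    proof -
      obtain r1 where r1: "0 < r1" "\<And>r K. r \<le> r1 \<Longrightarrow> mollifier r K \<Longrightarrow> (\<integral>\<^sup>+x. ennreal \<bar>conv K h x - h x\<bar> \<partial>lborel) \<le> ennreal (e / 2)"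
        using mollifier_L1_radius[OF h(1), of "e / 2"] e by (metis half_gt_zero)
      obtain r2 where r2: "0 < r2" "\<And>r K. r \<le> r2 \<Longrightarrow> mollifier r K \<Longrightarrow> (\<integral>\<^sup>+x. ennreal \<bar>conv K h' x - h' x\<bar> \<partial>lborel) \<le> ennreal (e / 2)"
        using mollifier_L1_radius[OF h'(1), of "e / 2"] e by (metis half_gt_zero)
      define r where "r = min (min r1 r2) (\<sigma> / 3)"
      have r: "0 < r" "r \<le> r1" "r \<le> r2" "r < \<sigma> / 2" using r1(1) r2(1) \<sigma> by (auto simp: r_def)
      obtain K :: "real^'n \<Rightarrow> real" where K: "mollifier r K" using exists_mollifier[OF r(1)] by blast
      have [measurable]: "conv K h \<in> borel_measurable borel" "conv K h' \<in> borel_measurable borel"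
        using Ck_on_2_imp_continuous_on[OF Ck_on_2_conv[OF mollifier_nice[OF K] h(1)]]
          Ck_on_2_imp_continuous_on[OF Ck_on_2_conv[OF mollifier_nice[OF K] h'(1)]]
        by (auto intro: borel_measurable_continuous_onI)
      have pt: "indicator ?U x * ennreal \<bar>h x - h' x\<bar> \<le> ennreal \<bar>conv K h x - h x\<bar> + ennreal \<bar>conv K h' x - h' x\<bar>" for x
      proof (cases "x \<in> ?U")
        case True
        then have xc: "x \<in> closure ?U" using closure_subset by blast
        have "conv K h x = conv K h' x"
          using A.hessian_mollified[OF K xc r(4) \<sigma> h] B.hessian_mollified[OF K xc r(4) \<sigma> h'] by simp
        then have "\<bar>h x - h' x\<bar> \<le> \<bar>conv K h x - h x\<bar> + \<bar>conv K h' x - h' x\<bar>" by linarith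
        then show ?thesis using True by (simp add: ennreal_leI flip: ennreal_plus)
      qed simp
      have "(\<integral>\<^sup>+x. indicator ?U x * ennreal \<bar>h x - h' x\<bar> \<partial>lborel)
          \<le> (\<integral>\<^sup>+x. ennreal \<bar>conv K h x - h x\<bar> + ennreal \<bar>conv K h' x - h' x\<bar> \<partial>lborel)"
        by (rule nn_integral_mono) (rule pt)
      also have "\<dots> = (\<integral>\<^sup>+x. ennreal \<bar>conv K h x - h x\<bar> \<partial>lborel) + (\<integral>\<^sup>+x. ennreal \<bar>conv K h' x - h' x\<bar> \<partial>lborel)"
        by (rule nn_integral_add) auto
      also have "\<dots> \<le> ennreal (e / 2) + ennreal (e / 2)"
        by (rule add_mono[OF r1(2)[OF r(2) K] r2(2)[OF r(3) K]])
      also have "\<dots> = ennreal e" using e by (simp flip: ennreal_plus)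
      finally show ?thesis .
    qed
    have "(\<integral>\<^sup>+x. indicator ?U x * ennreal \<bar>h x - h' x\<bar> \<partial>lborel) = 0"
    proof -
      have "(\<integral>\<^sup>+x. indicator ?U x * ennreal \<bar>h x - h' x\<bar> \<partial>lborel) \<le> 0"
        by (rule ennreal_le_epsilon) (simp add: small)
      then show ?thesis by simp
    qed
    then have "AE x in lborel. indicator ?U x * ennreal \<bar>h x - h' x\<bar> = 0"
      by (subst (asm) nn_integral_0_iff_AE) auto
    then have "AE x in lborel. x \<in> ?U \<longrightarrow> H x $ i $ j = H' x $ i $ j"
      using h(2) h'(2)
    proof eventually_elim
      case (elim x)
      show ?case
      proof
        assume x: "x \<in> ?U"
        then have "x \<in> ?N" using inner_part_mono[of "\<sigma> / 2" \<sigma> \<Omega>] \<sigma> closure_subset by fastforce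
        then show "H x $ i $ j = H' x $ i $ j" using elim x by (simp add: indicator_def)
      qed
    qed
    then show ?thesis by (simp add: AE_completion_iff)
  qed
  \<comment> \<open>Countably many inner parts exhaust \<open>\<Omega>\<close>, so the exceptional
    null sets can be united.\<close>
  have "AE x in lebesgue. \<forall>k. x \<in> inner_part \<Omega> (1 / real (Suc k)) \<longrightarrow> H x $ i $ j = H' x $ i $ j"
    unfolding AE_all_countable using AU by simp
  then show ?thesis
  proof eventually_elim
    case (elim x)
    show ?case
    proof
      assume x: "x \<in> \<Omega>"
      have "\<Omega> \<noteq> UNIV" using A.bd by (metis not_bounded_UNIV)
      moreover obtain r where r: "0 < r" "ball x r \<subseteq> \<Omega>" using A.op\<Omega> x unfolding open_contains_ball by blast
      ultimately have "r \<le> infdist x (- \<Omega>)" by (intro le_infdist_compl)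
      moreover obtain k where "inverse (real (Suc k)) < r" using reals_Archimedean[OF r(1)] by blast
      ultimately have "x \<in> inner_part \<Omega> (1 / real (Suc k))" by (simp add: inner_part_def inverse_eq_divide)
      then show "H x $ i $ j = H' x $ i $ j" using elim by blast
    qed
  qed
qed

text \<open>The Sobolev condition provides some version of the Hessian in L^n on compact subsets;
  uniqueness transfers this to the version \<open>H\<close> for which the equation is
  stated.\<close>

lemma weak_hessian_sum_Ln:
  fixes u :: "real^'n::finite \<Rightarrow> real"
  assumes ws: "weak_solution \<Omega> u H" and W: "in_W2_loc (real CARD('n)) \<Omega> u" and N: "compact N" "N \<subseteq> \<Omega>"
  shows "set_integrable lebesgue N (\<lambda>x. (\<Sum>i\<in>UNIV. \<Sum>j\<in>UNIV. \<bar>H x $ i $ j\<bar>) ^ CARD('n))"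
proof -
  let ?S = "\<lambda>A :: real^'n^'n. \<Sum>i\<in>UNIV. \<Sum>j\<in>UNIV. \<bar>A $ i $ j\<bar>"
  obtain H' where wh': "weak_hessian \<Omega> u H'" and Ln: "in_Lp_loc (real CARD('n)) \<Omega> H'"
    using W by (auto simp: in_W2_loc_def)
  interpret weak_solution \<Omega> u H by (rule ws)
  have ws': "weak_solution \<Omega> u H'" using op\<Omega> bd ucont wh' by unfold_locales
  have L: "in_Lp (real CARD('n)) N H'" using Ln N by (simp add: in_Lp_loc_def)
  have m: "(\<lambda>x. indicator N x *\<^sub>R H' x) \<in> borel_measurable lebesgue"
    and i: "integrable lebesgue (\<lambda>x. indicator N x *\<^sub>R norm (H' x) powr real CARD('n))"
    using L by (auto simp: in_Lp_def set_borel_measurable_def set_integrable_def)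
  have Ns: "N \<in> sets lebesgue" using N(1) by (simp add: lmeasurable_compact fmeasurableD)
  have comp: "(\<lambda>x. (indicator N x *\<^sub>R H' x) $ i $ j) \<in> borel_measurable lebesgue" for i j
  proof -
    have "(\<lambda>A :: real^'n^'n. A $ i $ j) \<in> borel_measurable borel"
      by (intro borel_measurable_continuous_onI continuous_intros)
    from measurable_compose[OF m this] show ?thesis .
  qed
  have Sm: "(\<lambda>x. indicator N x *\<^sub>R ?S (H' x) ^ CARD('n)) \<in> borel_measurable lebesgue"
  proof -
    have "(\<lambda>x. (\<Sum>i\<in>UNIV. \<Sum>j\<in>UNIV. \<bar>(indicator N x *\<^sub>R H' x) $ i $ j\<bar>) ^ CARD('n)) \<in> borel_measurable lebesgue"
      using comp by (intro borel_measurable_power borel_measurable_sum borel_measurable_abs)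
    moreover have "(\<lambda>x. (\<Sum>i\<in>UNIV. \<Sum>j\<in>UNIV. \<bar>(indicator N x *\<^sub>R H' x) $ i $ j\<bar>) ^ CARD('n))
        = (\<lambda>x. indicator N x *\<^sub>R ?S (H' x) ^ CARD('n))"
      by (auto simp: fun_eq_iff indicator_def)
    ultimately show ?thesis by simp
  qed
  have le: "?S A \<le> (real CARD('n))\<^sup>2 * norm A" for A :: "real^'n^'n"
  proof -
    have "\<bar>A $ i $ j\<bar> \<le> norm A" for i j
      using component_le_norm_cart[of "A $ i" j] Finite_Cartesian_Product.norm_nth_le[of A i] by linarith
    then have "?S A \<le> (\<Sum>i\<in>(UNIV :: 'n set). \<Sum>j\<in>(UNIV :: 'n set). norm A)" by (intro sum_mono)
    then show ?thesis by (simp add: power2_eq_square)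
  qed
  have i': "integrable lebesgue (\<lambda>x. indicator N x *\<^sub>R ?S (H' x) ^ CARD('n))"
  proof (rule Bochner_Integration.integrable_bound[OF _ Sm])
    show "integrable lebesgue (\<lambda>x. ((real CARD('n))\<^sup>2) ^ CARD('n) * (indicator N x *\<^sub>R norm (H' x) powr real CARD('n)))"
      using i by (rule integrable_mult_right)
    show "AE x in lebesgue. norm (indicator N x *\<^sub>R ?S (H' x) ^ CARD('n))
        \<le> norm (((real CARD('n))\<^sup>2) ^ CARD('n) * (indicator N x *\<^sub>R norm (H' x) powr real CARD('n)))"
    proof (rule AE_I2)
      fix x
      have S0: "0 \<le> ?S (H' x)" by (intro sum_nonneg) auto
      then have "?S (H' x) ^ CARD('n) \<le> ((real CARD('n))\<^sup>2 * norm (H' x)) ^ CARD('n)"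
        using le by (intro power_mono)
      also have "\<dots> = ((real CARD('n))\<^sup>2) ^ CARD('n) * norm (H' x) powr real CARD('n)"
        by (simp add: power_mult_distrib powr_realpow')
      finally show "norm (indicator N x *\<^sub>R ?S (H' x) ^ CARD('n))
          \<le> norm (((real CARD('n))\<^sup>2) ^ CARD('n) * (indicator N x *\<^sub>R norm (H' x) powr real CARD('n)))"
        using S0 by (auto simp: indicator_def)
    qed
  qed
  have "AE x in lebesgue. \<forall>i j. x \<in> \<Omega> \<longrightarrow> H' x $ i $ j = H x $ i $ j"
    by (intro eventually_all_finite weak_hessian_unique[OF ws' ws])
  then have ae: "AE x in lebesgue. indicator N x *\<^sub>R ?S (H' x) ^ CARD('n) = indicator N x *\<^sub>R ?S (H x) ^ CARD('n)"
  proof eventually_elim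
    case (elim x)
    then show ?case using N(2) by (cases "x \<in> N") auto
  qed
  show ?thesis
    unfolding set_integrable_def
    by (rule integrable_cong_AE_imp[OF i' borel_measurable_AE[OF Sm ae] ae])
qed

section \<open>Smooth approximation with control of the right-hand side\<close>

lemma
  fixes k :: "'a::euclidean_space \<Rightarrow> real"
  assumes g: "g \<in> borel_measurable borel" and ae: "AE y in lborel. g y = indicator N y * k y"
    and k: "set_integrable lebesgue N k"
  shows integrable_lborel_version: "integrable lborel g"
    and integral_lborel_version: "(LINT y|lborel. g y) = (LINT y:N|lebesgue. k y)"
proof -
  have ki: "integrable lebesgue (\<lambda>y. indicator N y *\<^sub>R k y)" using k by (simp add: set_integrable_def)
  have gm: "g \<in> borel_measurable lborel" "g \<in> borel_measurable lebesgue"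
    using g by (auto intro: measurable_completion)
  have ae': "AE y in lebesgue. indicator N y *\<^sub>R k y = g y"
    unfolding AE_completion_iff using ae by eventually_elim simp
  have "integrable lebesgue g" by (rule integrable_cong_AE_imp[OF ki gm(2) ae'])
  then show "integrable lborel g" using integrable_completion[OF gm(1)] by simp
  have "(LINT y|lborel. g y) = (LINT y|lebesgue. g y)" by (rule integral_completion[OF gm(1), symmetric])
  also have "\<dots> = (LINT y|lebesgue. indicator N y *\<^sub>R k y)"
    by (rule integral_cong_AE[OF gm(2) borel_measurable_integrable[OF ki]]) (use ae' in eventually_elim, simp)
  finally show "(LINT y|lborel. g y) = (LINT y:N|lebesgue. k y)" by (simp add: set_lebesgue_integral_def)
qed

text \<open>Mollification commutes with constant coefficients only. Freezing the coefficients at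
  \<open>x\<close> costs their oscillation over the kernel's support times the size of the
  Hessian.\<close>

lemma frozen_coefficients_bound:
  fixes c :: "real^'n::finite \<Rightarrow> real^'n^'n" and h :: "'n \<Rightarrow> 'n \<Rightarrow> real^'n \<Rightarrow> real"
  assumes K: "mollifier r K" and h: "\<And>i j. integrable lborel (h i j)" and f0: "integrable lborel f0"
    and eq: "AE y in lborel. norm (x - y) < r \<longrightarrow> (\<Sum>i\<in>UNIV. \<Sum>j\<in>UNIV. c y $ i $ j * h i j y) = f0 y"
    and osc: "\<And>y i j. norm (x - y) < r \<Longrightarrow> \<bar>c x $ i $ j - c y $ i $ j\<bar> \<le> \<omega>"
  shows "\<bar>\<Sum>i\<in>UNIV. \<Sum>j\<in>UNIV. c x $ i $ j * conv K (h i j) x\<bar>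
    \<le> conv K (\<lambda>y. \<bar>f0 y\<bar> + \<omega> * (\<Sum>i\<in>UNIV. \<Sum>j\<in>UNIV. \<bar>h i j y\<bar>)) x"
proof -
  note k = mollifier_facts[OF K]
  let ?P = "\<lambda>y. \<bar>f0 y\<bar> + \<omega> * (\<Sum>i\<in>UNIV. \<Sum>j\<in>UNIV. \<bar>h i j y\<bar>)"
  let ?g = "\<lambda>y. \<Sum>i\<in>UNIV. \<Sum>j\<in>UNIV. c x $ i $ j * h i j y"
  have gi: "integrable lborel ?g"
    by (intro Bochner_Integration.integrable_sum integrable_mult_right h)
  have Pi: "integrable lborel ?P"
    by (intro Bochner_Integration.integrable_add integrable_mult_right Bochner_Integration.integrable_sum integrable_abs h f0)
  have "(\<Sum>i\<in>UNIV. \<Sum>j\<in>UNIV. c x $ i $ j * conv K (h i j) x)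
      = (\<Sum>i\<in>UNIV. \<Sum>j\<in>UNIV. (LINT y|lborel. c x $ i $ j * (K (x - y) * h i j y)))"
    by (simp add: conv_def)
  also have "\<dots> = (LINT y|lborel. (\<Sum>i\<in>UNIV. \<Sum>j\<in>UNIV. c x $ i $ j * (K (x - y) * h i j y)))"
    by (subst Bochner_Integration.integral_sum)
      (intro Bochner_Integration.integrable_sum integrable_mult_right conv_integrable[OF k(1) h],
        intro sum.cong refl Bochner_Integration.integral_sum[symmetric] integrable_mult_right conv_integrable[OF k(1) h])
  also have "\<dots> = (LINT y|lborel. K (x - y) * ?g y)"
    by (simp add: sum_distrib_left mult_ac)
  also have "\<bar>\<dots>\<bar> \<le> (LINT y|lborel. \<bar>K (x - y) * ?g y\<bar>)"
    using integral_norm_bound[of lborel "\<lambda>y. K (x - y) * ?g y"] by simp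
  also have "\<dots> \<le> (LINT y|lborel. K (x - y) * ?P y)"
  proof (rule integral_mono_AE)
    show "integrable lborel (\<lambda>y. \<bar>K (x - y) * ?g y\<bar>)"
      by (intro integrable_abs conv_integrable[OF k(1) gi])
    show "integrable lborel (\<lambda>y. K (x - y) * ?P y)" by (rule conv_integrable[OF k(1) Pi])
    show "AE y in lborel. \<bar>K (x - y) * ?g y\<bar> \<le> K (x - y) * ?P y"
      using eq
    proof eventually_elim
      case (elim y)
      show ?case
      proof (cases "K (x - y) = 0")
        case False
        then have r: "norm (x - y) < r" by (rule k(3))
        have "?g y = f0 y + (\<Sum>i\<in>UNIV. \<Sum>j\<in>UNIV. (c x $ i $ j - c y $ i $ j) * h i j y)"
          using elim r by (simp add: left_diff_distrib sum_subtractf)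
        then have "\<bar>?g y\<bar> \<le> \<bar>f0 y\<bar> + \<bar>\<Sum>i\<in>UNIV. \<Sum>j\<in>UNIV. (c x $ i $ j - c y $ i $ j) * h i j y\<bar>"
          by linarith
        also have "\<bar>\<Sum>i\<in>UNIV. \<Sum>j\<in>UNIV. (c x $ i $ j - c y $ i $ j) * h i j y\<bar>
            \<le> (\<Sum>i\<in>UNIV. \<Sum>j\<in>UNIV. \<bar>(c x $ i $ j - c y $ i $ j) * h i j y\<bar>)"
          by (rule order_trans[OF sum_abs]) (intro sum_mono sum_abs)
        also have "\<dots> \<le> (\<Sum>i\<in>UNIV. \<Sum>j\<in>UNIV. \<omega> * \<bar>h i j y\<bar>)"
          unfolding abs_mult by (intro sum_mono mult_right_mono osc[OF r]) simp
        also have "\<dots> = \<omega> * (\<Sum>i\<in>UNIV. \<Sum>j\<in>UNIV. \<bar>h i j y\<bar>)" by (simp add: sum_distrib_left)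
        finally have "\<bar>?g y\<bar> \<le> ?P y" by simp
        then have "K (x - y) * \<bar>?g y\<bar> \<le> K (x - y) * ?P y" using k(2) by (intro mult_left_mono) auto
        then show ?thesis using k(2)[of "x - y"] by (simp add: abs_mult)
      qed simp
    qed
  qed
  finally show ?thesis by (simp add: conv_def)
qed

text \<open>The power inequality with weight 1/2 replaces Minkowski's inequality: two functions of
  norm at most \<open>F\<close> have a sum of norm at most \<open>2 * F\<close>.\<close>

lemma
  fixes a b :: "'a::euclidean_space \<Rightarrow> real"
  assumes m: "a \<in> borel_measurable borel" "b \<in> borel_measurable borel" and nn: "\<And>y. 0 \<le> a y" "\<And>y. 0 \<le> b y"
    and a: "integrable lborel (\<lambda>y. a y ^ n)" "(LINT y|lborel. a y ^ n) \<le> F ^ n"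
    and b: "integrable lborel (\<lambda>y. b y ^ n)" "(LINT y|lborel. b y ^ n) \<le> F ^ n"
    and n: "0 < n"
  shows integrable_power_add: "integrable lborel (\<lambda>y. (a y + b y) ^ n)"
    and integral_power_add_le: "(LINT y|lborel. (a y + b y) ^ n) \<le> (2 * F) ^ n"
proof -
  have le: "(a y + b y) ^ n \<le> 2 ^ (n - 1) * a y ^ n + 2 ^ (n - 1) * b y ^ n" for y
    using power_add_le_weighted[OF nn, of "1 / 2" n y y] n by (simp add: power_one_over mult.commute)
  have i: "integrable lborel (\<lambda>y. 2 ^ (n - 1) * a y ^ n + 2 ^ (n - 1) * b y ^ n)"
    using a b by (intro Bochner_Integration.integrable_add integrable_mult_right)
  show i': "integrable lborel (\<lambda>y. (a y + b y) ^ n)"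
  proof (rule Bochner_Integration.integrable_bound[OF i])
    show "(\<lambda>y. (a y + b y) ^ n) \<in> borel_measurable lborel" using m by measurable
    show "AE y in lborel. norm ((a y + b y) ^ n) \<le> norm (2 ^ (n - 1) * a y ^ n + 2 ^ (n - 1) * b y ^ n)"
      using le nn by (intro AE_I2) (simp add: abs_of_nonneg)
  qed
  have "(LINT y|lborel. (a y + b y) ^ n) \<le> (LINT y|lborel. 2 ^ (n - 1) * a y ^ n + 2 ^ (n - 1) * b y ^ n)"
    using i' i le by (rule integral_mono)
  also have "\<dots> = 2 ^ (n - 1) * (LINT y|lborel. a y ^ n) + 2 ^ (n - 1) * (LINT y|lborel. b y ^ n)"
    using a(1) b(1) by simp
  also have "\<dots> \<le> 2 ^ (n - 1) * F ^ n + 2 ^ (n - 1) * F ^ n"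
    using a(2) b(2) by (intro add_mono mult_left_mono) auto
  also have "\<dots> = (2 ^ (n - 1) * 2) * F ^ n" by simp
  also have "(2 :: real) ^ (n - 1) * 2 = 2 ^ n" using n by (simp flip: power_Suc2)
  finally show "(LINT y|lborel. (a y + b y) ^ n) \<le> (2 * F) ^ n" by (simp add: power_mult_distrib)
qed

lemma set_integrable_of_power:
  fixes f :: "'a::euclidean_space \<Rightarrow> real"
  assumes f: "set_borel_measurable lebesgue \<Omega> f" "set_integrable lebesgue \<Omega> (\<lambda>x. \<bar>f x\<bar> ^ n)" and n: "0 < n"
    and N: "compact N" "N \<subseteq> \<Omega>"
  shows "set_integrable lebesgue N f"
    and "set_integrable lebesgue N (\<lambda>x. \<bar>f x\<bar> ^ n)"
proof -
  have Ns: "N \<in> sets lebesgue" using N(1) by (simp add: lmeasurable_compact fmeasurableD)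
  have "(\<lambda>x. indicator N x *\<^sub>R (indicator \<Omega> x *\<^sub>R f x)) \<in> borel_measurable lebesgue"
    by (rule borel_measurable_scaleR[OF borel_measurable_indicator[OF Ns] f(1)[unfolded set_borel_measurable_def]])
  moreover have "(\<lambda>x. indicator N x *\<^sub>R (indicator \<Omega> x *\<^sub>R f x)) = (\<lambda>x. indicator N x *\<^sub>R f x)"
    using N(2) by (auto simp: indicator_def fun_eq_iff)
  ultimately have m: "(\<lambda>x. indicator N x *\<^sub>R f x) \<in> borel_measurable lebesgue" by simp
  show p: "set_integrable lebesgue N (\<lambda>x. \<bar>f x\<bar> ^ n)"
    by (rule set_integrable_subset[OF f(2) Ns N(2)])
  have c: "set_integrable lebesgue N (\<lambda>x. 1 :: real)"
    by (rule set_integrable_continuous_compact[OF N(1) continuous_on_const subset_refl Ns])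
  have le: "t \<le> 1 + t ^ n" if "0 \<le> t" for t :: real
  proof (cases "t \<le> 1")
    case False
    then have "t \<le> t ^ n" using n by (intro self_le_power) auto
    then show ?thesis by linarith
  qed (use that in \<open>auto intro: order_trans[of t 1]\<close>)
  show "set_integrable lebesgue N f"
    unfolding set_integrable_def
  proof (rule Bochner_Integration.integrable_bound[OF _ m])
    show "integrable lebesgue (\<lambda>x. indicator N x *\<^sub>R (1 + \<bar>f x\<bar> ^ n))"
      using set_integral_add(1)[OF c p] by (simp add: set_integrable_def)
    show "AE x in lebesgue. norm (indicator N x *\<^sub>R f x) \<le> norm (indicator N x *\<^sub>R (1 + \<bar>f x\<bar> ^ n))"
      using le[of "\<bar>f _\<bar>"] by (intro AE_I2) (auto simp: indicator_def abs_of_nonneg)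
  qed
qed

lemma smooth_approximation:
  fixes \<Omega> :: "(real^'n::finite) set"
  assumes pot: "potential \<Omega> \<phi> l L" and ws: "weak_solution \<Omega> u H"
    and eq: "AE x in lebesgue. x \<in> \<Omega> \<longrightarrow> lma \<phi> H x = f x"
    and f: "set_borel_measurable lebesgue \<Omega> f" "set_integrable lebesgue \<Omega> (\<lambda>x. \<bar>f x\<bar> ^ CARD('n))"
    and F: "0 < F" "(LINT x:\<Omega>|lebesgue. \<bar>f x\<bar> ^ CARD('n)) \<le> F ^ CARD('n)"
    and Sn: "\<And>N. compact N \<Longrightarrow> N \<subseteq> \<Omega> \<Longrightarrow>
      set_integrable lebesgue N (\<lambda>x. (\<Sum>i\<in>UNIV. \<Sum>j\<in>UNIV. \<bar>H x $ i $ j\<bar>) ^ CARD('n))"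
    and \<sigma>: "0 < \<sigma>" and \<eta>: "0 < \<eta>"
  obtains w where "Ck_on 2 UNIV w"
    "\<And>x. x \<in> closure (inner_part \<Omega> \<sigma>) \<Longrightarrow> \<bar>w x - u x\<bar> \<le> \<eta>"
    "(LINT z:inner_part \<Omega> \<sigma>|lebesgue. \<bar>lma \<phi> (hessian w) z\<bar> ^ CARD('n)) \<le> (2 * F) ^ CARD('n)"
    "\<And>i j. (\<integral>\<^sup>+x. indicator (inner_part \<Omega> \<sigma>) x * ennreal \<bar>hessian w x $ i $ j - H x $ i $ j\<bar> \<partial>lebesgue) \<le> ennreal \<eta>"
proof -
  interpret potential \<Omega> \<phi> l L by (rule pot)
  interpret weak_solution \<Omega> u H by (rule ws)
  let ?n = "CARD('n)"
  define U where "U = inner_part \<Omega> \<sigma>"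
  define N where "N = closure (inner_part \<Omega> (\<sigma> / 2))"
  have N: "compact N" "N \<subseteq> \<Omega>"
    using closure_inner_part_compact[of "\<sigma> / 2"] closure_inner_part_subset'[of "\<sigma> / 2"] \<sigma> by (auto simp: N_def)
  define h where "h i j = (SOME g. integrable lborel g \<and> (AE y in lborel. g y = indicator N y * H y $ i $ j))" for i j
  have "integrable lborel (h i j) \<and> (AE y in lborel. h i j y = indicator N y * H y $ i $ j)" for i j
  proof -
    obtain g where "integrable lborel g" "AE y in lborel. g y = indicator N y * H y $ i $ j"
      using borel_version[OF H_integrable[OF N, of i j]] .
    then have "\<exists>g. integrable lborel g \<and> (AE y in lborel. g y = indicator N y * H y $ i $ j)" by blast
    from someI_ex[OF this] show ?thesis unfolding h_def .
  qed
  then have h: "integrable lborel (h i j)" "AE y in lborel. h i j y = indicator N y * H y $ i $ j" for i j by auto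
  note fN = set_integrable_of_power[OF f zero_less_card_finite N]
  obtain f0 where f0: "integrable lborel f0" "AE y in lborel. f0 y = indicator N y * f y"
    using borel_version[OF fN(1)] .
  have hm[measurable]: "h i j \<in> borel_measurable borel" for i j using borel_measurable_integrable[OF h(1)] by simp
  have fm[measurable]: "f0 \<in> borel_measurable borel" using borel_measurable_integrable[OF f0(1)] by simp
  define S0 where "S0 y = (\<Sum>i\<in>UNIV. \<Sum>j\<in>UNIV. \<bar>h i j y\<bar>)" for y
  have S0nn: "0 \<le> S0 y" for y unfolding S0_def by (intro sum_nonneg) simp
  have S0m[measurable]: "S0 \<in> borel_measurable borel" unfolding S0_def[abs_def] by measurable
  have hall: "AE y in lborel. \<forall>i j. h i j y = indicator N y * H y $ i $ j"
    by (intro eventually_all_finite h(2))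
  have S0N: "AE y in lborel. S0 y ^ ?n = indicator N y * (\<Sum>i\<in>UNIV. \<Sum>j\<in>UNIV. \<bar>H y $ i $ j\<bar>) ^ ?n"
    using hall by eventually_elim (simp add: S0_def indicator_def power_0_left)
  have f0N: "AE y in lborel. \<bar>f0 y\<bar> ^ ?n = indicator N y * \<bar>f y\<bar> ^ ?n"
    using f0(2) by eventually_elim (simp add: indicator_def power_0_left)
  have S0i: "integrable lborel (\<lambda>y. S0 y ^ ?n)"
    by (rule integrable_lborel_version[OF _ S0N Sn[OF N]]) measurable
  have f0i: "integrable lborel (\<lambda>y. \<bar>f0 y\<bar> ^ ?n)"
    by (rule integrable_lborel_version[OF _ f0N fN(2)]) measurable
  have "(LINT y|lborel. \<bar>f0 y\<bar> ^ ?n) = (LINT y:N|lebesgue. \<bar>f y\<bar> ^ ?n)"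
    by (rule integral_lborel_version[OF _ f0N fN(2)]) measurable
  also have "\<dots> \<le> (LINT x:\<Omega>|lebesgue. \<bar>f x\<bar> ^ ?n)"
    unfolding set_lebesgue_integral_def
    using fN(2) f(2) N(2) by (intro integral_mono) (auto simp: set_integrable_def indicator_def)
  finally have f0F: "(LINT y|lborel. \<bar>f0 y\<bar> ^ ?n) \<le> F ^ ?n" using F(2) by linarith
  define I where "I = (LINT y|lborel. S0 y ^ ?n)"
  have I: "0 \<le> I" unfolding I_def using S0nn by simp
  \<comment> \<open>The admissible oscillation of the cofactors, chosen so that the commutator term
    has L^n norm at most \<open>F\<close>. It depends on \<open>H\<close> through \<open>I\<close>,
    which affects only the radius of the kernel.\<close>
  define \<omega> where "\<omega> = F / (I + 1)"
  have \<omega>: "0 < \<omega>" using F(1) I by (simp add: \<omega>_def)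
  have \<omega>i: "integrable lborel (\<lambda>y. (\<omega> * S0 y) ^ ?n)"
    unfolding power_mult_distrib using S0i by (rule integrable_mult_right)
  have "(LINT y|lborel. (\<omega> * S0 y) ^ ?n) = \<omega> ^ ?n * I"
    by (simp add: power_mult_distrib I_def)
  also have "\<dots> \<le> F ^ ?n"
  proof -
    have "I \<le> (I + 1) ^ ?n" using self_le_power[of "I + 1" ?n] I by simp
    then have "F ^ ?n * I \<le> F ^ ?n * (I + 1) ^ ?n" using F(1) by (intro mult_left_mono) auto
    then show ?thesis using I by (simp add: \<omega>_def power_divide pos_divide_le_eq)
  qed
  finally have \<omega>F: "(LINT y|lborel. (\<omega> * S0 y) ^ ?n) \<le> F ^ ?n" .
  define P where "P y = \<bar>f0 y\<bar> + \<omega> * S0 y" for y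
  have Pnn: "0 \<le> P y" for y using S0nn[of y] \<omega> by (simp add: P_def)
  have Pi: "integrable lborel P"
    unfolding P_def[abs_def] S0_def
    by (intro Bochner_Integration.integrable_add integrable_mult_right Bochner_Integration.integrable_sum integrable_abs h f0)
  have mm: "(\<lambda>y. \<bar>f0 y\<bar>) \<in> borel_measurable borel" "(\<lambda>y. \<omega> * S0 y) \<in> borel_measurable borel" by measurable
  have nn: "0 \<le> \<bar>f0 y\<bar>" "0 \<le> \<omega> * S0 y" for y using S0nn[of y] \<omega> by auto
  note Pn = integrable_power_add[OF mm nn f0i f0F \<omega>i \<omega>F zero_less_card_finite, folded P_def]
    integral_power_add_le[OF mm nn f0i f0F \<omega>i \<omega>F zero_less_card_finite, folded P_def]
  have "\<forall>i j. \<exists>d>0. \<forall>x\<in>N. \<forall>y\<in>N. dist y x < d \<longrightarrow> dist (cof_hessian \<phi> y $ i $ j) (cof_hessian \<phi> x $ i $ j) < \<omega>"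
  proof (intro allI)
    fix i j
    have "uniformly_continuous_on N (\<lambda>x. cof_hessian \<phi> x $ i $ j)"
      using N by (intro compact_uniformly_continuous continuous_on_cof_hessian Ck_on_subset[OF C]) (use det_pos in force)+
    then show "\<exists>d>0. \<forall>x\<in>N. \<forall>y\<in>N. dist y x < d \<longrightarrow> dist (cof_hessian \<phi> y $ i $ j) (cof_hessian \<phi> x $ i $ j) < \<omega>"
      using \<omega> unfolding uniformly_continuous_on_def by blast
  qed
  then obtain d where d: "\<And>i j. 0 < d i j"
    "\<And>i j x y. x \<in> N \<Longrightarrow> y \<in> N \<Longrightarrow> dist y x < d i j \<Longrightarrow> \<bar>cof_hessian \<phi> y $ i $ j - cof_hessian \<phi> x $ i $ j\<bar> < \<omega>"
    unfolding dist_real_def by metis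
  define R where "R i j = (SOME r0. 0 < r0 \<and> (\<forall>r K. r \<le> r0 \<longrightarrow> mollifier r K \<longrightarrow>
      (\<integral>\<^sup>+x. ennreal \<bar>conv K (h i j) x - h i j x\<bar> \<partial>lborel) \<le> ennreal \<eta>))" for i j
  have R: "0 < R i j \<and> (\<forall>r K. r \<le> R i j \<longrightarrow> mollifier r K \<longrightarrow>
      (\<integral>\<^sup>+x. ennreal \<bar>conv K (h i j) x - h i j x\<bar> \<partial>lborel) \<le> ennreal \<eta>)" for i j
  proof -
    obtain r0 where "0 < r0"
      "\<And>r K. r \<le> r0 \<Longrightarrow> mollifier r K \<Longrightarrow> (\<integral>\<^sup>+x. ennreal \<bar>conv K (h i j) x - h i j x\<bar> \<partial>lborel) \<le> ennreal \<eta>"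
      using mollifier_L1_radius[OF h(1)[of i j] \<eta>] by blast
    then have "\<exists>r0. 0 < r0 \<and> (\<forall>r K. r \<le> r0 \<longrightarrow> mollifier r K \<longrightarrow>
      (\<integral>\<^sup>+x. ennreal \<bar>conv K (h i j) x - h i j x\<bar> \<partial>lborel) \<le> ennreal \<eta>)" by blast
    from someI_ex[OF this] show ?thesis unfolding R_def .
  qed
  have "uniformly_continuous_on (closure \<Omega>) u"
    using bd by (intro compact_uniformly_continuous ucont) (simp add: compact_closure)
  then obtain e where e: "0 < e" "\<And>x y. x \<in> closure \<Omega> \<Longrightarrow> y \<in> closure \<Omega> \<Longrightarrow> dist y x < e \<Longrightarrow> dist (u y) (u x) < \<eta>"
    using \<eta> unfolding uniformly_continuous_on_def by blast
  \<comment> \<open>Below \<open>\<sigma> / 3\<close>, so that balls about points of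
    \<open>closure U\<close> stay in \<open>N\<close>; below the moduli of continuity of
    \<open>u\<close> and of all cofactors; and below the radii of L^1 convergence of all
    entries.\<close>
  define r where "r = min (min (\<sigma> / 3) e) (Min (range (\<lambda>(i, j). min (d i j) (R i j))))"
  have r: "0 < r" "r < \<sigma> / 2" "r \<le> e"
    using \<sigma> e(1) d(1) R by (auto simp: r_def)
  have "Min (range (\<lambda>(i, j). min (d i j) (R i j))) \<le> min (d i j) (R i j)" for i j
    by (rule Min_le) auto
  then have rd: "r \<le> d i j" "r \<le> R i j" for i j unfolding r_def by (simp_all add: min.coboundedI2)
  obtain K :: "real^'n \<Rightarrow> real" where K: "mollifier r K" using exists_mollifier[OF r(1)] by blast
  define w where "w = conv K u0"
  have w: "Ck_on 2 UNIV w" unfolding w_def by (rule Ck_on_2_conv[OF mollifier_nice[OF K] u0_integrable])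
  have ball: "y \<in> N" "y \<in> \<Omega>" if "x \<in> closure U" "norm (x - y) < r" for x y
  proof -
    have "y \<in> inner_part \<Omega> (\<sigma> / 2)"
      using cball_subset_inner_part[of x \<Omega> \<sigma> r] that r(2) by (auto simp: U_def dist_norm)
    then show "y \<in> N" using closure_subset by (auto simp: N_def)
    then show "y \<in> \<Omega>" using N(2) by blast
  qed
  have xN: "x \<in> N" "x \<in> \<Omega>" if "x \<in> closure U" for x using ball[OF that, of x] r(1) by simp_all
  have hess: "hessian w x $ i $ j = conv K (h i j) x" if "x \<in> closure U" for x i j
    unfolding w_def by (rule hessian_mollified[OF K that[unfolded U_def] r(2) \<sigma> h(1)]) (use h(2) in \<open>simp add: N_def\<close>)
  show thesis
  proof (rule that[OF w])
    fix x assume "x \<in> closure (inner_part \<Omega> \<sigma>)"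
    then have x: "x \<in> closure U" by (simp add: U_def)
    show "\<bar>w x - u x\<bar> \<le> \<eta>"
      unfolding w_def
    proof (rule conv_close[OF K u0_integrable])
      fix y assume y: "norm (x - y) < r"
      have "y \<in> \<Omega>" by (rule ball(2)[OF x y])
      moreover have "dist (u y) (u x) < \<eta>"
        using e(2)[of x y] xN(2)[OF x] \<open>y \<in> \<Omega>\<close> closure_subset y r(3) by (auto simp: dist_norm norm_minus_commute)
      ultimately show "\<bar>u0 y - u x\<bar> \<le> \<eta>" by (simp add: u0_def dist_real_def)
    qed
  next
    have Ub: "U \<in> sets lebesgue" "compact (closure U)" "closure U \<subseteq> \<Omega>"
      using closure_inner_part_compact[of \<sigma>] closure_inner_part_subset'[of \<sigma>] \<sigma> inner_part_lebesgue by (auto simp: U_def)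
    have pt: "\<bar>lma \<phi> (hessian w) x\<bar> \<le> conv K P x" if x: "x \<in> closure U" for x
    proof -
      have ae: "AE y in lborel. norm (x - y) < r \<longrightarrow> (\<Sum>i\<in>UNIV. \<Sum>j\<in>UNIV. cof_hessian \<phi> y $ i $ j * h i j y) = f0 y"
        using hall f0(2) eq[unfolded AE_completion_iff]
      proof eventually_elim
        case (elim y)
        show ?case
        proof
          assume y: "norm (x - y) < r"
          show "(\<Sum>i\<in>UNIV. \<Sum>j\<in>UNIV. cof_hessian \<phi> y $ i $ j * h i j y) = f0 y"
            using elim ball[OF x y] by (simp add: lma_def)
        qed
      qed
      have osc: "\<bar>cof_hessian \<phi> x $ i $ j - cof_hessian \<phi> y $ i $ j\<bar> \<le> \<omega>" if y: "norm (x - y) < r" for y i j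
        using d(2)[OF ball(1)[OF x y] xN(1)[OF x], of i j] y rd(1)[of i j] by (simp add: dist_norm)
      show ?thesis
        using frozen_coefficients_bound[OF K h(1) f0(1) ae osc] hess[OF x]
        by (simp add: lma_def P_def[abs_def] S0_def)
    qed
    have i1: "set_integrable lebesgue U (\<lambda>z. \<bar>lma \<phi> (hessian w) z\<bar> ^ ?n)"
    proof (rule set_integrable_continuous_compact[OF Ub(2) _ closure_subset Ub(1)])
      have "continuous_on (closure U) (hessian w)"
        using continuous_on_hessian[OF w] by (rule continuous_on_subset) simp
      then show "continuous_on (closure U) (\<lambda>z. \<bar>lma \<phi> (hessian w) z\<bar> ^ ?n)"
        using det_pos Ub(3) by (intro continuous_intros continuous_on_lma Ck_on_subset[OF C]) force+
    qed
    have Pn0: "0 \<le> P y ^ ?n" for y using Pnn by simp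
    have c1: "integrable lborel (conv K (\<lambda>y. P y ^ ?n))" by (rule conv_L1[OF K Pn(1) Pn0])
    have c2: "integrable lebesgue (conv K (\<lambda>y. P y ^ ?n))"
      using integrable_completion[of "conv K (\<lambda>y. P y ^ ?n)" lborel] c1 borel_measurable_integrable[OF c1] by simp
    have cnn: "0 \<le> conv K (\<lambda>y. P y ^ ?n) x" for x
      unfolding conv_def using mollifier_facts(2)[OF K] Pn0 by simp
    have "(LINT z:U|lebesgue. \<bar>lma \<phi> (hessian w) z\<bar> ^ ?n) \<le> (LINT z|lebesgue. conv K (\<lambda>y. P y ^ ?n) z)"
      unfolding set_lebesgue_integral_def
    proof (rule integral_mono[OF i1[unfolded set_integrable_def] c2])
      fix z
      show "indicator U z *\<^sub>R \<bar>lma \<phi> (hessian w) z\<bar> ^ ?n \<le> conv K (\<lambda>y. P y ^ ?n) z"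
      proof (cases "z \<in> U")
        case True
        then have "\<bar>lma \<phi> (hessian w) z\<bar> ^ ?n \<le> conv K P z ^ ?n"
          using closure_subset by (intro power_mono pt) auto
        also have "\<dots> \<le> conv K (\<lambda>y. P y ^ ?n) z" by (rule conv_power_le[OF K Pi Pnn Pn(1) zero_less_card_finite])
        finally show ?thesis using True by simp
      qed (use cnn in simp)
    qed
    also have "\<dots> = (LINT z|lborel. conv K (\<lambda>y. P y ^ ?n) z)"
      using borel_measurable_integrable[OF c1] by (rule integral_completion)
    also have "\<dots> = (LINT y|lborel. P y ^ ?n)" by (rule integral_conv[OF K Pn(1) Pn0])
    also have "\<dots> \<le> (2 * F) ^ ?n" by (rule Pn(2))
    finally show "(LINT z:inner_part \<Omega> \<sigma>|lebesgue. \<bar>lma \<phi> (hessian w) z\<bar> ^ ?n) \<le> (2 * F) ^ ?n" by (simp add: U_def)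
  next
    fix i j
    have cm: "conv K (h i j) \<in> borel_measurable borel"
      using Ck_on_2_imp_continuous_on[OF Ck_on_2_conv[OF mollifier_nice[OF K] h(1)]] by (rule borel_measurable_continuous_onI)
    have "AE x in lebesgue. indicator U x * ennreal \<bar>hessian w x $ i $ j - H x $ i $ j\<bar> \<le> ennreal \<bar>conv K (h i j) x - h i j x\<bar>"
      unfolding AE_completion_iff using h(2)[of i j]
    proof eventually_elim
      case (elim x)
      show ?case
      proof (cases "x \<in> U")
        case True
        then have x: "x \<in> closure U" using closure_subset by blast
        show ?thesis using elim xN(1)[OF x] hess[OF x] by (simp add: True)
      qed simp
    qed
    then have "(\<integral>\<^sup>+x. indicator U x * ennreal \<bar>hessian w x $ i $ j - H x $ i $ j\<bar> \<partial>lebesgue)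
        \<le> (\<integral>\<^sup>+x. ennreal \<bar>conv K (h i j) x - h i j x\<bar> \<partial>lebesgue)"
      by (rule nn_integral_mono_AE)
    also have "\<dots> = (\<integral>\<^sup>+x. ennreal \<bar>conv K (h i j) x - h i j x\<bar> \<partial>lborel)"
      using cm by (intro nn_integral_completion) 
    also have "\<dots> \<le> ennreal \<eta>" using R rd(2) K by blast
    finally show "(\<integral>\<^sup>+x. indicator (inner_part \<Omega> \<sigma>) x * ennreal \<bar>hessian w x $ i $ j - H x $ i $ j\<bar> \<partial>lebesgue) \<le> ennreal \<eta>"
      by (simp add: U_def)
  qed
qed

section \<open>Distribution of the Hessian\<close>

text \<open>Test the form with the sum and the difference of two coordinate vectors; each diagonal
  entry is at most the trace because all are nonnegative.\<close>

lemma psd_entry_le_trace: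
  fixes B :: "real^'n::finite^'n"
  assumes "psd B" shows "\<bar>B $ i $ j\<bar> \<le> trace B"
proof -
  have entry: "axis k 1 \<bullet> (B *v axis m 1) = B $ k $ m" for k m :: 'n
    by (simp add: matrix_vector_mult_basis column_def inner_axis')
  have nn: "0 \<le> B $ k $ k" for k
    using assms entry[of k k] unfolding psd_def by metis
  have sym: "B $ j $ i = B $ i $ j"
    using assms by (simp add: psd_def vec_eq_iff transpose_def)
  have q: "0 \<le> B $ i $ i + 2 * s * B $ i $ j + s * s * B $ j $ j" for s
  proof -
    have "0 \<le> (axis i 1 + s *\<^sub>R axis j 1) \<bullet> (B *v (axis i 1 + s *\<^sub>R axis j 1))"
      using assms unfolding psd_def by blast
    also have "\<dots> = axis i 1 \<bullet> (B *v axis i 1) + s * (axis i 1 \<bullet> (B *v axis j 1))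
        + s * (axis j 1 \<bullet> (B *v axis i 1)) + s * s * (axis j 1 \<bullet> (B *v axis j 1))"
      by (simp add: matrix_vector_right_distrib matrix_vector_mult_scaleR inner_add_left inner_add_right distrib_left)
    finally show ?thesis by (simp add: entry sym)
  qed
  have tr: "B $ k $ k \<le> trace B" for k
    unfolding trace_def using nn by (intro member_le_sum) auto
  show ?thesis using q[of 1] q[of "-1"] tr[of i] tr[of j] by simp
qed

text \<open>The two matrices differ by \<open>2 * t\<close> times \<open>W\<close>, and their traces
  add up to twice the trace of \<open>A\<close>, so the indefinite part of \<open>W\<close>
  disappears from the bound.\<close>

lemma entry_le_of_psd_perturbations:
  fixes A W :: "real^'n::finite^'n"
  assumes p: "psd (A + t *\<^sub>R W)" and m: "psd (A + t *\<^sub>R (- W))" and t: "0 < t"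
  shows "\<bar>W $ i $ j\<bar> \<le> trace A / t"
proof -
  have tr: "trace (A + t *\<^sub>R W) + trace (A + t *\<^sub>R (- W)) = 2 * trace A"
    by (simp add: trace_def sum.distrib sum_subtractf)
  have "2 * (t * W $ i $ j) = (A + t *\<^sub>R W) $ i $ j - (A + t *\<^sub>R (- W)) $ i $ j" by simp
  then have "\<bar>2 * (t * W $ i $ j)\<bar> \<le> 2 * trace A"
    using psd_entry_le_trace[OF p, of i j] psd_entry_le_trace[OF m, of i j] tr by linarith
  then have "t * \<bar>W $ i $ j\<bar> \<le> trace A" using t by (simp add: abs_mult)
  then show ?thesis using t by (simp add: pos_le_divide_eq mult.commute)
qed

lemma markov_lebesgue:
  fixes g :: "'a::euclidean_space \<Rightarrow> real"
  assumes m: "(\<lambda>x. indicator U x * g x) \<in> borel_measurable lebesgue" and U: "U \<in> sets lebesgue"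
    and I: "(\<integral>\<^sup>+x. indicator U x * ennreal \<bar>g x\<bar> \<partial>lebesgue) \<le> ennreal e" and c: "0 < c" and e: "0 \<le> e"
  shows "{x \<in> U. c < \<bar>g x\<bar>} \<in> lmeasurable" and "measure lebesgue {x \<in> U. c < \<bar>g x\<bar>} \<le> e / c"
proof -
  let ?E = "{x \<in> U. c < \<bar>g x\<bar>}"
  have eq: "?E = {x \<in> space lebesgue. c < \<bar>indicator U x * g x\<bar>}" using c by (auto simp: indicator_def)
  have s: "?E \<in> sets lebesgue"
    unfolding eq using borel_measurable_abs[OF m] by measurable
  have "ennreal c * emeasure lebesgue ?E = (\<integral>\<^sup>+x. ennreal c * indicator ?E x \<partial>lebesgue)"
    using s by (simp add: nn_integral_cmult_indicator)
  also have "\<dots> \<le> (\<integral>\<^sup>+x. indicator U x * ennreal \<bar>g x\<bar> \<partial>lebesgue)"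
    by (intro nn_integral_mono) (auto simp: indicator_def intro: ennreal_leI)
  also have "\<dots> \<le> ennreal e" by (rule I)
  finally have "ennreal (1 / c) * (ennreal c * emeasure lebesgue ?E) \<le> ennreal (1 / c) * ennreal e"
    by (rule mult_left_mono) simp
  moreover have "ennreal (1 / c) * (ennreal c * emeasure lebesgue ?E) = emeasure lebesgue ?E"
    using c by (simp flip: mult.assoc ennreal_mult)
  ultimately have b: "emeasure lebesgue ?E \<le> ennreal (e / c)"
    using c e by (simp flip: ennreal_mult)
  show f: "?E \<in> lmeasurable" using s b by (auto simp: fmeasurable_def intro: le_less_trans)
  show "measure lebesgue ?E \<le> e / c"
    using b c e f by (simp add: emeasure_eq_measure2)
qed

text \<open>A set \<open>S\<close> that is not measurable has measure 0 by convention, so only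
  \<open>T\<close> needs to be measurable.\<close>

lemma measure_lebesgue_mono:
  assumes "T \<in> lmeasurable" "S \<subseteq> T" shows "measure lebesgue S \<le> measure lebesgue T"
  using assms measure_mono_fmeasurable[of S T lebesgue]
  by (cases "S \<in> sets lebesgue") (auto simp: measure_notin_sets)

lemma potential_of_conds:
  fixes \<Omega> :: "(real^'n::finite) set"
  assumes dom: "bounded_convex_domain \<Omega>" and l: "0 < l" and A2: "cond_A2 l L \<Omega> \<phi>"
  shows "potential \<Omega> \<phi> l L"
proof
  show "convex_on \<Omega> \<phi>"
    using A2 dom convex_on_subset[of "closure \<Omega>" \<phi> \<Omega>] closure_subset
    by (auto simp: cond_A2_def bounded_convex_domain_def)
qed (use assms in \<open>auto simp: bounded_convex_domain_def cond_A2_def\<close>)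

text \<open>Local integrability gives measurability on compact subsets; on \<open>\<Omega>\<close>
  the function is a pointwise limit of its restrictions to inner parts.\<close>

lemma (in weak_solution) H_measurable: "set_borel_measurable lebesgue \<Omega> H"
proof -
  have nU: "\<Omega> \<noteq> UNIV" using bd by (metis not_bounded_UNIV)
  let ?U = "\<lambda>k. inner_part \<Omega> (1 / real (Suc k))"
  have comp: "(\<lambda>x. indicator \<Omega> x * H x $ i $ j) \<in> borel_measurable lebesgue" for i j
  proof (rule borel_measurable_LIMSEQ_real)
    fix k
    have "set_integrable lebesgue (closure (?U k)) (\<lambda>x. H x $ i $ j)"
      using closure_inner_part_compact[of "1 / real (Suc k)"] closure_inner_part_subset'[of "1 / real (Suc k)"]
      by (intro H_integrable) auto
    then have "set_integrable lebesgue (?U k) (\<lambda>x. H x $ i $ j)"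
      by (rule set_integrable_subset[OF _ inner_part_lebesgue closure_subset])
    then show "(\<lambda>x. indicator (?U k) x * H x $ i $ j) \<in> borel_measurable lebesgue"
      using borel_measurable_integrable by (auto simp: set_integrable_def)
  next
    fix x
    show "(\<lambda>k. indicator (?U k) x * H x $ i $ j) \<longlonglongrightarrow> indicator \<Omega> x * H x $ i $ j"
    proof (cases "x \<in> \<Omega>")
      case True
      obtain r where r: "0 < r" "ball x r \<subseteq> \<Omega>" using op\<Omega> True unfolding open_contains_ball by blast
      have rd: "r \<le> infdist x (- \<Omega>)" by (rule le_infdist_compl[OF r(2) nU])
      obtain k0 where k0: "inverse (real (Suc k0)) < r" using reals_Archimedean[OF r(1)] by blast
      have "x \<in> ?U k" if "k0 \<le> k" for k
      proof -
        have "1 / real (Suc k) \<le> 1 / real (Suc k0)" using that by (intro divide_left_mono) auto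
        then show ?thesis using rd k0 by (simp add: inner_part_def inverse_eq_divide)
      qed
      then have "\<forall>\<^sub>F k in sequentially. indicator (?U k) x * H x $ i $ j = indicator \<Omega> x * H x $ i $ j"
        using True by (intro eventually_sequentiallyI[of k0]) simp
      then show ?thesis by (rule tendsto_eventually)
    next
      case False
      then have "x \<notin> ?U k" for k using inner_part_subset[of "1 / real (Suc k)" \<Omega>] by auto
      then show ?thesis using False by simp
    qed
  qed
  show ?thesis
    unfolding set_borel_measurable_def borel_measurable_euclidean_space[of "\<lambda>x. indicator \<Omega> x *\<^sub>R H x"]
  proof
    fix b :: "real^'n^'n" assume "b \<in> Basis"
    then obtain i v where "v \<in> Basis" "b = axis i v" by (auto simp: Basis_vec_def)
    moreover from this obtain j where "v = axis j 1" by (auto simp: Basis_vec_def)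
    ultimately have b: "b = axis i (axis j 1)" by simp
    have "(\<lambda>x. (indicator \<Omega> x *\<^sub>R H x) \<bullet> b) = (\<lambda>x. indicator \<Omega> x * H x $ i $ j)"
      by (simp add: b inner_axis fun_eq_iff)
    then show "(\<lambda>x. (indicator \<Omega> x *\<^sub>R H x) \<bullet> b) \<in> borel_measurable lebesgue" using comp by simp
  qed
qed

text \<open>The bound of \<open>sup_bound\<close> divided by \<open>F\<close>, for boundary values
  at most \<open>2 * F\<close>, diameter bound \<open>2 / \<rho>\<close> and a right-hand side of
  norm at most \<open>2 * F\<close>.\<close>

definition sup_const :: "real \<Rightarrow> real \<Rightarrow> nat \<Rightarrow> real" where
  "sup_const \<rho> l n = 2 + 4 / \<rho> * max 1 (1 / (l ^ (n - 1) * unit_ball_vol (real n)))"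

text \<open>The perturbation \<open>\<phi> \<plusminus> w / M\<close> is used with \<open>M = 2 F T\<close>, where \<open>F\<close> bounds the norm of the right-hand side;
  this choice of \<open>T\<close> keeps the oscillation of \<open>w / M\<close> below the height of the sections.\<close>

definition slope_ratio :: "real \<Rightarrow> real \<Rightarrow> nat \<Rightarrow> real \<Rightarrow> real" where
  "slope_ratio \<rho> l n \<delta> = 2 + 2 * sup_const \<rho> l n / (section_const \<rho> l n * \<delta> ^ 4)"

text \<open>The contact estimate needs a smooth function and a domain compactly inside
  \<open>\<Omega>\<close>. Here \<open>\<sigma>\<close> is taken so small that, on the frontier of
  the smaller domain, \<open>u\<close> is still at most \<open>F\<close> and the section heights
  lose at most half; the estimate is then applied to \<open>w\<close> and to
  \<open>- w\<close>.\<close>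

lemma smooth_approximation_contact:
  fixes \<Omega> :: "(real^'n::finite) set"
  assumes \<rho>: "0 < \<rho>" and l: "0 < l" and dom: "bounded_convex_domain \<Omega>"
    and A1: "cond_A1 \<rho> \<Omega>" and A2: "cond_A2 l L \<Omega> \<phi>" and A3: "cond_A3 \<rho> \<Omega> \<phi>"
    and ws: "weak_solution \<Omega> u H" and bc: "\<And>x. x \<in> frontier \<Omega> \<Longrightarrow> u x = 0"
    and eq: "AE x in lebesgue. x \<in> \<Omega> \<longrightarrow> lma \<phi> H x = f x"
    and f: "set_borel_measurable lebesgue \<Omega> f" "set_integrable lebesgue \<Omega> (\<lambda>x. \<bar>f x\<bar> ^ CARD('n))"
    and F: "0 < F" "(LINT x:\<Omega>|lebesgue. \<bar>f x\<bar> ^ CARD('n)) \<le> F ^ CARD('n)"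
    and Sn: "\<And>N. compact N \<Longrightarrow> N \<subseteq> \<Omega> \<Longrightarrow>
      set_integrable lebesgue N (\<lambda>x. (\<Sum>i\<in>UNIV. \<Sum>j\<in>UNIV. \<bar>H x $ i $ j\<bar>) ^ CARD('n))"
    and \<delta>: "0 < \<delta>"
    and T: "T = slope_ratio \<rho> l CARD('n) \<delta>" and M: "M = T * (2 * F)"
  obtains w \<sigma> where "0 < \<sigma>" "\<sigma> < \<delta>" "Ck_on 2 UNIV w"
    "l * measure lebesgue (inner_part \<Omega> \<delta> - {z \<in> inner_part \<Omega> \<sigma>. psd (hessian \<phi> z + (1 / M) *\<^sub>R hessian w z)})
       \<le> L * measure lebesgue (inner_part \<Omega> \<sigma> - inner_part \<Omega> \<delta>)
          + (2 ^ CARD('n) * L * measure lebesgue (inner_part \<Omega> \<sigma>) + 1 / l ^ (CARD('n) - 1)) / T"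
    "l * measure lebesgue (inner_part \<Omega> \<delta> - {z \<in> inner_part \<Omega> \<sigma>. psd (hessian \<phi> z + (1 / M) *\<^sub>R - hessian w z)})
       \<le> L * measure lebesgue (inner_part \<Omega> \<sigma> - inner_part \<Omega> \<delta>)
          + (2 ^ CARD('n) * L * measure lebesgue (inner_part \<Omega> \<sigma>) + 1 / l ^ (CARD('n) - 1)) / T"
    "\<And>i j. (\<integral>\<^sup>+x. indicator (inner_part \<Omega> \<sigma>) x * ennreal \<bar>hessian w x $ i $ j - H x $ i $ j\<bar> \<partial>lebesgue) \<le> ennreal (F * \<delta>)"
proof -
  let ?n = "CARD('n)"
  interpret potential \<Omega> \<phi> l L by (rule potential_of_conds[OF dom l A2])
  interpret weak_solution \<Omega> u H by (rule ws)
  define c where "c = section_const \<rho> l ?n"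
  define C1 where "C1 = sup_const \<rho> l ?n"
  have c: "0 < c" unfolding c_def by (rule section_const_pos[OF \<rho> l])
  let ?K = "max 1 (1 / (l ^ (?n - 1) * unit_ball_vol (real ?n)))"
  have C1: "0 < C1" using \<rho> by (auto simp: C1_def sup_const_def intro!: add_pos_nonneg)
  have Teq: "T = 2 + 2 * C1 / (c * \<delta> ^ 4)" by (simp add: T slope_ratio_def c_def C1_def)
  have T2: "2 \<le> T" using C1 c \<delta> by (simp add: Teq)
  have nU: "\<Omega> \<noteq> UNIV" using bd by (metis not_bounded_UNIV)
  \<comment> \<open>This constant is not controlled by the data. It enters the choice of
    \<open>\<sigma>\<close> and nothing else.\<close>
  obtain Lip where Lip: "Lip-lipschitz_on (closure \<Omega>) \<phi>" using A2 by (auto simp: cond_A2_def)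
  have Lip0: "0 \<le> Lip" using Lip by (rule lipschitz_on_nonneg)
  obtain a s where as: "\<And>z. z \<in> \<Omega> \<Longrightarrow> 0 \<le> \<phi> z - a - s \<bullet> z \<and> \<phi> z - a - s \<bullet> z \<le> 4 / \<rho> ^ 3"
    using potential_affine_bound[OF dom \<rho> A1 A2 A3] by blast
  define G where "G = norm s + 4 / \<rho> ^ 3 / \<delta>"
  have G: "norm (grad \<phi> x) \<le> G" if x: "x \<in> inner_part \<Omega> \<delta>" for x
  proof -
    have "norm (grad \<phi> x - s) * \<delta> \<le> 4 / \<rho> ^ 3"
      using grad_bound[OF as x \<delta>] by (simp add: mult.commute)
    then have "norm (grad \<phi> x - s) \<le> 4 / \<rho> ^ 3 / \<delta>" by (rule mult_imp_le_div_pos[OF \<delta>])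
    then show ?thesis using norm_triangle_sub[of "grad \<phi> x" s] by (simp add: G_def)
  qed
  have G0: "0 \<le> G" using \<rho> \<delta> by (simp add: G_def)
  have "uniformly_continuous_on (closure \<Omega>) u"
    using bd by (intro compact_uniformly_continuous ucont) (simp add: compact_closure)
  then obtain e where e: "0 < e" "\<And>x y. x \<in> closure \<Omega> \<Longrightarrow> y \<in> closure \<Omega> \<Longrightarrow> dist y x < e \<Longrightarrow> dist (u y) (u x) < F"
    using F(1) unfolding uniformly_continuous_on_def by blast
  \<comment> \<open>Passing from the boundary of \<open>\<Omega>\<close> to the frontier of
    \<open>U\<close>, at distance \<open>\<sigma>\<close>, costs at most
    \<open>(Lip + G) * \<sigma>\<close> of the section height; \<open>s1\<close> keeps this below
    half of it. The summand 1 avoids a zero denominator.\<close>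
  define s1 where "s1 = c * \<delta> ^ 4 / 2 / (Lip + G + 1)"
  have s1: "0 < s1" "s1 * (Lip + G) \<le> c * \<delta> ^ 4 / 2"
  proof -
    show "0 < s1" using c \<delta> Lip0 G0 by (simp add: s1_def)
    then have "s1 * (Lip + G) \<le> s1 * (Lip + G + 1)" by (intro mult_left_mono) auto
    also have "\<dots> = c * \<delta> ^ 4 / 2"
      by (rule nonzero_eq_divide_eq[THEN iffD1, OF _ s1_def]) (use Lip0 G0 in linarith)
    finally show "s1 * (Lip + G) \<le> c * \<delta> ^ 4 / 2" .
  qed
  define \<sigma> where "\<sigma> = min (min (\<delta> / 2) (e / 2)) s1"
  have \<sigma>: "0 < \<sigma>" "\<sigma> < \<delta>" "\<sigma> < e" "\<sigma> \<le> s1" using \<delta> e(1) s1 by (auto simp: \<sigma>_def)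
  define U where "U = inner_part \<Omega> \<sigma>"
  define D where "D = inner_part \<Omega> \<delta>"
  have Uo: "open U" by (simp add: U_def open_inner_part)
  have UO: "closure U \<subseteq> \<Omega>" using closure_inner_part_subset'[OF \<sigma>(1)] by (simp add: U_def)
  have UO': "U \<subseteq> \<Omega>" using UO closure_subset by blast
  have Ub: "bounded U" using bd UO' by (rule bounded_subset)
  have DU: "D \<subseteq> U" unfolding D_def U_def using \<sigma>(2) by (intro inner_part_mono) auto
  have Dl: "D \<in> sets lebesgue" unfolding D_def by (rule inner_part_lebesgue)
  have \<Omega>c: "x \<in> closure \<Omega>" if "x \<in> \<Omega>" for x using that closure_subset by blast
  have frU: "\<exists>y'. y' \<in> frontier \<Omega> \<and> dist y y' = \<sigma>" if y: "y \<in> frontier U" for y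
  proof -
    have i: "infdist y (- \<Omega>) = \<sigma>" using frontier_inner_part y unfolding U_def by blast
    obtain y' where "y' \<in> frontier \<Omega>" "dist y y' = infdist y (- \<Omega>)"
      using nearest_frontier_point[OF op nU, of y] i \<sigma>(1) by auto
    then show ?thesis using i by auto
  qed
  have frc: "y \<in> closure U" "y \<in> \<Omega>" if "y \<in> frontier U" for y using that UO by (auto simp: frontier_def)
  have ufr: "\<bar>u y\<bar> \<le> F" if y: "y \<in> frontier U" for y
  proof -
    obtain y' where y': "y' \<in> frontier \<Omega>" "dist y y' = \<sigma>" using frU[OF y] by blast
    have "y' \<in> closure \<Omega>" using y'(1) by (simp add: frontier_def)
    then have "dist (u y) (u y') < F" using e(2)[of y' y] \<Omega>c[OF frc(2)[OF y]] y'(2) \<sigma>(3) by simp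
    then show ?thesis using bc[OF y'(1)] by (simp add: dist_real_def)
  qed
  \<comment> \<open>The bound \<open>F\<close> makes the boundary values of \<open>w\<close> at most
    \<open>2 * F\<close>; the bound \<open>F * \<delta>\<close> later makes the set where an entry
    is off by more than \<open>F\<close> of measure at most \<open>\<delta>\<close>.\<close>
  define \<eta> where "\<eta> = min F (F * \<delta>)"
  have \<eta>: "0 < \<eta>" "\<eta> \<le> F" "\<eta> \<le> F * \<delta>" using F(1) \<delta> by (auto simp: \<eta>_def)
  obtain w where w: "Ck_on 2 UNIV w"
    and wu: "\<And>x. x \<in> closure (inner_part \<Omega> \<sigma>) \<Longrightarrow> \<bar>w x - u x\<bar> \<le> \<eta>"
    and wF: "(LINT z:inner_part \<Omega> \<sigma>|lebesgue. \<bar>lma \<phi> (hessian w) z\<bar> ^ ?n) \<le> (2 * F) ^ ?n"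
    and wH: "\<And>i j. (\<integral>\<^sup>+x. indicator (inner_part \<Omega> \<sigma>) x * ennreal \<bar>hessian w x $ i $ j - H x $ i $ j\<bar> \<partial>lebesgue) \<le> ennreal \<eta>"
    using smooth_approximation[OF potential_axioms ws eq f F Sn \<sigma>(1) \<eta>(1)] by blast
  define w' where "w' x = - w x" for x
  have w': "Ck_on 2 UNIV w'" "\<And>x. hessian w' x = - hessian w x"
    using Ck_on_2_uminus[OF w open_UNIV] by (simp_all add: w'_def[abs_def])
  have wC: "Ck_on 2 \<Omega> w" "Ck_on 2 \<Omega> w'" by (rule Ck_on_subset[OF w subset_UNIV], rule Ck_on_subset[OF w'(1) subset_UNIV])
  have lw': "\<bar>lma \<phi> (hessian w') z\<bar> = \<bar>lma \<phi> (hessian w) z\<bar>" for z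
    by (simp add: lma_def w'(2) sum_negf)
  have wF': "(LINT z:U|lebesgue. \<bar>lma \<phi> (hessian w) z\<bar> ^ ?n) \<le> (2 * F) ^ ?n"
    "(LINT z:U|lebesgue. \<bar>lma \<phi> (hessian w') z\<bar> ^ ?n) \<le> (2 * F) ^ ?n"
    using wF by (simp_all add: lw' U_def)
  have wfr: "\<bar>w y\<bar> \<le> 2 * F" if "y \<in> frontier U" for y
    using wu[of y] ufr[OF that] frc(1)[OF that] \<eta>(2) by (simp add: U_def)
  have diam: "norm (y - x) \<le> 2 / \<rho>" if "x \<in> U" "y \<in> frontier U" for x y
    using cond_A1_facts(3)[OF dom \<rho> A1] \<Omega>c frc(2)[OF that(2)] UO' that(1) by blast
  define m where "m = C1 * F"
  have meq: "2 * F + 2 / \<rho> * ?K * (2 * F) = m" by (simp add: m_def C1_def sup_const_def algebra_simps)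
  have wU: "\<bar>w x\<bar> \<le> m" if x: "x \<in> U" for x
  proof -
    have R: "0 < 2 / \<rho>" using \<rho> by simp
    have F2: "0 \<le> 2 * F" using F(1) by simp
    have "- m \<le> w x"
      unfolding meq[symmetric]
      by (rule sup_bound[OF wC(1) Uo Ub UO _ R diam F2 wF'(1) x]) (use wfr in force)
    moreover have "- m \<le> w' x"
      unfolding meq[symmetric]
      by (rule sup_bound[OF wC(2) Uo Ub UO _ R diam F2 wF'(2) x]) (use wfr in \<open>force simp: w'_def\<close>)
    ultimately show ?thesis by (simp add: w'_def)
  qed
  have m2: "2 * F \<le> m"
    unfolding meq[symmetric] using \<rho> F(1) by simp
  have wclosure: "\<bar>w x\<bar> \<le> m" if "x \<in> closure U" for x
  proof (cases "x \<in> U")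
    case False
    then have "x \<in> frontier U" using that by (simp add: frontier_def interior_open[OF Uo])
    then show ?thesis using wfr m2 by force
  qed (rule wU)
  have M0: "0 < M" using T2 F(1) by (simp add: M)
  have height: "2 * m / M < \<phi> y - \<phi> x - grad \<phi> x \<bullet> (y - x)" if x: "x \<in> D" and y: "y \<in> frontier U" for x y
  proof -
    obtain y' where y': "y' \<in> frontier \<Omega>" "dist y y' = \<sigma>" using frU[OF y] by blast
    have "c * \<delta> ^ 4 \<le> \<phi> y' - \<phi> x - grad \<phi> x \<bullet> (y' - x)"
      unfolding c_def using x ball_subset_of_inner_part[of x \<Omega> \<delta>] \<delta> y'(1)
      by (intro section_height_ge[OF dom \<rho> l A1 A2 A3]) (auto simp: D_def)
    moreover have "\<phi> y' - \<phi> y \<le> Lip * \<sigma>"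
      using lipschitz_onD[OF Lip, of y' y] \<Omega>c[OF frc(2)[OF y]] y' by (simp add: frontier_def dist_real_def dist_commute)
    moreover have "grad \<phi> x \<bullet> (y - x) - grad \<phi> x \<bullet> (y' - x) \<le> G * \<sigma>"
    proof -
      have "grad \<phi> x \<bullet> (y - x) - grad \<phi> x \<bullet> (y' - x) = grad \<phi> x \<bullet> (y - y')" by (simp add: inner_diff_right)
      also have "\<dots> \<le> norm (grad \<phi> x) * norm (y - y')" by (rule norm_cauchy_schwarz)
      also have "\<dots> \<le> G * \<sigma>" using G[of x] x y'(2) \<sigma>(1) by (auto simp: D_def dist_norm intro: mult_right_mono)
      finally show ?thesis .
    qed
    moreover have "\<sigma> * (Lip + G) \<le> c * \<delta> ^ 4 / 2"
      using s1(2) mult_right_mono[OF \<sigma>(4), of "Lip + G"] Lip0 G0 by linarith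
    ultimately have h: "c * \<delta> ^ 4 / 2 \<le> \<phi> y - \<phi> x - grad \<phi> x \<bullet> (y - x)"
      by (simp add: algebra_simps)
    have cd: "0 < c * \<delta> ^ 4" using c \<delta> by simp
    \<comment> \<open>The summand 2 in \<open>T\<close> makes this strict, as the condition on the
      heights requires.\<close>
    have "2 * C1 < T * (c * \<delta> ^ 4)" using cd c \<delta> by (simp add: Teq distrib_right)
    then have "2 * m < c * \<delta> ^ 4 / 2 * M" using F(1) by (simp add: m_def M mult_ac)
    then have "2 * m / M < c * \<delta> ^ 4 / 2" using M0 by (simp add: pos_divide_less_eq)
    then show ?thesis using h by linarith
  qed
  have F2: "0 < 2 * F" using F(1) by simp
  have m': "\<bar>w' x\<bar> \<le> m" if "x \<in> closure U" for x using wclosure[OF that] by (simp add: w'_def)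
  have contact: "l * measure lebesgue (D - {z \<in> U. psd (hessian \<phi> z + (1 / M) *\<^sub>R hessian v z)})
       \<le> L * measure lebesgue (U - D) + (2 ^ ?n * L * measure lebesgue U + 1 / l ^ (?n - 1)) / T"
    if "v = w \<or> v = w'" for v
    using that
  proof
    assume "v = w"
    then show ?thesis
      using contact_set_measure[OF wC(1) Uo Ub UO wclosure Dl DU T2 F2 wF'(1) M height] by simp
  next
    assume "v = w'"
    then show ?thesis
      using contact_set_measure[OF wC(2) Uo Ub UO m' Dl DU T2 F2 wF'(2) M height] by simp
  qed
  show thesis
  proof (rule that[OF \<sigma>(1,2) w])
    show "l * measure lebesgue (inner_part \<Omega> \<delta> - {z \<in> inner_part \<Omega> \<sigma>. psd (hessian \<phi> z + (1 / M) *\<^sub>R hessian w z)})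
       \<le> L * measure lebesgue (inner_part \<Omega> \<sigma> - inner_part \<Omega> \<delta>)
          + (2 ^ CARD('n) * L * measure lebesgue (inner_part \<Omega> \<sigma>) + 1 / l ^ (CARD('n) - 1)) / T"
      using contact[of w] unfolding U_def D_def by simp
    show "l * measure lebesgue (inner_part \<Omega> \<delta> - {z \<in> inner_part \<Omega> \<sigma>. psd (hessian \<phi> z + (1 / M) *\<^sub>R - hessian w z)})
       \<le> L * measure lebesgue (inner_part \<Omega> \<sigma> - inner_part \<Omega> \<delta>)
          + (2 ^ CARD('n) * L * measure lebesgue (inner_part \<Omega> \<sigma>) + 1 / l ^ (CARD('n) - 1)) / T"
      using contact[of w'] unfolding U_def D_def w'(2) by simp
  next
    fix i j
    show "(\<integral>\<^sup>+x. indicator (inner_part \<Omega> \<sigma>) x * ennreal \<bar>hessian w x $ i $ j - H x $ i $ j\<bar> \<partial>lebesgue) \<le> ennreal (F * \<delta>)"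
      by (rule order_trans[OF wH ennreal_leI[OF \<eta>(3)]])
  qed
qed

text \<open>Off a set of measure \<open>O(\<delta>)\<close>, the trace of \<open>D\<^sup>2\<phi>\<close> is at most \<open>\<delta>\<^sup>-\<^sup>2\<close> and \<open>\<bar>D\<^sup>2w\<bar> \<le> M tr D\<^sup>2\<phi>\<close> with
  \<open>M = O(F \<delta>\<^sup>-\<^sup>4)\<close>; this is where the exponent \<open>6\<close> comes from.\<close>

lemma hessian_level_set_bound:
  fixes \<rho> l L :: real
  assumes \<rho>: "0 < \<rho>" and l: "0 < l" and lL: "l \<le> L"
  shows "\<exists>A>0. \<exists>B\<ge>0. \<forall>(\<Omega> :: (real^'n::finite) set) \<phi> u f H F \<delta>.
      bounded_convex_domain \<Omega> \<and> cond_A1 \<rho> \<Omega> \<and> cond_A2 l L \<Omega> \<phi> \<and> cond_A3 \<rho> \<Omega> \<phi> \<and>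
      weak_solution \<Omega> u H \<and> (\<forall>x\<in>frontier \<Omega>. u x = 0) \<and>
      (AE x in lebesgue. x \<in> \<Omega> \<longrightarrow> lma \<phi> H x = f x) \<and>
      set_borel_measurable lebesgue \<Omega> f \<and> set_integrable lebesgue \<Omega> (\<lambda>x. \<bar>f x\<bar> ^ CARD('n)) \<and>
      0 < F \<and> (LINT x:\<Omega>|lebesgue. \<bar>f x\<bar> ^ CARD('n)) \<le> F ^ CARD('n) \<and>
      (\<forall>N. compact N \<and> N \<subseteq> \<Omega> \<longrightarrow>
        set_integrable lebesgue N (\<lambda>x. (\<Sum>i\<in>UNIV. \<Sum>j\<in>UNIV. \<bar>H x $ i $ j\<bar>) ^ CARD('n))) \<and>
      0 < \<delta> \<and> \<delta> \<le> 1 \<longrightarrow>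
      measure lebesgue {x \<in> \<Omega>. A * F / \<delta> ^ 6 < norm (H x)} \<le> B * \<delta>"
proof -
  let ?n = "CARD('n)"
  define c where "c = section_const \<rho> l ?n"
  define C1 where "C1 = sup_const \<rho> l ?n"
  have c: "0 < c" unfolding c_def by (rule section_const_pos[OF \<rho> l])
  have C1: "0 < C1" using \<rho> by (auto simp: C1_def sup_const_def intro!: add_pos_nonneg)
  \<comment> \<open>\<open>b0 * \<delta>\<close> will bound the boundary layer,
    \<open>b1 * \<delta>\<close> each of the two sets where contact fails, and
    \<open>V1 * \<delta>\<close> the set of large trace. The last summand of \<open>B\<close> counts
    the entries of the Hessian.\<close>
  define V0 where "V0 = measure lebesgue (cball (0 :: real^'n) (1 / \<rho>))"
  define V1 where "V1 = measure lebesgue (cball (0 :: real^'n) (1 / \<rho> + 4 / \<rho> ^ 3))"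
  define b0 where "b0 = 2 * real ?n / \<rho> * V0"
  define b1 where "b1 = (L * b0 + (2 ^ ?n * L * V0 + 1 / l ^ (?n - 1)) * (c / (2 * C1))) / l"
  define A where "A = (real ?n)\<^sup>2 * (5 + 4 * C1 / c)"
  define B where "B = b0 + (b1 + (b1 + (V1 + (real ?n)\<^sup>2)))"
  have L: "0 < L" using l lL by linarith
  have V: "0 \<le> V0" "0 \<le> V1" by (auto simp: V0_def V1_def)
  have b0: "0 \<le> b0" using V \<rho> by (simp add: b0_def)
  have b1: "0 \<le> b1" using V b0 L l c C1 by (auto simp: b1_def intro!: divide_nonneg_nonneg add_nonneg_nonneg mult_nonneg_nonneg)
  have A: "0 < A" using c C1 by (auto simp: A_def intro!: mult_pos_pos add_pos_pos)
  have B: "0 \<le> B" using b0 b1 V by (simp add: B_def)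
  have main: "measure lebesgue {x \<in> \<Omega>. A * F / \<delta> ^ 6 < norm (H x)} \<le> B * \<delta>"
    if dom: "bounded_convex_domain \<Omega>" and A1: "cond_A1 \<rho> \<Omega>" and A2: "cond_A2 l L \<Omega> \<phi>" and A3: "cond_A3 \<rho> \<Omega> \<phi>"
      and ws: "weak_solution \<Omega> u H" and bc: "\<And>x. x \<in> frontier \<Omega> \<Longrightarrow> u x = 0"
      and eq: "AE x in lebesgue. x \<in> \<Omega> \<longrightarrow> lma \<phi> H x = f x"
      and f: "set_borel_measurable lebesgue \<Omega> f" "set_integrable lebesgue \<Omega> (\<lambda>x. \<bar>f x\<bar> ^ CARD('n))"
      and F: "0 < F" "(LINT x:\<Omega>|lebesgue. \<bar>f x\<bar> ^ CARD('n)) \<le> F ^ CARD('n)"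
      and Sn: "\<And>N. compact N \<Longrightarrow> N \<subseteq> \<Omega> \<Longrightarrow>
        set_integrable lebesgue N (\<lambda>x. (\<Sum>i\<in>UNIV. \<Sum>j\<in>UNIV. \<bar>H x $ i $ j\<bar>) ^ CARD('n))"
      and \<delta>: "0 < \<delta>" "\<delta> \<le> 1"
    for \<Omega> :: "(real^'n) set" and \<phi> u f H F \<delta>
  proof -
    interpret potential \<Omega> \<phi> l L by (rule potential_of_conds[OF dom l A2])
    interpret weak_solution \<Omega> u H by (rule ws)
    define T where "T = slope_ratio \<rho> l ?n \<delta>"
    define M where "M = T * (2 * F)"
    have Teq: "T = 2 + 2 * C1 / (c * \<delta> ^ 4)" by (simp add: T_def slope_ratio_def c_def C1_def)
    have T2: "2 \<le> T" using C1 c \<delta> by (simp add: Teq)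
    have M0: "0 < M" using T2 F(1) by (simp add: M_def)
    show ?thesis
    proof (rule smooth_approximation_contact[OF \<rho> l dom A1 A2 A3 ws bc eq f F Sn \<delta>(1) T_def M_def])
      fix w \<sigma> assume \<sigma>: "0 < \<sigma>" "\<sigma> < \<delta>" and w: "Ck_on 2 UNIV w"
        and cp: "l * measure lebesgue (inner_part \<Omega> \<delta> - {z \<in> inner_part \<Omega> \<sigma>. psd (hessian \<phi> z + (1 / M) *\<^sub>R hessian w z)})
         \<le> L * measure lebesgue (inner_part \<Omega> \<sigma> - inner_part \<Omega> \<delta>)
            + (2 ^ ?n * L * measure lebesgue (inner_part \<Omega> \<sigma>) + 1 / l ^ (?n - 1)) / T"
        and cm: "l * measure lebesgue (inner_part \<Omega> \<delta> - {z \<in> inner_part \<Omega> \<sigma>. psd (hessian \<phi> z + (1 / M) *\<^sub>R - hessian w z)})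
         \<le> L * measure lebesgue (inner_part \<Omega> \<sigma> - inner_part \<Omega> \<delta>)
            + (2 ^ ?n * L * measure lebesgue (inner_part \<Omega> \<sigma>) + 1 / l ^ (?n - 1)) / T"
        and wH: "\<And>i j. (\<integral>\<^sup>+x. indicator (inner_part \<Omega> \<sigma>) x * ennreal \<bar>hessian w x $ i $ j - H x $ i $ j\<bar> \<partial>lebesgue) \<le> ennreal (F * \<delta>)"
      define U where "U = inner_part \<Omega> \<sigma>"
      define D where "D = inner_part \<Omega> \<delta>"
      have \<Omega>m: "\<Omega> \<in> lmeasurable" using op\<Omega> bd by (simp add: lmeasurable_open)
      have \<Omega>R: "\<Omega> \<subseteq> cball 0 (1 / \<rho>)" using A1 ball_subset_cball unfolding cond_A1_def by blast
      have V: "measure lebesgue \<Omega> \<le> V0"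
        unfolding V0_def by (rule measure_lebesgue_mono[OF lmeasurable_cball \<Omega>R])
      have UO: "U \<subseteq> \<Omega>" using inner_part_subset[of \<sigma> \<Omega>] \<sigma>(1) by (simp add: U_def)
      have DU: "D \<subseteq> U" unfolding D_def U_def using \<sigma>(2) by (intro inner_part_mono) auto
      have sets: "U \<in> sets lebesgue" "D \<in> sets lebesgue" by (simp_all add: U_def D_def inner_part_lebesgue)
      have Um: "U \<in> lmeasurable" by (rule fmeasurableI2[OF \<Omega>m UO sets(1)])
      have Dm: "D \<in> lmeasurable" by (rule fmeasurableI2[OF Um DU sets(2)])
      have layer: "measure lebesgue (\<Omega> - D) \<le> b0 * \<delta>"
      proof -
        obtain z where z: "ball z \<rho> \<subseteq> \<Omega>" using cond_A1_facts(4)[OF dom \<rho> A1] by blast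
        have "measure lebesgue (\<Omega> - D) \<le> 2 * real ?n * \<delta> / \<rho> * measure lebesgue \<Omega>"
          unfolding D_def by (rule measure_boundary_layer_le[OF dom \<rho> z \<delta>(1)])
        also have "\<dots> \<le> 2 * real ?n * \<delta> / \<rho> * V0" using V \<rho> \<delta> by (intro mult_left_mono) auto
        finally show ?thesis by (simp add: b0_def mult_ac)
      qed
      have bad: "measure lebesgue (D - {z \<in> U. psd (hessian \<phi> z + (1 / M) *\<^sub>R W z)}) \<le> b1 * \<delta>"
        if W: "W = hessian w \<or> W = (\<lambda>z. - hessian w z)" for W
      proof -
        have "l * measure lebesgue (D - {z \<in> U. psd (hessian \<phi> z + (1 / M) *\<^sub>R W z)})
            \<le> L * measure lebesgue (U - D) + (2 ^ ?n * L * measure lebesgue U + 1 / l ^ (?n - 1)) / T"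
          using cp cm W by (auto simp: U_def D_def)
        also have "\<dots> \<le> L * (b0 * \<delta>) + (2 ^ ?n * L * V0 + 1 / l ^ (?n - 1)) * (c / (2 * C1) * \<delta>)"
        proof (rule add_mono)
          have "measure lebesgue (U - D) \<le> measure lebesgue (\<Omega> - D)"
            using \<Omega>m Dm UO by (intro measure_lebesgue_mono fmeasurable_Diff) auto
          then show "L * measure lebesgue (U - D) \<le> L * (b0 * \<delta>)" using layer L by (intro mult_left_mono) auto
          have U0: "measure lebesgue U \<le> V0" using measure_lebesgue_mono[OF \<Omega>m UO] V by linarith
          \<comment> \<open>\<open>1 / T\<close> is even of order \<open>\<delta> ^ 4\<close>; one
            power of \<open>\<delta>\<close> suffices, since the boundary layer is no
            better.\<close>
          have "1 / T \<le> c / (2 * C1) * \<delta>"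
          proof -
            have "\<delta> ^ 4 \<le> \<delta>" using \<delta> power_decreasing[of 1 4 \<delta>] by simp
            then have "c / (2 * C1) * \<delta> ^ 4 \<le> c / (2 * C1) * \<delta>" using c C1 by (intro mult_left_mono) auto
            moreover have "1 / T \<le> 1 / (2 * C1 / (c * \<delta> ^ 4))"
            proof (rule divide_left_mono)
              show "2 * C1 / (c * \<delta> ^ 4) \<le> T" by (simp add: Teq)
              have "0 < 2 * C1 / (c * \<delta> ^ 4)" using c C1 \<delta> by simp
              moreover have "0 < T" using T2 by simp
              ultimately show "0 < T * (2 * C1 / (c * \<delta> ^ 4))" by (rule mult_pos_pos[rotated])
            qed simp
            ultimately show ?thesis by simp
          qed
          then show "(2 ^ ?n * L * measure lebesgue U + 1 / l ^ (?n - 1)) / T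
              \<le> (2 ^ ?n * L * V0 + 1 / l ^ (?n - 1)) * (c / (2 * C1) * \<delta>)"
            using U0 L l T2 mult_mono[of "2 ^ ?n * L * measure lebesgue U + 1 / l ^ (?n - 1)" "2 ^ ?n * L * V0 + 1 / l ^ (?n - 1)" "1 / T" "c / (2 * C1) * \<delta>"]
            by (simp add: mult_left_mono V0_def)
        qed
        finally have "measure lebesgue (D - {z \<in> U. psd (hessian \<phi> z + (1 / M) *\<^sub>R W z)})
            \<le> (L * (b0 * \<delta>) + (2 ^ ?n * L * V0 + 1 / l ^ (?n - 1)) * (c / (2 * C1) * \<delta>)) / l"
          using l by (simp add: pos_le_divide_eq mult.commute)
        also have "\<dots> = b1 * \<delta>" by (simp add: b1_def distrib_right mult.assoc)
        finally show ?thesis .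
      qed
      have Es: "D - {z \<in> U. psd (hessian \<phi> z + (1 / M) *\<^sub>R W z)} \<in> lmeasurable"
        if "W = hessian v" "Ck_on 2 UNIV v" for W v
      proof -
        have v: "Ck_on 2 \<Omega> v" using that(2) by (rule Ck_on_subset) simp
        have "{z \<in> U. psd (hessian (\<lambda>x. \<phi> x + (1 / M) * v x) z)} \<in> sets lebesgue"
          using Ck_on_2_add_scaled(1)[OF C v op] open_inner_part UO unfolding U_def by (rule psd_hessian_set_lebesgue)
        moreover have "{z \<in> U. psd (hessian (\<lambda>x. \<phi> x + (1 / M) * v x) z)} = {z \<in> U. psd (hessian \<phi> z + (1 / M) *\<^sub>R W z)}"
        proof (rule Collect_cong, rule conj_cong[OF refl])
          fix z assume "z \<in> U"
          then have "hessian (\<lambda>x. \<phi> x + (1 / M) * v x) z = hessian \<phi> z + (1 / M) *\<^sub>R hessian v z"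
            by (intro Ck_on_2_add_scaled(3)[OF C v op]) (use UO in blast)
          then show "psd (hessian (\<lambda>x. \<phi> x + (1 / M) * v x) z) = psd (hessian \<phi> z + (1 / M) *\<^sub>R W z)"
            by (simp only: that(1))
        qed
        ultimately show ?thesis using Dm by (intro fmeasurable_Diff) auto
      qed
      let ?Ep = "D - {z \<in> U. psd (hessian \<phi> z + (1 / M) *\<^sub>R hessian w z)}"
      let ?Em = "D - {z \<in> U. psd (hessian \<phi> z + (1 / M) *\<^sub>R (- hessian w z))}"
      have Ep: "?Ep \<in> lmeasurable" "measure lebesgue ?Ep \<le> b1 * \<delta>"
        using Es[OF refl w] bad[of "hessian w"] by auto
      have Em: "?Em \<in> lmeasurable" "measure lebesgue ?Em \<le> b1 * \<delta>"
      proof -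
        have "(\<lambda>z. - hessian w z) = hessian (\<lambda>x. - w x)"
          using Ck_on_2_uminus(2)[OF w open_UNIV] by (simp add: fun_eq_iff)
        from Es[OF this Ck_on_2_uminus(1)[OF w open_UNIV]] show "?Em \<in> lmeasurable" .
        show "measure lebesgue ?Em \<le> b1 * \<delta>" using bad[of "\<lambda>z. - hessian w z"] by simp
      qed
      \<comment> \<open>With this threshold Markov's inequality turns the integral bound
        \<open>V1 / \<delta>\<close> into measure at most \<open>V1 * \<delta>\<close>.\<close>
      let ?Et = "{x \<in> D. 1 / \<delta>\<^sup>2 < \<bar>trace (hessian \<phi> x)\<bar>}"
      have Et: "?Et \<in> lmeasurable" "measure lebesgue ?Et \<le> V1 * \<delta>"
      proof -
        obtain a s where as: "\<And>z. z \<in> \<Omega> \<Longrightarrow> 0 \<le> \<phi> z - a - s \<bullet> z \<and> \<phi> z - a - s \<bullet> z \<le> 4 / \<rho> ^ 3"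
          using potential_affine_bound[OF dom \<rho> A1 A2 A3] by blast
        note t = integral_trace_hessian_le[OF as \<Omega>R \<delta>(1) D_def]
        have i: "integrable lebesgue (\<lambda>x. indicator D x * trace (hessian \<phi> x))"
          using t(1) by (simp add: set_integrable_def)
        have nn: "0 \<le> trace (hessian \<phi> x)" if "x \<in> D" for x
          using psd_trace_det_nonneg(1)[OF psd_hessian] that DU UO by blast
        have "(\<integral>\<^sup>+x. indicator D x * ennreal \<bar>trace (hessian \<phi> x)\<bar> \<partial>lebesgue) = (\<integral>\<^sup>+x. ennreal (indicator D x * trace (hessian \<phi> x)) \<partial>lebesgue)"
          by (rule nn_integral_cong) (use nn in \<open>auto simp: indicator_def\<close>)
        also have "\<dots> = ennreal (LINT x:D|lebesgue. trace (hessian \<phi> x))"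
          unfolding set_lebesgue_integral_def real_scaleR_def
          using nn by (intro nn_integral_eq_integral[OF i]) (auto simp: indicator_def)
        also have "\<dots> \<le> ennreal (V1 / \<delta>)"
          using t(2) \<delta> by (intro ennreal_leI) (simp add: V1_def pos_le_divide_eq mult.commute)
        finally have nI: "(\<integral>\<^sup>+x. indicator D x * ennreal \<bar>trace (hessian \<phi> x)\<bar> \<partial>lebesgue) \<le> ennreal (V1 / \<delta>)" .
        note mk = markov_lebesgue[OF borel_measurable_integrable[OF i] sets(2) nI, of "1 / \<delta>\<^sup>2"]
        show "?Et \<in> lmeasurable" using mk(1) V1_def \<delta> by simp
        have "measure lebesgue ?Et \<le> V1 / \<delta> / (1 / \<delta>\<^sup>2)" using mk(2) V1_def \<delta> by simp
        also have "\<dots> = V1 * \<delta>" using \<delta> by (simp add: power2_eq_square)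
        finally show "measure lebesgue ?Et \<le> V1 * \<delta>" .
      qed
      \<comment> \<open>Where one entry of the smooth Hessian misses that of \<open>H\<close> by
        more than \<open>F\<close>; the L^1 error is at most \<open>F * \<delta>\<close>.\<close>
      define E where "E p = {x \<in> U. F < \<bar>hessian w x $ fst p $ snd p - H x $ fst p $ snd p\<bar>}" for p
      have E: "E p \<in> lmeasurable" "measure lebesgue (E p) \<le> \<delta>" for p
      proof -
        obtain i j where p: "p = (i, j)" by (cases p)
        have "closure U \<subseteq> \<Omega>" "compact (closure U)"
          using closure_inner_part_subset'[OF \<sigma>(1)] closure_inner_part_compact[of \<sigma>] \<sigma>(1) by (auto simp: U_def)
        then have "set_integrable lebesgue (closure U) (\<lambda>x. H x $ i $ j)" by (intro H_integrable)
        then have "set_integrable lebesgue U (\<lambda>x. H x $ i $ j)"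
          by (rule set_integrable_subset[OF _ sets(1) closure_subset])
        moreover have "set_integrable lebesgue U (\<lambda>x. hessian w x $ i $ j)"
        proof (rule set_integrable_continuous_compact[OF \<open>compact (closure U)\<close> _ closure_subset sets(1)])
          have "continuous_on (closure U) (hessian w)"
            using continuous_on_hessian[OF w] by (rule continuous_on_subset) simp
          then show "continuous_on (closure U) (\<lambda>x. hessian w x $ i $ j)" by (intro continuous_intros)
        qed
        ultimately have "set_integrable lebesgue U (\<lambda>x. hessian w x $ i $ j - H x $ i $ j)" by (intro set_integral_diff(1))
        then have m: "(\<lambda>x. indicator U x * (hessian w x $ i $ j - H x $ i $ j)) \<in> borel_measurable lebesgue"
          using borel_measurable_integrable by (auto simp: set_integrable_def)
        have wH': "(\<integral>\<^sup>+x. indicator U x * ennreal \<bar>hessian w x $ i $ j - H x $ i $ j\<bar> \<partial>lebesgue) \<le> ennreal (F * \<delta>)"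
          using wH[of i j] by (simp add: U_def)
        have "0 \<le> F * \<delta>" using F(1) \<delta>(1) by simp
        note mk = markov_lebesgue[OF m sets(1) wH' F(1) this]
        show "E p \<in> lmeasurable" using mk(1) by (simp add: E_def p)
        show "measure lebesgue (E p) \<le> \<delta>" using mk(2) F(1) by (simp add: E_def p)
      qed
      let ?EE = "\<Union>p\<in>UNIV. E p"
      have EE: "?EE \<in> lmeasurable" "measure lebesgue ?EE \<le> (real ?n)\<^sup>2 * \<delta>"
      proof -
        show "?EE \<in> lmeasurable" using E(1) by (intro fmeasurable.finite_UN) auto
        have "measure lebesgue ?EE \<le> (\<Sum>p\<in>UNIV. measure lebesgue (E p))"
          using E(1) by (intro measure_UNION_le) auto
        also have "\<dots> \<le> (\<Sum>p\<in>(UNIV :: ('n \<times> 'n) set). \<delta>)" by (intro sum_mono E(2))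
        finally show "measure lebesgue ?EE \<le> (real ?n)\<^sup>2 * \<delta>" by (simp add: power2_eq_square)
      qed
      have Hle: "norm (H x) \<le> A * F / \<delta> ^ 6"
        if x: "x \<in> D" "x \<notin> ?Ep" "x \<notin> ?Em" "x \<notin> ?Et" "x \<notin> ?EE" for x
      proof -
        have xU: "x \<in> U" using x(1) DU by blast
        have p: "psd (hessian \<phi> x + (1 / M) *\<^sub>R hessian w x)" "psd (hessian \<phi> x + (1 / M) *\<^sub>R (- hessian w x))"
          using x by auto
        have tr: "trace (hessian \<phi> x) \<le> 1 / \<delta>\<^sup>2" using x(1,4) by auto
        have ent: "\<bar>H x $ i $ j\<bar> \<le> M / \<delta>\<^sup>2 + F" for i j
        proof -
          have "x \<notin> E (i, j)" using x(5) by blast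
          then have "\<bar>hessian w x $ i $ j - H x $ i $ j\<bar> \<le> F" using xU by (simp add: E_def)
          moreover have "\<bar>hessian w x $ i $ j\<bar> \<le> trace (hessian \<phi> x) / (1 / M)"
            using M0 by (intro entry_le_of_psd_perturbations p) simp
          moreover have "trace (hessian \<phi> x) * M \<le> 1 / \<delta>\<^sup>2 * M" using tr M0 by (intro mult_right_mono) auto
          ultimately show ?thesis by simp
        qed
        have "norm (H x) \<le> (\<Sum>i\<in>UNIV. norm (H x $ i))" unfolding norm_vec_def[of "H x"] by (rule L2_set_le_sum) simp
        also have "\<dots> \<le> (\<Sum>i\<in>UNIV. \<Sum>j\<in>UNIV. \<bar>H x $ i $ j\<bar>)" by (intro sum_mono norm_le_l1_cart)
        also have "\<dots> \<le> (\<Sum>i\<in>(UNIV :: 'n set). \<Sum>j\<in>(UNIV :: 'n set). M / \<delta>\<^sup>2 + F)" by (intro sum_mono ent)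
        also have "\<dots> = (real ?n)\<^sup>2 * (M / \<delta>\<^sup>2 + F)" by (simp add: power2_eq_square)
        also have "\<dots> \<le> (real ?n)\<^sup>2 * ((5 + 4 * C1 / c) * F / \<delta> ^ 6)"
        proof (rule mult_left_mono)
          have d: "1 \<le> 1 / \<delta> ^ k" for k using \<delta> by (simp add: power_le_one)
          \<comment> \<open>\<open>T\<close> contributes \<open>\<delta>\<close> to the power -4 and
            the trace the power -2; the remaining \<open>F\<close> is absorbed because
            \<open>\<delta> \<le> 1\<close>.\<close>
          have "T \<le> (2 + 2 * C1 / c) / \<delta> ^ 4"
            using d[of 4] by (simp add: Teq add_divide_distrib)
          then have "M \<le> (2 + 2 * C1 / c) / \<delta> ^ 4 * (2 * F)" unfolding M_def using F(1) by (intro mult_right_mono) auto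
          then have "M / \<delta>\<^sup>2 \<le> (2 + 2 * C1 / c) / \<delta> ^ 4 * (2 * F) / \<delta>\<^sup>2" by (intro divide_right_mono) auto
          also have "\<dots> = (2 + 2 * C1 / c) * (2 * F) / (\<delta> ^ 4 * \<delta>\<^sup>2)" by simp
          also have "\<delta> ^ 4 * \<delta>\<^sup>2 = \<delta> ^ 6" by (simp flip: power_add)
          finally have "M / \<delta>\<^sup>2 \<le> (4 + 4 * C1 / c) * F / \<delta> ^ 6" by (simp add: algebra_simps)
          moreover have "F \<le> F / \<delta> ^ 6" using mult_left_mono[OF d[of 6], of F] F(1) by simp
          moreover have "(5 + 4 * C1 / c) * F / \<delta> ^ 6 = (4 + 4 * C1 / c) * F / \<delta> ^ 6 + F / \<delta> ^ 6"
            by (simp add: distrib_right flip: add_divide_distrib)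
          ultimately show "M / \<delta>\<^sup>2 + F \<le> (5 + 4 * C1 / c) * F / \<delta> ^ 6" by linarith
        qed simp
        finally show ?thesis by (simp add: A_def mult_ac)
      qed
      have DD: "\<Omega> - D \<in> lmeasurable" by (rule fmeasurable_Diff[OF \<Omega>m sets(2)])
      have "{x \<in> \<Omega>. A * F / \<delta> ^ 6 < norm (H x)} \<subseteq> (\<Omega> - D) \<union> (?Ep \<union> (?Em \<union> (?Et \<union> ?EE)))"
      proof
        fix x assume x: "x \<in> {x \<in> \<Omega>. A * F / \<delta> ^ 6 < norm (H x)}"
        then have "\<not> norm (H x) \<le> A * F / \<delta> ^ 6" by simp
        then have "\<not> (x \<in> D \<and> x \<notin> ?Ep \<and> x \<notin> ?Em \<and> x \<notin> ?Et \<and> x \<notin> ?EE)" using Hle[of x] by argo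
        then show "x \<in> (\<Omega> - D) \<union> (?Ep \<union> (?Em \<union> (?Et \<union> ?EE)))" using x by (simp only: Un_iff Diff_iff mem_Collect_eq) argo
      qed
      then have "measure lebesgue {x \<in> \<Omega>. A * F / \<delta> ^ 6 < norm (H x)}
          \<le> measure lebesgue ((\<Omega> - D) \<union> (?Ep \<union> (?Em \<union> (?Et \<union> ?EE))))"
        by (intro measure_lebesgue_mono fmeasurable.Un DD Ep(1) Em(1) Et(1) EE(1))
      also have "\<dots> \<le> measure lebesgue (\<Omega> - D) + measure lebesgue (?Ep \<union> (?Em \<union> (?Et \<union> ?EE)))"
        by (intro measure_Un_le fmeasurableD fmeasurable.Un DD Ep(1) Em(1) Et(1) EE(1))
      also have "measure lebesgue (?Ep \<union> (?Em \<union> (?Et \<union> ?EE))) \<le> measure lebesgue ?Ep + measure lebesgue (?Em \<union> (?Et \<union> ?EE))"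
        by (intro measure_Un_le fmeasurableD fmeasurable.Un Ep(1) Em(1) Et(1) EE(1))
      also have "measure lebesgue (?Em \<union> (?Et \<union> ?EE)) \<le> measure lebesgue ?Em + measure lebesgue (?Et \<union> ?EE)"
        by (intro measure_Un_le fmeasurableD fmeasurable.Un Em(1) Et(1) EE(1))
      also have "measure lebesgue (?Et \<union> ?EE) \<le> measure lebesgue ?Et + measure lebesgue ?EE"
        by (intro measure_Un_le fmeasurableD Et(1) EE(1))
      finally have "measure lebesgue {x \<in> \<Omega>. A * F / \<delta> ^ 6 < norm (H x)}
          \<le> b0 * \<delta> + (b1 * \<delta> + (b1 * \<delta> + (V1 * \<delta> + (real ?n)\<^sup>2 * \<delta>)))"
        using layer Ep(2) Em(2) Et(2) EE(2) by linarith
      then show ?thesis by (simp only: B_def distrib_right)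
    qed
  qed
  show ?thesis
  proof (rule exI[of _ A], rule conjI[OF A], rule exI[of _ B], rule conjI[OF B], intro allI impI)
    fix \<Omega> :: "(real^'n) set" and \<phi> u f H and F \<delta> :: real
    assume h: "bounded_convex_domain \<Omega> \<and> cond_A1 \<rho> \<Omega> \<and> cond_A2 l L \<Omega> \<phi> \<and> cond_A3 \<rho> \<Omega> \<phi> \<and>
      weak_solution \<Omega> u H \<and> (\<forall>x\<in>frontier \<Omega>. u x = 0) \<and>
      (AE x in lebesgue. x \<in> \<Omega> \<longrightarrow> lma \<phi> H x = f x) \<and>
      set_borel_measurable lebesgue \<Omega> f \<and> set_integrable lebesgue \<Omega> (\<lambda>x. \<bar>f x\<bar> ^ CARD('n)) \<and>
      0 < F \<and> (LINT x:\<Omega>|lebesgue. \<bar>f x\<bar> ^ CARD('n)) \<le> F ^ CARD('n) \<and>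
      (\<forall>N. compact N \<and> N \<subseteq> \<Omega> \<longrightarrow>
        set_integrable lebesgue N (\<lambda>x. (\<Sum>i\<in>UNIV. \<Sum>j\<in>UNIV. \<bar>H x $ i $ j\<bar>) ^ CARD('n))) \<and>
      0 < \<delta> \<and> \<delta> \<le> 1"
    show "measure lebesgue {x \<in> \<Omega>. A * F / \<delta> ^ 6 < norm (H x)} \<le> B * \<delta>"
      by (rule main[where \<phi> = \<phi> and u = u and f = f]) (use h in simp_all)
  qed
qed

theorem theorem3p9:
  fixes \<rho> l L :: real
  assumes "0 < \<rho>" and "0 < l" and "l \<le> L"
  shows "\<exists>p>0. \<forall>K>0. \<exists>C>0.
    \<forall>(\<Omega> :: (real^'n::finite) set) \<phi> u f H.
      bounded_convex_domain \<Omega> \<and> cond_A1 \<rho> \<Omega> \<and> cond_A2 l L \<Omega> \<phi> \<and> cond_A3 \<rho> \<Omega> \<phi> \<and>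
      C11_boundary K \<Omega> \<and>
      in_Lp (real CARD('n)) \<Omega> f \<and>
      continuous_on (closure \<Omega>) u \<and> Ck_on 1 \<Omega> u \<and> in_W2_loc (real CARD('n)) \<Omega> u \<and>
      weak_hessian \<Omega> u H \<and> linearized_MA_ae \<Omega> \<phi> H f \<and>
      (\<forall>x\<in>frontier \<Omega>. u x = 0) \<longrightarrow>
      in_Lp p \<Omega> H \<and> Lp_norm p \<Omega> H \<le> C * Lp_norm (real CARD('n)) \<Omega> f"
proof -
  let ?n = "CARD('n)"
  obtain A B where A: "0 < A" and B: "0 \<le> B" and est: "\<forall>(\<Omega> :: (real^'n::finite) set) \<phi> u f H F \<delta>.
      bounded_convex_domain \<Omega> \<and> cond_A1 \<rho> \<Omega> \<and> cond_A2 l L \<Omega> \<phi> \<and> cond_A3 \<rho> \<Omega> \<phi> \<and>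
      weak_solution \<Omega> u H \<and> (\<forall>x\<in>frontier \<Omega>. u x = 0) \<and>
      (AE x in lebesgue. x \<in> \<Omega> \<longrightarrow> lma \<phi> H x = f x) \<and>
      set_borel_measurable lebesgue \<Omega> f \<and> set_integrable lebesgue \<Omega> (\<lambda>x. \<bar>f x\<bar> ^ CARD('n)) \<and>
      0 < F \<and> (LINT x:\<Omega>|lebesgue. \<bar>f x\<bar> ^ CARD('n)) \<le> F ^ CARD('n) \<and>
      (\<forall>N. compact N \<and> N \<subseteq> \<Omega> \<longrightarrow>
        set_integrable lebesgue N (\<lambda>x. (\<Sum>i\<in>UNIV. \<Sum>j\<in>UNIV. \<bar>H x $ i $ j\<bar>) ^ CARD('n))) \<and>
      0 < \<delta> \<and> \<delta> \<le> 1 \<longrightarrow>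
      measure lebesgue {x \<in> \<Omega>. A * F / \<delta> ^ 6 < norm (H x)} \<le> B * \<delta>"
    using hessian_level_set_bound[OF assms, where 'n = 'n] by (elim exE conjE)
  \<comment> \<open>Bounds the volume of \<open>\<Omega>\<close> plus \<open>B\<close> times the
    geometric series of \<open>weak_type_imp_Lp\<close>. Its twelfth power in the final constant is
    \<open>1 / p\<close>.\<close>
  define V where "V = measure lebesgue (cball (0 :: real^'n) (1 / \<rho>)) + B * (sqrt 2 / (1 - 1 / sqrt 2))"
  have s2: "0 < 1 - 1 / sqrt 2" by (simp add: field_simps)
  have V: "0 < V"
    unfolding V_def using assms(1) B s2
    by (intro add_pos_nonneg mult_nonneg_nonneg divide_nonneg_pos) (auto simp: content_cball_pos)
  have main: "in_Lp (1 / 12) \<Omega> H \<and> Lp_norm (1 / 12) \<Omega> H \<le> A * V ^ 12 * Lp_norm (real ?n) \<Omega> f"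
    if dom: "bounded_convex_domain \<Omega>" and A1: "cond_A1 \<rho> \<Omega>" and A2: "cond_A2 l L \<Omega> \<phi>" and A3: "cond_A3 \<rho> \<Omega> \<phi>"
      and f: "in_Lp (real ?n) \<Omega> f" and uc: "continuous_on (closure \<Omega>) u" and W: "in_W2_loc (real ?n) \<Omega> u"
      and wh: "weak_hessian \<Omega> u H" and eq: "linearized_MA_ae \<Omega> \<phi> H f" and bc: "\<forall>x\<in>frontier \<Omega>. u x = 0"
    for \<Omega> :: "(real^'n) set" and \<phi> u f H
  proof -
    have ws: "weak_solution \<Omega> u H"
      using dom uc wh by (simp add: weak_solution_def bounded_convex_domain_def)
    interpret weak_solution \<Omega> u H by (rule ws)
    have eq': "AE x in lebesgue. x \<in> \<Omega> \<longrightarrow> lma \<phi> H x = f x"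
      using eq by (simp add: linearized_MA_ae_def lma_def)
    have pw: "\<bar>t\<bar> powr real ?n = \<bar>t\<bar> ^ ?n" for t :: real
      by (simp add: powr_realpow')
    have fm: "set_borel_measurable lebesgue \<Omega> f" and fi: "set_integrable lebesgue \<Omega> (\<lambda>x. \<bar>f x\<bar> ^ ?n)"
      using f by (simp_all add: in_Lp_def pw)
    have Sn: "\<forall>N. compact N \<and> N \<subseteq> \<Omega> \<longrightarrow>
        set_integrable lebesgue N (\<lambda>x. (\<Sum>i\<in>UNIV. \<Sum>j\<in>UNIV. \<bar>H x $ i $ j\<bar>) ^ ?n)"
      using weak_hessian_sum_Ln[OF ws W] by blast
    have \<Omega>m: "\<Omega> \<in> lmeasurable" using op\<Omega> bd by (simp add: lmeasurable_open)
    have Hm: "set_borel_measurable lebesgue \<Omega> (\<lambda>x. norm (H x))"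
    proof -
      have "(\<lambda>x. norm (indicator \<Omega> x *\<^sub>R H x)) \<in> borel_measurable lebesgue"
        by (rule measurable_compose[OF H_measurable[unfolded set_borel_measurable_def] borel_measurable_norm])
      then show ?thesis by (simp add: set_borel_measurable_def)
    qed
    have \<Omega>V: "measure lebesgue \<Omega> + B * (sqrt 2 / (1 - 1 / sqrt 2)) \<le> V"
    proof -
      have "\<Omega> \<subseteq> cball 0 (1 / \<rho>)" using A1 ball_subset_cball unfolding cond_A1_def by blast
      then show ?thesis unfolding V_def using measure_lebesgue_mono[OF lmeasurable_cball] by (intro add_right_mono)
    qed
    define I where "I = (LINT x:\<Omega>|lebesgue. \<bar>f x\<bar> ^ ?n)"
    have I: "0 \<le> I" unfolding I_def set_lebesgue_integral_def by simp
    define N where "N = Lp_norm (real ?n) \<Omega> f"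
    have Neq: "N = I powr (1 / real ?n)" by (simp add: N_def Lp_norm_def pw I_def)
    have N: "0 \<le> N" by (simp add: Neq)
    have NI: "I \<le> N ^ ?n"
      using I by (simp add: Neq powr_powr flip: powr_realpow')
    \<comment> \<open>The level set bound asks for a positive \<open>F\<close>, while the norm
      \<open>N\<close> of \<open>f\<close> may vanish. So all \<open>F > N\<close> are treated, and
      \<open>F\<close> decreases to \<open>N\<close> at the end.\<close>
    have level: "measure lebesgue {x \<in> \<Omega>. A * F / \<delta> ^ 6 < norm (H x)} \<le> B * \<delta>"
      if F: "N < F" and \<delta>: "0 < \<delta>" "\<delta> \<le> 1" for F \<delta>
    proof -
      have "0 < F" using F N by linarith
      moreover have "(LINT x:\<Omega>|lebesgue. \<bar>f x\<bar> ^ ?n) \<le> F ^ ?n"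
        unfolding I_def[symmetric] by (rule order_trans[OF NI power_mono]) (use F N in auto)
      ultimately show ?thesis
        using est[rule_format, of \<Omega> \<phi> u H f F \<delta>] dom A1 A2 A3 ws bc eq' fm fi Sn \<delta> by blast
    qed
    have Lp: "set_integrable lebesgue \<Omega> (\<lambda>x. norm (H x) powr (1 / 12))"
      "(LINT x:\<Omega>|lebesgue. norm (H x) powr (1 / 12)) \<le> (A * F) powr (1 / 12) * V" if F: "N < F" for F
    proof -
      have AF: "0 < A * F" using A F N by simp
      note wt = weak_type_imp_Lp[OF \<Omega>m Hm norm_ge_zero AF B level[OF F]]
      show "set_integrable lebesgue \<Omega> (\<lambda>x. norm (H x) powr (1 / 12))" by (rule wt(1))
      show "(LINT x:\<Omega>|lebesgue. norm (H x) powr (1 / 12)) \<le> (A * F) powr (1 / 12) * V"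
        using wt(2) mult_left_mono[OF \<Omega>V, of "(A * F) powr (1 / 12)"] by simp
    qed
    have in12: "in_Lp (1 / 12) \<Omega> H"
      unfolding in_Lp_def using H_measurable Lp(1)[of "N + 1"] by simp
    have bnd: "Lp_norm (1 / 12) \<Omega> H \<le> A * V ^ 12 * F" if F: "N < F" for F
    proof -
      have AF: "0 < A * F" using A F N by simp
      have "Lp_norm (1 / 12) \<Omega> H = (LINT x:\<Omega>|lebesgue. norm (H x) powr (1 / 12)) powr 12" by (simp add: Lp_norm_def)
      also have "\<dots> \<le> ((A * F) powr (1 / 12) * V) powr 12"
      proof (rule powr_mono2)
        show "0 \<le> (LINT x:\<Omega>|lebesgue. norm (H x) powr (1 / 12))"
          unfolding set_lebesgue_integral_def by simp
      qed (use Lp(2)[OF F] in auto)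
      also have "\<dots> = ((A * F) powr (1 / 12)) powr 12 * V powr 12" using AF V by (simp add: powr_mult)
      also have "((A * F) powr (1 / 12)) powr 12 = A * F" using AF by (simp add: powr_powr)
      also have "V powr 12 = V ^ 12" using V powr_realpow[of V 12] by simp
      finally show ?thesis by (simp add: mult_ac)
    qed
    have AV: "0 < A * V ^ 12" using A V by simp
    have "Lp_norm (1 / 12) \<Omega> H \<le> A * V ^ 12 * N"
    proof (rule field_le_epsilon)
      fix e :: real assume e: "0 < e"
      have "Lp_norm (1 / 12) \<Omega> H \<le> A * V ^ 12 * (N + e / (A * V ^ 12))"
        using e AV by (intro bnd) simp
      also have "\<dots> = A * V ^ 12 * N + e" using A V by (simp add: distrib_left)
      finally show "Lp_norm (1 / 12) \<Omega> H \<le> A * V ^ 12 * N + e" .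
    qed
    then show ?thesis using in12 by (simp add: N_def)
  qed
  have AV: "0 < A * V ^ 12" using A V by simp
  show ?thesis
  proof (rule exI[of _ "1 / 12"], rule conjI)
    show "\<forall>K>0. \<exists>C>0. \<forall>(\<Omega> :: (real^'n::finite) set) \<phi> u f H.
      bounded_convex_domain \<Omega> \<and> cond_A1 \<rho> \<Omega> \<and> cond_A2 l L \<Omega> \<phi> \<and> cond_A3 \<rho> \<Omega> \<phi> \<and>
      C11_boundary K \<Omega> \<and>
      in_Lp (real CARD('n)) \<Omega> f \<and>
      continuous_on (closure \<Omega>) u \<and> Ck_on 1 \<Omega> u \<and> in_W2_loc (real CARD('n)) \<Omega> u \<and>
      weak_hessian \<Omega> u H \<and> linearized_MA_ae \<Omega> \<phi> H f \<and>
      (\<forall>x\<in>frontier \<Omega>. u x = 0) \<longrightarrow>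
      in_Lp (1 / 12) \<Omega> H \<and> Lp_norm (1 / 12) \<Omega> H \<le> C * Lp_norm (real CARD('n)) \<Omega> f"
    proof (intro allI impI, rule exI[of _ "A * V ^ 12"], rule conjI[OF AV], intro allI impI)
      fix K :: real and \<Omega> :: "(real^'n) set" and \<phi> u f H
      assume h: "bounded_convex_domain \<Omega> \<and> cond_A1 \<rho> \<Omega> \<and> cond_A2 l L \<Omega> \<phi> \<and> cond_A3 \<rho> \<Omega> \<phi> \<and>
        C11_boundary K \<Omega> \<and>
        in_Lp (real CARD('n)) \<Omega> f \<and>
        continuous_on (closure \<Omega>) u \<and> Ck_on 1 \<Omega> u \<and> in_W2_loc (real CARD('n)) \<Omega> u \<and>
        weak_hessian \<Omega> u H \<and> linearized_MA_ae \<Omega> \<phi> H f \<and>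
        (\<forall>x\<in>frontier \<Omega>. u x = 0)"
      show "in_Lp (1 / 12) \<Omega> H \<and> Lp_norm (1 / 12) \<Omega> H \<le> A * V ^ 12 * Lp_norm (real ?n) \<Omega> f"
        by (rule main[where \<phi> = \<phi> and u = u]) (use h in simp_all)
    qed
  qed simp
qed

end
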